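(* Let $1\le p,q<\infty$ and $s\in\mathbb{R}$. Then the Besov space $B^{p,q}_{s+nq/2-n}$ on the forward light cone equals the coorbit space $\mathrm{Co}_{\mathcal{S}_\Lambda}^uL^{p,q}_s(G)$ (as subspaces of $\mathcal{S}_\Lambda^*$), with equivalent norms.
   Context: Let $n\ge2$, $B(x,y)=x_ny_n-x_{n-1}y_{n-1}-\dots-x_1y_1$ on $\mathbb{R}^n$, $\Lambda=\{x\in\mathbb{R}^n: B(x,x)>0,\ x_n>0\}$ the forward light cone, $\mathrm{Det}(x)=\sqrt{B(x,x)}$, and $e=(0,\dots,0,1)^T\in\Lambda$. Let, for $t\in\mathbb{R}$, $c\in\mathbb{R}^{n-2}$, $$a_t=\begin{pmatrix}\cosh t&0&\sinh t\\0&I_{n-2}&0\\\sinh t&0&\cosh t\end{pmatrix},\qquad n_c=\begin{pmatrix}1-|c|^2/2&-c^T&|c|^2/2\\c&I_{n-2}&-c\\-|c|^2/2&-c^T&1+|c|^2/2\end{pmatrix},$$ and $K=\left\{\begin{pmatrix}\sigma&0\\0&1\end{pmatrix}:\sigma\in SO(n-1)\right\}$. The group $H=\mathbb{R}_+AN=\{\gamma a_tn_c:\gamma>0,t\in\mathbb{R},c\in\mathbb{R}^{n-2}\}$ acts simply transitively on $\Lambda$ by matrix multiplication. Let $G=H\ltimes\mathbb{R}^n$ with left Haar measure $\frac{d\gamma\,dt\,dc\,db}{\gamma^{n+1}}$ (elements $(\gamma a_tn_c,b)$). Fourier transform: $\widetilde f(w)=(2\pi)^{-n/2}\int_{\mathbb{R}^n}f(x)e^{-iB(x,w)}\,dx$.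 $\mathcal{S}_\Lambda=\{f\in\mathcal{S}(\mathbb{R}^n):\mathrm{supp}(\widetilde f)\subseteq\overline\Lambda\}$ with the topology inherited from the Schwartz space $\mathcal{S}(\mathbb{R}^n)$, and $\mathcal{S}_\Lambda^*$ is its conjugate linear dual, with pairing $\langle\cdot,\cdot\rangle$ extending the $L^2$ inner product. $G$ acts on $\mathcal{S}_\Lambda$ by $\pi(\gamma a_tn_c,b)f(x)=\gamma^{-n/2}f((\gamma a_tn_c)^{-1}(x-b))$. The wavelet $u\in\mathcal{S}_\Lambda$ is such that $\widetilde u$ has compact support contained in $\Lambda$, $0\le\widetilde u\le1$, and $1/2<\widetilde u\le1$ on a neighbourhood of $e$. $W_u(\phi)(g)=\langle\phi,\pi(g)u\rangle$ for $\phi\in\mathcal{S}_\Lambda^*$, $g\in G$. $L^{p,q}_s(G)$ is the space of measurable $f$ on $G$ with $$\|f\|_{L^{p,q}_s}=\Big(\int_H\Big(\int_{\mathbb{R}^n}|f(\gamma a_tn_c,b)|^p\,db\Big)^{q/p}\gamma^s\frac{d\gamma\,dt\,dc}{\gamma^{n+1}}\Big)^{1/q}<\infty,$$ and $\mathrm{Co}_{\mathcal{S}_\Lambda}^uL^{p,q}_s(G)=\{\phi\in\mathcal{S}_\Lambda^*: W_u(\phi)\in L^{p,q}_s(G)\}$ with norm $\|W_u(\phi)\|_{L^{p,q}_s}$. Besov spaces: for $\rho>0$ let $B_\rho(e)=\{k\,e^{t}a_{\tau}\,e: k\in K,\ t^2+\tau^2<\rho\}\subseteq\Lambda$ (here $e^t$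 is the scalar exponential), and for $w=he$ with $h\in H$ let $B_\rho(w)=hB_\rho(e)$. Fix $\delta>0$ and a Whitney cover with lattice points $w_j\in\Lambda$: the balls $B_{\delta/2}(w_j)$ are disjoint, the balls $B_\delta(w_j)$ cover $\Lambda$, and there is $N$ such that each $w\in\Lambda$ lies in at most $N$ of the balls $B_\delta(w_j)$. Let $0\le\varphi\le1$ be smooth with support in $B_{2\delta}(e)$ and $\varphi=1$ on $B_\delta(e)$; write $w_j=g_je$ with $g_j\in H$, $\varphi_j(w)=\varphi(g_j^{-1}w)$, and define $\psi_j$ by $\widetilde\psi_j=\varphi_j/\sum_i\varphi_i$ (a Littlewood–Paley decomposition). For $\sigma\in\mathbb{R}$, $B^{p,q}_\sigma$ is the space of $f\in\mathcal{S}_\Lambda^*$ with $$\|f\|_{B^{p,q}_\sigma}=\Big(\sum_j\mathrm{Det}(w_j)^{-\sigma}\|f*\psi_j\|_p^q\Big)^{1/q}<\infty,$$ where $f*\psi_j$ is distributional convolution on $\mathbb{R}^n$, $(f*\psi_j)(x)=\langle f,\overline{\psi_j(x-\cdot)}\rangle$, and $\|\cdot\|_p$ is the $L^p(\mathbb{R}^n)$-norm. (Up to equivalence the norm is independent of the choice of cover and of $\psi_j$.) *)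

theory Defs
  imports "HOL-Analysis.Analysis"
begin

text \<open>
  The space \<open>\<real>\<^sup>n\<close> is \<^typ>\<open>real ^ 'n\<close> with a linearly ordered finite index type, so \<open>n = CARD('n)\<close>,
  the coordinates \<open>x\<^sub>1\<close> and \<open>x\<^sub>n\<close> belong to the least and the greatest index, and \<open>\<real>\<^sup>n\<^sup>-\<^sup>2\<close> is the
  set of functions on the remaining indices (a one-point space if \<open>n = 2\<close>), extended by
  \<^const>\<open>undefined\<close> as in the library's product measures.
\<close>

type_synonym 'n rvec = "(real, 'n) vec"
type_synonym 'n rmat = "((real, 'n) vec, 'n) vec"

section \<open>The light cone and its groups\<close>

definition idx_first :: "'n::{finite,linorder}" where "idx_first = Min UNIV"
definition idx_last :: "'n::{finite,linorder}" where "idx_last = Max UNIV"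
definition idx_mid :: "'n::{finite,linorder} set" where "idx_mid = UNIV - {idx_first, idx_last}"

definition lorentz :: "'n::{finite,linorder} rvec \<Rightarrow> 'n rvec \<Rightarrow> real" where
  "lorentz x y = x $ idx_last * y $ idx_last - (\<Sum>i\<in>UNIV - {idx_last}. x $ i * y $ i)"

definition light_cone :: "('n::{finite,linorder} rvec) set" where
  "light_cone = {x. lorentz x x > 0 \<and> x $ idx_last > 0}"

definition Det :: "'n::{finite,linorder} rvec \<Rightarrow> real" where
  "Det x = sqrt (lorentz x x)"

definition base_pt :: "'n::{finite,linorder} rvec" where
  "base_pt = axis idx_last 1"

definition a_mat :: "real \<Rightarrow> 'n::{finite,linorder} rmat" where
  "a_mat t = (\<chi> i j.
     if i = j then (if i \<in> idx_mid then 1 else cosh t)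
     else if i \<in> idx_mid \<or> j \<in> idx_mid then 0
     else sinh t)"

definition n_mat :: "('n::{finite,linorder} \<Rightarrow> real) \<Rightarrow> 'n rmat" where
  "n_mat c = (let r = (\<Sum>k\<in>idx_mid. (c k)\<^sup>2) in \<chi> i j.
     if i = idx_first then
       (if j = idx_first then 1 - r / 2 else if j = idx_last then r / 2 else - c j)
     else if i = idx_last then
       (if j = idx_first then - r / 2 else if j = idx_last then 1 + r / 2 else - c j)
     else
       (if j = idx_first then c i else if j = idx_last then - c i else if i = j then 1 else 0))"

definition h_mat :: "real \<Rightarrow> real \<Rightarrow> ('n::{finite,linorder} \<Rightarrow> real) \<Rightarrow> 'n rmat" where
  "h_mat \<gamma> t c = \<gamma> *\<^sub>R (a_mat t ** n_mat c)"

definition H_grp :: "('n::{finite,linorder} rmat) set" where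
  "H_grp = {h_mat \<gamma> t c | \<gamma> t c. \<gamma> > 0 \<and> c \<in> idx_mid \<rightarrow>\<^sub>E UNIV}"

text \<open>A block matrix with blocks \<open>\<sigma>\<close> and \<open>1\<close> is orthogonal of determinant one
  exactly if \<open>\<sigma>\<close> is.\<close>

definition K_grp :: "('n::{finite,linorder} rmat) set" where
  "K_grp = {k. orthogonal_matrix k \<and> det k = 1 \<and> k $ idx_last $ idx_last = 1 \<and>
     (\<forall>i. i \<noteq> idx_last \<longrightarrow> k $ i $ idx_last = 0 \<and> k $ idx_last $ i = 0)}"

section \<open>Schwartz functions with Fourier support in the cone\<close>

definition partial_deriv ::
    "'n::finite \<Rightarrow> ('n rvec \<Rightarrow> 'a::real_normed_vector) \<Rightarrow> 'n rvec \<Rightarrow> 'a" where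
  "partial_deriv i f x = vector_derivative (\<lambda>t. f (x + t *\<^sub>R axis i 1)) (at 0)"

fun partial_derivs ::
    "'n::finite list \<Rightarrow> ('n rvec \<Rightarrow> 'a::real_normed_vector) \<Rightarrow> 'n rvec \<Rightarrow> 'a" where
  "partial_derivs [] f = f"
| "partial_derivs (i # is) f = partial_deriv i (partial_derivs is f)"

text \<open>Differentiability (in the sense of Frechet) of all iterated partial derivatives makes all
  of them continuous, so this is the class of infinitely often differentiable functions.\<close>

definition smooth :: "('n::finite rvec \<Rightarrow> 'a::real_normed_vector) \<Rightarrow> bool" where
  "smooth f \<longleftrightarrow> (\<forall>is. partial_derivs is f differentiable_on UNIV)"

definition schwartz :: "('n::finite rvec \<Rightarrow> complex) set" where
  "schwartz = {f. smooth f \<and>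
     (\<forall>k is. bounded (range (\<lambda>x. (1 + norm x) ^ k *\<^sub>R partial_derivs is f x)))}"

definition schwartz_seminorm ::
    "nat \<Rightarrow> 'n::finite list \<Rightarrow> ('n rvec \<Rightarrow> complex) \<Rightarrow> real" where
  "schwartz_seminorm k is f = (SUP x. (1 + norm x) ^ k * norm (partial_derivs is f x))"

definition schwartz_topology :: "('n::finite rvec \<Rightarrow> complex) topology" where
  "schwartz_topology = topology_generated_by
     {{g \<in> schwartz. schwartz_seminorm k is (\<lambda>x. g x - f x) < \<epsilon>} | f k is \<epsilon>. f \<in> schwartz \<and> \<epsilon> > 0}"

definition supp :: "('a::topological_space \<Rightarrow> 'b::zero) \<Rightarrow> 'a set" where
  "supp f = closure {x. f x \<noteq> 0}"

definition fourier :: "('n::{finite,linorder} rvec \<Rightarrow> complex) \<Rightarrow> 'n rvec \<Rightarrow> complex" where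
  "fourier f w = of_real ((2 * pi) powr (- real CARD('n) / 2)) *
     (\<integral>x. f x * exp (- \<i> * of_real (lorentz x w)) \<partial>lborel)"

definition S_cone :: "('n::{finite,linorder} rvec \<Rightarrow> complex) set" where
  "S_cone = {f \<in> schwartz. supp (fourier f) \<subseteq> closure light_cone}"

text \<open>The conjugate linear dual; the pairing of \<open>\<phi>\<close> with \<open>f\<close> is \<open>\<phi> f\<close>. A functional is
  normalised outside its domain, so that equality of functionals is equality of functions.\<close>

definition S_cone_dual :: "(('n::{finite,linorder} rvec \<Rightarrow> complex) \<Rightarrow> complex) set" where
  "S_cone_dual = {\<phi> \<in> extensional S_cone.
     (\<forall>f\<in>S_cone. \<forall>g\<in>S_cone. \<phi> (\<lambda>x. f x + g x) = \<phi> f + \<phi> g) \<and>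
     (\<forall>a. \<forall>f\<in>S_cone. \<phi> (\<lambda>x. a * f x) = cnj a * \<phi> f) \<and>
     continuous_map (subtopology schwartz_topology S_cone) euclidean \<phi>}"

section \<open>Mixed norm spaces and coorbits\<close>

text \<open>Used only with positive exponents.\<close>

definition epowr :: "ennreal \<Rightarrow> real \<Rightarrow> ennreal" where
  "epowr x r = (if x = \<infinity> then \<infinity> else ennreal (enn2real x powr r))"

definition Lp_norm :: "real \<Rightarrow> ('n::finite rvec \<Rightarrow> complex) \<Rightarrow> ennreal" where
  "Lp_norm p f = epowr (\<integral>\<^sup>+x. ennreal (cmod (f x) powr p) \<partial>lborel) (1 / p)"

text \<open>The coordinates \<open>(\<gamma>, t, c)\<close> of \<open>\<gamma> a\<^sub>t n\<^sub>c\<close> in the group \<open>H\<close> are global, as are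
  the coordinates \<open>((\<gamma>, t, c), b)\<close> on the semidirect product of \<open>H\<close> with the translations;
  functions on the groups are functions of these coordinates. The measure below is
  \<open>d\<gamma> dt dc\<close>; the factor \<open>1 / \<gamma>\<^sup>n\<^sup>+\<^sup>1\<close> of the Haar measure is part of the mixed norm.\<close>

type_synonym 'n H_coords = "real \<times> real \<times> ('n \<Rightarrow> real)"

definition coord_measure :: "'n::{finite,linorder} H_coords measure" where
  "coord_measure =
     restrict_space lborel {0<..} \<Otimes>\<^sub>M (lborel \<Otimes>\<^sub>M (\<Pi>\<^sub>M i\<in>idx_mid. lborel))"

definition Lpqs_norm ::
    "real \<Rightarrow> real \<Rightarrow> real \<Rightarrow> ('n::{finite,linorder} H_coords \<times> 'n rvec \<Rightarrow> complex) \<Rightarrow> ennreal" where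
  "Lpqs_norm p q s F = epowr
     (\<integral>\<^sup>+(\<gamma>, t, c). epowr (\<integral>\<^sup>+b. ennreal (cmod (F ((\<gamma>, t, c), b)) powr p) \<partial>lborel) (q / p)
        * ennreal (\<gamma> powr s / \<gamma> ^ (CARD('n) + 1)) \<partial>coord_measure) (1 / q)"

definition Lpqs ::
    "real \<Rightarrow> real \<Rightarrow> real \<Rightarrow> ('n::{finite,linorder} H_coords \<times> 'n rvec \<Rightarrow> complex) set" where
  "Lpqs p q s = {F \<in> borel_measurable (coord_measure \<Otimes>\<^sub>M lborel). Lpqs_norm p q s F < \<infinity>}"

fun G_rep ::
    "'n::{finite,linorder} H_coords \<times> 'n rvec \<Rightarrow> ('n rvec \<Rightarrow> complex) \<Rightarrow> 'n rvec \<Rightarrow> complex" where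
  "G_rep ((\<gamma>, t, c), b) f x =
     of_real (\<gamma> powr (- real CARD('n) / 2)) * f (matrix_inv (h_mat \<gamma> t c) *v (x - b))"

definition wavelet_transform ::
    "('n::{finite,linorder} rvec \<Rightarrow> complex) \<Rightarrow> (('n rvec \<Rightarrow> complex) \<Rightarrow> complex)
     \<Rightarrow> 'n H_coords \<times> 'n rvec \<Rightarrow> complex" where
  "wavelet_transform u \<phi> g = \<phi> (G_rep g u)"

definition coorbit_norm ::
    "('n::{finite,linorder} rvec \<Rightarrow> complex) \<Rightarrow> real \<Rightarrow> real \<Rightarrow> real
     \<Rightarrow> (('n rvec \<Rightarrow> complex) \<Rightarrow> complex) \<Rightarrow> ennreal" where
  "coorbit_norm u p q s \<phi> = Lpqs_norm p q s (wavelet_transform u \<phi>)"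

definition coorbit ::
    "('n::{finite,linorder} rvec \<Rightarrow> complex) \<Rightarrow> real \<Rightarrow> real \<Rightarrow> real
     \<Rightarrow> (('n rvec \<Rightarrow> complex) \<Rightarrow> complex) set" where
  "coorbit u p q s = {\<phi> \<in> S_cone_dual. wavelet_transform u \<phi> \<in> Lpqs p q s}"

definition cone_wavelet :: "('n::{finite,linorder} rvec \<Rightarrow> complex) \<Rightarrow> bool" where
  "cone_wavelet u \<longleftrightarrow> u \<in> S_cone \<and>
     compact (supp (fourier u)) \<and> supp (fourier u) \<subseteq> light_cone \<and>
     (\<forall>w. fourier u w \<in> of_real ` {0..1}) \<and>
     (\<exists>U. open U \<and> base_pt \<in> U \<and> (\<forall>w\<in>U. fourier u w \<in> of_real ` {1/2<..1}))"

section \<open>Whitney covers and Besov spaces\<close>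

definition cone_ball_base :: "real \<Rightarrow> ('n::{finite,linorder} rvec) set" where
  "cone_ball_base \<rho> =
     {k *v (exp t *\<^sub>R (a_mat \<tau> *v base_pt)) | k t \<tau>. k \<in> K_grp \<and> t\<^sup>2 + \<tau>\<^sup>2 < \<rho>}"

text \<open>For \<open>w\<close> in the cone the union has exactly one member.\<close>

definition cone_ball :: "real \<Rightarrow> 'n::{finite,linorder} rvec \<Rightarrow> ('n rvec) set" where
  "cone_ball \<rho> w = (\<Union>h\<in>{h \<in> H_grp. h *v base_pt = w}. (*v) h ` cone_ball_base \<rho>)"

text \<open>The cone is not compact and its balls are relatively compact with nonempty interior, so a
  Whitney cover is countably infinite; hence the index set \<^typ>\<open>nat\<close>.\<close>

definition whitney_cover :: "real \<Rightarrow> (nat \<Rightarrow> 'n::{finite,linorder} rvec) \<Rightarrow> bool" where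
  "whitney_cover \<delta> w \<longleftrightarrow> \<delta> > 0 \<and> range w \<subseteq> light_cone \<and>
     disjoint_family (\<lambda>j. cone_ball (\<delta> / 2) (w j)) \<and>
     light_cone \<subseteq> (\<Union>j. cone_ball \<delta> (w j)) \<and>
     (\<exists>N. \<forall>v\<in>light_cone. finite {j. v \<in> cone_ball \<delta> (w j)} \<and> card {j. v \<in> cone_ball \<delta> (w j)} \<le> N)"

text \<open>At each point of the cone only finitely many summands of the denominator are nonzero and
  at least one equals one; off the cone the quotient is \<open>0 / 0 = 0\<close>.\<close>

definition littlewood_paley ::
    "real \<Rightarrow> (nat \<Rightarrow> 'n::{finite,linorder} rvec) \<Rightarrow> ('n rvec \<Rightarrow> real) \<Rightarrow> (nat \<Rightarrow> 'n rmat)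
     \<Rightarrow> (nat \<Rightarrow> 'n rvec \<Rightarrow> complex) \<Rightarrow> bool" where
  "littlewood_paley \<delta> w \<phi> g \<psi> \<longleftrightarrow>
     smooth \<phi> \<and> (\<forall>x. 0 \<le> \<phi> x \<and> \<phi> x \<le> 1) \<and>
     supp \<phi> \<subseteq> cone_ball (2 * \<delta>) base_pt \<and> (\<forall>x\<in>cone_ball \<delta> base_pt. \<phi> x = 1) \<and>
     (\<forall>j. g j \<in> H_grp \<and> w j = g j *v base_pt) \<and>
     (\<forall>j. \<psi> j \<in> schwartz \<and>
        fourier (\<psi> j) = (\<lambda>v. of_real
          (\<phi> (matrix_inv (g j) *v v) / (\<Sum>i. \<phi> (matrix_inv (g i) *v v)))))"

definition dist_conv ::
    "(('n::finite rvec \<Rightarrow> complex) \<Rightarrow> complex) \<Rightarrow> ('n rvec \<Rightarrow> complex) \<Rightarrow> 'n rvec \<Rightarrow> complex" where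
  "dist_conv f \<psi> x = f (\<lambda>y. cnj (\<psi> (x - y)))"

definition besov_norm ::
    "(nat \<Rightarrow> 'n::{finite,linorder} rvec) \<Rightarrow> (nat \<Rightarrow> 'n rvec \<Rightarrow> complex) \<Rightarrow> real \<Rightarrow> real \<Rightarrow> real
     \<Rightarrow> (('n rvec \<Rightarrow> complex) \<Rightarrow> complex) \<Rightarrow> ennreal" where
  "besov_norm w \<psi> p q \<sigma> f = epowr
     (\<Sum>j. ennreal (Det (w j) powr (- \<sigma>)) * epowr (Lp_norm p (dist_conv f (\<psi> j))) q) (1 / q)"

definition besov ::
    "(nat \<Rightarrow> 'n::{finite,linorder} rvec) \<Rightarrow> (nat \<Rightarrow> 'n rvec \<Rightarrow> complex) \<Rightarrow> real \<Rightarrow> real \<Rightarrow> real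
     \<Rightarrow> (('n rvec \<Rightarrow> complex) \<Rightarrow> complex) set" where
  "besov w \<psi> p q \<sigma> = {f \<in> S_cone_dual. besov_norm w \<psi> p q \<sigma> f < \<infinity>}"

end

theory Submission
  imports Defs "HOL-Probability.Characteristic_Functions" "HOL-Probability.Sinc_Integral"
begin

text \<open>
  Both norms measure the size of a functional \<open>f\<close> on test functions through coefficient functions
  \<open>x \<mapsto> f(T\<^sub>x a)\<close>: for the coorbit norm \<open>a\<close> runs through the dilates of the wavelet, for the
  Besov norm through the Littlewood--Paley pieces. If the transform of \<open>a\<close> is a multiplier \<open>F\<close>
  times that of \<open>b\<close>, then \<open>a\<close> is the convolution of \<open>b\<close> with the kernel of \<open>F\<close>, and the
  \<open>L\<^sup>p\<close> norm of the coefficient function of \<open>a\<close> is at most the \<open>L\<^sup>1\<close> norm of the kernel times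
  that of \<open>b\<close> (\<open>young_coeff_fun\<close>). The theorem follows from two such multiplier identities with
  kernels bounded uniformly over all scales.

  For the bound of the coorbit norm: on the support of the transform of a dilated wavelet the
  partition of unity sums to one, and only boundedly many of its members are active. Hence each
  wavelet coefficient is dominated by boundedly many Besov terms (\<open>wavelet_coeff_le\<close>). Integration
  over the group replaces each Besov term by itself times the measure of a group box, which gives
  the Besov weight (\<open>wint_le_bsum\<close>).

  For the bound of the Besov norm: finitely many dilates of the wavelet have transforms whose sum
  is bounded below on the support of the bump function, and this remains true when each dilation
  is perturbed within a small box. Dividing by this sum expresses every Littlewood--Paley piece
  through dilated wavelets, with a multiplier of fixed compact support and with derivatives bounded
  uniformly in the lattice point and in the perturbations; its kernels are uniformly integrable
  (\<open>inv_fourier_uniform_decay\<close>, \<open>psi_le_wavelet_coeff\<close>). As the perturbations are arbitrary, each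
  wavelet coefficient may be replaced by its infimum over a box, which is at most its average
  (\<open>weighted_INF_le_wint\<close>).

  Uniformity rests on the geometry of the action. It is proper on compact subsets of the cone
  (\<open>proper_action\<close>), and a comparison of volumes shows that a group box contains boundedly many
  points of a Whitney cover (\<open>count_bound\<close>).
\<close>

section \<open>Schwartz functions\<close>

lemma norm_matrix_vector_le: "norm (A *v x) \<le> norm A * norm (x :: real ^ 'm)" for A :: "real ^ 'm ^ 'n"
proof -
 have "norm (A *v x) = L2_set (\<lambda>k. \<bar>A $ k \<bullet> x\<bar>) UNIV"
  by (simp add: norm_vec_def matrix_vector_mul_component)
 also have "\<dots> \<le> L2_set (\<lambda>k. norm (A $ k) * norm x) UNIV"
  by (intro L2_set_mono) (auto simp: Cauchy_Schwarz_ineq2)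
 also have "\<dots> = norm A * norm x"
  by (simp add: norm_vec_def L2_set_left_distrib)
 finally show ?thesis .
qed

lemma partial_deriv_eq:
 fixes f :: "'n::finite rvec => 'a::real_normed_vector"
 assumes "(f has_derivative f') (at x)"
 shows "partial_deriv i f x = f' (axis i 1)"
proof -
 have 1: "((\<lambda>t. x + t *\<^sub>R axis i 1) has_derivative (\<lambda>t. t *\<^sub>R axis i 1)) (at 0)"
  by (auto intro!: derivative_eq_intros)
 have "((\<lambda>t. f (x + t *\<^sub>R axis i 1)) has_derivative (\<lambda>t. f' (t *\<^sub>R axis i 1))) (at 0)"
  using has_derivative_compose[OF 1, of f f'] assms by simp
 then have "((\<lambda>t. f (x + t *\<^sub>R axis i 1)) has_vector_derivative f' (axis i 1)) (at 0)"
  using assms by (simp add: has_vector_derivative_def bounded_linear.linear[OF has_derivative_bounded_linear] linear_cmul)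
 then show ?thesis
  unfolding partial_deriv_def by (rule vector_derivative_at)
qed

lemma has_derivative_partial_deriv:
 fixes f :: "'n::finite rvec => 'a::real_normed_vector"
 assumes "f differentiable at x"
 shows "(f has_derivative (\<lambda>h. \<Sum>l\<in>UNIV. (h $ l) *\<^sub>R partial_deriv l f x)) (at x)"
proof -
 obtain f' where f': "(f has_derivative f') (at x)"
  using assms by (auto simp: differentiable_def)
 have lin: "linear f'"
  using f' has_derivative_bounded_linear bounded_linear.linear by blast
 have "f' h = (\<Sum>l\<in>UNIV. (h $ l) *\<^sub>R partial_deriv l f x)" for h
 proof -
  have "f' h = f' (\<Sum>l\<in>UNIV. (h $ l) *\<^sub>R axis l 1)"
   using basis_expansion[of h] by (simp add: scalar_mult_eq_scaleR)
  also have "\<dots> = (\<Sum>l\<in>UNIV. (h $ l) *\<^sub>R f' (axis l 1))"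
   by (simp add: linear_sum[OF lin] linear_cmul[OF lin])
  finally show ?thesis
   by (simp add: partial_deriv_eq[OF f'])
 qed
 then have "f' = (\<lambda>h. \<Sum>l\<in>UNIV. (h $ l) *\<^sub>R partial_deriv l f x)" by auto
 with f' show ?thesis by simp
qed

lemma partial_deriv_has_vector_derivative:
 fixes f :: "'n::finite rvec => 'a::real_normed_vector"
 assumes "f differentiable at (x + t *\<^sub>R axis i 1)"
 shows "((\<lambda>t. f (x + t *\<^sub>R axis i 1)) has_vector_derivative partial_deriv i f (x + t *\<^sub>R axis i 1)) (at t)"
proof -
 obtain f' where f': "(f has_derivative f') (at (x + t *\<^sub>R axis i 1))"
  using assms by (auto simp: differentiable_def)
 have 1: "((\<lambda>t. x + t *\<^sub>R axis i 1) has_derivative (\<lambda>t. t *\<^sub>R axis i 1)) (at t)"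
  by (auto intro!: derivative_eq_intros)
 have "((\<lambda>t. f (x + t *\<^sub>R axis i 1)) has_derivative (\<lambda>t. f' (t *\<^sub>R axis i 1))) (at t)"
  using has_derivative_compose[OF 1, of f f'] f' by simp
 then show ?thesis
  using f' by (simp add: has_vector_derivative_def partial_deriv_eq[OF f'] bounded_linear.linear[OF has_derivative_bounded_linear] linear_cmul)
qed

lemma partial_deriv_add:
 fixes f g :: "'n::finite rvec => 'a::real_normed_vector"
 assumes "f differentiable at x" "g differentiable at x"
 shows "partial_deriv i (\<lambda>x. f x + g x) x = partial_deriv i f x + partial_deriv i g x"
proof -
 obtain f' g' where d: "(f has_derivative f') (at x)" "(g has_derivative g') (at x)"
  using assms by (auto simp: differentiable_def)
 show ?thesis
  using partial_deriv_eq[OF has_derivative_add[OF d]] by (simp add: partial_deriv_eq[OF d(1)] partial_deriv_eq[OF d(2)])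
qed

lemma differentiable_bounded_linear:
 assumes "bounded_linear T" "f differentiable (at x)"
 shows "(\<lambda>x. T (f x)) differentiable (at x)"
 using assms bounded_linear.has_derivative unfolding differentiable_def by blast

lemma partial_deriv_bounded_linear:
 fixes f :: "'n::finite rvec => 'a::real_normed_vector"
 assumes "bounded_linear T" "f differentiable at x"
 shows "partial_deriv i (\<lambda>x. T (f x)) x = T (partial_deriv i f x)"
proof -
 obtain f' where d: "(f has_derivative f') (at x)"
  using assms by (auto simp: differentiable_def)
 show ?thesis
  using partial_deriv_eq[OF bounded_linear.has_derivative[OF assms(1) d]] by (simp add: partial_deriv_eq[OF d])
qed

text \<open>
  Composition with \<open>x \<mapsto> L x + b\<close> mixes the partial derivatives linearly with
  the entries of \<open>L\<close>; this is what makes affine substitutions act on Schwartz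
  functions and on their limits.
\<close>

lemma partial_deriv_affine:
 fixes f :: "'n::finite rvec => 'a::real_normed_vector"
 assumes "f differentiable at (L *v x + b)"
 shows "partial_deriv i (\<lambda>x. f (L *v x + b)) x = (\<Sum>l\<in>UNIV. (L $ l $ i) *\<^sub>R partial_deriv l f (L *v x + b))"
proof -
 have 1: "((\<lambda>x. L *v x + b) has_derivative (\<lambda>h. L *v h)) (at x)"
  by (auto intro!: derivative_eq_intros simp: linear_linear bounded_linear_imp_has_derivative)
 have "((\<lambda>x. f (L *v x + b)) has_derivative (\<lambda>h. \<Sum>l\<in>UNIV. ((L *v h) $ l) *\<^sub>R partial_deriv l f (L *v x + b))) (at x)"
  using has_derivative_compose[OF 1 has_derivative_partial_deriv[OF assms]] .
 from partial_deriv_eq[OF this, of i] show ?thesis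
  by (simp add: matrix_vector_mult_basis column_def)
qed

lemma differentiable_affine:
 fixes f :: "'n::finite rvec => 'a::real_normed_vector"
 assumes "f differentiable at (L *v x + b)"
 shows "(\<lambda>x. f (L *v x + b)) differentiable at x"
proof -
 have 1: "((\<lambda>x. L *v x + b) has_derivative (\<lambda>h. L *v h)) (at x)"
  by (auto intro!: derivative_eq_intros simp: linear_linear bounded_linear_imp_has_derivative)
 show ?thesis
  using has_derivative_compose[OF 1 has_derivative_partial_deriv[OF assms]] differentiableI by blast
qed

lemma partial_derivs_append:
 "partial_derivs (is @ js) f = partial_derivs is (partial_derivs js f)"
 by (induction "is") auto

text \<open>
  Derivatives of a Schwartz function are Schwartz functions, so membership is proved
  coinductively: a class of differentiable, rapidly decreasing functions that is closed under
  partial derivatives consists of Schwartz functions. The closure properties below all follow this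
  pattern.
\<close>

lemma schwartz_coinduct:
 assumes "v \<in> X"
  and "\<And>v x. v \<in> X ==> v differentiable at x"
  and bd: "\<And>v k. v \<in> X ==> \<exists>C. \<forall>x. (1 + norm x) ^ k * cmod (v x) \<le> C"
  and "\<And>v i. v \<in> X ==> partial_deriv i v \<in> X"
 shows "v \<in> schwartz"
proof -
 have *: "partial_derivs is v \<in> X" for "is"
  by (induction "is") (auto intro: assms)
 have "bounded (range (\<lambda>x. (1 + norm x) ^ k *\<^sub>R partial_derivs is v x))" for k "is"
 proof -
  obtain C where C: "\<forall>x. (1 + norm x) ^ k * cmod (partial_derivs is v x) \<le> C"
   using bd[OF *] by blast
  show ?thesis
   unfolding bounded_iff by (rule exI[of _ C]) (use C in auto)
 qed
 moreover have "smooth v"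
  unfolding smooth_def differentiable_on_def
  using assms(2)[OF *] by (auto intro: differentiable_at_withinI)
 ultimately show ?thesis
  by (auto simp: schwartz_def)
qed

lemma schwartz_differentiable: "v \<in> schwartz ==> v differentiable at x"
 unfolding schwartz_def smooth_def differentiable_on_def
 by (metis (mono_tags, lifting) UNIV_I mem_Collect_eq partial_derivs.simps(1))

lemma schwartz_partial_deriv: "v \<in> schwartz ==> partial_deriv i v \<in> schwartz"
 unfolding schwartz_def smooth_def using partial_derivs_append[of _ "[i]" v] by simp metis

lemma schwartz_partial_derivs: "v \<in> schwartz ==> partial_derivs is v \<in> schwartz"
 by (induction "is") (auto intro: schwartz_partial_deriv)

lemma schwartz_decay:
 assumes "v \<in> schwartz"
 obtains C where "C > 0" "\<And>x. (1 + norm x) ^ k * cmod (v x) \<le> C"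
proof -
 have "bounded (range (\<lambda>x. (1 + norm x) ^ k *\<^sub>R partial_derivs [] v x))"
  using assms unfolding schwartz_def by blast
 then obtain C where "C > 0" "\<forall>x\<in>range (\<lambda>x. (1 + norm x) ^ k *\<^sub>R partial_derivs [] v x). norm x \<le> C"
  unfolding bounded_pos by blast
 then show ?thesis by (intro that[of C]) auto
qed

lemma schwartz_add: assumes "f \<in> schwartz" "g \<in> schwartz" shows "(\<lambda>x. f x + g x) \<in> schwartz"
proof (rule schwartz_coinduct[where X = "{\<lambda>x. f x + g x | f g. f \<in> schwartz \<and> g \<in> schwartz}"], goal_cases)
 case 1 then show ?case using assms by blast
next
 case (2 v x) then show ?case using differentiable_add[OF schwartz_differentiable schwartz_differentiable] by auto
next
 case (3 v k)
 then obtain f g where v: "v = (\<lambda>x. f x + g x)" "f \<in> schwartz" "g \<in> schwartz" by blast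
 obtain C where C: "\<And>x. (1 + norm x) ^ k * cmod (f x) \<le> C" using schwartz_decay[OF v(2), of k] by metis
 obtain D where D: "\<And>x. (1 + norm x) ^ k * cmod (g x) \<le> D" using schwartz_decay[OF v(3), of k] by metis
 have "(1 + norm x) ^ k * cmod (f x + g x) \<le> C + D" for x
 proof -
  have "(1 + norm x) ^ k * cmod (f x + g x) \<le> (1 + norm x) ^ k * (cmod (f x) + cmod (g x))"
   by (intro mult_left_mono norm_triangle_ineq) simp
  with C[of x] D[of x] show ?thesis by (simp add: distrib_left)
 qed
 then show ?case unfolding v(1) by blast
next
 case (4 v i)
 then obtain f g where v: "v = (\<lambda>x. f x + g x)" "f \<in> schwartz" "g \<in> schwartz" by blast
 have "partial_deriv i v = (\<lambda>x. partial_deriv i f x + partial_deriv i g x)"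
  unfolding v(1) by (intro ext partial_deriv_add schwartz_differentiable v)
 then show ?case using v schwartz_partial_deriv by blast
qed

lemma schwartz_cmult: assumes "f \<in> schwartz" shows "(\<lambda>x. c * f x) \<in> schwartz"
proof (rule schwartz_coinduct[where X = "{\<lambda>x. c * f x | f. f \<in> schwartz}"], goal_cases)
 case 1 then show ?case using assms by blast
next
 case (2 v x)
 then obtain f where "v = (\<lambda>x. c * f x)" "f \<in> schwartz" by blast
 then show ?case using differentiable_bounded_linear[OF bounded_linear_mult_right[of c] schwartz_differentiable] by metis
next
 case (3 v k)
 then obtain f where v: "v = (\<lambda>x. c * f x)" "f \<in> schwartz" by blast
 obtain C where C: "\<And>x. (1 + norm x) ^ k * cmod (f x) \<le> C" using schwartz_decay[OF v(2), of k] by metis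
 have "(1 + norm x) ^ k * cmod (c * f x) \<le> cmod c * C" for x
  using mult_left_mono[OF C[of x], of "cmod c"] by (simp add: norm_mult mult_ac)
 then show ?case unfolding v(1) by blast
next
 case (4 v i)
 then obtain f where v: "v = (\<lambda>x. c * f x)" "f \<in> schwartz" by blast
 have "partial_deriv i v = (\<lambda>x. c * partial_deriv i f x)"
  unfolding v(1) by (intro ext partial_deriv_bounded_linear[OF bounded_linear_mult_right] schwartz_differentiable v)
 then show ?case using v schwartz_partial_deriv by blast
qed

lemma schwartz_zero: "(\<lambda>x. 0) \<in> schwartz"
proof (rule schwartz_coinduct[where X = "{\<lambda>x. 0}"], goal_cases)
 case (4 v i)
 have "partial_deriv i (\<lambda>x. 0 :: complex) = (\<lambda>x. 0)"
  by (intro ext) (auto simp: partial_deriv_eq[OF has_derivative_const])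
 with 4 show ?case by simp
qed auto

lemma schwartz_sum:
 assumes "\<And>j. j \<in> J ==> f j \<in> schwartz" shows "(\<lambda>x. \<Sum>j\<in>J. f j x) \<in> schwartz"
 using assms by (induction J rule: infinite_finite_induct) (auto intro: schwartz_zero schwartz_add)

lemma schwartz_diff: assumes "f \<in> schwartz" "g \<in> schwartz" shows "(\<lambda>x. f x - g x) \<in> schwartz"
 using schwartz_add[OF assms(1) schwartz_cmult[OF assms(2), of "-1"]] by simp

lemma partial_derivs_add:
 assumes "f \<in> schwartz" "g \<in> schwartz"
 shows "partial_derivs is (\<lambda>x. f x + g x) x = partial_derivs is f x + partial_derivs is g x"
proof -
 have "partial_derivs is (\<lambda>x. f x + g x) = (\<lambda>x. partial_derivs is f x + partial_derivs is g x)"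
 proof (induction "is")
  case (Cons i "is")
  have "partial_derivs (i # is) (\<lambda>x. f x + g x) = partial_deriv i (\<lambda>x. partial_derivs is f x + partial_derivs is g x)"
   using Cons by simp
  also have "\<dots> = (\<lambda>x. partial_derivs (i # is) f x + partial_derivs (i # is) g x)"
   by (intro ext, subst partial_deriv_add)
     (auto intro!: schwartz_differentiable schwartz_partial_derivs assms)
  finally show ?case .
 qed auto
 then show ?thesis by simp
qed

lemma partial_derivs_cmult:
 assumes "f \<in> schwartz"
 shows "partial_derivs is (\<lambda>x. c * f x) x = c * partial_derivs is f x"
proof -
 have "partial_derivs is (\<lambda>x. c * f x) = (\<lambda>x. c * partial_derivs is f x)"
 proof (induction "is")
  case (Cons i "is")
  have "partial_derivs (i # is) (\<lambda>x. c * f x) = partial_deriv i (\<lambda>x. c * partial_derivs is f x)"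
   using Cons by simp
  also have "\<dots> = (\<lambda>x. c * partial_derivs (i # is) f x)"
   by (intro ext, subst partial_deriv_bounded_linear[OF bounded_linear_mult_right])
     (auto intro!: schwartz_differentiable schwartz_partial_derivs assms)
  finally show ?case .
 qed auto
 then show ?thesis by simp
qed

lemma partial_derivs_diff:
 assumes "f \<in> schwartz" "g \<in> schwartz"
 shows "partial_derivs is (\<lambda>x. f x - g x) x = partial_derivs is f x - partial_derivs is g x"
 using partial_derivs_add[OF assms(1) schwartz_cmult[OF assms(2), of "-1"]]
  partial_derivs_cmult[OF assms(2), of _ "-1"] by simp

lemma partial_derivs_sum:
 assumes "finite J" "\<And>j. j \<in> J ==> f j \<in> schwartz"
 shows "partial_derivs is (\<lambda>x. \<Sum>j\<in>J. f j x) x = (\<Sum>j\<in>J. partial_derivs is (f j) x)"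
 using assms
proof (induction J arbitrary: x)
 case empty
 have "partial_derivs is (\<lambda>x. 0::complex) x = 0"
  using partial_derivs_cmult[OF schwartz_zero, of "is" 0 x] by simp
 then show ?case by simp
next
 case (insert j J)
 have "partial_derivs is (\<lambda>x. f j x + (\<Sum>j\<in>J. f j x)) x = partial_derivs is (f j) x + partial_derivs is (\<lambda>x. \<Sum>j\<in>J. f j x) x"
  by (rule partial_derivs_add) (use insert in \<open>auto intro: schwartz_sum\<close>)
 with insert show ?case by simp
qed

lemma matrix_inv_works:
 fixes L :: "real ^ 'n::finite ^ 'n"
 assumes "invertible L"
 shows "matrix_inv L ** L = mat 1" "L ** matrix_inv L = mat 1"
proof -
 have "\<exists>A'. L ** A' = mat 1 \<and> A' ** L = mat 1"
  using assms unfolding invertible_def by blast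
 from someI_ex[OF this] show "matrix_inv L ** L = mat 1" "L ** matrix_inv L = mat 1"
  unfolding matrix_inv_def by auto
qed

lemma invertible_mat_one: "invertible (mat 1 :: real ^ 'n::finite ^ 'n)"
 unfolding invertible_def by (rule exI[of _ "mat 1"]) simp

text \<open>
  Weights \<open>(1 + norm x) ^ k\<close> can be moved across an invertible affine map. The
  constants are uniform for maps near the given one, because \<open>M\<close>, the inverse of
  \<open>L\<close>, gives \<open>x = M (z - b' - (L' - L) x)\<close> and the last term is absorbed
  on the left for small \<open>d\<close>.
\<close>

lemma affine_expansion_bound:
 fixes L :: "real ^ 'n::finite ^ 'n"
 assumes "invertible L"
 obtains A d where "A \<ge> 1" "d > 0"
  "\<And>L' b' x. norm (L' - L) \<le> d ==> norm (b' - b) \<le> d ==> 1 + norm x \<le> A * (1 + norm (L' *v x + b'))"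
proof -
 define M where "M = matrix_inv L"
 have MiL: "M ** L = mat 1" unfolding M_def using matrix_inv_works[OF assms] by simp
 define N where "N = norm M + 1"
 have N: "N > 0" "norm M \<le> N" unfolding N_def by (auto intro: add_nonneg_pos)
 define d where "d = min 1 (1 / (2 * N))"
 have d: "d > 0" "d \<le> 1" "N * d \<le> 1 / 2" using N unfolding d_def by (auto simp: min_def field_simps)
 define A where "A = 1 + 2 * N * (1 + (norm b + 1))"
 have A: "A \<ge> 1" using N unfolding A_def by auto
 show ?thesis
 proof (rule that[OF A d(1)])
  fix L' :: "real ^ 'n::finite ^ 'n" and b' x
  assume L': "norm (L' - L) \<le> d" and b': "norm (b' - b) \<le> d"
  define z where "z = L' *v x + b'"
  have "x = M *v (L *v x)" by (simp add: matrix_vector_mul_assoc MiL)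
  also have "L *v x = z - b' - (L' - L) *v x"
   unfolding z_def by (simp add: matrix_vector_mult_diff_rdistrib)
  finally have "norm x \<le> norm M * norm (z - b' - (L' - L) *v x)"
   using norm_matrix_vector_le[of M] by metis
  also have "\<dots> \<le> N * (norm z + norm b' + norm ((L' - L) *v x))"
   using N by (intro mult_mono order.trans[OF norm_triangle_ineq4] add_mono) auto
  also have "\<dots> \<le> N * (norm z + norm b' + d * norm x)"
   using N L' by (intro mult_left_mono add_left_mono order.trans[OF norm_matrix_vector_le] mult_right_mono) auto
  also have "\<dots> \<le> N * (norm z + norm b') + 1 / 2 * norm x"
   using mult_right_mono[OF d(3), of "norm x"] by (simp add: algebra_simps)
  finally have "norm x \<le> 2 * N * (norm z + norm b')" by (simp add: algebra_simps)
  also have "norm b' \<le> norm b + 1"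
   using b' d(2) norm_triangle_ineq2[of b' b] by linarith
  finally have "norm x \<le> 2 * N * (norm z + (norm b + 1))" using N by (simp add: mult_left_mono)
  also have "\<dots> \<le> 2 * N * (1 + (norm b + 1)) * (1 + norm z)"
  proof -
   have "norm z + (norm b + 1) \<le> (1 + (norm b + 1)) * (1 + norm z)"
    by (simp add: algebra_simps)
   with N show ?thesis by (simp add: mult.assoc)
  qed
  finally have nx: "norm x \<le> 2 * N * (1 + (norm b + 1)) * (1 + norm z)" .
  have "1 + norm x \<le> 1 * (1 + norm z) + 2 * N * (1 + (norm b + 1)) * (1 + norm z)"
   by (rule add_mono[OF _ nx]) simp
  then show "1 + norm x \<le> A * (1 + norm z)"
   unfolding A_def by (simp only: distrib_right)
 qed
qed

lemma schwartz_affine: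
 fixes f :: "'n::finite rvec => complex" and L :: "'n rmat"
 assumes "f \<in> schwartz" "invertible L" shows "(\<lambda>x. f (L *v x + b)) \<in> schwartz"
proof (rule schwartz_coinduct[where X = "{\<lambda>x. f (L *v x + b) | f. f \<in> schwartz}"], goal_cases)
 case 1 then show ?case using assms by blast
next
 case (2 v x) then show ?case
  using differentiable_affine[OF schwartz_differentiable] by auto
next
 case (3 v k)
 then obtain f where v: "v = (\<lambda>x. f (L *v x + b))" "f \<in> schwartz" by blast
 obtain C where C: "\<And>x. (1 + norm x) ^ k * cmod (f x) \<le> C" using schwartz_decay[OF v(2), of k] by metis
 obtain A d where A: "A \<ge> 1" "d > 0" "\<And>L' b' x. norm (L' - L) \<le> d ==> norm (b' - b) \<le> d ==> 1 + norm x \<le> A * (1 + norm (L' *v x + b'))"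
  using affine_expansion_bound[OF assms(2)] by metis
 have "(1 + norm x) ^ k * cmod (f (L *v x + b)) \<le> A ^ k * C" for x
 proof -
  have "(1 + norm x) ^ k * cmod (f (L *v x + b)) \<le> (A * (1 + norm (L *v x + b))) ^ k * cmod (f (L *v x + b))"
   using A by (intro mult_right_mono power_mono) auto
  also have "\<dots> \<le> A ^ k * C"
   using C[of "L *v x + b"] A by (simp add: power_mult_distrib mult.assoc)
  finally show ?thesis .
 qed
 then show ?case unfolding v(1) by blast
next
 case (4 v i)
 then obtain f where v: "v = (\<lambda>x. f (L *v x + b))" "f \<in> schwartz" by blast
 define f' where "f' = (\<lambda>y. \<Sum>l\<in>UNIV. of_real (L $ l $ i) * partial_deriv l f y)"
 have "partial_deriv i v = (\<lambda>x. f' (L *v x + b))"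
  unfolding v(1) f'_def
  by (intro ext, subst partial_deriv_affine) (auto intro: schwartz_differentiable v simp: scaleR_conv_of_real)
 moreover have "f' \<in> schwartz"
  unfolding f'_def by (intro schwartz_sum schwartz_cmult schwartz_partial_deriv v)
 ultimately show ?case by blast
qed

lemma schwartz_translate: "f \<in> schwartz ==> (\<lambda>x. f (x - b)) \<in> schwartz"
 using schwartz_affine[of f "mat 1" "- b"] by (simp add: invertible_mat_one)

section \<open>Convergence in the Schwartz space\<close>

text \<open>
  Convergence in all Schwartz seminorms, in the form in which it is verified; it implies
  convergence in the topology.
\<close>

definition schwartz_lim :: "(nat => 'n::finite rvec => complex) => ('n rvec => complex) => bool" where
 "schwartz_lim G g \<longleftrightarrow> (\<forall>k is. uniform_limit UNIV (\<lambda>m x. (1 + norm x) ^ k *\<^sub>R partial_derivs is (G m) x)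
   (\<lambda>x. (1 + norm x) ^ k *\<^sub>R partial_derivs is g x) sequentially)"

lemma schwartz_limI:
 assumes "\<And>k is e. e > 0 ==> \<forall>\<^sub>F m in sequentially. \<forall>x.
   (1 + norm x) ^ k * cmod (partial_derivs is (G m) x - partial_derivs is g x) < e"
 shows "schwartz_lim G g"
 unfolding schwartz_lim_def
proof (intro allI uniform_limitI)
 fix k "is" and e :: real assume "e > 0"
 from assms[OF this, of k "is"]
 show "\<forall>\<^sub>F m in sequentially. \<forall>x\<in>UNIV. dist ((1 + norm x) ^ k *\<^sub>R partial_derivs is (G m) x)
   ((1 + norm x) ^ k *\<^sub>R partial_derivs is g x) < e"
  by (rule eventually_mono) (simp add: dist_norm flip: scaleR_diff_right)
qed

lemma schwartz_limD:
 assumes "schwartz_lim G g" "e > 0"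
 shows "\<forall>\<^sub>F m in sequentially. \<forall>x.
   (1 + norm x) ^ k * cmod (partial_derivs is (G m) x - partial_derivs is g x) < e"
proof -
 have "uniform_limit UNIV (\<lambda>m x. (1 + norm x) ^ k *\<^sub>R partial_derivs is (G m) x)
   (\<lambda>x. (1 + norm x) ^ k *\<^sub>R partial_derivs is g x) sequentially"
  using assms(1) unfolding schwartz_lim_def by blast
 from uniform_limitD[OF this assms(2)] show ?thesis
  by (rule eventually_mono) (simp add: dist_norm flip: scaleR_diff_right)
qed

lemma schwartz_seminorm_upper:
 assumes "f \<in> schwartz"
 shows "(1 + norm x) ^ k * norm (partial_derivs is f x) \<le> schwartz_seminorm k is f"
proof -
 obtain C where C: "\<And>x. (1 + norm x) ^ k * cmod (partial_derivs is f x) \<le> C"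
  using schwartz_decay[OF schwartz_partial_derivs[OF assms]] by metis
 show ?thesis
  unfolding schwartz_seminorm_def by (rule cSUP_upper) (auto intro!: bdd_aboveI[where M = C] C)
qed

text \<open>
  Only subbasic sets need to be checked, and on these the triangle inequality for one seminorm
  suffices.
\<close>

lemma limitin_schwartz_topology:
 assumes G: "\<And>m. G m \<in> schwartz" and g: "g \<in> schwartz" and lim: "schwartz_lim G g"
 shows "limitin schwartz_topology G g sequentially"
proof -
 let ?B = "{{g \<in> schwartz. schwartz_seminorm k is (\<lambda>x. g x - f x) < \<epsilon>} | (f :: 'a rvec => complex) k is \<epsilon>. f \<in> schwartz \<and> \<epsilon> > 0}"
 have ev: "\<forall>\<^sub>F m in sequentially. G m \<in> U" if "generate_topology_on ?B U" "g \<in> U" for U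
  using that
 proof induction
  case (Basis U)
  then obtain f k "is" \<epsilon> where U: "U = {g \<in> schwartz. schwartz_seminorm k is (\<lambda>x. g x - f x) < \<epsilon>}"
   and f: "f \<in> schwartz" "\<epsilon> > 0" by blast
  define e where "e = (\<epsilon> - schwartz_seminorm k is (\<lambda>x. g x - f x)) / 2"
  have e: "e > 0" using Basis U unfolding e_def by auto
  have "\<forall>\<^sub>F m in sequentially. \<forall>x. (1 + norm x) ^ k * cmod (partial_derivs is (G m) x - partial_derivs is g x) < e"
   by (rule schwartz_limD[OF lim e])
  then show ?case
  proof (rule eventually_mono)
   fix m assume m: "\<forall>x. (1 + norm x) ^ k * cmod (partial_derivs is (G m) x - partial_derivs is g x) < e"
   have "schwartz_seminorm k is (\<lambda>x. G m x - f x) \<le> e + schwartz_seminorm k is (\<lambda>x. g x - f x)"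
    unfolding schwartz_seminorm_def[of k "is" "\<lambda>x. G m x - f x"]
   proof (rule cSUP_least)
    fix x
    have "(1 + norm x) ^ k * cmod (partial_derivs is (\<lambda>x. G m x - f x) x)
     = (1 + norm x) ^ k * cmod ((partial_derivs is (G m) x - partial_derivs is g x) + partial_derivs is (\<lambda>x. g x - f x) x)"
     by (simp add: partial_derivs_diff G f g)
    also have "\<dots> \<le> (1 + norm x) ^ k * (cmod (partial_derivs is (G m) x - partial_derivs is g x) + cmod (partial_derivs is (\<lambda>x. g x - f x) x))"
     by (intro mult_left_mono norm_triangle_ineq) auto
    also have "\<dots> \<le> e + schwartz_seminorm k is (\<lambda>x. g x - f x)"
     using m schwartz_seminorm_upper[OF schwartz_diff[OF g f(1)], of x k "is"]
     by (simp add: distrib_left add_mono less_imp_le)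
    finally show "(1 + norm x) ^ k * cmod (partial_derivs is (\<lambda>x. G m x - f x) x) \<le> e + schwartz_seminorm k is (\<lambda>x. g x - f x)" .
   qed auto
   also have "\<dots> < \<epsilon>" using e unfolding e_def by (simp add: field_simps)
   finally show "G m \<in> U" using U G by auto
  qed
 next
  case (Int a b) then show ?case by (auto intro: eventually_conj)
 next
  case (UN K)
  then obtain X where X: "X \<in> K" "g \<in> X" by blast
  from UN.IH[OF this] show ?case by (rule eventually_mono) (use X in blast)
 qed auto
 have top: "g \<in> topspace schwartz_topology"
 proof -
  have "openin schwartz_topology {h \<in> schwartz. schwartz_seminorm 0 [] (\<lambda>x. h x - g x) < 1}"
   unfolding schwartz_topology_def openin_topology_generated_by_iff
   by (rule generate_topology_on.Basis) (use g in force)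
  moreover have "g \<in> {h \<in> schwartz. schwartz_seminorm 0 [] (\<lambda>x. h x - g x) < 1}"
   using g by (simp add: schwartz_seminorm_def)
  ultimately show ?thesis using openin_subset by blast
 qed
 show ?thesis
  unfolding limitin_def using top ev
  unfolding schwartz_topology_def openin_topology_generated_by_iff by auto
qed

text \<open>
  The only way in which continuity of a functional in the dual is used.
\<close>

lemma S_cone_dual_tendsto:
 assumes f: "f \<in> S_cone_dual" and G: "\<And>m. G m \<in> S_cone" "g \<in> S_cone" and lim: "schwartz_lim G g"
 shows "(\<lambda>m. f (G m)) \<longlonglongrightarrow> f g"
proof -
 have "limitin (subtopology schwartz_topology S_cone) G g sequentially"
  unfolding limitin_subtopology using G lim
  by (auto intro!: limitin_schwartz_topology simp: S_cone_def)
 moreover have "continuous_map (subtopology schwartz_topology S_cone) euclidean f"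
  using f unfolding S_cone_dual_def by blast
 ultimately have "limitin euclidean (f \<circ> G) (f g) sequentially"
  by (rule continuous_map_limit[rotated])
 then show ?thesis by (simp add: o_def)
qed

lemma partial_deriv_translate:
 "partial_deriv i (\<lambda>y. v (y - x)) y = partial_deriv i v (y - x)"
 unfolding partial_deriv_def by (simp add: algebra_simps)

lemma partial_derivs_translate:
 "partial_derivs is (\<lambda>y. v (y - x)) y = partial_derivs is v (y - x)"
proof -
 have "partial_derivs is (\<lambda>y. v (y - x)) = (\<lambda>y. partial_derivs is v (y - x))"
  by (induction "is") (auto simp: partial_deriv_translate)
 then show ?thesis by simp
qed

lemma schwartz_lim_translate:
 assumes "schwartz_lim G g"
 shows "schwartz_lim (\<lambda>m y. G m (y - x)) (\<lambda>y. g (y - x))"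
proof (rule schwartz_limI)
 fix k "is" and e :: real assume e: "e > 0"
 define e' where "e' = e / (1 + norm x) ^ k"
 have e': "e' > 0" using e unfolding e'_def by (simp add: add_pos_nonneg)
 from schwartz_limD[OF assms this, of k "is"]
 show "\<forall>\<^sub>F m in sequentially. \<forall>y.
   (1 + norm y) ^ k * cmod (partial_derivs is (\<lambda>y. G m (y - x)) y - partial_derivs is (\<lambda>y. g (y - x)) y) < e"
 proof (rule eventually_mono, intro allI)
  fix m y
  assume *: "\<forall>x. (1 + norm x) ^ k * cmod (partial_derivs is (G m) x - partial_derivs is g x) < e'"
  let ?d = "cmod (partial_derivs is (G m) (y - x) - partial_derivs is g (y - x))"
  have "1 + norm y \<le> 1 + (norm (y - x) + norm x)" using norm_triangle_sub[of y x] by linarith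
  also have "\<dots> \<le> (1 + norm x) * (1 + norm (y - x))"
   by (simp add: algebra_simps)
  finally have "(1 + norm y) ^ k * ?d \<le> ((1 + norm x) * (1 + norm (y - x))) ^ k * ?d"
   by (intro mult_right_mono power_mono) auto
  also have "\<dots> = (1 + norm x) ^ k * ((1 + norm (y - x)) ^ k * ?d)"
   by (simp add: power_mult_distrib mult_ac)
  also have "\<dots> < (1 + norm x) ^ k * e'"
   using * by (intro mult_strict_left_mono) (auto intro!: zero_less_power add_pos_nonneg)
  also have "\<dots> = e"
  proof -
   have "(1 + norm x) ^ k > 0" by (intro zero_less_power add_pos_nonneg) auto
   then show ?thesis unfolding e'_def by (metis less_numeral_extra(3) nonzero_mult_div_cancel_left times_divide_eq_right)
  qed
  finally show "(1 + norm y) ^ k * cmod (partial_derivs is (\<lambda>y. G m (y - x)) y - partial_derivs is (\<lambda>y. g (y - x)) y) < e"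
   by (simp add: partial_derivs_translate)
 qed
qed

text \<open>
  Weighted mean value inequality: along the segment the weight at \<open>x\<close> is dominated by
  the weight at the point where the derivative is evaluated.
\<close>

lemma schwartz_lipschitz:
 fixes v :: "'n::finite rvec => complex"
 assumes v: "v \<in> schwartz"
 obtains C where "C > 0"
  "\<And>x z1 z2 A. A \<ge> 1 ==> (\<And>z. z \<in> closed_segment z1 z2 ==> 1 + norm (x :: 'n::finite rvec) \<le> A * (1 + norm z)) ==>
   (1 + norm x) ^ k * cmod (v z1 - v z2) \<le> C * A ^ k * norm (z1 - z2)"
proof -
 have "\<forall>l. \<exists>C. C > 0 \<and> (\<forall>x. (1 + norm x) ^ k * cmod (partial_deriv l v x) \<le> C)"
  using schwartz_decay[OF schwartz_partial_deriv[OF v]] by metis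
 then obtain c where c: "\<And>l. c l > 0" "\<And>l x. (1 + norm x) ^ k * cmod (partial_deriv l v x) \<le> c l" by metis
 define C where "C = (\<Sum>l\<in>UNIV. c l)"
 have C: "C > 0" unfolding C_def by (intro sum_pos c) auto
 show ?thesis
 proof (rule that[OF C])
  fix x z1 z2 :: "'n rvec" and A :: real
  assume A: "A \<ge> 1" and seg: "\<And>z. z \<in> closed_segment z1 z2 ==> 1 + norm x \<le> A * (1 + norm z)"
  have xp: "(1 + norm x) ^ k > 0" by (intro zero_less_power add_pos_nonneg) auto
  have bd: "onorm (\<lambda>h. \<Sum>l\<in>UNIV. (h $ l) *\<^sub>R partial_deriv l v z) \<le> C * A ^ k / (1 + norm x) ^ k"
   if z: "z \<in> closed_segment z1 z2" for z
  proof (rule onorm_le)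
   fix h :: "'n rvec"
   have "(1 + norm x) ^ k * cmod (partial_deriv l v z) \<le> A ^ k * c l" for l
   proof -
    have "(1 + norm x) ^ k * cmod (partial_deriv l v z) \<le> (A * (1 + norm z)) ^ k * cmod (partial_deriv l v z)"
     by (intro mult_right_mono power_mono seg z) auto
    also have "\<dots> \<le> A ^ k * c l"
     using c(2)[of z l] A by (simp add: power_mult_distrib mult.assoc)
    finally show ?thesis .
   qed
   then have b: "cmod (partial_deriv l v z) \<le> A ^ k * c l / (1 + norm x) ^ k" for l
    using xp by (simp add: pos_le_divide_eq mult.commute)
   have "cmod (\<Sum>l\<in>UNIV. (h $ l) *\<^sub>R partial_deriv l v z) \<le> (\<Sum>l\<in>UNIV. norm h * (A ^ k * c l / (1 + norm x) ^ k))"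
    by (rule order.trans[OF norm_sum], rule sum_mono, unfold norm_scaleR, rule mult_mono)
      (auto intro: b component_le_norm_cart)
   also have "\<dots> = C * A ^ k / (1 + norm x) ^ k * norm h"
    unfolding C_def by (simp add: sum_distrib_left sum_distrib_right sum_divide_distrib mult_ac)
   finally show "cmod (\<Sum>l\<in>UNIV. (h $ l) *\<^sub>R partial_deriv l v z) \<le> C * A ^ k / (1 + norm x) ^ k * norm h" .
  qed
  have "cmod (v z1 - v z2) \<le> C * A ^ k / (1 + norm x) ^ k * norm (z1 - z2)"
   by (rule differentiable_bound[OF convex_closed_segment has_derivative_at_withinI[OF has_derivative_partial_deriv[OF schwartz_differentiable[OF v]]] bd])
     auto
  then show "(1 + norm x) ^ k * cmod (v z1 - v z2) \<le> C * A ^ k * norm (z1 - z2)"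
   using xp by (simp add: field_simps)
 qed
qed

lemma schwartz_affine_uniform_limit:
 fixes v :: "'n::finite rvec => complex" and L :: "'n rmat"
 assumes v: "v \<in> schwartz" and L: "invertible L" and lim: "Lm \<longlonglongrightarrow> L" "bm \<longlonglongrightarrow> b"
 shows "uniform_limit UNIV (\<lambda>m x. (1 + norm x) ^ k *\<^sub>R v (Lm m *v x + bm m)) (\<lambda>x. (1 + norm x) ^ k *\<^sub>R v (L *v x + b)) sequentially"
proof (rule uniform_limitI)
 fix e :: real assume e: "e > 0"
 obtain A d where A: "A \<ge> 1" "d > 0" "\<And>L' b' x. norm (L' - L) \<le> d ==> norm (b' - b) \<le> d ==> 1 + norm x \<le> A * (1 + norm (L' *v x + b'))"
  using affine_expansion_bound[OF L] by metis
 obtain C where C: "C > 0"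
  "\<And>x z1 z2 A. A \<ge> 1 ==> (\<And>z. z \<in> closed_segment z1 z2 ==> 1 + norm (x :: 'n::finite rvec) \<le> A * (1 + norm z)) ==>
   (1 + norm x) ^ (Suc k) * cmod (v z1 - v z2) \<le> C * A ^ (Suc k) * norm (z1 - z2)"
  using schwartz_lipschitz[OF v, of "Suc k"] by metis
 define d' where "d' = min d (e / (4 * C * A ^ Suc k))"
 have CA: "C * A ^ Suc k > 0" using C A by auto
 have d': "d' > 0" using A e CA unfolding d'_def by (auto simp: mult.assoc simp del: power_Suc)
 have "\<forall>\<^sub>F m in sequentially. norm (Lm m - L) < d'" "\<forall>\<^sub>F m in sequentially. norm (bm m - b) < d'"
  using lim[THEN tendstoD, OF d'] by (auto simp: dist_norm)
 then show "\<forall>\<^sub>F m in sequentially. \<forall>x\<in>UNIV. dist ((1 + norm x) ^ k *\<^sub>R v (Lm m *v x + bm m)) ((1 + norm x) ^ k *\<^sub>R v (L *v x + b)) < e"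
 proof eventually_elim
  case (elim m)
  show ?case
  proof
   fix x :: "'n rvec"
   have xp: "1 + norm x > 0" by (intro add_pos_nonneg) auto
   have seg: "1 + norm x \<le> A * (1 + norm z)" if "z \<in> closed_segment (Lm m *v x + bm m) (L *v x + b)" for z
   proof -
    obtain \<theta> where \<theta>: "0 \<le> \<theta>" "\<theta> \<le> 1" "z = (1 - \<theta>) *\<^sub>R (Lm m *v x + bm m) + \<theta> *\<^sub>R (L *v x + b)"
     using \<open>z \<in> _\<close> unfolding in_segment by blast
    define L' where "L' = L + (1 - \<theta>) *\<^sub>R (Lm m - L)"
    define b' where "b' = b + (1 - \<theta>) *\<^sub>R (bm m - b)"
    have z: "z = L' *v x + b'"
     unfolding \<theta>(3) L'_def b'_def
     by (simp add: algebra_simps matrix_vector_mult_add_rdistrib matrix_vector_mult_diff_rdistrib scaleR_matrix_vector_assoc[symmetric] del: vector_scaleR_matrix_ac)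
    have "(1 - \<theta>) * norm (Lm m - L) \<le> 1 * d" "(1 - \<theta>) * norm (bm m - b) \<le> 1 * d"
     using elim \<theta> A unfolding d'_def by (intro mult_mono; auto)+
    then have "norm (L' - L) \<le> d" "norm (b' - b) \<le> d"
     using \<theta> unfolding L'_def b'_def by auto
    from A(3)[OF this] show ?thesis unfolding z .
   qed
   have "norm ((Lm m *v x + bm m) - (L *v x + b)) \<le> norm ((Lm m - L) *v x) + norm (bm m - b)"
    using norm_triangle_ineq[of "(Lm m - L) *v x" "bm m - b"] by (simp add: matrix_vector_mult_diff_rdistrib algebra_simps)
   also have "\<dots> \<le> d' * norm x + d'"
    using elim by (intro add_mono order.trans[OF norm_matrix_vector_le] mult_right_mono) auto
   finally have nz: "norm ((Lm m *v x + bm m) - (L *v x + b)) \<le> d' * (1 + norm x)" by (simp add: algebra_simps)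
   have "(1 + norm x) ^ Suc k * cmod (v (Lm m *v x + bm m) - v (L *v x + b)) \<le> C * A ^ Suc k * (d' * (1 + norm x))"
    using C(2)[OF A(1) seg] mult_left_mono[OF nz, of "C * A ^ Suc k"] CA by (meson less_imp_le order.trans)
   then have "(1 + norm x) * ((1 + norm x) ^ k * cmod (v (Lm m *v x + bm m) - v (L *v x + b))) \<le> (1 + norm x) * (C * A ^ Suc k * d')"
    by (simp add: mult_ac)
   then have "(1 + norm x) ^ k * cmod (v (Lm m *v x + bm m) - v (L *v x + b)) \<le> C * A ^ Suc k * d'"
    using xp mult_le_cancel_left_pos by blast
   also have "\<dots> \<le> C * A ^ Suc k * (e / (4 * C * A ^ Suc k))"
    using CA unfolding d'_def by (intro mult_left_mono) auto
   also have "\<dots> = e / 4" using C(1) A(1) by (simp add: field_simps del: power_Suc)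
   also have "\<dots> < e" using e by simp
   finally show "dist ((1 + norm x) ^ k *\<^sub>R v (Lm m *v x + bm m)) ((1 + norm x) ^ k *\<^sub>R v (L *v x + b)) < e"
    by (simp add: dist_norm flip: scaleR_diff_right)
  qed
 qed
qed

lemma uniform_limit_sum_finite:
 assumes "finite J" "\<And>j. j \<in> J ==> uniform_limit X (f j) (g j) F"
 shows "uniform_limit X (\<lambda>m x. \<Sum>j\<in>J. f j m x) (\<lambda>x. \<Sum>j\<in>J. (g j x :: 'a :: real_normed_vector)) F"
 using assms by (induction J) (auto intro!: uniform_limit_const uniform_limit_add)

lemma partial_derivs_snoc_affine:
 fixes v :: "'n::finite rvec => complex" and L :: "'n rmat"
 assumes v: "v \<in> schwartz" and L: "invertible L"
 shows "partial_derivs (is @ [i]) (\<lambda>x. v (L *v x + b)) x =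
  (\<Sum>l\<in>UNIV. (L $ l $ i) *\<^sub>R partial_derivs is (\<lambda>x. partial_deriv l v (L *v x + b)) x)"
proof -
 have "partial_deriv i (\<lambda>x. v (L *v x + b)) = (\<lambda>x. \<Sum>l\<in>UNIV. of_real (L $ l $ i) * partial_deriv l v (L *v x + b))"
  by (intro ext, subst partial_deriv_affine) (auto intro: schwartz_differentiable v simp: scaleR_conv_of_real)
 moreover have s: "(\<lambda>x. partial_deriv l v (L *v x + b)) \<in> schwartz" for l
  by (intro schwartz_affine[of "partial_deriv l v"] schwartz_partial_deriv v L)
 ultimately have "partial_derivs (is @ [i]) (\<lambda>x. v (L *v x + b)) x =
  (\<Sum>l\<in>UNIV. partial_derivs is (\<lambda>x. of_real (L $ l $ i) * partial_deriv l v (L *v x + b)) x)"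
  by (simp add: partial_derivs_append) (intro partial_derivs_sum schwartz_cmult s finite)
 also have "\<dots> = (\<Sum>l\<in>UNIV. (L $ l $ i) *\<^sub>R partial_derivs is (\<lambda>x. partial_deriv l v (L *v x + b)) x)"
  by (intro sum.cong refl) (simp add: partial_derivs_cmult[OF s] scaleR_conv_of_real)
 finally show ?thesis .
qed

text \<open>
  Affine substitutions depend continuously on the affine map. This yields the measurability of the
  wavelet transform in the group variable.
\<close>

lemma schwartz_lim_affine:
 fixes v :: "'n::finite rvec => complex" and L :: "'n rmat"
 assumes v: "v \<in> schwartz" and L: "invertible L" "\<And>m. invertible (Lm m)" and lim: "Lm \<longlonglongrightarrow> L" "bm \<longlonglongrightarrow> b"
 shows "schwartz_lim (\<lambda>m x. v (Lm m *v x + bm m)) (\<lambda>x. v (L *v x + b))"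
 unfolding schwartz_lim_def
proof (intro allI)
 fix k "is"
 show "uniform_limit UNIV (\<lambda>m x. (1 + norm x) ^ k *\<^sub>R partial_derivs is (\<lambda>x. v (Lm m *v x + bm m)) x)
   (\<lambda>x. (1 + norm x) ^ k *\<^sub>R partial_derivs is (\<lambda>x. v (L *v x + b)) x) sequentially"
  using v
 proof (induction "is" arbitrary: v rule: rev_induct)
  case Nil
  then show ?case using schwartz_affine_uniform_limit[OF _ L(1) lim] by simp
 next
  case (snoc i "is")
  let ?t = "\<lambda>l m x. (1 + norm x) ^ k *\<^sub>R partial_derivs is (\<lambda>x. partial_deriv l v (Lm m *v x + bm m)) x"
  let ?t' = "\<lambda>l x. (1 + norm x) ^ k *\<^sub>R partial_derivs is (\<lambda>x. partial_deriv l v (L *v x + b)) x"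
  have "uniform_limit UNIV (\<lambda>m x. \<Sum>l\<in>UNIV. (Lm m $ l $ i) *\<^sub>R ?t l m x) (\<lambda>x. \<Sum>l\<in>UNIV. (L $ l $ i) *\<^sub>R ?t' l x) sequentially"
  proof (rule uniform_limit_sum_finite)
   fix l
   have 1: "uniform_limit UNIV (?t l) (?t' l) sequentially"
    by (rule snoc.IH) (rule schwartz_partial_deriv[OF snoc.prems])
   have "(\<lambda>m. Lm m $ l $ i) \<longlonglongrightarrow> L $ l $ i"
    by (intro tendsto_vec_nth lim)
   then have 2: "uniform_limit UNIV (\<lambda>m (x::'n rvec). Lm m $ l $ i) (\<lambda>x. L $ l $ i) sequentially"
    by (intro uniform_limitI) (auto dest: tendstoD)
   have s: "(\<lambda>x. partial_deriv l v (L *v x + b)) \<in> schwartz"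
    by (intro schwartz_affine[of "partial_deriv l v"] schwartz_partial_deriv snoc.prems L)
   obtain C where C: "\<And>x. (1 + norm x) ^ k * cmod (partial_derivs is (\<lambda>x. partial_deriv l v (L *v x + b)) x) \<le> C"
    using schwartz_decay[OF schwartz_partial_derivs[OF s], of k "is"] by metis
   have 3: "bounded (range (?t' l))"
    unfolding bounded_iff by (rule exI[of _ C]) (use C in auto)
   show "uniform_limit UNIV (\<lambda>m x. (Lm m $ l $ i) *\<^sub>R ?t l m x) (\<lambda>x. (L $ l $ i) *\<^sub>R ?t' l x) sequentially"
    by (rule bounded_bilinear.bounded_uniform_limit[OF bounded_bilinear_scaleR 2 1 3]) (auto simp: bounded_iff)
  qed simp
  then show ?case
   by (simp add: partial_derivs_snoc_affine[OF snoc.prems] L scaleR_sum_right mult.commute)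
 qed
qed

section \<open>Linear change of variables\<close>

lemma borel_measurable_vec_lambda:
 fixes f :: "'n::finite => 'a => real"
 assumes "\<And>i. f i \<in> borel_measurable M"
 shows "(\<lambda>x. \<chi> i. f i x) \<in> borel_measurable M"
proof (subst borel_measurable_euclidean_space, rule ballI)
 fix b :: "real ^ 'n" assume "b \<in> Basis"
 then obtain i where "b = axis i 1" by (auto simp: Basis_vec_def)
 then show "(\<lambda>x. (\<chi> i. f i x) \<bullet> b) \<in> borel_measurable M"
  using assms[of i] by (simp add: inner_axis)
qed

lemma prod_Basis_vec:
 fixes f :: "real ^ 'n::finite => 'a::comm_monoid_mult"
 shows "(\<Prod>b\<in>Basis. f b) = (\<Prod>i\<in>UNIV. f (axis i 1))"
proof -
 have "(Basis :: (real ^ 'n) set) = (\<lambda>i. axis i 1) ` UNIV"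
  by (auto simp: Basis_vec_def)
 moreover have "inj (\<lambda>i::'n. axis i (1::real))"
  by (auto intro!: injI simp: axis_eq_axis)
 ultimately show ?thesis using prod.reindex[of "\<lambda>i. axis i 1" UNIV f] by (simp add: o_def)
qed

lemma measurable_vec_lambda_PiM:
 "(\<lambda>f. \<chi> i. f i) \<in> borel_measurable (\<Pi>\<^sub>M i\<in>(UNIV::'n::finite set). (lborel :: real measure))"
proof (rule borel_measurable_vec_lambda)
 fix i :: 'n
 have "(\<lambda>f. f i) \<in> measurable (\<Pi>\<^sub>M i\<in>(UNIV::'n::finite set). (lborel :: real measure)) lborel"
  by (rule measurable_component_singleton) simp
 then show "(\<lambda>f. f i) \<in> borel_measurable (\<Pi>\<^sub>M i\<in>(UNIV::'n::finite set). (lborel :: real measure))"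
  by simp
qed

text \<open>
  Identifies Lebesgue measure on vectors with a product measure, so that Fubini lets the
  coordinates be integrated one at a time.
\<close>

lemma lborel_vec: "(lborel :: (real ^ 'n::finite) measure) = distr (\<Pi>\<^sub>M i\<in>UNIV. lborel) borel (\<lambda>f. \<chi> i. f i)"
proof (rule lborel_eqI)
 interpret product_sigma_finite "\<lambda>_::'n. lborel :: real measure"
  by standard
 have m[measurable]: "(\<lambda>f. \<chi> i. f i) \<in> borel_measurable (\<Pi>\<^sub>M i\<in>(UNIV::'n set). (lborel :: real measure))"
  by (rule measurable_vec_lambda_PiM)
 fix l u :: "real ^ 'n" assume lu: "\<And>b. b \<in> Basis ==> l \<bullet> b \<le> u \<bullet> b"
 have lu': "l $ i \<le> u $ i" for i using lu[of "axis i 1"] by (simp add: inner_axis)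
 have "emeasure (distr (\<Pi>\<^sub>M i\<in>UNIV. lborel) borel (\<lambda>f. \<chi> i. f i)) (box l u) =
   emeasure (\<Pi>\<^sub>M i\<in>(UNIV::'n set). lborel) (\<Pi>\<^sub>E i\<in>UNIV. {l $ i <..< u $ i})"
  by (subst emeasure_distr) (auto simp: space_PiM mem_box_cart PiE_iff intro!: arg_cong[where f = "emeasure _"] m)
 also have "\<dots> = (\<Prod>i\<in>UNIV. ennreal (u $ i - l $ i))"
  by (subst emeasure_PiM) (auto simp: lu')
 also have "\<dots> = (\<Prod>b\<in>Basis. (u - l) \<bullet> b)"
  by (simp add: prod_Basis_vec inner_axis prod_ennreal lu')
 finally show "emeasure (distr (\<Pi>\<^sub>M i\<in>UNIV. lborel) borel (\<lambda>f. \<chi> i. f i)) (box l u) = (\<Prod>b\<in>Basis. (u - l) \<bullet> b)" .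
qed simp

declare measurable_vec_lambda_PiM[measurable]

lemma measurable_matrix_vector_mult[measurable]:
 fixes A :: "real ^ 'n::finite ^ 'm::finite"
 shows "(\<lambda>x. A *v x) \<in> borel_measurable borel"
 by (intro borel_measurable_continuous_onI linear_continuous_on matrix_vector_mul_bounded_linear)

lemma measurable_vec_nth[measurable]: "(\<lambda>x::real ^ 'n::finite. x $ i) \<in> borel_measurable borel"
 by (intro borel_measurable_continuous_onI linear_continuous_on bounded_linear_vec_nth)

lemma borel_measurable_shear:
 "(\<lambda>x::real ^ 'n::finite. \<chi> i. if i = m then x $ m + x $ k else x $ i) \<in> borel_measurable borel"
proof (rule borel_measurable_vec_lambda)
 fix i
 have "(\<lambda>x::real ^ 'n::finite. x $ m + x $ k) \<in> borel_measurable borel"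
  by (intro borel_measurable_add measurable_vec_nth)
 then show "(\<lambda>x::real ^ 'n::finite. if i = m then x $ m + x $ k else x $ i) \<in> borel_measurable borel"
  by (cases "i = m") (simp_all only: refl if_True if_False measurable_vec_nth)
qed

text \<open>
  A shear translates one coordinate by a multiple of another, so the inner one-dimensional
  integral is unchanged.
\<close>

lemma nn_integral_shear:
 fixes m k :: "'n::finite"
 assumes mk: "m \<noteq> k" and f[measurable]: "f \<in> borel_measurable borel"
 defines "T \<equiv> (\<lambda>x::real ^ 'n. \<chi> i. if i = m then x $ m + x $ k else x $ i)"
 shows "(\<integral>\<^sup>+x. f (T x) \<partial>lborel) = (\<integral>\<^sup>+x. f x \<partial>lborel)"
proof -
 interpret product_sigma_finite "\<lambda>_::'n. lborel :: real measure"
  by standard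
 have T[measurable]: "T \<in> borel_measurable borel"
  unfolding T_def by (rule borel_measurable_shear)
 define I where "I = UNIV - {m}"
 have I: "finite I" "m \<notin> I" "UNIV = insert m I" "k \<in> I" using mk unfolding I_def by auto
 have ext: "f \<in> borel_measurable (PiM (insert m I) (\<lambda>_::'n. lborel :: real measure))"
  if "f \<in> borel_measurable (PiM UNIV (\<lambda>_::'n. lborel :: real measure))" for f :: "('n => real) => ennreal"
  using that unfolding I(3)[symmetric] .
 have "(\<integral>\<^sup>+x. f (T x) \<partial>lborel) = (\<integral>\<^sup>+x. f (T (\<chi> i. x i)) \<partial>(\<Pi>\<^sub>M i\<in>UNIV. lborel))"
  by (subst lborel_vec) (simp add: nn_integral_distr)
 also have "\<dots> = (\<integral>\<^sup>+x. (\<integral>\<^sup>+y. f (T (\<chi> i. (x(m := y)) i)) \<partial>lborel) \<partial>(\<Pi>\<^sub>M i\<in>I. lborel))"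
  unfolding I(3) by (rule product_nn_integral_insert) (use I in \<open>auto intro!: ext\<close>)
 also have "\<dots> = (\<integral>\<^sup>+x. (\<integral>\<^sup>+y. f (\<chi> i. (x(m := y)) i) \<partial>lborel) \<partial>(\<Pi>\<^sub>M i\<in>I. lborel))"
 proof (rule nn_integral_cong)
  fix x :: "'n => real"
  define h where "h y = f (\<chi> i. (x(m := y)) i)" for y
  have [measurable]: "h \<in> borel_measurable borel"
   unfolding h_def
   by (rule measurable_compose[OF borel_measurable_vec_lambda f]) (auto simp: fun_upd_def)
  have "T (\<chi> i. (x(m := y)) i) = (\<chi> i. (x(m := x k + y)) i)" for y
   using mk by (auto simp: T_def vec_eq_iff)
  then have "(\<integral>\<^sup>+y. f (T (\<chi> i. (x(m := y)) i)) \<partial>lborel) = (\<integral>\<^sup>+y. h (x k + y) \<partial>lborel)"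
   by (simp add: h_def)
  also have "\<dots> = (\<integral>\<^sup>+y. h y \<partial>distr lborel borel ((+) (x k)))"
   by (simp add: nn_integral_distr)
  also have "\<dots> = (\<integral>\<^sup>+y. h y \<partial>lborel)"
   by (simp add: lborel_distr_plus)
  finally show "(\<integral>\<^sup>+y. f (T (\<chi> i. (x(m := y)) i)) \<partial>lborel) = (\<integral>\<^sup>+y. f (\<chi> i. (x(m := y)) i) \<partial>lborel)"
   by (simp add: h_def)
 qed
 also have "\<dots> = (\<integral>\<^sup>+x. f (\<chi> i. x i) \<partial>(\<Pi>\<^sub>M i\<in>UNIV. lborel))"
  unfolding I(3) by (rule product_nn_integral_insert[of I m "\<lambda>x. f (\<chi> i. x i)", symmetric]) (use I in \<open>auto intro!: ext\<close>)
 also have "\<dots> = (\<integral>\<^sup>+x. f x \<partial>distr (\<Pi>\<^sub>M i\<in>UNIV. lborel) borel (\<lambda>f. \<chi> i. f i))"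
  by (rule nn_integral_distr[OF measurable_vec_lambda_PiM, symmetric]) (simp add: f)
 also have "\<dots> = (\<integral>\<^sup>+x. f x \<partial>lborel)"
  by (simp only: lborel_vec[symmetric])
 finally show ?thesis .
qed

lemma nn_integral_swap:
 fixes m k :: "'n::finite"
 assumes f[measurable]: "f \<in> borel_measurable borel"
 defines "T \<equiv> (\<lambda>x::real ^ 'n. \<chi> i. x $ Transposition.transpose m k i)"
 shows "(\<integral>\<^sup>+x. f (T x) \<partial>lborel) = (\<integral>\<^sup>+x. f x \<partial>lborel)"
proof -
 have T[measurable]: "T \<in> borel_measurable borel"
  unfolding T_def by (intro borel_measurable_vec_lambda measurable_vec_nth)
 let ?t = "Transposition.transpose m k"
 have "lborel = distr lborel borel T"
 proof (rule lborel_eqI)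
  fix l u :: "real ^ 'n" assume lu: "\<And>b. b \<in> Basis ==> l \<bullet> b \<le> u \<bullet> b"
  have lu': "l $ i \<le> u $ i" for i using lu[of "axis i 1"] by (simp add: inner_axis)
  have "T -` box l u = box (T l) (T u)"
  proof (intro set_eqI)
   fix x
   have "x \<in> T -` box l u \<longleftrightarrow> (\<forall>i. l $ i < x $ ?t i \<and> x $ ?t i < u $ i)"
    by (auto simp: mem_box_cart T_def)
   also have "\<dots> \<longleftrightarrow> (\<forall>i. l $ ?t i < x $ i \<and> x $ i < u $ ?t i)"
    by (metis transpose_involutory)
   finally show "x \<in> T -` box l u \<longleftrightarrow> x \<in> box (T l) (T u)"
    by (auto simp: mem_box_cart T_def)
  qed
  then have "emeasure (distr lborel borel T) (box l u) = emeasure lborel (box (T l) (T u))"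
   by (simp add: emeasure_distr)
  also have "\<dots> = (\<Prod>i\<in>UNIV. ennreal ((u - l) $ ?t i))"
  proof (subst emeasure_lborel_box)
   show "T l \<bullet> b \<le> T u \<bullet> b" if "b \<in> Basis" for b
    using that lu' by (auto simp: Basis_vec_def inner_axis T_def)
   have "(\<Prod>b\<in>Basis. (T u - T l) \<bullet> b) = (\<Prod>i\<in>UNIV. (u - l) $ ?t i)"
    by (simp add: prod_Basis_vec inner_axis T_def)
   then show "ennreal (\<Prod>b\<in>Basis. (T u - T l) \<bullet> b) = (\<Prod>i\<in>UNIV. ennreal ((u - l) $ ?t i))"
    by (simp add: prod_ennreal lu')
  qed
  also have "\<dots> = (\<Prod>i\<in>UNIV. ennreal ((u - l) $ i))"
   by (rule prod.reindex_bij_betw[of ?t UNIV UNIV]) (simp add: bij_betw_def)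
  also have "\<dots> = (\<Prod>b\<in>Basis. (u - l) \<bullet> b)"
   by (simp add: prod_Basis_vec inner_axis prod_ennreal lu')
  finally show "emeasure (distr lborel borel T) (box l u) = (\<Prod>b\<in>Basis. (u - l) \<bullet> b)" .
 qed simp
 then have "(\<integral>\<^sup>+x. f x \<partial>lborel) = (\<integral>\<^sup>+x. f x \<partial>distr lborel borel T)" by simp
 then show ?thesis by (simp add: nn_integral_distr)
qed

lemma nn_integral_diagonal:
 fixes A :: "real ^ 'n::finite ^ 'n"
 assumes f[measurable]: "f \<in> borel_measurable borel"
 assumes diag: "\<And>i j. i \<noteq> j ==> A $ i $ j = 0" and nz: "det A \<noteq> 0"
 shows "(\<integral>\<^sup>+x. f (A *v x) \<partial>lborel) * ennreal \<bar>det A\<bar> = (\<integral>\<^sup>+x. f x \<partial>lborel)"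
proof -
 define c where "c b = (A *v b) \<bullet> b" for b
 have dA: "det A = (\<Prod>i\<in>UNIV. A $ i $ i)" by (rule det_diagonal[OF diag])
 have nz': "A $ i $ i \<noteq> 0" for i using nz unfolding dA by auto
 have c: "c (axis i 1) = A $ i $ i" for i
  unfolding c_def by (simp add: matrix_vector_mult_basis column_def inner_axis)
 have T: "A *v x = 0 + (\<Sum>j\<in>Basis. (c j * (x \<bullet> j)) *\<^sub>R j)" for x
 proof -
  have "(\<Sum>j\<in>Basis. (c j * (x \<bullet> j)) *\<^sub>R j) = (\<Sum>i\<in>UNIV. (A $ i $ i * x $ i) *\<^sub>R axis i 1)"
  proof -
   have "(Basis :: (real ^ 'n) set) = (\<lambda>i. axis i 1) ` UNIV" by (auto simp: Basis_vec_def)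
   moreover have "inj (\<lambda>i::'n. axis i (1::real))" by (auto intro!: injI simp: axis_eq_axis)
   ultimately show ?thesis
    using sum.reindex[of "\<lambda>i. axis i 1" UNIV "\<lambda>j. (c j * (x \<bullet> j)) *\<^sub>R j"] by (simp add: o_def c inner_axis)
  qed
  also have "\<dots> = A *v x"
  proof (subst vec_eq_iff, intro allI)
   fix k
   have "(A *v x) $ k = (\<Sum>j\<in>UNIV. if j = k then A $ k $ k * x $ k else 0)"
    unfolding matrix_vector_mult_def vec_lambda_beta by (rule sum.cong) (auto simp: diag)
   then have "(A *v x) $ k = A $ k $ k * x $ k" by simp
   then show "(\<Sum>i\<in>UNIV. (A $ i $ i * x $ i) *\<^sub>R axis i 1) $ k = (A *v x) $ k"
    by (simp add: axis_def if_distrib cong: if_cong)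
  qed
  finally show ?thesis by simp
 qed
 have l: "lborel = density (distr lborel borel (\<lambda>x. A *v x)) (\<lambda>_. (\<Prod>j\<in>Basis. \<bar>c j\<bar>))"
  unfolding T by (rule lborel_affine_euclidean) (auto simp: Basis_vec_def c nz')
 have p: "(\<Prod>j\<in>Basis. \<bar>c j\<bar>) = \<bar>det A\<bar>"
  unfolding prod_Basis_vec by (simp add: c dA abs_prod)
 have "(\<integral>\<^sup>+x. f x \<partial>lborel) = (\<integral>\<^sup>+x. f x \<partial>density (distr lborel borel (\<lambda>x. A *v x)) (\<lambda>_. \<bar>det A\<bar>))"
  by (subst l) (simp add: p)
 also have "\<dots> = ennreal \<bar>det A\<bar> * (\<integral>\<^sup>+x. f (A *v x) \<partial>lborel)"
  by (simp add: nn_integral_density nn_integral_distr nn_integral_cmult)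
 finally show ?thesis by (simp add: mult.commute)
qed

text \<open>
  Every matrix is a product of elementary matrices: shears, transpositions and diagonal matrices.
  The formula is multiplicative, so it suffices to know it for these.
\<close>

lemma nn_integral_linear:
 fixes A :: "real ^ 'n::finite ^ 'n"
 assumes "f \<in> borel_measurable borel" and "det A \<noteq> 0"
 shows "(\<integral>\<^sup>+x. f (A *v x) \<partial>lborel) * ennreal \<bar>det A\<bar> = (\<integral>\<^sup>+x. f x \<partial>lborel)"
proof -
 have "det A \<noteq> 0 \<longrightarrow> (\<forall>f\<in>borel_measurable borel. (\<integral>\<^sup>+x. f (A *v x) \<partial>lborel) * ennreal \<bar>det A\<bar> = (\<integral>\<^sup>+x. f x \<partial>lborel))"
 proof (induction A rule: induct_matrix_elementary_alt)
  case (1 A B)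
  show ?case
  proof (intro impI ballI)
   fix f :: "real ^ 'n => ennreal" assume nz: "det (A ** B) \<noteq> 0" and f[measurable]: "f \<in> borel_measurable borel"
   from nz have nz': "det A \<noteq> 0" "det B \<noteq> 0" by (auto simp: det_mul)
   have m: "(\<lambda>x. f (A *v x)) \<in> borel_measurable borel" by measurable
   have "(\<integral>\<^sup>+x. f (A *v (B *v x)) \<partial>lborel) * ennreal \<bar>det B\<bar> = (\<integral>\<^sup>+x. f (A *v x) \<partial>lborel)"
    using bspec[OF mp[OF 1(2) nz'(2)] m] by simp
   moreover have "(\<integral>\<^sup>+x. f (A *v x) \<partial>lborel) * ennreal \<bar>det A\<bar> = (\<integral>\<^sup>+x. f x \<partial>lborel)"
    using bspec[OF mp[OF 1(1) nz'(1)] f] by simp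
   ultimately show "(\<integral>\<^sup>+x. f ((A ** B) *v x) \<partial>lborel) * ennreal \<bar>det (A ** B)\<bar> = (\<integral>\<^sup>+x. f x \<partial>lborel)"
    by (simp add: det_mul abs_mult ennreal_mult matrix_vector_mul_assoc mult_ac)
  qed
 next
  case (2 A i) then show ?case using det_zero_row(1)[OF 2] by simp
 next
  case (3 A) then show ?case by (auto intro!: nn_integral_diagonal)
 next
  case (4 m k)
  let ?A = "(\<chi> i j. mat 1 $ i $ Transposition.transpose m k j) :: real ^ 'n ^ 'n"
  have tr: "i = Transposition.transpose m k j \<longleftrightarrow> j = Transposition.transpose m k i" for i j
   by (metis transpose_involutory)
  have v: "?A *v x = (\<chi> i. x $ Transposition.transpose m k i)" for x
  proof (subst vec_eq_iff, intro allI)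
   fix i
   have "(?A *v x) $ i = (\<Sum>j\<in>UNIV. if j = Transposition.transpose m k i then x $ j else 0)"
    unfolding matrix_vector_mult_def vec_lambda_beta
    by (rule sum.cong) (simp_all add: mat_def tr)
   then show "(?A *v x) $ i = (\<chi> i. x $ Transposition.transpose m k i) $ i" by simp
  qed
  have "?A ** ?A = mat 1"
   by (subst matrix_eq) (simp add: matrix_vector_mul_assoc[symmetric] v vec_eq_iff)
  then have "det ?A * det ?A = 1" by (metis det_I det_mul)
  then have "\<bar>det ?A\<bar> = 1" using abs_square_eq_1[of "det ?A", unfolded power2_eq_square] by blast
  then show ?case
   using nn_integral_swap[of _ m k] by (simp only: v ennreal_1 mult_1_right) blast
 next
  case (5 m k)
  let ?A = "(\<chi> i j. of_bool (i = m \<and> j = k \<or> i = j)) :: real ^ 'n ^ 'n"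
  have v: "?A *v x = (\<chi> i. if i = m then x $ m + x $ k else x $ i)" for x
  proof (subst vec_eq_iff, intro allI)
   fix i
   have "(?A *v x) $ i = (\<Sum>j\<in>UNIV. (if j = i then x $ j else 0) + (if i = m \<and> j = k then x $ j else 0))"
    unfolding matrix_vector_mult_def vec_lambda_beta
    by (rule sum.cong) (use 5 in auto)
   also have "\<dots> = x $ i + (if i = m then x $ k else 0)"
    by (simp add: sum.distrib)
   finally show "(?A *v x) $ i = (\<chi> i. if i = m then x $ m + x $ k else x $ i) $ i" by simp
  qed
  have "?A = (\<chi> i. if i = m then row m (mat 1) + 1 *s row k (mat 1) else row i (mat 1))"
   using 5 by (auto simp: vec_eq_iff row_def mat_def)
  then have "det ?A = 1" using det_row_operation[OF 5, of "mat 1 :: real ^ 'n ^ 'n" 1] by (metis det_I)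
  then show ?case
   using nn_integral_shear[OF 5] by (simp only: v abs_one ennreal_1 mult_1_right) blast
 qed
 then show ?thesis using assms by blast
qed

lemma lborel_affine_vec:
 fixes L :: "real ^ 'n::finite ^ 'n"
 assumes "det L \<noteq> 0"
 shows "density (distr lborel borel (\<lambda>x. L *v x + b)) (\<lambda>_. ennreal \<bar>det L\<bar>) = lborel"
proof -
 have "distr lborel borel (\<lambda>x. L *v x + b) = distr (distr lborel borel ((*v) L)) borel ((+) b)"
  by (subst distr_distr) (auto simp: o_def add.commute)
 moreover have "density (distr lborel borel ((*v) L)) (\<lambda>_. ennreal \<bar>det L\<bar>) = lborel"
 proof (rule measure_eqI)
  fix X assume "X \<in> sets (density (distr lborel borel ((*v) L)) (\<lambda>_. ennreal \<bar>det L\<bar>))"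
  then have X[measurable]: "X \<in> sets borel" by simp
  have "emeasure (density (distr lborel borel ((*v) L)) (\<lambda>_. ennreal \<bar>det L\<bar>)) X
   = (\<integral>\<^sup>+x. indicator X (L *v x) \<partial>lborel) * ennreal \<bar>det L\<bar>"
   by (simp add: emeasure_density nn_integral_distr nn_integral_cmult mult.commute)
  also have "\<dots> = (\<integral>\<^sup>+x. indicator X x \<partial>lborel)"
   by (rule nn_integral_linear[OF _ assms]) simp
  finally show "emeasure (density (distr lborel borel ((*v) L)) (\<lambda>_. ennreal \<bar>det L\<bar>)) X = emeasure lborel X"
   by simp
 qed simp
 moreover have "density (distr M borel ((+) b)) (\<lambda>_. c) = distr (density M (\<lambda>_. c)) borel ((+) b)"
  if "sets M = sets borel" for M :: "(real ^ 'n) measure" and c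
 proof -
  have [measurable]: "((+) b) \<in> measurable M borel"
   unfolding measurable_cong_sets[OF that refl] by simp
  show ?thesis by (rule density_distr) simp_all
 qed
 ultimately show ?thesis by (simp add: lborel_distr_plus)
qed

lemma nn_integral_affine:
 fixes L :: "real ^ 'n::finite ^ 'n"
 assumes [measurable]: "f \<in> borel_measurable borel" and "det L \<noteq> 0"
 shows "(\<integral>\<^sup>+x. f x \<partial>lborel) = ennreal \<bar>det L\<bar> * (\<integral>\<^sup>+x. f (L *v x + b) \<partial>lborel)"
 by (subst lborel_affine_vec[OF assms(2), of b, symmetric]) (simp add: nn_integral_density nn_integral_distr nn_integral_cmult)

lemma integral_affine:
 fixes L :: "real ^ 'n::finite ^ 'n" and f :: "_ => complex"
 assumes [measurable]: "f \<in> borel_measurable borel" and "det L \<noteq> 0"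
 shows "(\<integral>x. f x \<partial>lborel) = \<bar>det L\<bar> *\<^sub>R (\<integral>x. f (L *v x + b) \<partial>lborel)"
 by (subst lborel_affine_vec[OF assms(2), of b, symmetric]) (simp add: integral_density integral_distr)

lemma integrable_affine:
 fixes L :: "real ^ 'n::finite ^ 'n" and f :: "_ => complex"
 assumes f: "integrable lborel f" and "det L \<noteq> 0"
 shows "integrable lborel (\<lambda>x. f (L *v x + b))"
proof -
 have [measurable]: "f \<in> borel_measurable borel" using f by auto
 have "integrable (density (distr lborel borel (\<lambda>x. L *v x + b)) (\<lambda>_. ennreal \<bar>det L\<bar>)) f"
  using f by (simp add: lborel_affine_vec[OF assms(2)])
 then have "integrable (distr lborel borel (\<lambda>x. L *v x + b)) (\<lambda>x. \<bar>det L\<bar> *\<^sub>R f x)"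
  by (subst (asm) integrable_density) auto
 then have "integrable (distr lborel borel (\<lambda>x. L *v x + b)) (\<lambda>x. inverse \<bar>det L\<bar> *\<^sub>R (\<bar>det L\<bar> *\<^sub>R f x))"
  by (rule integrable_scaleR_right)
 moreover have "(\<lambda>x. inverse \<bar>det L\<bar> *\<^sub>R (\<bar>det L\<bar> *\<^sub>R f x)) = f" using assms(2) by (simp add: fun_eq_iff)
 ultimately have "integrable (distr lborel borel (\<lambda>x. L *v x + b)) f" by simp
 then show ?thesis by (rule integrable_distr[rotated]) measurable
qed

lemma nn_integral_translate:
 fixes f :: "real ^ 'n::finite => ennreal"
 assumes "f \<in> borel_measurable borel"
 shows "(\<integral>\<^sup>+x. f (x + b) \<partial>lborel) = (\<integral>\<^sup>+x. f x \<partial>lborel)"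
 using nn_integral_affine[OF assms, of "mat 1" b] by simp

section \<open>The Lorentz form and rapidly decreasing functions\<close>

text \<open>
  The linear map that turns the Lorentz form into the Euclidean inner product, so that the Fourier
  transform of the cone is the Euclidean one up to a change of sign in the frequency coordinates.
\<close>

definition lflip :: "'n::{finite,linorder} rvec => 'n rvec" where
 "lflip w = (\<chi> i. if i = idx_last then w $ i else - w $ i)"

lemma lorentz_eq_inner: "lorentz x w = x \<bullet> lflip w"
proof -
 have "x \<bullet> lflip w = (\<Sum>i\<in>UNIV. x $ i * (if i = idx_last then w $ i else - w $ i))"
  by (simp add: inner_vec_def lflip_def)
 also have "\<dots> = x $ idx_last * w $ idx_last + (\<Sum>i\<in>UNIV - {idx_last}. x $ i * (if i = idx_last then w $ i else - w $ i))"
  by (subst sum.remove[of _ idx_last]) auto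
 also have "(\<Sum>i\<in>UNIV - {idx_last}. x $ i * (if i = idx_last then w $ i else - w $ i)) = (\<Sum>i\<in>UNIV - {idx_last}. - (x $ i * w $ i))"
  by (rule sum.cong) auto
 finally show ?thesis by (simp add: lorentz_def sum_negf)
qed

lemma inner_lflip: "x \<bullet> lflip w = lflip x \<bullet> w"
 by (simp add: inner_vec_def lflip_def) (rule sum.cong, auto)

lemma lorentz_commute: "lorentz x y = lorentz y x"
 by (metis lorentz_eq_inner inner_lflip inner_commute)

lemma norm_lflip[simp]: "norm (lflip w) = norm w"
proof -
 have "lflip w \<bullet> lflip w = w \<bullet> w"
  unfolding inner_vec_def lflip_def by (rule sum.cong) auto
 then show ?thesis by (simp add: norm_eq_sqrt_inner)
qed

lemma abs_lorentz_le: "\<bar>lorentz x w\<bar> \<le> norm x * norm w"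
 using Cauchy_Schwarz_ineq2[of x "lflip w"] by (simp add: lorentz_eq_inner)

lemma lorentz_add_left: "lorentz (x + y) w = lorentz x w + lorentz y w"
 by (simp add: lorentz_eq_inner inner_add_left)

lemma lorentz_diff_left: "lorentz (x - y) w = lorentz x w - lorentz y w"
 by (simp add: lorentz_eq_inner inner_diff_left)

lemma lorentz_add_right: "lorentz x (w + v) = lorentz x w + lorentz x v"
 by (metis lorentz_add_left lorentz_commute)

lemma lorentz_scaleR_left: "lorentz (c *\<^sub>R x) w = c * lorentz x w"
 by (simp add: lorentz_eq_inner)

lemma lorentz_scaleR_right: "lorentz x (c *\<^sub>R w) = c * lorentz x w"
 by (metis lorentz_scaleR_left lorentz_commute)

lemma lorentz_minus_left: "lorentz (- x) w = - lorentz x w"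
 by (simp add: lorentz_eq_inner)

lemma linear_lflip: "linear lflip"
 by (rule linearI) (auto simp: lflip_def vec_eq_iff)

lemma continuous_lflip: "continuous_on S lflip"
 by (rule linear_continuous_on) (use linear_lflip in \<open>simp add: linear_linear\<close>)

lemma continuous_on_lorentz[continuous_intros]:
 fixes f g :: "'a::topological_space => 'n::{finite,linorder} rvec"
 assumes "continuous_on S f" "continuous_on S g"
 shows "continuous_on S (\<lambda>x. lorentz (f x) (g x))"
 unfolding lorentz_eq_inner
 using assms continuous_on_compose2[OF continuous_lflip[of UNIV], of S g] by (auto intro!: continuous_intros)

lemma measurable_lorentz[measurable (raw)]:
 fixes f g :: "'a => 'n::{finite,linorder} rvec"
 assumes [measurable]: "f \<in> borel_measurable M" "g \<in> borel_measurable M"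
 shows "(\<lambda>x. lorentz (f x) (g x)) \<in> borel_measurable M"
proof -
 have "(\<lambda>x. lflip (g x)) \<in> borel_measurable M"
  by (rule measurable_compose[OF assms(2)]) (rule borel_measurable_continuous_onI[OF continuous_lflip])
 then show ?thesis unfolding lorentz_eq_inner by measurable
qed

lemma cmod_exp_minus_i: "cmod (exp (- \<i> * complex_of_real t)) = 1"
 using norm_exp_i_times[of "-t"] by simp

lemma
 fixes g :: "'n::finite => real => 'b::{real_normed_field,banach,second_countable_topology}"
 assumes g: "\<And>i. integrable lborel (g i)"
 shows integrable_vec_prod: "integrable lborel (\<lambda>x::real ^ 'n. \<Prod>i\<in>UNIV. g i (x $ i))" (is ?A)
  and integral_vec_prod: "(\<integral>x. (\<Prod>i\<in>UNIV. g i (x $ i)) \<partial>(lborel :: (real ^ 'n) measure)) = (\<Prod>i\<in>UNIV. \<integral>t. g i t \<partial>lborel)" (is ?B)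
proof -
 interpret product_sigma_finite "\<lambda>_::'n. lborel :: real measure"
  by standard
 have m: "(\<lambda>x::real ^ 'n. \<Prod>i\<in>UNIV. g i (x $ i)) \<in> borel_measurable borel"
 proof (rule borel_measurable_prod)
  fix i
  have "g i \<in> borel_measurable borel" using g[of i] by auto
  then show "(\<lambda>x::real ^ 'n. g i (x $ i)) \<in> borel_measurable borel"
   by (rule measurable_compose[OF measurable_vec_nth])
 qed
 show ?A
  by (subst lborel_vec, subst integrable_distr_eq[OF measurable_vec_lambda_PiM m])
    (use product_integrable_prod[of UNIV g] g in simp)
 show ?B
  by (subst lborel_vec, subst integral_distr[OF measurable_vec_lambda_PiM m])
    (use product_integral_prod[of UNIV g] g in simp)
qed

text \<open>
  The weight dominates the product of the one-dimensional weights \<open>1 +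
  x\<^sub>i\<^sup>2\<close>, whose reciprocals are integrable.
\<close>

lemma integrable_inverse_power_norm:
 "integrable lborel (\<lambda>x::real ^ 'n::finite. 1 / (1 + norm x) ^ (2 * CARD('n)))"
proof (rule Bochner_Integration.integrable_bound)
 have "integrable lborel (\<lambda>x::real. inverse (1 + x^2))"
  using integrable_inverse_1_plus_square by (simp add: set_integrable_def)
 then show "integrable lborel (\<lambda>x::real ^ 'n. \<Prod>i\<in>UNIV. inverse (1 + (x $ i)^2))"
  by (rule integrable_vec_prod)
 show "(\<lambda>x::real ^ 'n. 1 / (1 + norm x) ^ (2 * CARD('n))) \<in> borel_measurable lborel"
  by measurable
 have "norm (1 / (1 + norm x) ^ (2 * CARD('n))) \<le> norm (\<Prod>i\<in>UNIV. inverse (1 + (x $ i)^2))" for x :: "real ^ 'n"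
 proof -
  have i: "1 + (x $ i)^2 \<le> (1 + norm x)^2" for i
  proof -
   have "(x $ i)^2 \<le> (norm x)^2"
    using component_le_norm_cart[of x i] by (metis abs_ge_zero power2_abs power_mono)
   moreover have "(1 + norm x)\<^sup>2 = 1 + (norm x)\<^sup>2 + 2 * norm x" by (simp add: power2_sum)
   ultimately show ?thesis using norm_ge_zero[of x] by linarith
  qed
  have p: "0 < (\<Prod>i\<in>UNIV. (1 + (x $ i)^2))"
   by (intro prod_pos ballI add_pos_nonneg) auto
  have "(\<Prod>i\<in>UNIV. (1 + (x $ i)^2)) \<le> (\<Prod>i\<in>(UNIV::'n set). (1 + norm x)^2)"
   by (intro prod_mono conjI i) (auto intro: add_nonneg_nonneg)
  also have "\<dots> = (1 + norm x) ^ (2 * CARD('n))" by (simp add: power_mult)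
  finally have "1 / (1 + norm x) ^ (2 * CARD('n)) \<le> 1 / (\<Prod>i\<in>UNIV. (1 + (x $ i)^2))"
   using p by (intro divide_left_mono mult_pos_pos) auto
  also have "\<dots> = (\<Prod>i\<in>UNIV. inverse (1 + (x $ i)^2))"
   by (simp add: prod_dividef inverse_eq_divide)
  finally show ?thesis using p by (simp add: prod_nonneg)
 qed
 then show "AE x in lborel. norm (1 / (1 + norm x) ^ (2 * CARD('n))) \<le> norm (\<Prod>i\<in>UNIV. inverse (1 + ((x :: real ^ 'n) $ i)^2))"
  by simp
qed

text \<open>
  Rapid decay without any smoothness. This is the regularity in which the kernels of multipliers
  enter the estimates.
\<close>

definition rapid :: "('n::finite rvec => complex) => bool" where
 "rapid m \<longleftrightarrow> m \<in> borel_measurable borel \<and> (\<forall>k. \<exists>C. \<forall>x. (1 + norm x) ^ k * cmod (m x) \<le> C)"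

lemma rapid_measurable: "rapid m ==> m \<in> borel_measurable borel"
 by (simp add: rapid_def)

lemma integrable_decay:
 fixes m :: "'n::finite rvec => complex"
 assumes [measurable]: "m \<in> borel_measurable borel" and C: "\<And>x. (1 + norm x) ^ (2 * CARD('n)) * cmod (m x) \<le> C"
 shows "integrable lborel m"
proof (rule Bochner_Integration.integrable_bound)
 show "integrable lborel (\<lambda>x::'n rvec. C * (1 / (1 + norm x) ^ (2 * CARD('n))))"
  by (intro integrable_mult_right integrable_inverse_power_norm)
 have "norm (m x) \<le> norm (C * (1 / (1 + norm x) ^ (2 * CARD('n))))" for x
 proof -
  have p: "(1 + norm x) ^ (2 * CARD('n)) > 0" by (intro zero_less_power add_pos_nonneg) auto
  have "0 \<le> (1 + norm x) ^ (2 * CARD('n)) * cmod (m x)" using p by (simp add: less_imp_le)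
  then have "C \<ge> 0" using C[of x] by linarith
  with C[of x] p show ?thesis by (simp add: field_simps abs_mult)
 qed
 then show "AE x in lborel. norm (m x) \<le> norm (C * (1 / (1 + norm x) ^ (2 * CARD('n))))" by simp
qed simp

lemma rapid_integrable_weight:
 fixes m :: "'n::finite rvec => complex"
 assumes "rapid m" shows "integrable lborel (\<lambda>x. of_real ((1 + norm x) ^ k) * m x)"
proof -
 obtain C where C: "\<And>x. (1 + norm x) ^ (2 * CARD('n) + k) * cmod (m x) \<le> C"
  using assms unfolding rapid_def by blast
 have [measurable]: "m \<in> borel_measurable borel" by (rule rapid_measurable[OF assms])
 show ?thesis
 proof (rule integrable_decay)
  fix x
  have "(1 + norm x) ^ (2 * CARD('n)) * cmod (of_real ((1 + norm x) ^ k) * m x) = (1 + norm x) ^ (2 * CARD('n) + k) * cmod (m x)"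
   by (simp add: norm_mult norm_power power_add del: of_real_power)
  with C show "(1 + norm x) ^ (2 * CARD('n)) * cmod (of_real ((1 + norm x) ^ k) * m x) \<le> C" by simp
 qed measurable
qed

lemma rapid_integrable: "rapid m ==> integrable lborel m"
 using rapid_integrable_weight[of m 0] by simp

lemma schwartz_continuous: "v \<in> schwartz ==> continuous_on S v"
 by (meson continuous_at_imp_continuous_on differentiable_imp_continuous_within schwartz_differentiable)

lemma schwartz_rapid: "v \<in> schwartz ==> rapid v"
 unfolding rapid_def by (metis schwartz_decay schwartz_continuous borel_measurable_continuous_onI)

lemma schwartz_integrable: "v \<in> schwartz ==> integrable lborel v"
 by (intro rapid_integrable schwartz_rapid)

lemma schwartz_measurable: "v \<in> schwartz ==> v \<in> borel_measurable borel"
 by (intro rapid_measurable schwartz_rapid)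

lemma rapid_mult_coord: assumes "rapid m" shows "rapid (\<lambda>x. of_real (x $ i) * m x)"
 unfolding rapid_def
proof (intro conjI allI)
 have [measurable]: "m \<in> borel_measurable borel" by (rule rapid_measurable[OF assms])
 show "(\<lambda>x. of_real (x $ i) * m x) \<in> borel_measurable borel"
  by (intro borel_measurable_times borel_measurable_of_real measurable_vec_nth) measurable
 fix k
 obtain C where C: "\<And>x. (1 + norm x) ^ Suc k * cmod (m x) \<le> C"
  using assms unfolding rapid_def by blast
 have "(1 + norm x) ^ k * cmod (of_real (x $ i) * m x) \<le> C" for x
 proof -
  have "(1 + norm x) ^ k * cmod (of_real (x $ i) * m x) = \<bar>x $ i\<bar> * ((1 + norm x) ^ k * cmod (m x))"
   by (simp add: norm_mult)
  also have "\<dots> \<le> (1 + norm x) * ((1 + norm x) ^ k * cmod (m x))"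
   using component_le_norm_cart[of x i] by (intro mult_right_mono) auto
  also have "\<dots> \<le> C" using C[of x] by (simp add: mult.assoc)
  finally show ?thesis .
 qed
 then show "\<exists>C. \<forall>x. (1 + norm x) ^ k * cmod (of_real (x $ i) * m x) \<le> C" by blast
qed

lemma rapid_cmult: assumes "rapid m" shows "rapid (\<lambda>x. c * m x)"
 unfolding rapid_def
proof (intro conjI allI)
 have [measurable]: "m \<in> borel_measurable borel" by (rule rapid_measurable[OF assms])
 show "(\<lambda>x. c * m x) \<in> borel_measurable borel" by measurable
 fix k
 obtain C where C: "\<And>x. (1 + norm x) ^ k * cmod (m x) \<le> C"
  using assms unfolding rapid_def by blast
 have "(1 + norm x) ^ k * cmod (c * m x) \<le> cmod c * C" for x
  using mult_left_mono[OF C[of x], of "cmod c"] by (simp add: norm_mult mult_ac)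
 then show "\<exists>C. \<forall>x. (1 + norm x) ^ k * cmod (c * m x) \<le> C" by blast
qed

section \<open>Gaussians and Fourier inversion\<close>

lemma gaussian_1d:
 "integrable lborel (\<lambda>x::real. exp (\<i> * of_real (t * x)) * complex_of_real (exp (- x\<^sup>2 / 2)))"
 "(\<integral>x. exp (\<i> * of_real (t * x)) * complex_of_real (exp (- x\<^sup>2 / 2)) \<partial>lborel) = of_real (sqrt (2 * pi) * exp (- t\<^sup>2 / 2))"
proof -
 have d: "std_normal_density x = exp (- x\<^sup>2 / 2) / sqrt (2 * pi)" for x
  by (simp add: normal_density_def)
 have s: "sqrt (2 * pi) > 0" by simp
 have i: "integrable lborel std_normal_density"
  using integrable_normal_density[of 1 0] by simp
 then have "integrable lborel (\<lambda>x. sqrt (2 * pi) * std_normal_density x)" by (rule integrable_mult_right)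
 then have i2: "integrable lborel (\<lambda>x::real. exp (- x\<^sup>2 / 2))" unfolding d by simp
 show "integrable lborel (\<lambda>x::real. exp (\<i> * of_real (t * x)) * complex_of_real (exp (- x\<^sup>2 / 2)))"
  by (rule Bochner_Integration.integrable_bound[OF i2]) (auto simp: norm_mult)
 have "char std_normal_distribution t = (\<integral>x. std_normal_density x *\<^sub>R exp (\<i> * of_real (t * x)) \<partial>lborel)"
  unfolding char_def by (subst integral_density) auto
 also have "\<dots> = (\<integral>x. (exp (\<i> * of_real (t * x)) * complex_of_real (exp (- x\<^sup>2 / 2))) / of_real (sqrt (2 * pi)) \<partial>lborel)"
  by (rule Bochner_Integration.integral_cong) (auto simp: d scaleR_conv_of_real mult.commute)
 also have "\<dots> = (\<integral>x. (exp (\<i> * of_real (t * x)) * complex_of_real (exp (- x\<^sup>2 / 2))) \<partial>lborel) / of_real (sqrt (2 * pi))"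
  by (rule integral_divide_zero)
 finally have "(\<integral>x. (exp (\<i> * of_real (t * x)) * complex_of_real (exp (- x\<^sup>2 / 2))) \<partial>lborel) / of_real (sqrt (2 * pi)) = of_real (exp (- t\<^sup>2 / 2))"
  by (simp add: char_std_normal_distribution)
 then show "(\<integral>x. exp (\<i> * of_real (t * x)) * complex_of_real (exp (- x\<^sup>2 / 2)) \<partial>lborel) = of_real (sqrt (2 * pi) * exp (- t\<^sup>2 / 2))"
  using s by (simp add: field_simps)
qed

definition gauss :: "real ^ 'n::finite => real" where "gauss v = exp (- (norm v)\<^sup>2 / 2)"

lemma gauss_prod: "gauss v = (\<Prod>i\<in>UNIV. exp (- (v $ i)\<^sup>2 / 2))"
proof -
 have "(norm v)\<^sup>2 = (\<Sum>i\<in>UNIV. (v $ i)\<^sup>2)"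
  unfolding power2_norm_eq_inner by (simp add: inner_vec_def power2_eq_square)
 then show ?thesis
  unfolding gauss_def by (simp add: exp_sum[symmetric] sum_divide_distrib[symmetric] sum_negf)
qed

text \<open>
  Both sides factor over the coordinates, which reduces the claim to the characteristic function
  of the normal distribution.
\<close>

lemma fourier_gauss:
 fixes z :: "real ^ 'n::finite"
 shows "integrable lborel (\<lambda>v. exp (\<i> * of_real (z \<bullet> v)) * complex_of_real (gauss v))"
  "(\<integral>v. exp (\<i> * of_real (z \<bullet> v)) * complex_of_real (gauss v) \<partial>lborel) = of_real (sqrt (2 * pi) ^ CARD('n) * gauss z)"
proof -
 have eq: "exp (\<i> * of_real (z \<bullet> v)) * complex_of_real (gauss v) =
  (\<Prod>i\<in>UNIV. exp (\<i> * of_real (z $ i * v $ i)) * complex_of_real (exp (- (v $ i)\<^sup>2 / 2)))" for v :: "real ^ 'n"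
 proof -
  have "exp (\<i> * of_real (z \<bullet> v)) = (\<Prod>i\<in>UNIV. exp (\<i> * of_real (z $ i * v $ i)))"
   by (simp add: inner_vec_def exp_sum[symmetric] sum_distrib_left)
  moreover have "complex_of_real (gauss v) = (\<Prod>i\<in>UNIV. complex_of_real (exp (- (v $ i)\<^sup>2 / 2)))"
   unfolding gauss_prod by (rule of_real_prod)
  ultimately show ?thesis by (simp only: prod.distrib)
 qed
 show "integrable lborel (\<lambda>v. exp (\<i> * of_real (z \<bullet> v)) * complex_of_real (gauss v))"
  unfolding eq by (rule integrable_vec_prod) (rule gaussian_1d)
 have "(\<integral>v. exp (\<i> * of_real (z \<bullet> v)) * complex_of_real (gauss v) \<partial>lborel) =
  (\<Prod>i\<in>UNIV. of_real (sqrt (2 * pi) * exp (- (z $ i)\<^sup>2 / 2)))"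
  unfolding eq by (subst integral_vec_prod) (rule gaussian_1d, simp only: gaussian_1d)
 also have "\<dots> = of_real (sqrt (2 * pi) ^ CARD('n) * gauss z)"
  by (simp add: gauss_prod prod.distrib)
 finally show "(\<integral>v. exp (\<i> * of_real (z \<bullet> v)) * complex_of_real (gauss v) \<partial>lborel) = of_real (sqrt (2 * pi) ^ CARD('n) * gauss z)" .
qed

lemma integral_scale:
 fixes f :: "real ^ 'n::finite => complex"
 assumes [measurable]: "f \<in> borel_measurable borel" and c: "c > 0"
 shows "(\<integral>x. f x \<partial>lborel) = of_real (c ^ CARD('n)) * (\<integral>x. f (t + c *\<^sub>R x) \<partial>lborel)"
proof -
 have "(\<integral>x. f x \<partial>lborel) = (\<integral>x. f x \<partial>density (distr lborel borel (\<lambda>x. t + c *\<^sub>R x)) (\<lambda>_. \<bar>c\<bar> ^ DIM(real ^ 'n)))"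
  using lborel_affine[of c t] c by simp
 also have "\<dots> = (c ^ CARD('n)) *\<^sub>R (\<integral>x. f (t + c *\<^sub>R x) \<partial>lborel)"
  using c by (subst integral_density) (auto simp: integral_distr)
 finally show ?thesis by (simp add: scaleR_conv_of_real)
qed

definition fcst :: "'n::finite itself => real" where
 "fcst _ = (2 * pi) powr (- real CARD('n) / 2)"

lemma fcst_pos: "fcst TYPE('n::finite) > 0" by (simp add: fcst_def)

lemma fcst_sqrt: "fcst TYPE('n::finite) * sqrt (2 * pi) ^ CARD('n) = 1"
proof -
 have "sqrt (2 * pi) ^ CARD('n) = (2 * pi) powr (real CARD('n) / 2)"
  by (simp add: powr_half_sqrt[symmetric] powr_realpow[symmetric] powr_powr)
 then show ?thesis by (simp add: fcst_def powr_add[symmetric])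
qed

lemma fourier_eq: "fourier (f :: 'n::{finite,linorder} rvec => complex) w = of_real (fcst TYPE('n)) * (\<integral>x. f x * exp (- \<i> * of_real (lorentz x w)) \<partial>lborel)"
 by (simp add: fourier_def fcst_def)

definition inv_fourier :: "('n::{finite,linorder} rvec => complex) => 'n rvec => complex" where
 "inv_fourier F x = of_real (fcst TYPE('n)) * (\<integral>w. F w * exp (\<i> * of_real (lorentz x w)) \<partial>lborel)"

text \<open>
  Fubini for \<open>F(w) b(z) U(w,z)\<close>: the kernel has modulus one, so the product of the
  two integrable functions is a majorant.
\<close>

lemma Fubini_unimodular:
 fixes F b :: "'n::finite rvec => complex" and U :: "'n rvec => 'n rvec => complex"
 assumes F: "integrable lborel F" and b: "integrable lborel b"
  and U: "(\<lambda>(w, z). U w z) \<in> borel_measurable (borel \<Otimes>\<^sub>M borel)" "\<And>w z. cmod (U w z) = 1"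
 shows "(\<integral>w. F w * (\<integral>z. b z * U w z \<partial>lborel) \<partial>lborel) = (\<integral>z. b z * (\<integral>w. F w * U w z \<partial>lborel) \<partial>lborel)"
proof -
 have Fm[measurable]: "F \<in> borel_measurable borel" and bm[measurable]: "b \<in> borel_measurable borel"
  using F b by auto
 have U'[measurable]: "(\<lambda>(w, z). U w z) \<in> borel_measurable (lborel \<Otimes>\<^sub>M lborel)"
  using U(1) measurable_cong_sets[OF sets_pair_measure_cong[OF sets_lborel sets_lborel] refl] by blast
 have Um: "(\<lambda>z. U w z) \<in> borel_measurable borel" for w
  using measurable_Pair2[OF U(1), of w] by simp
 have i: "integrable lborel (\<lambda>z. F w * b z * U w z)" for w
  by (rule Bochner_Integration.integrable_bound[OF integrable_mult_right[OF b, of "F w"]])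
    (use Um[of w] in \<open>auto simp: norm_mult U(2)\<close>)
 have m: "(\<lambda>(w, z). F w * b z * U w z) \<in> borel_measurable (lborel \<Otimes>\<^sub>M lborel)"
 proof -
  have "(\<lambda>x. F (fst x) * b (snd x) * (case x of (w, z) => U w z)) \<in> borel_measurable (lborel \<Otimes>\<^sub>M lborel)"
   by measurable
  then show ?thesis by (simp add: case_prod_beta')
 qed
 have int: "integrable (lborel \<Otimes>\<^sub>M lborel) (\<lambda>(w, z). F w * b z * U w z)"
 proof (rule lborel_pair.Fubini_integrable[OF m])
  have "(\<lambda>x. \<integral>y. norm (case (x, y) of (w, z) => F w * b z * U w z) \<partial>lborel) = (\<lambda>x. norm (F x) * (\<integral>y. norm (b y) \<partial>lborel))"
   by (simp add: norm_mult U(2))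
  moreover have "integrable lborel (\<lambda>x. norm (F x) * (\<integral>y. norm (b y) \<partial>lborel))"
   using F by (intro integrable_mult_left integrable_norm)
  ultimately show "integrable lborel (\<lambda>x. \<integral>y. norm (case (x, y) of (w, z) => F w * b z * U w z) \<partial>lborel)" by simp
  show "AE x in lborel. integrable lborel (\<lambda>y. case (x, y) of (w, z) => F w * b z * U w z)"
   using i by simp
 qed
 have "(\<integral>w. F w * (\<integral>z. b z * U w z \<partial>lborel) \<partial>lborel) = (\<integral>w. (\<integral>z. F w * b z * U w z \<partial>lborel) \<partial>lborel)"
  by (simp add: mult.assoc)
 also have "\<dots> = (\<integral>z. (\<integral>w. F w * b z * U w z \<partial>lborel) \<partial>lborel)"
  using lborel_pair.Fubini_integral[OF int] by simp
 also have "\<dots> = (\<integral>z. (\<integral>w. b z * (F w * U w z) \<partial>lborel) \<partial>lborel)"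
  by (simp add: mult_ac)
 also have "\<dots> = (\<integral>z. b z * (\<integral>w. F w * U w z \<partial>lborel) \<partial>lborel)"
  by simp
 finally show ?thesis .
qed

lemma measurable_borel_pair_continuous:
 fixes f :: "'n::finite rvec \<times> 'n rvec => complex"
 assumes "continuous_on UNIV f" shows "f \<in> borel_measurable (borel \<Otimes>\<^sub>M borel)"
 using borel_measurable_continuous_onI[OF assms] by (simp add: borel_prod)

lemma integrable_scale:
 fixes f :: "real ^ 'n::finite => complex"
 assumes f: "integrable lborel f" and c: "c \<noteq> 0"
 shows "integrable lborel (\<lambda>x. f (t + c *\<^sub>R x))"
proof -
 have [measurable]: "f \<in> borel_measurable borel" using f by auto
 have "integrable (density (distr lborel borel (\<lambda>x. t + c *\<^sub>R x)) (\<lambda>_. \<bar>c\<bar> ^ DIM(real ^ 'n))) f"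
  using f lborel_affine[of c t] c by simp
 then have "integrable (distr lborel borel (\<lambda>x. t + c *\<^sub>R x)) (\<lambda>x. \<bar>c\<bar> ^ DIM(real ^ 'n) *\<^sub>R f x)"
  by (subst (asm) integrable_density) auto
 then have "integrable (distr lborel borel (\<lambda>x. t + c *\<^sub>R x)) (\<lambda>x. inverse (\<bar>c\<bar> ^ DIM(real ^ 'n)) *\<^sub>R (\<bar>c\<bar> ^ DIM(real ^ 'n) *\<^sub>R f x))"
  by (rule integrable_scaleR_right)
 moreover have "(\<lambda>x. inverse (\<bar>c\<bar> ^ DIM(real ^ 'n)) *\<^sub>R (\<bar>c\<bar> ^ DIM(real ^ 'n) *\<^sub>R f x)) = f" using c by (simp add: fun_eq_iff)
 ultimately have "integrable (distr lborel borel (\<lambda>x. t + c *\<^sub>R x)) f" by simp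
 then show ?thesis by (rule integrable_distr[rotated]) measurable
qed

lemma integral_lborel_translate:
 fixes f :: "real ^ 'n::finite => complex"
 assumes "f \<in> borel_measurable borel"
 shows "(\<integral>x. f (t + x) \<partial>lborel) = (\<integral>x. f x \<partial>lborel)"
 using integral_scale[OF assms, of 1 t] by simp

lemma gauss_minus[simp]: "gauss (- v) = gauss v" by (simp add: gauss_def)

lemma gauss_le_1: "gauss v \<le> 1" "gauss v > 0" by (auto simp: gauss_def)

lemma continuous_gauss: "continuous_on S gauss"
 unfolding gauss_def[abs_def] by (auto intro!: continuous_intros)

lemma measurable_gauss[measurable]: "gauss \<in> borel_measurable borel"
 by (rule borel_measurable_continuous_onI[OF continuous_gauss])

lemma integrable_gauss: "integrable lborel (\<lambda>v::real ^ 'n::finite. complex_of_real (gauss v))"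
 using fourier_gauss(1)[of "0 :: real ^ 'n"] by simp

lemma integral_gauss: "(\<integral>v. complex_of_real (gauss v) \<partial>(lborel :: (real ^ 'n::finite) measure)) = of_real (sqrt (2 * pi) ^ CARD('n))"
 using fourier_gauss(2)[of "0 :: real ^ 'n"] by (simp add: gauss_def)

lemma continuous_exp_lorentz:
 "continuous_on UNIV (\<lambda>(w, z). exp (- \<i> * complex_of_real (lorentz z w)))"
 "continuous_on UNIV (\<lambda>(w, z). exp (\<i> * complex_of_real (lorentz z w)))"
 unfolding case_prod_beta' by (auto intro!: continuous_intros)

lemma lborel_pair_exp_lorentz:
 "(\<lambda>(w, z). exp (- \<i> * complex_of_real (lorentz z w))) \<in> borel_measurable (borel \<Otimes>\<^sub>M borel)"
 by (rule measurable_borel_pair_continuous[OF continuous_exp_lorentz(1)])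

text \<open>
  Gauss summability: with the factor \<open>gauss (w / N)\<close> inserted the double integral may
  be interchanged, and the inner integral becomes a Gaussian of width \<open>1 / N\<close> around
  \<open>x\<close>. Letting \<open>N\<close> tend to infinity on both sides, by dominated
  convergence, gives \<open>a x\<close>.
\<close>

theorem fourier_inversion:
 fixes a :: "'n::{finite,linorder} rvec => complex"
 assumes cont: "continuous_on UNIV a" and bd: "\<And>x. cmod (a x) \<le> B" and int: "integrable lborel a"
  and fint: "integrable lborel (fourier a)"
 shows "inv_fourier (fourier a) x = a x"
proof -
 let ?n = "CARD('n)"
 define K where "K = sqrt (2 * pi) ^ ?n"
 define c where "c = fcst TYPE('n)"
 have cK: "c * K = 1" unfolding c_def K_def by (rule fcst_sqrt)
 have [measurable]: "a \<in> borel_measurable borel" by (rule borel_measurable_continuous_onI[OF cont])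
 have [measurable]: "fourier a \<in> borel_measurable borel" using fint by auto
 define N where "N m = real (Suc m)" for m
 have N: "N m > 0" for m by (simp add: N_def)
 define I where "I m = (\<integral>w. fourier a w * exp (\<i> * of_real (lorentz x w)) * of_real (gauss ((1 / N m) *\<^sub>R w)) \<partial>lborel)" for m
 have N0: "(\<lambda>m. 1 / N m) \<longlonglongrightarrow> 0"
  unfolding N_def by (rule LIMSEQ_Suc[OF lim_1_over_n])
 have lim1: "I \<longlonglongrightarrow> (\<integral>w. fourier a w * exp (\<i> * of_real (lorentz x w)) \<partial>lborel)"
  unfolding I_def
 proof (rule integral_dominated_convergence[where w = "\<lambda>w. norm (fourier a w)"])
  show "integrable lborel (\<lambda>w. norm (fourier a w))" using fint by (rule integrable_norm)
  show "AE w in lborel. (\<lambda>m. fourier a w * exp (\<i> * of_real (lorentz x w)) * of_real (gauss ((1 / N m) *\<^sub>R w)))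
   \<longlonglongrightarrow> fourier a w * exp (\<i> * of_real (lorentz x w))"
  proof (rule AE_I2)
   fix w :: "'n rvec"
   have "(\<lambda>m. gauss ((1 / N m) *\<^sub>R w)) \<longlonglongrightarrow> gauss (0 *\<^sub>R w)"
    by (rule continuous_on_tendsto_compose[OF continuous_gauss[of UNIV] tendsto_scaleR[OF N0 tendsto_const]]) auto
   then have "(\<lambda>m. gauss ((1 / N m) *\<^sub>R w)) \<longlonglongrightarrow> 1" by (simp add: gauss_def)
   then have "(\<lambda>m. fourier a w * exp (\<i> * of_real (lorentz x w)) * of_real (gauss ((1 / N m) *\<^sub>R w)))
    \<longlonglongrightarrow> fourier a w * exp (\<i> * of_real (lorentz x w)) * of_real 1"
    by (intro tendsto_mult tendsto_const tendsto_of_real)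
   then show "(\<lambda>m. fourier a w * exp (\<i> * of_real (lorentz x w)) * of_real (gauss ((1 / N m) *\<^sub>R w)))
    \<longlonglongrightarrow> fourier a w * exp (\<i> * of_real (lorentz x w))" by simp
  qed
  show "AE w in lborel. norm (fourier a w * exp (\<i> * of_real (lorentz x w)) * of_real (gauss ((1 / N m) *\<^sub>R w))) \<le> norm (fourier a w)" for m
  proof (rule AE_I2)
   fix w :: "'n rvec"
   have "cmod (fourier a w) * gauss ((1 / N m) *\<^sub>R w) \<le> cmod (fourier a w) * 1"
    by (intro mult_left_mono gauss_le_1) auto
   then show "norm (fourier a w * exp (\<i> * of_real (lorentz x w)) * of_real (gauss ((1 / N m) *\<^sub>R w))) \<le> norm (fourier a w)"
    using gauss_le_1(2)[of "(1 / N m) *\<^sub>R w"] by (simp add: norm_mult)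
  qed
 qed measurable
 have inner: "(\<integral>w. exp (\<i> * of_real (lorentz x w)) * of_real (gauss ((1 / N m) *\<^sub>R w)) * exp (- \<i> * of_real (lorentz z w)) \<partial>lborel)
  = of_real (N m ^ ?n * K * gauss (N m *\<^sub>R (x - z)))" for m z
 proof -
  have "(\<integral>w. exp (\<i> * of_real (lorentz x w)) * of_real (gauss ((1 / N m) *\<^sub>R w)) * exp (- \<i> * of_real (lorentz z w)) \<partial>lborel)
   = (\<integral>w. exp (\<i> * of_real (lflip (x - z) \<bullet> w)) * of_real (gauss ((1 / N m) *\<^sub>R w)) \<partial>lborel)"
   by (rule Bochner_Integration.integral_cong)
     (auto simp: inner_lflip[symmetric] lorentz_eq_inner inner_diff_left exp_minus exp_diff field_simps)
  also have "\<dots> = of_real (N m ^ ?n) * (\<integral>v. exp (\<i> * of_real (lflip (x - z) \<bullet> (N m *\<^sub>R v))) * of_real (gauss v) \<partial>lborel)"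
   by (subst integral_scale[OF _ N[of m], of _ 0]) (use N[of m] in simp_all)
  also have "\<dots> = of_real (N m ^ ?n) * (\<integral>v. exp (\<i> * of_real ((N m *\<^sub>R lflip (x - z)) \<bullet> v)) * of_real (gauss v) \<partial>lborel)"
   by simp
  also have "\<dots> = of_real (N m ^ ?n) * of_real (K * gauss (N m *\<^sub>R lflip (x - z)))"
   unfolding K_def by (simp only: fourier_gauss)
  also have "gauss (N m *\<^sub>R lflip (x - z)) = gauss (N m *\<^sub>R (x - z))"
   by (simp add: gauss_def)
  finally show ?thesis by (simp add: mult_ac)
 qed
 have I: "I m = of_real c * (of_real K * (\<integral>v. a (x + (1 / N m) *\<^sub>R v) * of_real (gauss v) \<partial>lborel))" for m
 proof -
  have gi: "integrable lborel (\<lambda>w. exp (\<i> * of_real (lorentz x w)) * complex_of_real (gauss ((1 / N m) *\<^sub>R w)))"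
  proof (rule Bochner_Integration.integrable_bound)
   show "integrable lborel (\<lambda>w::'n rvec. complex_of_real (gauss (0 + (1 / N m) *\<^sub>R w)))"
    by (rule integrable_scale[OF integrable_gauss]) (use N[of m] in simp)
  qed (auto simp: norm_mult)
  have "I m = (\<integral>w. of_real c * ((exp (\<i> * of_real (lorentz x w)) * of_real (gauss ((1 / N m) *\<^sub>R w))) *
    (\<integral>z. a z * exp (- \<i> * of_real (lorentz z w)) \<partial>lborel)) \<partial>lborel)"
   unfolding I_def by (rule Bochner_Integration.integral_cong) (auto simp: fourier_eq c_def)
  also have "\<dots> = of_real c * (\<integral>w. (exp (\<i> * of_real (lorentz x w)) * of_real (gauss ((1 / N m) *\<^sub>R w))) *
    (\<integral>z. a z * exp (- \<i> * of_real (lorentz z w)) \<partial>lborel) \<partial>lborel)"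
   by simp
  also have "\<dots> = of_real c * (\<integral>z. a z * (\<integral>w. (exp (\<i> * of_real (lorentz x w)) * of_real (gauss ((1 / N m) *\<^sub>R w))) * exp (- \<i> * of_real (lorentz z w)) \<partial>lborel) \<partial>lborel)"
   by (subst Fubini_unimodular[OF gi int lborel_pair_exp_lorentz cmod_exp_minus_i]) (rule refl)
  also have "\<dots> = of_real c * (\<integral>z. a z * of_real (N m ^ ?n * K * gauss (N m *\<^sub>R (x - z))) \<partial>lborel)"
   by (simp only: inner)
  also have "(\<integral>z. a z * of_real (N m ^ ?n * K * gauss (N m *\<^sub>R (x - z))) \<partial>lborel)
   = of_real ((1 / N m) ^ ?n) * (\<integral>v. a (x + (1 / N m) *\<^sub>R v) * of_real (N m ^ ?n * K * gauss (N m *\<^sub>R (x - (x + (1 / N m) *\<^sub>R v)))) \<partial>lborel)"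
   by (rule integral_scale) (use N[of m] in auto)
  also have "\<dots> = of_real ((1 / N m) ^ ?n) * (\<integral>v. of_real (N m ^ ?n * K) * (a (x + (1 / N m) *\<^sub>R v) * of_real (gauss v)) \<partial>lborel)"
   using N[of m] by (simp add: mult_ac)
  also have "\<dots> = of_real ((1 / N m) ^ ?n * (N m ^ ?n * K)) * (\<integral>v. a (x + (1 / N m) *\<^sub>R v) * of_real (gauss v) \<partial>lborel)"
   by simp
  also have "(1 / N m) ^ ?n * (N m ^ ?n * K) = K"
   using N[of m] by (simp add: power_divide)
  finally show ?thesis .
 qed
 have lim2: "(\<lambda>m. \<integral>v. a (x + (1 / N m) *\<^sub>R v) * of_real (gauss v) \<partial>lborel) \<longlonglongrightarrow> (\<integral>v. a x * of_real (gauss v) \<partial>(lborel :: 'n rvec measure))"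
 proof (rule integral_dominated_convergence[where w = "\<lambda>v::'n rvec. B * gauss v"])
  have "integrable lborel (\<lambda>v::'n rvec. gauss v)"
   using integrable_Re[OF integrable_gauss[where 'n = 'n]] by simp
  then show "integrable lborel (\<lambda>v::'n rvec. B * gauss v)" by (rule integrable_mult_right)
  show "AE v in lborel. (\<lambda>m. a (x + (1 / N m) *\<^sub>R v) * of_real (gauss v)) \<longlonglongrightarrow> a x * of_real (gauss v)"
  proof (rule AE_I2)
   fix v :: "'n rvec"
   have "(\<lambda>m. x + (1 / N m) *\<^sub>R v) \<longlonglongrightarrow> x + 0 *\<^sub>R v"
    by (intro tendsto_add tendsto_scaleR tendsto_const N0)
   then have "(\<lambda>m. a (x + (1 / N m) *\<^sub>R v)) \<longlonglongrightarrow> a (x + 0 *\<^sub>R v)"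
    by (rule continuous_on_tendsto_compose[OF cont]) auto
   then show "(\<lambda>m. a (x + (1 / N m) *\<^sub>R v) * of_real (gauss v)) \<longlonglongrightarrow> a x * of_real (gauss v)"
    by (auto intro: tendsto_mult tendsto_const)
  qed
  show "AE v in lborel. norm (a (x + (1 / N m) *\<^sub>R v) * of_real (gauss v)) \<le> B * gauss v" for m
  proof (rule AE_I2)
   fix v :: "'n rvec"
   show "norm (a (x + (1 / N m) *\<^sub>R v) * of_real (gauss v)) \<le> B * gauss v"
    using mult_right_mono[OF bd[of "x + (1 / N m) *\<^sub>R v"], of "gauss v"] gauss_le_1(2)[of v]
    by (simp add: norm_mult)
  qed
 qed measurable
 have "(\<integral>v. a x * of_real (gauss v) \<partial>(lborel :: 'n rvec measure)) = a x * of_real K"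
  by (simp only: integral_mult_right_zero integral_gauss[where 'n = 'n] K_def)
 note lim2' = lim2[unfolded this]
 have lim3: "I \<longlonglongrightarrow> of_real c * (of_real K * (a x * of_real K))"
  unfolding I by (intro tendsto_mult tendsto_const lim2')
 have "(\<integral>w. fourier a w * exp (\<i> * of_real (lorentz x w)) \<partial>lborel) = of_real c * (of_real K * (a x * of_real K))"
  by (rule LIMSEQ_unique[OF lim1 lim3])
 also have "\<dots> = of_real (c * K) * (a x * of_real K)" by simp
 finally have J: "(\<integral>w. fourier a w * exp (\<i> * of_real (lorentz x w)) \<partial>lborel) = of_real (c * K) * (a x * of_real K)" .
 have "inv_fourier (fourier a) x = of_real c * (of_real (c * K) * (a x * of_real K))"
  by (simp only: inv_fourier_def J c_def[symmetric])
 also have "\<dots> = of_real (c * K) * of_real (c * K) * a x" by (simp add: mult_ac)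
 finally show ?thesis unfolding cK by simp
qed

lemma inv_fourier_mult:
 fixes F b :: "'n::{finite,linorder} rvec => complex"
 assumes F: "integrable lborel F" and b: "integrable lborel b"
 shows "inv_fourier (\<lambda>w. F w * fourier b w) x = of_real (fcst TYPE('n)) * (\<integral>z. b z * inv_fourier F (x - z) \<partial>lborel)"
proof -
 define c where "c = fcst TYPE('n)"
 have Fe: "integrable lborel (\<lambda>w. F w * exp (\<i> * of_real (lorentz x w)))"
  by (rule Bochner_Integration.integrable_bound[OF F]) (use F in \<open>auto simp: norm_mult\<close>)
 have "inv_fourier (\<lambda>w. F w * fourier b w) x =
  of_real c * (\<integral>w. of_real c * ((F w * exp (\<i> * of_real (lorentz x w))) * (\<integral>z. b z * exp (- \<i> * of_real (lorentz z w)) \<partial>lborel)) \<partial>lborel)"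
  unfolding inv_fourier_def fourier_eq c_def[symmetric] by (simp add: mult_ac)
 also have "\<dots> = of_real c * (of_real c * (\<integral>w. (F w * exp (\<i> * of_real (lorentz x w))) * (\<integral>z. b z * exp (- \<i> * of_real (lorentz z w)) \<partial>lborel) \<partial>lborel))"
  by simp
 also have "\<dots> = of_real c * (of_real c * (\<integral>z. b z * (\<integral>w. (F w * exp (\<i> * of_real (lorentz x w))) * exp (- \<i> * of_real (lorentz z w)) \<partial>lborel) \<partial>lborel))"
  by (subst Fubini_unimodular[OF Fe b lborel_pair_exp_lorentz cmod_exp_minus_i]) (rule refl)
 also have "\<dots> = of_real c * (\<integral>z. b z * (of_real c * (\<integral>w. F w * exp (\<i> * of_real (lorentz (x - z) w)) \<partial>lborel)) \<partial>lborel)"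
 proof -
  have e: "(F w * exp (\<i> * of_real (lorentz x w))) * exp (- \<i> * of_real (lorentz z w)) = F w * exp (\<i> * of_real (lorentz (x - z) w))" for z w
   by (simp add: lorentz_diff_left exp_diff exp_minus field_simps)
  show ?thesis unfolding e by (simp add: mult_ac)
 qed
 finally show ?thesis by (simp add: inv_fourier_def c_def)
qed

lemma has_derivative_quadratic:
 fixes f :: "'a::real_normed_vector => 'b::real_normed_vector"
 assumes D: "bounded_linear D" and q: "\<And>h. norm (f (x + h) - f x - D h) \<le> C * (norm h)\<^sup>2"
 shows "(f has_derivative D) (at x)"
proof -
 have "(\<lambda>h. norm (f (x + h) - f x - D h) / norm h) \<midarrow>0\<rightarrow> 0"
 proof (rule real_tendsto_sandwich[where f = "\<lambda>_. 0" and h = "\<lambda>h. C * norm h"])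
  show "\<forall>\<^sub>F h in at 0. norm (f (x + h) - f x - D h) / norm h \<le> C * norm h"
  proof (rule eventually_at_filter[THEN iffD2], rule always_eventually, intro allI impI)
   fix h :: 'a assume "h \<noteq> 0"
   with q[of h] show "norm (f (x + h) - f x - D h) / norm h \<le> C * norm h"
    by (simp add: divide_le_eq power2_eq_square mult.assoc)
  qed
  have "((\<lambda>h::'a. C * norm h) \<longlongrightarrow> C * norm (0::'a)) (at 0)"
   by (rule tendsto_mult[OF tendsto_const tendsto_norm[OF tendsto_ident_at]])
  then show "((\<lambda>h::'a. C * norm h) \<longlongrightarrow> 0) (at 0)" by simp
 qed auto
 with D show ?thesis by (simp add: has_derivative_at)
qed

definition lsign :: "'n::{finite,linorder} => real" where
 "lsign l = (if l = idx_last then 1 else - 1)"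

lemma lorentz_sum: "lorentz x h = (\<Sum>l\<in>UNIV. lsign l * x $ l * h $ l)"
 unfolding lorentz_eq_inner inner_vec_def lflip_def lsign_def by (rule sum.cong) auto

text \<open>
  Differentiation under the integral: the remainder of the exponential is quadratic, and a
  quadratic weight is integrable against a rapidly decreasing function.
\<close>

lemma fourier_has_derivative:
 fixes f :: "'n::{finite,linorder} rvec => complex"
 assumes f: "rapid f"
 shows "(fourier f has_derivative (\<lambda>h. \<Sum>l\<in>UNIV. h $ l *\<^sub>R fourier (\<lambda>x. (- \<i> * of_real (lsign l)) * (of_real (x $ l) * f x)) w)) (at w)"
proof (rule has_derivative_quadratic)
 have [measurable]: "f \<in> borel_measurable borel" by (rule rapid_measurable[OF f])
 show "bounded_linear (\<lambda>h. \<Sum>l\<in>UNIV. h $ l *\<^sub>R fourier (\<lambda>x. (- \<i> * of_real (lsign l)) * (of_real (x $ l) * f x)) w)"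
  by (intro bounded_linear_sum bounded_linear_compose[OF bounded_linear_scaleR_left bounded_linear_vec_nth])
 fix h :: "'n rvec"
 define e where "e x = exp (- \<i> * complex_of_real (lorentz x w))" for x :: "'n rvec"
 have ce: "cmod (e x) = 1" for x unfolding e_def by (rule cmod_exp_minus_i)
 have em[measurable]: "e \<in> borel_measurable borel" unfolding e_def by measurable
 have i0: "integrable lborel (\<lambda>x. g x * e x)" if "rapid g" for g
  by (rule Bochner_Integration.integrable_bound[OF rapid_integrable[OF that]])
    (use rapid_measurable[OF that] in \<open>auto simp: norm_mult ce\<close>)
 have i1: "integrable lborel (\<lambda>x. f x * exp (- \<i> * of_real (lorentz x (w + h))))"
  by (rule Bochner_Integration.integrable_bound[OF rapid_integrable[OF f]])
    (simp_all add: norm_mult cmod_exp_minus_i del: mult_minus_left)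
 have r: "rapid (\<lambda>x. (- \<i> * of_real (lsign l)) * (of_real (x $ l) * f x))" for l
  by (intro rapid_cmult rapid_mult_coord f)
 have D: "(\<Sum>l\<in>UNIV. h $ l *\<^sub>R fourier (\<lambda>x. (- \<i> * of_real (lsign l)) * (of_real (x $ l) * f x)) w)
  = of_real (fcst TYPE('n)) * (\<integral>x. f x * e x * (- \<i> * of_real (lorentz x h)) \<partial>lborel)"
 proof -
  have "(\<Sum>l\<in>UNIV. h $ l *\<^sub>R fourier (\<lambda>x. (- \<i> * of_real (lsign l)) * (of_real (x $ l) * f x)) w)
   = (\<Sum>l\<in>UNIV. of_real (fcst TYPE('n)) * (\<integral>x. of_real (h $ l) * ((- \<i> * of_real (lsign l)) * (of_real (x $ l) * f x) * e x) \<partial>lborel))"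
  proof (rule sum.cong[OF refl])
   fix l
   show "h $ l *\<^sub>R fourier (\<lambda>x. (- \<i> * of_real (lsign l)) * (of_real (x $ l) * f x)) w =
    of_real (fcst TYPE('n)) * (\<integral>x. of_real (h $ l) * ((- \<i> * of_real (lsign l)) * (of_real (x $ l) * f x) * e x) \<partial>lborel)"
    unfolding integral_mult_right_zero fourier_eq e_def scaleR_conv_of_real by (rule mult.left_commute)
  qed
  also have "\<dots> = of_real (fcst TYPE('n)) * (\<integral>x. (\<Sum>l\<in>UNIV. of_real (h $ l) * ((- \<i> * of_real (lsign l)) * (of_real (x $ l) * f x) * e x)) \<partial>lborel)"
   by (subst Bochner_Integration.integral_sum, rule integrable_mult_right, rule i0, rule r, simp only: sum_distrib_left)
  also have "(\<lambda>x. \<Sum>l\<in>UNIV. of_real (h $ l) * ((- \<i> * of_real (lsign l)) * (of_real (x $ l) * f x) * e x)) = (\<lambda>x. f x * e x * (- \<i> * of_real (lorentz x h)))"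
   by (rule ext) (simp add: lorentz_sum sum_distrib_left mult_ac sum_negf)
  finally show ?thesis .
 qed
 have i2: "integrable lborel (\<lambda>x. f x * e x * (- \<i> * of_real (lorentz x h)))"
 proof -
  have "(\<lambda>x. f x * e x * (- \<i> * of_real (lorentz x h))) = (\<lambda>x. \<Sum>l\<in>UNIV. of_real (h $ l) * ((- \<i> * of_real (lsign l)) * (of_real (x $ l) * f x) * e x))"
   by (rule ext) (simp add: lorentz_sum sum_distrib_left mult_ac sum_negf)
  moreover have "integrable lborel (\<lambda>x. \<Sum>l\<in>UNIV. of_real (h $ l) * ((- \<i> * of_real (lsign l)) * (of_real (x $ l) * f x) * e x))"
   by (intro Bochner_Integration.integrable_sum integrable_mult_right i0 r)
  ultimately show ?thesis by simp
 qed
 have "fourier f (w + h) - fourier f w - (\<Sum>l\<in>UNIV. h $ l *\<^sub>R fourier (\<lambda>x. (- \<i> * of_real (lsign l)) * (of_real (x $ l) * f x)) w)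
  = of_real (fcst TYPE('n)) * ((\<integral>x. f x * exp (- \<i> * of_real (lorentz x (w + h))) \<partial>lborel) - (\<integral>x. f x * e x \<partial>lborel) - (\<integral>x. f x * e x * (- \<i> * of_real (lorentz x h)) \<partial>lborel))"
  unfolding D by (simp add: fourier_eq e_def algebra_simps)
 also have "\<dots> = of_real (fcst TYPE('n)) * (\<integral>x. f x * exp (- \<i> * of_real (lorentz x (w + h))) - f x * e x - f x * e x * (- \<i> * of_real (lorentz x h)) \<partial>lborel)"
  using i1 i0[OF f] i2 by (simp only: Bochner_Integration.integral_diff Bochner_Integration.integrable_diff)
 finally have eq: "fourier f (w + h) - fourier f w - (\<Sum>l\<in>UNIV. h $ l *\<^sub>R fourier (\<lambda>x. (- \<i> * of_real (lsign l)) * (of_real (x $ l) * f x)) w)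
  = of_real (fcst TYPE('n)) * (\<integral>x. f x * exp (- \<i> * of_real (lorentz x (w + h))) - f x * e x - f x * e x * (- \<i> * of_real (lorentz x h)) \<partial>lborel)" .
 have iw: "integrable lborel (\<lambda>x. (norm h)\<^sup>2 * cmod (of_real ((1 + norm x) ^ 2) * f x))"
  by (intro integrable_mult_right integrable_norm rapid_integrable_weight f)
 have "cmod (\<integral>x. f x * exp (- \<i> * of_real (lorentz x (w + h))) - f x * e x - f x * e x * (- \<i> * of_real (lorentz x h)) \<partial>lborel)
  \<le> (\<integral>x. (norm h)\<^sup>2 * cmod (of_real ((1 + norm x) ^ 2) * f x) \<partial>lborel)"
 proof (rule Bochner_Integration.integral_norm_bound_integral[OF _ iw])
  show "integrable lborel (\<lambda>x. f x * exp (- \<i> * of_real (lorentz x (w + h))) - f x * e x - f x * e x * (- \<i> * of_real (lorentz x h)))"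
   by (intro Bochner_Integration.integrable_diff i1 i2 i0 f)
  fix x
  define \<theta> where "\<theta> = - lorentz x h"
  have "f x * exp (- \<i> * of_real (lorentz x (w + h))) - f x * e x - f x * e x * (- \<i> * of_real (lorentz x h))
   = f x * e x * (exp (\<i> * of_real \<theta>) - (1 + \<i> * of_real \<theta>))"
   unfolding \<theta>_def e_def by (simp add: lorentz_add_right exp_add[symmetric] algebra_simps exp_diff)
  then have "cmod (f x * exp (- \<i> * of_real (lorentz x (w + h))) - f x * e x - f x * e x * (- \<i> * of_real (lorentz x h)))
   = cmod (f x) * cmod (exp (\<i> * of_real \<theta>) - (1 + \<i> * of_real \<theta>))"
   by (simp add: norm_mult ce)
  also have "\<dots> \<le> cmod (f x) * (\<theta>\<^sup>2)"
  proof (intro mult_left_mono)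
   have "cmod (exp (\<i> * of_real \<theta>) - (1 + \<i> * of_real \<theta>)) \<le> \<theta>\<^sup>2 / 2"
    using iexp_approx1[of \<theta> 1] by (simp add: power2_eq_square)
   then show "cmod (exp (\<i> * of_real \<theta>) - (1 + \<i> * of_real \<theta>)) \<le> \<theta>\<^sup>2"
    using zero_le_power2[of \<theta>] by linarith
  qed simp
  also have "cmod (f x) * \<theta>\<^sup>2 \<le> cmod (f x) * ((1 + norm x) * norm h)\<^sup>2"
  proof (rule mult_left_mono)
   have "(1 + norm x) * norm h = norm h + norm x * norm h" by (simp add: algebra_simps)
   then have "\<bar>\<theta>\<bar> \<le> (1 + norm x) * norm h"
    unfolding \<theta>_def using abs_lorentz_le[of x h] norm_ge_zero[of h] by linarith
   from power_mono[OF this, of 2] show "\<theta>\<^sup>2 \<le> ((1 + norm x) * norm h)\<^sup>2" by simp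
  qed simp
  finally show "norm (f x * exp (- \<i> * of_real (lorentz x (w + h))) - f x * e x - f x * e x * (- \<i> * of_real (lorentz x h)))
   \<le> (norm h)\<^sup>2 * cmod (of_real ((1 + norm x) ^ 2) * f x)"
   by (simp add: norm_mult norm_power power_mult_distrib mult_ac del: of_real_power)
 qed
 also have "\<dots> = (norm h)\<^sup>2 * (\<integral>x. cmod (of_real ((1 + norm x) ^ 2) * f x) \<partial>lborel)" by simp
 finally show "norm (fourier f (w + h) - fourier f w - (\<Sum>l\<in>UNIV. h $ l *\<^sub>R fourier (\<lambda>x. (- \<i> * of_real (lsign l)) * (of_real (x $ l) * f x)) w))
  \<le> (fcst TYPE('n) * (\<integral>x. cmod (of_real ((1 + norm x) ^ 2) * f x) \<partial>lborel)) * (norm h)\<^sup>2"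
  unfolding eq using fcst_pos[where 'n = 'n] by (simp add: norm_mult mult_ac mult_left_mono)
qed

section \<open>Convolutions and Fourier multipliers\<close>

lemma fourier_continuous: "rapid f ==> continuous_on S (fourier f)"
 by (meson continuous_at_imp_continuous_on has_derivative_continuous fourier_has_derivative)

lemma fourier_bound:
 fixes f :: "'n::{finite,linorder} rvec => complex"
 assumes "integrable lborel f"
 shows "cmod (fourier f w) \<le> fcst TYPE('n) * (\<integral>x. cmod (f x) \<partial>lborel)"
proof -
 have "cmod (\<integral>x. f x * exp (- \<i> * of_real (lorentz x w)) \<partial>lborel) \<le> (\<integral>x. cmod (f x) \<partial>lborel)"
 proof (rule Bochner_Integration.integral_norm_bound_integral)
  show "integrable lborel (\<lambda>x. f x * exp (- \<i> * of_real (lorentz x w)))"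
   by (rule Bochner_Integration.integrable_bound[OF assms])
     (use assms in \<open>simp_all add: norm_mult cmod_exp_minus_i del: mult_minus_left\<close>)
 qed (use assms in \<open>simp_all add: norm_mult cmod_exp_minus_i del: mult_minus_left\<close>)
 then show ?thesis
  using fcst_pos[where 'n = 'n] by (simp add: fourier_eq norm_mult)
qed

lemma integral_reflect_shift:
 fixes f :: "real ^ 'n::finite => complex"
 assumes [measurable]: "f \<in> borel_measurable borel"
 shows "(\<integral>y. f (x - y) \<partial>lborel) = (\<integral>y. f y \<partial>lborel)"
proof -
 have "(lborel :: (real ^ 'n) measure) = density (distr lborel borel (\<lambda>y. x + (- 1) *\<^sub>R y)) (\<lambda>_. 1)"
  using lborel_affine[of "- 1" x] by simp
 then have "(\<integral>y. f y \<partial>lborel) = (\<integral>y. f y \<partial>distr lborel borel (\<lambda>y. x - y))"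
  by (simp add: density_1)
 then show ?thesis by (simp add: integral_distr)
qed

definition convol :: "('n::finite rvec => complex) => ('n rvec => complex) => 'n rvec => complex" where
 "convol m b x = (\<integral>y. m y * b (x - y) \<partial>lborel)"

text \<open>
  The function \<open>a\<close> is recovered from its transform by inversion; inserting the
  integral for the transform of \<open>b\<close> and interchanging the integrations produces the
  convolution.
\<close>

lemma fourier_multiplier_convol:
 fixes a b F :: "'n::{finite,linorder} rvec => complex"
 assumes a: "a \<in> schwartz" and b: "b \<in> schwartz" and F: "integrable lborel F"
  and eq: "\<And>w. fourier a w = F w * fourier b w"
  and m: "inv_fourier F \<in> borel_measurable borel"
 shows "a = convol (\<lambda>y. of_real (fcst TYPE('n)) * inv_fourier F y) b"
proof
 fix x
 have bi: "integrable lborel b" by (rule schwartz_integrable[OF b])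
 have [measurable]: "b \<in> borel_measurable borel" by (rule schwartz_measurable[OF b])
 have [measurable]: "fourier b \<in> borel_measurable borel"
  by (rule borel_measurable_continuous_onI[OF fourier_continuous[OF schwartz_rapid[OF b]]])
 have [measurable]: "F \<in> borel_measurable borel" using F by auto
 note m[measurable]
 have fa: "fourier a = (\<lambda>w. F w * fourier b w)" using eq by auto
 have fi: "integrable lborel (fourier a)"
 proof (rule Bochner_Integration.integrable_bound)
  show "integrable lborel (\<lambda>w. of_real (fcst TYPE('n) * (\<integral>x. cmod (b x) \<partial>lborel)) * F w)"
   by (rule integrable_mult_right[OF F])
  show "fourier a \<in> borel_measurable lborel" unfolding fa by measurable
  have "0 \<le> fcst TYPE('n) * (\<integral>x. cmod (b x) \<partial>lborel)"
   using fcst_pos[where 'n = 'n] by (intro mult_nonneg_nonneg) auto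
  then show "AE w in lborel. norm (fourier a w) \<le> norm (of_real (fcst TYPE('n) * (\<integral>x. cmod (b x) \<partial>lborel)) * F w)"
   using mult_right_mono[OF fourier_bound[OF bi] norm_ge_zero]
   by (intro AE_I2) (simp only: fa norm_mult norm_of_real abs_of_nonneg mult.commute)
 qed
 obtain B where B: "\<And>x. (1 + norm x) ^ 0 * cmod (a x) \<le> B"
  using schwartz_decay[OF a, of 0] by metis
 have "a x = inv_fourier (fourier a) x"
  by (rule fourier_inversion[symmetric]) (use B schwartz_continuous[OF a] schwartz_integrable[OF a] fi in auto)
 also have "\<dots> = of_real (fcst TYPE('n)) * (\<integral>z. b z * inv_fourier F (x - z) \<partial>lborel)"
  unfolding fa by (rule inv_fourier_mult[OF F bi])
 also have "(\<integral>z. b z * inv_fourier F (x - z) \<partial>lborel) = (\<integral>y. b (x - y) * inv_fourier F (x - (x - y)) \<partial>lborel)"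
  by (rule integral_reflect_shift[symmetric]) measurable
 finally have 1: "a x = of_real (fcst TYPE('n)) * (\<integral>y. b (x - y) * inv_fourier F (x - (x - y)) \<partial>lborel)" .
 have 2: "convol (\<lambda>y. of_real (fcst TYPE('n)) * inv_fourier F y) b x
  = (\<integral>y. of_real (fcst TYPE('n)) * (b (x - y) * inv_fourier F (x - (x - y))) \<partial>lborel)"
  unfolding convol_def by (rule Bochner_Integration.integral_cong) (simp_all add: mult_ac)
 show "a x = convol (\<lambda>y. of_real (fcst TYPE('n)) * inv_fourier F y) b x"
  by (simp only: 1 2 integral_mult_right_zero)
qed

lemma schwartz_taylor:
 fixes b :: "'n::finite rvec => complex"
 assumes b: "b \<in> schwartz"
 obtains C where "C > 0" "\<And>z t. cmod (b (z + t *\<^sub>R axis i 1) - b z - t *\<^sub>R partial_deriv i b z) \<le> C * t\<^sup>2"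
proof -
 obtain C where C: "C > 0" "\<And>x z1 z2 A. A \<ge> 1 ==> (\<And>z. z \<in> closed_segment z1 z2 ==> 1 + norm (x :: 'n rvec) \<le> A * (1 + norm z)) ==>
   (1 + norm x) ^ 0 * cmod (partial_deriv i b z1 - partial_deriv i b z2) \<le> C * A ^ 0 * norm (z1 - z2)"
  using schwartz_lipschitz[OF schwartz_partial_deriv[OF b], of 0 i] by metis
 have lip: "cmod (partial_deriv i b z1 - partial_deriv i b z2) \<le> C * norm (z1 - z2)" for z1 z2
  using C(2)[of 1 z1 z2 0] by simp
 show ?thesis
 proof (rule that[OF C(1)])
  fix z t
  define h where "h s = b (z + s *\<^sub>R axis i 1) - s *\<^sub>R partial_deriv i b z" for s
  have "cmod (h t - h 0) \<le> (C * \<bar>t\<bar>) * norm (t - 0)"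
  proof (rule differentiable_bound[OF convex_closed_segment])
   fix s assume s: "s \<in> closed_segment 0 t"
   have "(h has_vector_derivative (partial_deriv i b (z + s *\<^sub>R axis i 1) - partial_deriv i b z)) (at s)"
    unfolding h_def
    by (rule has_vector_derivative_diff[OF partial_deriv_has_vector_derivative[OF schwartz_differentiable[OF b]]])
      (auto intro!: derivative_eq_intros)
   then show "(h has_derivative (\<lambda>u. u *\<^sub>R (partial_deriv i b (z + s *\<^sub>R axis i 1) - partial_deriv i b z))) (at s within closed_segment 0 t)"
    unfolding has_vector_derivative_def by (rule has_derivative_at_withinI)
   have "\<bar>s\<bar> \<le> \<bar>t\<bar>" using s by (auto simp: closed_segment_eq_real_ivl split: if_splits)
   then have "C * \<bar>s\<bar> \<le> C * \<bar>t\<bar>" using C(1) by (intro mult_left_mono) auto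
   with lip[of "z + s *\<^sub>R axis i 1" z] have "cmod (partial_deriv i b (z + s *\<^sub>R axis i 1) - partial_deriv i b z) \<le> C * \<bar>t\<bar>"
    by simp
   then show "onorm (\<lambda>u. u *\<^sub>R (partial_deriv i b (z + s *\<^sub>R axis i 1) - partial_deriv i b z)) \<le> C * \<bar>t\<bar>"
    by (intro onorm_le) (simp add: mult_left_mono mult.commute)
  qed auto
  then show "cmod (b (z + t *\<^sub>R axis i 1) - b z - t *\<^sub>R partial_deriv i b z) \<le> C * t\<^sup>2"
   by (simp add: h_def power2_eq_square mult.assoc algebra_simps)
 qed
qed

lemma convol_integrable:
 fixes b :: "'n::finite rvec => complex"
 assumes m: "integrable lborel m" and b: "b \<in> schwartz"
 shows "integrable lborel (\<lambda>y. m y * b (x - y))"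
proof -
 obtain B where B: "\<And>x. (1 + norm x) ^ 0 * cmod (b x) \<le> B"
  using schwartz_decay[OF b, of 0] by metis
 then have B0: "B \<ge> 0" using norm_ge_zero[of "b 0"] by (metis order.trans mult_1 power_0)
 have [measurable]: "b \<in> borel_measurable borel" by (rule schwartz_measurable[OF b])
 have [measurable]: "m \<in> borel_measurable borel" using m by auto
 show ?thesis
 proof (rule Bochner_Integration.integrable_bound)
  show "integrable lborel (\<lambda>y. of_real B * m y)" by (rule integrable_mult_right[OF m])
  show "AE y in lborel. norm (m y * b (x - y)) \<le> norm (of_real B * m y)"
  proof (rule AE_I2)
   fix y
   show "norm (m y * b (x - y)) \<le> norm (of_real B * m y)"
    using mult_left_mono[OF B[of "x - y"], of "cmod (m y)"] B0 by (simp add: norm_mult mult.commute)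
  qed
 qed measurable
qed

text \<open>
  Differentiation under the integral, with the uniform second-order bound from Taylor expansion as
  control of the difference quotients.
\<close>

lemma partial_deriv_convol:
 fixes b :: "'n::finite rvec => complex"
 assumes m: "integrable lborel m" and b: "b \<in> schwartz"
 shows "partial_deriv i (convol m b) x = convol m (partial_deriv i b) x"
proof -
 obtain C where C: "C > 0" "\<And>z t. cmod (b (z + t *\<^sub>R axis i 1) - b z - t *\<^sub>R partial_deriv i b z) \<le> C * t\<^sup>2"
  using schwartz_taylor[OF b] by metis
 have pb: "partial_deriv i b \<in> schwartz" by (rule schwartz_partial_deriv[OF b])
 define g where "g t = convol m b (x + t *\<^sub>R axis i 1)" for t
 have "(g has_derivative (\<lambda>t. t *\<^sub>R convol m (partial_deriv i b) x)) (at 0)"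
 proof (rule has_derivative_quadratic)
  show "bounded_linear (\<lambda>t. t *\<^sub>R convol m (partial_deriv i b) x)" by (rule bounded_linear_scaleR_left)
  fix t :: real
  have "g (0 + t) - g 0 - t *\<^sub>R convol m (partial_deriv i b) x
   = (\<integral>y. m y * b (x + t *\<^sub>R axis i 1 - y) \<partial>lborel) - (\<integral>y. m y * b (x - y) \<partial>lborel) - (\<integral>y. of_real t * (m y * partial_deriv i b (x - y)) \<partial>lborel)"
   by (simp add: g_def convol_def scaleR_conv_of_real)
  also have "\<dots> = (\<integral>y. m y * b (x + t *\<^sub>R axis i 1 - y) - m y * b (x - y) - of_real t * (m y * partial_deriv i b (x - y)) \<partial>lborel)"
   using convol_integrable[OF m b] convol_integrable[OF m pb]
   by (simp only: Bochner_Integration.integral_diff Bochner_Integration.integrable_diff integrable_mult_right)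
  finally have eq: "g (0 + t) - g 0 - t *\<^sub>R convol m (partial_deriv i b) x
   = (\<integral>y. m y * b (x + t *\<^sub>R axis i 1 - y) - m y * b (x - y) - of_real t * (m y * partial_deriv i b (x - y)) \<partial>lborel)" .
  have "cmod \<dots> \<le> (\<integral>y. C * t\<^sup>2 * cmod (m y) \<partial>lborel)"
  proof (rule Bochner_Integration.integral_norm_bound_integral)
   show "integrable lborel (\<lambda>y. m y * b (x + t *\<^sub>R axis i 1 - y) - m y * b (x - y) - of_real t * (m y * partial_deriv i b (x - y)))"
    by (intro Bochner_Integration.integrable_diff integrable_mult_right convol_integrable m b pb)
   show "integrable lborel (\<lambda>y. C * t\<^sup>2 * cmod (m y))" by (intro integrable_mult_right integrable_norm m)
   fix y
   have "m y * b (x + t *\<^sub>R axis i 1 - y) - m y * b (x - y) - of_real t * (m y * partial_deriv i b (x - y))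
    = m y * (b ((x - y) + t *\<^sub>R axis i 1) - b (x - y) - t *\<^sub>R partial_deriv i b (x - y))"
    by (simp add: algebra_simps scaleR_conv_of_real)
   then have "norm (m y * b (x + t *\<^sub>R axis i 1 - y) - m y * b (x - y) - of_real t * (m y * partial_deriv i b (x - y)))
    = cmod (m y) * cmod (b ((x - y) + t *\<^sub>R axis i 1) - b (x - y) - t *\<^sub>R partial_deriv i b (x - y))"
    by (simp only: norm_mult)
   also have "\<dots> \<le> cmod (m y) * (C * t\<^sup>2)" by (intro mult_left_mono C) auto
   finally show "norm (m y * b (x + t *\<^sub>R axis i 1 - y) - m y * b (x - y) - of_real t * (m y * partial_deriv i b (x - y))) \<le> C * t\<^sup>2 * cmod (m y)"
    by (simp add: mult_ac)
  qed
  also have "\<dots> = (C * (\<integral>y. cmod (m y) \<partial>lborel)) * (norm t)\<^sup>2" by simp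
  finally show "norm (g (0 + t) - g 0 - t *\<^sub>R convol m (partial_deriv i b) x) \<le> (C * (\<integral>y. cmod (m y) \<partial>lborel)) * (norm t)\<^sup>2"
   unfolding eq .
 qed
 then have "(g has_vector_derivative convol m (partial_deriv i b) x) (at 0)"
  by (simp add: has_vector_derivative_def)
 then show ?thesis
  unfolding partial_deriv_def g_def by (rule vector_derivative_at)
qed

lemma partial_derivs_convol:
 fixes b :: "'n::finite rvec => complex"
 assumes m: "integrable lborel m" and b: "b \<in> schwartz"
 shows "partial_derivs is (convol m b) = convol m (partial_derivs is b)"
proof (induction "is")
 case (Cons i "is")
 then show ?case
  using partial_deriv_convol[OF m schwartz_partial_derivs[OF b]] by auto
qed simp

lemma fine_partition:
 fixes R e :: real
 assumes "e > 0"
 obtains n :: nat and y :: "nat => 'n::finite rvec" and A :: "nat => 'n rvec set"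
 where "disjoint_family_on A {..<n}" "(\<Union>j<n. A j) = cball 0 R" "\<And>j. j < n ==> A j \<in> sets borel"
  "\<And>j x. j < n ==> x \<in> A j ==> dist x (y j) < e"
proof -
 have "seq_compact (cball (0::'n rvec) R)"
  by (simp add: compact_imp_seq_compact)
 from seq_compact_imp_totally_bounded[OF this] assms
 obtain k where k: "finite k" "cball (0::'n rvec) R \<subseteq> (\<Union>x\<in>k. ball x e)" by blast
 obtain n and y :: "nat => 'n rvec" where ny: "k = y ` {i. i < n}" "inj_on y {i. i < n}"
  using finite_imp_nat_seg_image_inj_on[OF k(1)] by metis
 define A where "A = (\<lambda>j. cball 0 R \<inter> (ball (y j) e - (\<Union>i<j. ball (y i) e)))"
 show ?thesis
 proof (rule that[of A n y])
  show "disjoint_family_on A {..<n}"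
   unfolding disjoint_family_on_def
  proof (intro ballI impI)
   fix i j :: nat assume "i \<noteq> j"
   then consider "i < j" | "j < i" by linarith
   then show "A i \<inter> A j = {}" by cases (auto simp: A_def)
  qed
  show "(\<Union>j<n. A j) = cball 0 R"
  proof
   show "cball 0 R \<subseteq> (\<Union>j<n. A j)"
   proof
    fix x :: "'n rvec" assume x: "x \<in> cball 0 R"
    then obtain i where i: "i < n" "x \<in> ball (y i) e" using k(2) ny(1) by auto
    define j where "j = (LEAST i. x \<in> ball (y i) e)"
    have "x \<in> ball (y j) e" unfolding j_def by (rule LeastI[of _ i]) (rule i)
    moreover have "j \<le> i" unfolding j_def by (rule Least_le) (rule i)
    moreover have "x \<notin> ball (y i') e" if "i' < j" for i'
     using not_less_Least[of i' "\<lambda>i. x \<in> ball (y i) e"] that unfolding j_def by blast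
    ultimately show "x \<in> (\<Union>j<n. A j)" using x i(1) by (auto simp: A_def intro!: bexI[of _ j])
   qed
  qed (auto simp: A_def)
  show "A j \<in> sets borel" for j unfolding A_def
   by (intro sets.Int sets.Diff sets.countable_UN'') (auto)
  show "dist x (y j) < e" if "x \<in> A j" for j x
   using that by (auto simp: A_def dist_commute)
 qed
qed

text \<open>
  Riemann sums for the convolution integral: the ball of radius \<open>N\<close> is split into
  finitely many pieces of diameter tending to zero, and \<open>m\<close> is replaced by its masses
  \<open>c N j\<close> on the pieces. Convergence holds in every Schwartz seminorm, so a
  continuous functional can be applied term by term.
\<close>

lemma convol_approx:
 fixes b :: "'n::finite rvec => complex"
 assumes m: "rapid m" and b: "b \<in> schwartz"
 obtains n :: "nat => nat" and c :: "nat => nat => complex" and y :: "nat => nat => 'n rvec"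
 where "\<And>N. (\<Sum>j<n N. cmod (c N j)) \<le> (\<integral>x. cmod (m x) \<partial>lborel)"
  "schwartz_lim (\<lambda>N x. \<Sum>j<n N. c N j * b (x - y N j)) (convol m b)"
proof -
 have mi: "integrable lborel m" by (rule rapid_integrable[OF m])
 have [measurable]: "m \<in> borel_measurable borel" by (rule rapid_measurable[OF m])
 define e where "e N = 1 / (1 + real N)" for N
 have e: "0 < e N" "e N \<le> 1" for N by (auto simp: e_def)
 have "\<exists>n y A. disjoint_family_on A {..<n::nat} \<and> (\<Union>j<n. A j) = cball (0::'n rvec) (real N) \<and> (\<forall>j<n. A j \<in> sets borel) \<and>
   (\<forall>j<n. \<forall>x\<in>A j. dist x (y j) < e N)" for N
  using fine_partition[OF e(1)[of N], where R = "real N"] by metis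
 then obtain n y A where P: "\<And>N. disjoint_family_on (A N) {..<n N::nat}" "\<And>N. (\<Union>j<n N. A N j) = cball (0::'n rvec) (real N)"
  "\<And>N j. j < n N ==> A N j \<in> sets borel" "\<And>N j x. j < n N ==> x \<in> A N j ==> dist x (y N j) < e N"
  by metis
 define c where "c N j = (\<integral>x. indicat_real (A N j) x *\<^sub>R m x \<partial>lborel)" for N j
 have Ai: "integrable lborel (\<lambda>x. indicat_real (A N j) x *\<^sub>R m x)" if "j < n N" for N j
  using integrable_mult_indicator[OF _ mi, of "A N j"] P(3)[OF that] by simp
 have ind_sum: "(\<Sum>j<n N. indicat_real (A N j) x) \<le> 1" for N x
 proof -
  have "(\<Sum>j<n N. indicat_real (A N j) x) = indicat_real (\<Union>j<n N. A N j) x"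
   by (rule indicator_UN_disjoint[symmetric]) (use P(1) in \<open>auto\<close>)
  then show ?thesis by (simp add: indicator_def)
 qed
 have csum: "(\<Sum>j<n N. cmod (c N j)) \<le> (\<integral>x. cmod (m x) \<partial>lborel)" for N
 proof -
  have "(\<Sum>j<n N. cmod (c N j)) \<le> (\<Sum>j<n N. \<integral>x. norm (indicat_real (A N j) x *\<^sub>R m x) \<partial>lborel)"
   unfolding c_def by (intro sum_mono integral_norm_bound)
  also have "\<dots> = (\<integral>x. (\<Sum>j<n N. norm (indicat_real (A N j) x *\<^sub>R m x)) \<partial>lborel)"
   by (rule Bochner_Integration.integral_sum[symmetric]) (intro integrable_norm Ai, simp)
  also have "\<dots> \<le> (\<integral>x. cmod (m x) \<partial>lborel)"
  proof (rule integral_mono)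
   show "integrable lborel (\<lambda>x. \<Sum>j<n N. norm (indicat_real (A N j) x *\<^sub>R m x))"
    by (intro Bochner_Integration.integrable_sum integrable_norm Ai) auto
   show "integrable lborel (\<lambda>x. cmod (m x))" by (rule integrable_norm[OF mi])
   fix x
   have "(\<Sum>j<n N. norm (indicat_real (A N j) x *\<^sub>R m x)) = (\<Sum>j<n N. indicat_real (A N j) x) * cmod (m x)"
    by (simp add: sum_distrib_right)
   also have "\<dots> \<le> 1 * cmod (m x)" by (intro mult_right_mono ind_sum) auto
   finally show "(\<Sum>j<n N. norm (indicat_real (A N j) x *\<^sub>R m x)) \<le> cmod (m x)" by simp
  qed
  finally show ?thesis .
 qed
 show ?thesis
 proof (rule that[where n = n and c = c and y = y, OF csum], rule schwartz_limI)
  fix k "is" and \<epsilon> :: real assume \<epsilon>: "\<epsilon> > 0"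
  define v where "v = partial_derivs is b"
  have v: "v \<in> schwartz" unfolding v_def by (rule schwartz_partial_derivs[OF b])
  have D1: "partial_derivs is (\<lambda>x. \<Sum>j<n N. c N j * b (x - y N j)) x = (\<Sum>j<n N. c N j * v (x - y N j))" for N x
  proof -
   have "partial_derivs is (\<lambda>x. \<Sum>j<n N. c N j * b (x - y N j)) x = (\<Sum>j<n N. partial_derivs is (\<lambda>x. c N j * b (x - y N j)) x)"
    by (rule partial_derivs_sum) (auto intro: schwartz_cmult schwartz_translate[OF b])
   also have "\<dots> = (\<Sum>j<n N. c N j * v (x - y N j))"
    by (rule sum.cong) (simp_all add: partial_derivs_cmult[OF schwartz_translate[OF b]] partial_derivs_translate v_def)
   finally show ?thesis .
  qed
  have D2: "partial_derivs is (convol m b) x = convol m v x" for x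
   unfolding v_def partial_derivs_convol[OF mi b] ..
  obtain C1 where C1: "C1 > 0" "\<And>x z1 z2 A. A \<ge> 1 ==> (\<And>z. z \<in> closed_segment z1 z2 ==> 1 + norm (x :: 'n rvec) \<le> A * (1 + norm z)) ==>
   (1 + norm x) ^ k * cmod (v z1 - v z2) \<le> C1 * A ^ k * norm (z1 - z2)"
   using schwartz_lipschitz[OF v, of k] by metis
  obtain C2 where C2: "C2 > 0" "\<And>x. (1 + norm x) ^ k * cmod (v x) \<le> C2" using schwartz_decay[OF v, of k] by metis
  define C where "C = C1 * 2 ^ k + C2"
  have C: "C > 0" "C1 * 2 ^ k \<le> C" "C2 \<le> C" using C1(1) C2(1) by (auto simp: C_def add_pos_pos)
  define W where "W = (\<integral>x. cmod (of_real ((1 + norm x) ^ Suc k) * m x) \<partial>lborel)"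
  define err where "err N x z = (\<Sum>j<n N. indicat_real (A N j) z *\<^sub>R v (x - y N j)) - v (x - z)" for N x z
  have tri: "1 + norm x \<le> (1 + norm z) * (1 + norm (x - z))" for x z :: "'n rvec"
  proof -
   have "1 + norm x \<le> 1 + (norm (x - z) + norm z)" using norm_triangle_sub[of x z] by linarith
   also have "\<dots> \<le> (1 + norm z) * (1 + norm (x - z))" by (simp add: algebra_simps)
   finally show ?thesis .
  qed
  have errb: "(1 + norm x) ^ k * cmod (err N x z) \<le> C * e N * (1 + norm z) ^ Suc k" for N x z
  proof (cases "z \<in> cball 0 (real N)")
   case True
   then have "z \<in> (\<Union>j<n N. A N j)" unfolding P(2) .
   then obtain j where j: "j < n N" "z \<in> A N j" by blast
   have "(\<Sum>i<n N. indicat_real (A N i) z *\<^sub>R v (x - y N i)) = (\<Sum>i<n N. if i = j then v (x - y N j) else 0)"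
   proof (rule sum.cong)
    fix i assume "i \<in> {..<n N}"
    then show "indicat_real (A N i) z *\<^sub>R v (x - y N i) = (if i = j then v (x - y N j) else 0)"
     using j P(1)[of N] unfolding disjoint_family_on_def by (auto simp: indicator_def)
   qed simp
   also have "\<dots> = v (x - y N j)" using j by simp
   finally have er: "err N x z = v (x - y N j) - v (x - z)" by (simp add: err_def)
   have dz: "norm (z - y N j) < e N" using P(4)[OF j] by (simp add: dist_norm)
   have "(1 + norm x) ^ k * cmod (v (x - y N j) - v (x - z)) \<le> C1 * (2 * (1 + norm z)) ^ k * norm ((x - y N j) - (x - z))"
   proof (rule C1(2))
    show "1 \<le> 2 * (1 + norm z)" by simp
    fix u assume "u \<in> closed_segment (x - y N j) (x - z)"
    then obtain \<theta> where \<theta>: "0 \<le> \<theta>" "\<theta> \<le> 1" "u = (1 - \<theta>) *\<^sub>R (x - y N j) + \<theta> *\<^sub>R (x - z)" unfolding in_segment by blast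
    have u: "x - u = z - (1 - \<theta>) *\<^sub>R (z - y N j)" unfolding \<theta>(3) by (simp add: algebra_simps)
    have "(1 - \<theta>) * norm (z - y N j) \<le> 1 * 1" using dz e(2)[of N] \<theta> by (intro mult_mono) auto
    then have "norm (x - u) \<le> norm z + 1"
     unfolding u using norm_triangle_ineq4[of z "(1 - \<theta>) *\<^sub>R (z - y N j)"] \<theta> by simp
    moreover have "2 * (1 + norm z) = 1 + (norm z + 1) + norm z" by simp
    ultimately have "1 + norm (x - u) \<le> 2 * (1 + norm z)" using norm_ge_zero[of z] by linarith
    then have "(1 + norm (x - u)) * (1 + norm (x - (x - u))) \<le> (2 * (1 + norm z)) * (1 + norm u)"
     by (rule mult_mono) simp_all
    with tri[of x "x - u"] show "1 + norm x \<le> 2 * (1 + norm z) * (1 + norm u)" by linarith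
   qed
   also have "norm ((x - y N j) - (x - z)) = norm (z - y N j)" by simp
   also have "C1 * (2 * (1 + norm z)) ^ k * norm (z - y N j) \<le> C1 * (2 * (1 + norm z)) ^ k * e N"
    using dz C1(1) by (intro mult_left_mono) auto
   also have "\<dots> = (C1 * 2 ^ k) * e N * (1 + norm z) ^ k" by (simp only: power_mult_distrib mult_ac)
   also have "\<dots> \<le> C * e N * (1 + norm z) ^ Suc k"
    using C e[of N] by (intro mult_mono power_increasing) (auto simp: less_imp_le)
   finally show ?thesis unfolding er .
  next
   case False
   then have "indicat_real (A N i) z = 0" if "i < n N" for i using P(2)[of N] that by (auto simp: indicator_def)
   then have er: "cmod (err N x z) = cmod (v (x - z))" by (simp add: err_def)
   have "(1 + norm x) ^ k * cmod (v (x - z)) \<le> ((1 + norm z) * (1 + norm (x - z))) ^ k * cmod (v (x - z))"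
    by (intro mult_right_mono power_mono tri) auto
   also have "\<dots> = (1 + norm z) ^ k * ((1 + norm (x - z)) ^ k * cmod (v (x - z)))"
    by (simp add: power_mult_distrib mult_ac)
   also have "\<dots> \<le> (1 + norm z) ^ k * (C * 1)"
    using C2(2)[of "x - z"] C(3) by (intro mult_left_mono) auto
   also have "\<dots> \<le> (1 + norm z) ^ k * (C * (e N * (1 + norm z)))"
   proof (intro mult_left_mono)
    have "norm z > real N" using False by simp
    then show "1 \<le> e N * (1 + norm z)" by (simp add: e_def field_simps)
   qed (use C in auto)
   finally show ?thesis unfolding er by (simp add: mult_ac)
  qed
  have bound: "(1 + norm x) ^ k * cmod ((\<Sum>j<n N. c N j * v (x - y N j)) - convol m v x) \<le> C * e N * W" for N x
  proof -
   have vi: "integrable lborel (\<lambda>z. m z * v (x - z))" by (rule convol_integrable[OF mi v])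
   have i1: "integrable lborel (\<lambda>z. (indicat_real (A N j) z *\<^sub>R m z) * v (x - y N j))" if "j < n N" for j
    by (intro integrable_mult_left Ai that)
   have err_eq: "m z * err N x z = (\<Sum>j<n N. (indicat_real (A N j) z *\<^sub>R m z) * v (x - y N j)) - m z * v (x - z)" for z
    by (simp add: err_def right_diff_distrib sum_distrib_left scaleR_conv_of_real mult_ac)
   have ei: "integrable lborel (\<lambda>z. m z * err N x z)"
    unfolding err_eq by (intro Bochner_Integration.integrable_diff Bochner_Integration.integrable_sum i1 vi) auto
   have "(\<Sum>j<n N. c N j * v (x - y N j)) - convol m v x = (\<integral>z. m z * err N x z \<partial>lborel)"
   proof -
    have "(\<integral>z. m z * err N x z \<partial>lborel) = (\<integral>z. (\<Sum>j<n N. (indicat_real (A N j) z *\<^sub>R m z) * v (x - y N j)) \<partial>lborel) - (\<integral>z. m z * v (x - z) \<partial>lborel)"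
     unfolding err_eq by (rule Bochner_Integration.integral_diff) (auto intro!: Bochner_Integration.integrable_sum i1 vi simp del: mult_scaleR_left)
    also have "(\<integral>z. (\<Sum>j<n N. (indicat_real (A N j) z *\<^sub>R m z) * v (x - y N j)) \<partial>lborel) = (\<Sum>j<n N. (\<integral>z. (indicat_real (A N j) z *\<^sub>R m z) * v (x - y N j) \<partial>lborel))"
     by (rule Bochner_Integration.integral_sum) (simp only: i1 lessThan_iff)
    also have "\<dots> = (\<Sum>j<n N. c N j * v (x - y N j))"
     by (simp only: c_def integral_mult_left_zero)
    finally show ?thesis by (simp add: convol_def)
   qed
   then have "(1 + norm x) ^ k * cmod ((\<Sum>j<n N. c N j * v (x - y N j)) - convol m v x) = cmod (\<integral>z. of_real ((1 + norm x) ^ k) * (m z * err N x z) \<partial>lborel)"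
    by (simp add: norm_mult norm_power del: of_real_power)
   also have "\<dots> \<le> (\<integral>z. C * e N * cmod (of_real ((1 + norm z) ^ Suc k) * m z) \<partial>lborel)"
   proof (rule Bochner_Integration.integral_norm_bound_integral)
    show "integrable lborel (\<lambda>z. of_real ((1 + norm x) ^ k) * (m z * err N x z))"
     by (rule integrable_mult_right[OF ei])
    show "integrable lborel (\<lambda>z. C * e N * cmod (of_real ((1 + norm z) ^ Suc k) * m z))"
     by (intro integrable_mult_right integrable_norm rapid_integrable_weight m)
    fix z
    have "norm (of_real ((1 + norm x) ^ k) * (m z * err N x z)) = cmod (m z) * ((1 + norm x) ^ k * cmod (err N x z))"
     by (simp add: norm_mult norm_power mult_ac del: of_real_power)
    also have "\<dots> \<le> cmod (m z) * (C * e N * (1 + norm z) ^ Suc k)"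
     by (intro mult_left_mono errb) auto
    also have "\<dots> = C * e N * cmod (of_real ((1 + norm z) ^ Suc k) * m z)"
     by (simp add: norm_mult norm_power mult_ac del: of_real_power power_Suc)
    finally show "norm (of_real ((1 + norm x) ^ k) * (m z * err N x z)) \<le> C * e N * cmod (of_real ((1 + norm z) ^ Suc k) * m z)" .
   qed
   also have "\<dots> = C * e N * W" unfolding W_def by (rule integral_mult_right_zero)
   finally show ?thesis .
  qed
  have "e \<longlonglongrightarrow> 0"
  proof -
   have "(\<lambda>N. 1 / real (Suc N)) \<longlonglongrightarrow> 0" by (rule LIMSEQ_Suc[OF lim_1_over_n])
   then show ?thesis by (simp add: e_def[abs_def])
  qed
  then have "(\<lambda>N. C * e N * W) \<longlonglongrightarrow> C * 0 * W" by (intro tendsto_mult tendsto_const)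
  then have "\<forall>\<^sub>F N in sequentially. C * e N * W < \<epsilon>"
   using \<epsilon> by (intro order_tendstoD) auto
  then show "\<forall>\<^sub>F N in sequentially. \<forall>x. (1 + norm x) ^ k *
   cmod (partial_derivs is (\<lambda>x. \<Sum>j<n N. c N j * b (x - y N j)) x - partial_derivs is (convol m b) x) < \<epsilon>"
   unfolding D1 D2 by (rule eventually_mono) (use bound in \<open>auto intro: le_less_trans\<close>)
 qed
qed

section \<open>Test functions and coefficient functions\<close>

lemma powr_convex_nonneg: assumes p: "p \<ge> 1" shows "convex_on {0..} (\<lambda>x::real. x powr p)"
proof (rule convex_onI)
 fix t x y :: real assume t: "0 < t" "t < 1" and xy: "x \<in> {0..}" "y \<in> {0..}"
 have scale: "(s * z) powr p \<le> s * z powr p" if "0 < s" "s < 1" "z \<ge> 0" for s z :: real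
 proof -
  have "s powr p \<le> s powr 1" using that p by (intro powr_mono') auto
  then show ?thesis using that by (simp add: powr_mult mult_right_mono)
 qed
 show "((1 - t) *\<^sub>R x + t *\<^sub>R y) powr p \<le> (1 - t) * x powr p + t * y powr p"
 proof (cases "x = 0 \<or> y = 0")
  case True
  then show ?thesis using scale[of t y] scale[of "1 - t" x] t xy by auto
 next
  case False
  then show ?thesis using convex_onD[OF powr_convex[OF p], of t x y] t xy by auto
 qed
qed (rule convex_real_interval)

text \<open>
  Jensen for the weights \<open>cmod (c j)\<close>.
\<close>

lemma powr_sum_le:
 fixes c z :: "nat => complex"
 assumes p: "p \<ge> 1"
 shows "cmod (\<Sum>j<n. c j * z j) powr p \<le> (\<Sum>j<n. cmod (c j)) powr (p - 1) * (\<Sum>j<n. cmod (c j) * cmod (z j) powr p)"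
proof -
 define S where "S = (\<Sum>j<n. cmod (c j))"
 have S0: "S \<ge> 0" unfolding S_def by (intro sum_nonneg) auto
 show ?thesis
 proof (cases "S = 0")
  case True
  then have "c j = 0" if "j < n" for j
   using that unfolding S_def by (subst (asm) sum_nonneg_eq_0_iff) auto
  then show ?thesis using p by simp
 next
  case False
  then have S: "S > 0" using S0 by simp
  have "cmod (\<Sum>j<n. c j * z j) \<le> (\<Sum>j<n. cmod (c j) * cmod (z j))"
   by (rule order.trans[OF norm_sum]) (simp add: norm_mult)
  also have "\<dots> = S * (\<Sum>j<n. (cmod (c j) / S) *\<^sub>R cmod (z j))"
   using S by (simp add: sum_distrib_left)
  finally have "cmod (\<Sum>j<n. c j * z j) powr p \<le> (S * (\<Sum>j<n. (cmod (c j) / S) *\<^sub>R cmod (z j))) powr p"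
   using p by (intro powr_mono2) auto
  also have "\<dots> = S powr p * (\<Sum>j<n. (cmod (c j) / S) *\<^sub>R cmod (z j)) powr p"
   by (rule powr_mult)
  also have "\<dots> \<le> S powr p * (\<Sum>j<n. (cmod (c j) / S) * cmod (z j) powr p)"
  proof (intro mult_left_mono convex_on_sum[OF _ _ powr_convex_nonneg[OF p]])
   show "{..<n} \<noteq> {}" using S unfolding S_def by auto
   show "(\<Sum>j<n. cmod (c j) / S) = 1" using S by (simp add: sum_divide_distrib[symmetric] S_def)
  qed (use S in auto)
  also have "\<dots> = S powr p / S * (\<Sum>j<n. cmod (c j) * cmod (z j) powr p)"
   by (simp add: sum_distrib_left)
  also have "S powr p / S = S powr (p - 1)" using S by (simp add: powr_diff)
  finally show ?thesis unfolding S_def .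
 qed
qed

lemma S_cone_schwartz: "f \<in> S_cone ==> f \<in> schwartz" by (simp add: S_cone_def)

lemma fourier_add:
 assumes "f \<in> schwartz" "g \<in> schwartz"
 shows "fourier (\<lambda>x. f x + g x) w = fourier f w + fourier g w"
proof -
 have i: "integrable lborel (\<lambda>x. f x * exp (- \<i> * of_real (lorentz x w)))" if "f \<in> schwartz" for f
  by (rule Bochner_Integration.integrable_bound[OF schwartz_integrable[OF that]])
    (use schwartz_measurable[OF that] in \<open>simp_all add: norm_mult cmod_exp_minus_i del: mult_minus_left\<close>)
 show ?thesis
  unfolding fourier_eq distrib_right Bochner_Integration.integral_add[OF i[OF assms(1)] i[OF assms(2)]] by (rule distrib_left)
qed

lemma fourier_cmult: "fourier (\<lambda>x. c * f x) w = c * fourier f w"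
 unfolding fourier_eq mult.assoc integral_mult_right_zero by (rule mult.left_commute)

lemma S_coneI:
 assumes "f \<in> schwartz" "{w. fourier f w \<noteq> 0} \<subseteq> closure light_cone" shows "f \<in> S_cone"
 using assms by (auto simp: S_cone_def supp_def intro: closure_minimal[THEN subsetD])

lemma S_coneD: "f \<in> S_cone ==> fourier f w \<noteq> 0 ==> w \<in> closure light_cone"
 using closure_subset[of "{w. fourier f w \<noteq> 0}"] by (auto simp: S_cone_def supp_def)

lemma S_cone_add: assumes "f \<in> S_cone" "g \<in> S_cone" shows "(\<lambda>x. f x + g x) \<in> S_cone"
proof (rule S_coneI)
 show "(\<lambda>x. f x + g x) \<in> schwartz" using assms by (intro schwartz_add S_cone_schwartz)
 show "{w. fourier (\<lambda>x. f x + g x) w \<noteq> 0} \<subseteq> closure light_cone"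
  using S_coneD[OF assms(1)] S_coneD[OF assms(2)] assms
  by (auto simp: fourier_add S_cone_schwartz) (metis add_0)
qed

lemma S_cone_cmult: assumes "f \<in> S_cone" shows "(\<lambda>x. c * f x) \<in> S_cone"
 by (rule S_coneI) (use assms S_coneD[OF assms] in \<open>auto intro: schwartz_cmult S_cone_schwartz simp: fourier_cmult\<close>)

lemma S_cone_zero: "(\<lambda>x. 0) \<in> S_cone"
 by (rule S_coneI) (auto simp: schwartz_zero fourier_eq)

lemma S_cone_sum: "(\<And>j. j \<in> J ==> f j \<in> S_cone) ==> (\<lambda>x. \<Sum>j\<in>J. f j x) \<in> S_cone"
 by (induction J rule: infinite_finite_induct) (auto intro: S_cone_zero S_cone_add)

lemma fourier_translate:
 fixes f :: "'n::{finite,linorder} rvec => complex"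
 assumes fm: "f \<in> borel_measurable borel"
 shows "fourier (\<lambda>y. f (y - x)) w = exp (- \<i> * of_real (lorentz x w)) * fourier f w"
proof -
 define G where "G y = f (y - x) * exp (- \<i> * of_real (lorentz y w))" for y
 have "(\<lambda>y. f (y - x)) \<in> borel_measurable borel"
  by (rule measurable_compose[OF _ fm]) simp
 then have Gm: "G \<in> borel_measurable borel"
  unfolding G_def by (intro borel_measurable_times) simp_all
 have G: "G (x + y) = exp (- \<i> * of_real (lorentz x w)) * (f y * exp (- \<i> * of_real (lorentz y w)))" for y
 proof -
  have "exp (- \<i> * of_real (lorentz (x + y) w)) = exp (- \<i> * of_real (lorentz x w)) * exp (- \<i> * of_real (lorentz y w))"
   by (simp only: lorentz_add_left of_real_add distrib_left exp_add)
  then show ?thesis by (simp only: G_def mult.left_commute add_diff_cancel_left')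
 qed
 have "fourier (\<lambda>y. f (y - x)) w = of_real (fcst TYPE('n)) * (\<integral>y. G y \<partial>lborel)"
  by (simp only: fourier_eq G_def)
 also have "(\<integral>y. G y \<partial>lborel) = (\<integral>y. G (x + y) \<partial>lborel)"
  by (rule integral_lborel_translate[OF Gm, symmetric])
 also have "\<dots> = exp (- \<i> * of_real (lorentz x w)) * (\<integral>y. f y * exp (- \<i> * of_real (lorentz y w)) \<partial>lborel)"
  by (simp only: G integral_mult_right_zero)
 finally show ?thesis by (simp only: fourier_eq mult.left_commute)
qed

lemma S_cone_translate: assumes "f \<in> S_cone" shows "(\<lambda>y. f (y - x)) \<in> S_cone"
proof (rule S_coneI)
 show "(\<lambda>y. f (y - x)) \<in> schwartz" using assms by (intro schwartz_translate S_cone_schwartz)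
 show "{w. fourier (\<lambda>y. f (y - x)) w \<noteq> 0} \<subseteq> closure light_cone"
  using S_coneD[OF assms] by (auto simp: fourier_translate[OF schwartz_measurable[OF S_cone_schwartz[OF assms]]])
qed

lemma S_cone_dual_cmult: "f \<in> S_cone_dual ==> g \<in> S_cone ==> f (\<lambda>x. a * g x) = cnj a * f g"
 unfolding S_cone_dual_def by blast

lemma S_cone_dual_add: "f \<in> S_cone_dual ==> g \<in> S_cone ==> h \<in> S_cone ==> f (\<lambda>x. g x + h x) = f g + f h"
 unfolding S_cone_dual_def by blast

lemma S_cone_dual_sum:
 assumes "f \<in> S_cone_dual" "finite J" "\<And>j. j \<in> J ==> g j \<in> S_cone"
 shows "f (\<lambda>x. \<Sum>j\<in>J. g j x) = (\<Sum>j\<in>J. f (g j))"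
 using assms(2,3)
proof (induction J)
 case empty
 show ?case using S_cone_dual_cmult[OF assms(1) S_cone_zero, of 0] by simp
next
 case (insert j J)
 then show ?case by (simp add: S_cone_dual_add[OF assms(1)] S_cone_sum)
qed

text \<open>
  The function \<open>x \<mapsto> f(T\<^sub>x a)\<close> of coefficients along translations.
  Wavelet coefficients at a fixed dilation and convolutions with Littlewood--Paley pieces are both
  of this form, which makes them comparable.
\<close>

definition coeff_fun :: "(('n::finite rvec => complex) => complex) => ('n rvec => complex) => 'n rvec => complex" where
 "coeff_fun f a x = f (\<lambda>y. a (y - x))"

lemma continuous_coeff_fun:
 assumes f: "f \<in> S_cone_dual" and a: "a \<in> S_cone"
 shows "continuous_on UNIV (coeff_fun f a)"
proof (rule continuous_on_sequentiallyI)
 fix u x assume u: "u \<longlonglongrightarrow> (x :: 'a rvec)"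
 have "schwartz_lim (\<lambda>m y. a (mat 1 *v y + (- u m))) (\<lambda>y. a (mat 1 *v y + (- x)))"
  by (rule schwartz_lim_affine[OF S_cone_schwartz[OF a]]) (auto intro!: invertible_mat_one tendsto_minus u)
 then have "schwartz_lim (\<lambda>m y. a (y - u m)) (\<lambda>y. a (y - x))" by simp
 from S_cone_dual_tendsto[OF f _ _ this] show "(\<lambda>n. coeff_fun f a (u n)) \<longlonglongrightarrow> coeff_fun f a x"
  unfolding coeff_fun_def using S_cone_translate[OF a] by blast
qed

lemma measurable_coeff_fun:
 assumes "f \<in> S_cone_dual" and "a \<in> S_cone" shows "coeff_fun f a \<in> borel_measurable borel"
 by (rule borel_measurable_continuous_onI[OF continuous_coeff_fun[OF assms]])

definition pint :: "real => ('n::finite rvec => complex) => ennreal" where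
 "pint p F = (\<integral>\<^sup>+x. ennreal (cmod (F x) powr p) \<partial>lborel)"

section \<open>The group action in light-cone coordinates\<close>

locale forward_cone =
 fixes dummy :: "'n::{finite,linorder} itself"
 assumes card2: "CARD('n) \<ge> 2"
begin

lemma idx_neq: "(idx_first :: 'n) \<noteq> idx_last"
proof
 assume eq: "(idx_first :: 'n) = idx_last"
 have "x = idx_last" for x :: 'n
 proof (rule antisym)
  show "x \<le> idx_last" by (simp add: idx_last_def)
  show "idx_last \<le> x" unfolding eq[symmetric] by (simp add: idx_first_def)
 qed
 then have "(UNIV :: 'n set) = {idx_last}" by auto
 then have "CARD('n) = 1" by (metis card.empty card_insert_disjoint empty_iff finite.emptyI One_nat_def)
 with card2 show False by simp
qed

lemma idx_mid_simps[simp]: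
 "(idx_first :: 'n) \<notin> idx_mid" "(idx_last :: 'n) \<notin> idx_mid"
 "(idx_first :: 'n) \<noteq> idx_last" "(idx_last :: 'n) \<noteq> idx_first"
 using idx_neq by (auto simp: idx_mid_def)

lemma idx_cases: fixes i :: 'n
 obtains "i = idx_first" | "i = idx_last" | "i \<in> idx_mid"
 by (auto simp: idx_mid_def)

lemma idx_mid_neq: "(i :: 'n) \<in> idx_mid ==> i \<noteq> idx_first \<and> i \<noteq> idx_last"
 by (auto simp: idx_mid_def)

lemma sum_idx: "(\<Sum>i\<in>(UNIV::'n set). f i) = f idx_first + f idx_last + (\<Sum>i\<in>idx_mid. f i)"
 for f :: "'n => 'b::comm_monoid_add"
proof -
 have "(UNIV::'n set) = insert idx_first (insert idx_last idx_mid)" by (auto simp: idx_mid_def)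
 then have "(\<Sum>i\<in>(UNIV::'n set). f i) = (\<Sum>i\<in>insert idx_first (insert idx_last idx_mid). f i)" by simp
 also have "\<dots> = f idx_first + (f idx_last + (\<Sum>i\<in>idx_mid. f i))"
  by (subst sum.insert; simp)+
 finally show ?thesis by (simp add: add.assoc)
qed

text \<open>
  Light-cone coordinates: \<open>a\<^sub>t\<close> is diagonal and \<open>n\<^sub>c\<close> is
  triangular in them, which makes products, inverses and the Lorentz form computable.
\<close>

definition lc_p :: "'n rvec => real" where "lc_p x = x $ idx_last - x $ idx_first"
definition lc_r :: "'n rvec => real" where "lc_r x = x $ idx_last + x $ idx_first"

text \<open>
  Vectors are determined by their light-cone and middle coordinates; equality of matrices is
  checked on these throughout.
\<close>

lemma lc_eqI:
 assumes "lc_p x = lc_p y" "lc_r x = lc_r y" "\<And>i. i \<in> idx_mid ==> x $ i = y $ i"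
 shows "x = y"
proof (subst vec_eq_iff, intro allI)
 fix i show "x $ i = y $ i"
  by (cases i rule: idx_cases) (use assms in \<open>auto simp: lc_p_def lc_r_def\<close>)
qed

lemma lorentz_lc: "lorentz x x = lc_p x * lc_r x - (\<Sum>i\<in>idx_mid. (x $ i)\<^sup>2)" for x :: "'n rvec"
proof -
 have "UNIV - {idx_last} = insert (idx_first::'n) idx_mid" by (auto simp: idx_mid_def)
 then have "(\<Sum>i\<in>UNIV - {idx_last}. x $ i * x $ i) = x $ idx_first * x $ idx_first + (\<Sum>i\<in>idx_mid. x $ i * x $ i)"
  by simp
 then show ?thesis by (simp add: lorentz_def lc_p_def lc_r_def algebra_simps power2_eq_square)
qed

lemma a_mat_mult:
 fixes x :: "'n rvec"
 shows "i \<in> idx_mid ==> (a_mat t *v x) $ i = x $ i"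
  "lc_p (a_mat t *v x) = exp (- t) * lc_p x"
  "lc_r (a_mat t *v x) = exp t * lc_r x"
proof -
 show "(a_mat t *v x) $ i = x $ i" if "i \<in> idx_mid"
 proof -
  have "(a_mat t *v x) $ i = (\<Sum>j\<in>UNIV. if j = i then x $ j else 0)"
   unfolding matrix_vector_mult_def vec_lambda_beta a_mat_def
   by (rule sum.cong) (use that in auto)
  then show ?thesis by simp
 qed
 have z: "(\<Sum>j\<in>idx_mid. a_mat t $ i $ j * x $ j) = 0" if "i = idx_first \<or> i = idx_last" for i
  using that idx_mid_neq by (intro sum.neutral ballI) (auto simp: a_mat_def)
 have 1: "(a_mat t *v x) $ idx_first = cosh t * x $ idx_first + sinh t * x $ idx_last"
  by (simp add: matrix_vector_mult_def sum_idx z) (simp add: a_mat_def)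
 have 2: "(a_mat t *v x) $ idx_last = sinh t * x $ idx_first + cosh t * x $ idx_last"
  by (simp add: matrix_vector_mult_def sum_idx z) (simp add: a_mat_def)
 have e: "exp (- t) = cosh t - sinh t" "exp t = cosh t + sinh t"
  by (simp_all add: cosh_def sinh_def field_simps)
 show "lc_p (a_mat t *v x) = exp (- t) * lc_p x"
  unfolding e lc_p_def 1 2 by (simp add: algebra_simps)
 show "lc_r (a_mat t *v x) = exp t * lc_r x"
  unfolding e lc_r_def 1 2 by (simp add: algebra_simps)
qed

lemma n_mat_mult:
 fixes x :: "'n rvec"
 shows "i \<in> idx_mid ==> (n_mat c *v x) $ i = x $ i - c i * lc_p x"
  "lc_p (n_mat c *v x) = lc_p x"
  "lc_r (n_mat c *v x) = lc_r x + (\<Sum>k\<in>idx_mid. (c k)\<^sup>2) * lc_p x - 2 * (\<Sum>k\<in>idx_mid. c k * x $ k)"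
proof -
 define r where "r = (\<Sum>k\<in>idx_mid. (c k)\<^sup>2)"
 show "(n_mat c *v x) $ i = x $ i - c i * lc_p x" if "i \<in> idx_mid"
 proof -
  have "(\<Sum>j\<in>idx_mid. n_mat c $ i $ j * x $ j) = (\<Sum>j\<in>idx_mid. if j = i then x $ j else 0)"
   using that idx_mid_neq by (intro sum.cong) (auto simp: n_mat_def Let_def dest: idx_mid_neq)
  also have "\<dots> = x $ i" using that by simp
  finally show ?thesis
   using that idx_mid_neq[OF that] by (simp add: matrix_vector_mult_def sum_idx) (simp add: n_mat_def Let_def lc_p_def algebra_simps)
 qed
 have s: "(\<Sum>j\<in>idx_mid. n_mat c $ i $ j * x $ j) = - (\<Sum>j\<in>idx_mid. c j * x $ j)" if "i = idx_first \<or> i = idx_last" for i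
  unfolding sum_negf[symmetric] using that idx_mid_neq by (intro sum.cong) (auto simp: n_mat_def Let_def)
 have 1: "(n_mat c *v x) $ idx_first = (1 - r / 2) * x $ idx_first + r / 2 * x $ idx_last - (\<Sum>j\<in>idx_mid. c j * x $ j)"
  by (simp add: matrix_vector_mult_def sum_idx s) (simp add: n_mat_def Let_def r_def)
 have 2: "(n_mat c *v x) $ idx_last = - (r / 2) * x $ idx_first + (1 + r / 2) * x $ idx_last - (\<Sum>j\<in>idx_mid. c j * x $ j)"
  by (simp add: matrix_vector_mult_def sum_idx s) (simp add: n_mat_def Let_def r_def)
 show "lc_p (n_mat c *v x) = lc_p x"
  unfolding lc_p_def 1 2 by (simp add: field_simps)
 show "lc_r (n_mat c *v x) = lc_r x + (\<Sum>k\<in>idx_mid. (c k)\<^sup>2) * lc_p x - 2 * (\<Sum>k\<in>idx_mid. c k * x $ k)"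
  unfolding lc_r_def lc_p_def 1 2 r_def[symmetric] by (simp add: field_simps)
qed

fun hm :: "'n H_coords => 'n rmat" where "hm (\<gamma>, t, c) = h_mat \<gamma> t c"

lemma h_mat_mult:
 fixes x :: "'n rvec"
 shows "i \<in> idx_mid ==> (h_mat \<gamma> t c *v x) $ i = \<gamma> * (x $ i - c i * lc_p x)"
  "lc_p (h_mat \<gamma> t c *v x) = \<gamma> * exp (- t) * lc_p x"
  "lc_r (h_mat \<gamma> t c *v x) = \<gamma> * exp t * (lc_r x + (\<Sum>k\<in>idx_mid. (c k)\<^sup>2) * lc_p x - 2 * (\<Sum>k\<in>idx_mid. c k * x $ k))"
proof -
 have h: "h_mat \<gamma> t c *v x = \<gamma> *\<^sub>R (a_mat t *v (n_mat c *v x))"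
  by (simp add: h_mat_def matrix_vector_mul_assoc scaleR_matrix_vector_assoc)
 show "(h_mat \<gamma> t c *v x) $ i = \<gamma> * (x $ i - c i * lc_p x)" if "i \<in> idx_mid"
  unfolding h using that by (simp add: a_mat_mult n_mat_mult)
 have s: "lc_p (\<gamma> *\<^sub>R y) = \<gamma> * lc_p y" "lc_r (\<gamma> *\<^sub>R y) = \<gamma> * lc_r y" for y
  by (simp_all add: lc_p_def lc_r_def algebra_simps)
 show "lc_p (h_mat \<gamma> t c *v x) = \<gamma> * exp (- t) * lc_p x"
  unfolding h s a_mat_mult n_mat_mult by simp
 show "lc_r (h_mat \<gamma> t c *v x) = \<gamma> * exp t * (lc_r x + (\<Sum>k\<in>idx_mid. (c k)\<^sup>2) * lc_p x - 2 * (\<Sum>k\<in>idx_mid. c k * x $ k))"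
  unfolding h s a_mat_mult n_mat_mult by simp
qed

text \<open>
  Multiplication and inversion of the group in the coordinates \<open>(\<gamma>, t, c)\<close>.
  Working with coordinates and not with matrices keeps the measure on the group explicit.
\<close>

fun hprod :: "'n H_coords => 'n H_coords => 'n H_coords" where
 "hprod (\<gamma>, t, c) (\<gamma>', t', c') = (\<gamma> * \<gamma>', t + t', \<lambda>i. c' i + exp (- t') * c i)"

fun hinv :: "'n H_coords => 'n H_coords" where
 "hinv (\<gamma>, t, c) = (1 / \<gamma>, - t, \<lambda>i. - exp t * c i)"

lemma hm_hprod: "hm (hprod a b) = hm a ** hm b"
proof (cases a; cases b)
 fix \<gamma> t c \<gamma>' t' c' assume ab: "a = (\<gamma>, t, c)" "b = (\<gamma>', t', c')"
 have "hm (hprod a b) *v x = hm a *v (hm b *v x)" for x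
 proof (rule lc_eqI)
  have S: "(\<Sum>k\<in>idx_mid. (c' k + exp (- t') * c k)\<^sup>2) = (\<Sum>k\<in>idx_mid. (c' k)\<^sup>2) + 2 * exp (- t') * (\<Sum>k\<in>idx_mid. c' k * c k) + (exp (- t'))\<^sup>2 * (\<Sum>k\<in>idx_mid. (c k)\<^sup>2)"
   by (simp add: power2_sum sum.distrib sum_distrib_left power_mult_distrib algebra_simps)
  have S2: "(\<Sum>k\<in>idx_mid. (c' k + exp (- t') * c k) * x $ k) = (\<Sum>k\<in>idx_mid. c' k * x $ k) + exp (- t') * (\<Sum>k\<in>idx_mid. c k * x $ k)"
   by (simp add: sum.distrib sum_distrib_left algebra_simps)
  have S3: "(\<Sum>k\<in>idx_mid. c k * (hm b *v x) $ k) = \<gamma>' * ((\<Sum>k\<in>idx_mid. c k * x $ k) - (\<Sum>k\<in>idx_mid. c' k * c k) * lc_p x)"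
  proof -
   have "(\<Sum>k\<in>idx_mid. c k * (hm b *v x) $ k) = (\<Sum>k\<in>idx_mid. \<gamma>' * (c k * x $ k - c' k * c k * lc_p x))"
    by (rule sum.cong) (simp_all add: ab h_mat_mult algebra_simps)
   also have "\<dots> = \<gamma>' * ((\<Sum>k\<in>idx_mid. c k * x $ k) - (\<Sum>k\<in>idx_mid. c' k * c k) * lc_p x)"
    by (simp add: sum_distrib_left[symmetric] sum_subtractf sum_distrib_right)
   finally show ?thesis .
  qed
  have E: "exp t' * exp (- t') = 1" by (simp add: exp_minus)
  show "lc_p (hm (hprod a b) *v x) = lc_p (hm a *v (hm b *v x))"
   by (simp add: ab h_mat_mult exp_add exp_diff exp_minus field_simps)
  have "lc_r (hm a *v (hm b *v x)) = \<gamma> * exp t * (\<gamma>' * exp t' * (lc_r x + (\<Sum>k\<in>idx_mid. (c' k)\<^sup>2) * lc_p x - 2 * (\<Sum>k\<in>idx_mid. c' k * x $ k))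
   + (\<Sum>k\<in>idx_mid. (c k)\<^sup>2) * (\<gamma>' * exp (- t') * lc_p x) - 2 * (\<gamma>' * ((\<Sum>k\<in>idx_mid. c k * x $ k) - (\<Sum>k\<in>idx_mid. c' k * c k) * lc_p x)))"
   unfolding S3[symmetric] by (simp add: ab h_mat_mult)
  also have "\<dots> = \<gamma> * \<gamma>' * (exp t * exp t') * (lc_r x + ((\<Sum>k\<in>idx_mid. (c' k)\<^sup>2) + 2 * exp (- t') * (\<Sum>k\<in>idx_mid. c' k * c k) + (exp (- t'))\<^sup>2 * (\<Sum>k\<in>idx_mid. (c k)\<^sup>2)) * lc_p x
    - 2 * ((\<Sum>k\<in>idx_mid. c' k * x $ k) + exp (- t') * (\<Sum>k\<in>idx_mid. c k * x $ k)))"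
   using E by algebra
  also have "\<dots> = lc_r (hm (hprod a b) *v x)"
   unfolding S[symmetric] S2[symmetric] by (simp add: ab h_mat_mult exp_add)
  finally show "lc_r (hm (hprod a b) *v x) = lc_r (hm a *v (hm b *v x))" ..
  show "(hm (hprod a b) *v x) $ i = (hm a *v (hm b *v x)) $ i" if "i \<in> idx_mid" for i
   using that by (simp add: ab h_mat_mult algebra_simps)
 qed
 then show ?thesis by (simp add: matrix_eq matrix_vector_mul_assoc[symmetric])
qed

lemma hm_one: "hm (1, 0, \<lambda>_. 0) = mat 1"
proof -
 have "hm (1, 0, \<lambda>_. 0) *v x = mat 1 *v x" for x
  by (rule lc_eqI) (auto simp: h_mat_mult)
 then show ?thesis by (simp add: matrix_eq)
qed

lemma hm_cong: assumes "\<And>i. i \<in> idx_mid ==> c i = c' i" shows "hm (\<gamma>, t, c) = hm (\<gamma>, t, c')"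
proof -
 have "hm (\<gamma>, t, c) *v x = hm (\<gamma>, t, c') *v x" for x
  by (rule lc_eqI) (use assms in \<open>auto simp: h_mat_mult intro!: sum.cong\<close>)
 then show ?thesis by (simp add: matrix_eq)
qed

lemma hm_hinv: assumes "fst a > 0" shows "hm a ** hm (hinv a) = mat 1" "hm (hinv a) ** hm a = mat 1"
proof -
 obtain \<gamma> t c where a: "a = (\<gamma>, t, c)" by (cases a)
 have "hprod a (hinv a) = (1, 0, \<lambda>_. 0)" "hprod (hinv a) a = (1, 0, \<lambda>_. 0)"
  using assms by (auto simp: a fun_eq_iff exp_minus)
 then show "hm a ** hm (hinv a) = mat 1" "hm (hinv a) ** hm a = mat 1"
  by (simp_all add: hm_hprod[symmetric] hm_one del: hm.simps)
qed

lemma hm_invertible: "fst a > 0 ==> invertible (hm a)"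
 unfolding invertible_def using hm_hinv by blast

lemma matrix_inv_hm: assumes "fst a > 0" shows "matrix_inv (hm a) = hm (hinv a)"
proof -
 have "matrix_inv (hm a) = matrix_inv (hm a) ** (hm a ** hm (hinv a))" by (simp add: hm_hinv[OF assms])
 also have "\<dots> = hm (hinv a)" by (simp add: matrix_mul_assoc matrix_inv_works[OF hm_invertible[OF assms]])
 finally show ?thesis .
qed

lemma fst_hinv: "fst a > 0 ==> fst (hinv a) > 0" by (cases a) auto
lemma fst_hprod: "fst a > 0 ==> fst b > 0 ==> fst (hprod a b) > 0" by (cases a; cases b) auto

lemma lorentz_hm: "lorentz (hm a *v x) (hm a *v x) = (fst a)\<^sup>2 * lorentz x x"
proof (cases a)
 fix \<gamma> t c assume a: "a = (\<gamma>, t, c)"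
 define A where "A = (\<Sum>k\<in>idx_mid. (x $ k)\<^sup>2)"
 define B where "B = (\<Sum>k\<in>idx_mid. c k * x $ k)"
 define D where "D = (\<Sum>k\<in>idx_mid. (c k)\<^sup>2)"
 have S: "(\<Sum>i\<in>idx_mid. ((hm a *v x) $ i)\<^sup>2) = \<gamma>\<^sup>2 * (A - 2 * lc_p x * B + (lc_p x)\<^sup>2 * D)"
 proof -
  have "(\<Sum>i\<in>idx_mid. ((hm a *v x) $ i)\<^sup>2) = (\<Sum>i\<in>idx_mid. \<gamma>\<^sup>2 * ((x $ i)\<^sup>2 - 2 * lc_p x * (c i * x $ i) + (lc_p x)\<^sup>2 * (c i)\<^sup>2))"
   by (rule sum.cong) (simp_all add: a h_mat_mult power2_eq_square algebra_simps)
  also have "\<dots> = \<gamma>\<^sup>2 * (A - 2 * lc_p x * B + (lc_p x)\<^sup>2 * D)"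
   unfolding A_def B_def D_def by (simp add: sum_distrib_left[symmetric] sum_subtractf sum.distrib)
  finally show ?thesis .
 qed
 have E: "exp t * exp (- t) = 1" by (simp add: exp_minus)
 have "lorentz (hm a *v x) (hm a *v x) = \<gamma> * exp (- t) * lc_p x * (\<gamma> * exp t * (lc_r x + D * lc_p x - 2 * B)) - \<gamma>\<^sup>2 * (A - 2 * lc_p x * B + (lc_p x)\<^sup>2 * D)"
  unfolding lorentz_lc[of "hm a *v x"] S by (simp add: a h_mat_mult B_def D_def)
 also have "\<dots> = \<gamma>\<^sup>2 * (lc_p x * lc_r x - A)" using E by algebra
 finally show ?thesis by (simp add: a lorentz_lc A_def)
qed

lemma lorentz_hm_polar: "lorentz (hm a *v x) (hm a *v y) = (fst a)\<^sup>2 * lorentz x y"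
proof -
 have pol: "2 * lorentz x y = lorentz (x + y) (x + y) - lorentz x x - lorentz y y" for x y :: "'n rvec"
  by (simp add: lorentz_add_left lorentz_add_right lorentz_commute)
 have "2 * lorentz (hm a *v x) (hm a *v y) = (fst a)\<^sup>2 * (2 * lorentz x y)"
  unfolding pol matrix_vector_right_distrib[symmetric] lorentz_hm by (simp add: algebra_simps)
 then show ?thesis by simp
qed

lemma light_cone_iff: "x \<in> light_cone \<longleftrightarrow> lorentz x x > 0 \<and> lc_p x > 0" for x :: "'n rvec"
proof -
 have m: "(\<Sum>i\<in>idx_mid. (x $ i)\<^sup>2) \<ge> 0" by (simp add: sum_nonneg)
 have *: "lc_p x > 0 \<longleftrightarrow> x $ idx_last > 0" if "lorentz x x > 0"
 proof -
  have pr: "lc_p x * lc_r x > 0" using that m unfolding lorentz_lc by linarith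
  have "x $ idx_last = (lc_p x + lc_r x) / 2" by (simp add: lc_p_def lc_r_def)
  with pr show ?thesis by (auto simp: zero_less_mult_iff)
 qed
 then show ?thesis by (auto simp: light_cone_def)
qed

lemma hm_light_cone: assumes "fst a > 0" "x \<in> light_cone" shows "hm a *v x \<in> light_cone"
proof -
 have "lc_p (hm a *v x) > 0" using assms by (cases a) (auto simp: h_mat_mult light_cone_iff)
 with assms show ?thesis by (simp add: light_cone_iff lorentz_hm)
qed

lemma hm_light_cone_iff: assumes "fst a > 0" shows "hm a *v x \<in> light_cone \<longleftrightarrow> x \<in> light_cone"
proof
 assume "hm a *v x \<in> light_cone"
 from hm_light_cone[OF fst_hinv[OF assms] this] show "x \<in> light_cone"
  by (simp add: matrix_vector_mul_assoc hm_hinv[OF assms])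
qed (rule hm_light_cone[OF assms])

lemma base_pt_lc: "lc_p base_pt = 1" "lc_r base_pt = 1" "i \<in> idx_mid ==> (base_pt :: 'n rvec) $ i = 0" "lorentz base_pt (base_pt :: 'n rvec) = 1"
proof -
 show 1: "lc_p base_pt = 1" "lc_r base_pt = 1" by (simp_all add: lc_p_def lc_r_def base_pt_def axis_def)
 show 2: "(base_pt :: 'n rvec) $ i = 0" if "i \<in> idx_mid" for i using idx_mid_neq[OF that] by (simp add: base_pt_def axis_def)
 show "lorentz base_pt (base_pt :: 'n rvec) = 1" unfolding lorentz_lc by (simp add: 1 2)
qed

lemma base_pt_light_cone: "(base_pt :: 'n rvec) \<in> light_cone" by (simp add: light_cone_iff base_pt_lc)

text \<open>
  The coordinates are read off from the target: \<open>\<gamma>\<close> from the Lorentz square,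
  \<open>t\<close> from the first light-cone coordinate, \<open>c\<close> from the middle
  coordinates.
\<close>

lemma hm_transitive: assumes "y \<in> light_cone" obtains a where "fst a > 0" "hm a *v base_pt = y"
proof -
 define \<gamma> where "\<gamma> = sqrt (lorentz y y)"
 have \<gamma>: "\<gamma> > 0" using assms by (simp add: \<gamma>_def light_cone_iff)
 have p: "lc_p y > 0" using assms by (simp add: light_cone_iff)
 define t where "t = ln (\<gamma> / lc_p y)"
 define a where "a = (\<gamma>, t, \<lambda>i. - y $ i / \<gamma>)"
 have et: "exp (- t) = lc_p y / \<gamma>" using \<gamma> p by (simp add: t_def exp_minus)
 have pe: "lc_p (hm a *v base_pt) = lc_p y" using \<gamma> by (simp add: a_def h_mat_mult base_pt_lc et)
 have me: "(hm a *v base_pt) $ i = y $ i" if "i \<in> idx_mid" for i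
  using \<gamma> that by (simp add: a_def h_mat_mult base_pt_lc)
 have "lorentz (hm a *v base_pt) (hm a *v base_pt) = \<gamma>\<^sup>2" by (simp add: lorentz_hm base_pt_lc a_def del: hm.simps)
 also have "\<dots> = lorentz y y" using assms by (simp add: \<gamma>_def light_cone_iff)
 finally have "lc_p (hm a *v base_pt) * lc_r (hm a *v base_pt) - (\<Sum>i\<in>idx_mid. ((hm a *v base_pt) $ i)\<^sup>2) = lc_p y * lc_r y - (\<Sum>i\<in>idx_mid. (y $ i)\<^sup>2)"
  by (simp only: lorentz_lc)
 moreover have "(\<Sum>i\<in>idx_mid. ((hm a *v base_pt) $ i)\<^sup>2) = (\<Sum>i\<in>idx_mid. (y $ i)\<^sup>2)"
  by (rule sum.cong) (simp_all add: me)
 ultimately have re: "lc_r (hm a *v base_pt) = lc_r y" using p by (simp add: pe)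
 have "hm a *v base_pt = y" by (rule lc_eqI[OF pe re me])
 then show ?thesis using \<gamma> by (intro that[of a]) (auto simp: a_def)
qed

text \<open>
  The action on the orbit of the base point is free, since Lorentz square, light-cone coordinate
  and middle coordinates recover the group coordinates.
\<close>

lemma hm_base_inj:
 assumes "fst a > 0" "fst b > 0" "hm a *v base_pt = hm b *v base_pt" shows "hm a = hm b"
proof -
 obtain \<gamma> t c \<gamma>' t' c' where ab: "a = (\<gamma>, t, c)" "b = (\<gamma>', t', c')" by (cases a; cases b)
 have "\<gamma>\<^sup>2 = \<gamma>'\<^sup>2" using arg_cong[OF assms(3), of "\<lambda>x. lorentz x x"] by (simp add: lorentz_hm base_pt_lc ab del: hm.simps)
 then have g: "\<gamma> = \<gamma>'" using assms by (simp add: ab power2_eq_iff)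
 have "\<gamma> * exp (- t) = \<gamma>' * exp (- t')" using arg_cong[OF assms(3), of lc_p] by (simp add: ab h_mat_mult base_pt_lc)
 then have t: "t = t'" using assms by (simp add: g ab)
 have c: "c i = c' i" if "i \<in> idx_mid" for i
  using arg_cong[OF assms(3), of "\<lambda>x. x $ i"] that assms by (simp add: ab h_mat_mult base_pt_lc g)
 show ?thesis unfolding ab g t by (rule hm_cong[OF c])
qed

text \<open>
  With \<open>J\<close> the matrix of the Lorentz form, \<open>h\<^sup>T J h = \<gamma>\<^sup>2
  J\<close>; taking determinants gives the absolute value of the determinant of \<open>h\<close>.
\<close>

lemma abs_det_hm: assumes "fst a > 0" shows "\<bar>det (hm a)\<bar> = fst a ^ CARD('n)"
proof -
 define J :: "real => 'n rmat" where "J s = (\<chi> i j. if i = j then s * lsign i else 0)" for s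
 have Jv: "J s *v x = s *\<^sub>R lflip x" for s x
 proof (subst vec_eq_iff, intro allI)
  fix i
  have "(J s *v x) $ i = (\<Sum>j\<in>UNIV. if j = i then s * lsign i * x $ i else 0)"
   unfolding matrix_vector_mult_def vec_lambda_beta J_def by (rule sum.cong) auto
  then show "(J s *v x) $ i = (s *\<^sub>R lflip x) $ i" by (simp add: lflip_def lsign_def)
 qed
 have dJ: "det (J s) = s ^ CARD('n) * (\<Prod>i\<in>UNIV. lsign (i::'n))" for s
  by (subst det_diagonal) (simp_all add: J_def prod.distrib)
 have "transpose (hm a) ** J 1 ** hm a = J ((fst a)\<^sup>2)"
 proof (subst matrix_eq, intro allI)
  fix x
  have "((transpose (hm a) ** J 1 ** hm a) *v x) \<bullet> y = (J ((fst a)\<^sup>2) *v x) \<bullet> y" for y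
  proof -
   have "((transpose (hm a) ** J 1 ** hm a) *v x) \<bullet> y = (transpose (hm a) *v (lflip (hm a *v x))) \<bullet> y"
    by (simp add: matrix_vector_mul_assoc[symmetric] Jv)
   also have "\<dots> = lflip (hm a *v x) \<bullet> (hm a *v y)"
    by (metis dot_lmul_matrix transpose_matrix_vector inner_commute)
   also have "\<dots> = lorentz (hm a *v x) (hm a *v y)" by (simp add: lorentz_eq_inner inner_lflip)
   also have "\<dots> = (fst a)\<^sup>2 * lorentz x y" by (rule lorentz_hm_polar)
   also have "\<dots> = (J ((fst a)\<^sup>2) *v x) \<bullet> y" by (simp add: Jv lorentz_eq_inner inner_lflip)
   finally show ?thesis .
  qed
  then show "(transpose (hm a) ** J 1 ** hm a) *v x = J ((fst a)\<^sup>2) *v x"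
   using vector_eq_rdot by blast
 qed
 then have "det (hm a) * det (J 1) * det (hm a) = det (J ((fst a)\<^sup>2))"
  by (metis det_mul det_transpose)
 moreover have nz: "(\<Prod>i\<in>UNIV. lsign (i::'n)) \<noteq> 0" by (simp add: lsign_def)
 ultimately have "(det (hm a))\<^sup>2 = ((fst a)\<^sup>2) ^ CARD('n)"
  unfolding dJ by (simp add: power2_eq_square)
 also have "\<dots> = (fst a ^ CARD('n))\<^sup>2" by (simp add: power_mult[symmetric] mult.commute)
 finally have "\<bar>det (hm a)\<bar> = \<bar>fst a ^ CARD('n)\<bar>" by (simp add: power2_eq_iff abs_eq_iff)
 then show ?thesis using assms by simp
qed

lemma det_hm_nz: "fst a > 0 ==> det (hm a) \<noteq> 0"
 using abs_det_hm[of a] by auto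

end

section \<open>A Young inequality for coefficient functions\<close>

text \<open>
  If \<open>a = m * b\<close>, then formally the coefficient function of \<open>a\<close> is a
  superposition of translates of that of \<open>b\<close> with total mass
  \<open>\<parallel>m\<parallel>\<^sub>1\<close>. For the Riemann sums of the convolution this is
  literally true and Jensen gives the bound; the functional being continuous, Fatou carries the
  bound to the limit.
\<close>

theorem young_coeff_fun:
 assumes f: "f \<in> S_cone_dual" and a: "a \<in> S_cone" and b: "b \<in> S_cone" and m: "rapid m"
  and eq: "a = convol m b" and p: "p \<ge> 1" and L: "(\<integral>x. cmod (m x) \<partial>lborel) \<le> L"
 shows "pint p (coeff_fun f a) \<le> ennreal (L powr p) * pint p (coeff_fun f b)"
proof -
 define M where "M = (\<integral>x. cmod (m x) \<partial>lborel)"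
 have M0: "M \<ge> 0" unfolding M_def by simp
 have "\<exists>(n :: nat => nat) c y. (\<forall>N. (\<Sum>j<n N. cmod (c N j)) \<le> (\<integral>x. cmod (m x) \<partial>lborel)) \<and>
  schwartz_lim (\<lambda>N x. \<Sum>j<n N. c N j * b (x - y N j)) (convol m b)"
 proof (rule convol_approx[OF m S_cone_schwartz[OF b]])
  fix n :: "nat => nat" and c y
  assume 1: "\<And>N. (\<Sum>j<n N. cmod (c N j)) \<le> (\<integral>x. cmod (m x) \<partial>lborel)"
   and 2: "schwartz_lim (\<lambda>N x. \<Sum>j<n N. c N j * b (x - y N j)) (convol m b)"
  show ?thesis
   using 1 2 by blast
 qed
 then obtain n :: "nat => nat" and c y where cy0: "\<And>N. (\<Sum>j<n N. cmod (c N j)) \<le> (\<integral>x. cmod (m x) \<partial>lborel)"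
  "schwartz_lim (\<lambda>N x. \<Sum>j<n N. c N j * b (x - y N j)) (convol m b)"
  by (elim exE conjE) (rule that, erule spec)
 note cy = cy0[folded M_def eq]
 define u where "u N x = (\<Sum>j<n N. cnj (c N j) * coeff_fun f b (x + y N j))" for N x
 have F[measurable]: "coeff_fun f b \<in> borel_measurable borel" by (rule measurable_coeff_fun[OF f b])
 have um[measurable]: "u N \<in> borel_measurable borel" for N unfolding u_def by measurable
 have Tb: "(\<lambda>z. b (z - t)) \<in> S_cone" for t by (rule S_cone_translate[OF b])
 have lim: "(\<lambda>N. u N x) \<longlonglongrightarrow> coeff_fun f a x" for x
 proof -
  have "schwartz_lim (\<lambda>N z. \<Sum>j<n N. c N j * b (z - x - y N j)) (\<lambda>z. a (z - x))"
   by (rule schwartz_lim_translate[OF cy(2)])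
  then have sl: "schwartz_lim (\<lambda>N z. \<Sum>j<n N. c N j * b (z - (x + y N j))) (\<lambda>z. a (z - x))"
   by (simp add: diff_diff_eq)
  have "(\<lambda>N. f (\<lambda>z. \<Sum>j<n N. c N j * b (z - (x + y N j)))) \<longlonglongrightarrow> f (\<lambda>z. a (z - x))"
   by (rule S_cone_dual_tendsto[OF f _ _ sl]) (intro S_cone_sum S_cone_cmult Tb, rule S_cone_translate[OF a])
  moreover have "f (\<lambda>z. \<Sum>j<n N. c N j * b (z - (x + y N j))) = u N x" for N
   unfolding u_def coeff_fun_def
  proof (subst S_cone_dual_sum[OF f])
   show "(\<lambda>z. c N j * b (z - (x + y N j))) \<in> S_cone" for j by (intro S_cone_cmult Tb)
   show "(\<Sum>j<n N. f (\<lambda>z. c N j * b (z - (x + y N j)))) = (\<Sum>j<n N. cnj (c N j) * f (\<lambda>z. b (z - (x + y N j))))"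
    by (simp only: S_cone_dual_cmult[OF f Tb])
  qed simp
  ultimately show ?thesis by (simp add: coeff_fun_def)
 qed
 have ub: "pint p (u N) \<le> ennreal (L powr p) * pint p (coeff_fun f b)" for N
 proof -
  have "pint p (u N) \<le> (\<integral>\<^sup>+x. ennreal (M powr (p - 1)) * (\<Sum>j<n N. ennreal (cmod (c N j)) * ennreal (cmod (coeff_fun f b (x + y N j)) powr p)) \<partial>lborel)"
   unfolding pint_def
  proof (rule nn_integral_mono)
   fix x
   have "cmod (u N x) powr p \<le> (\<Sum>j<n N. cmod (cnj (c N j))) powr (p - 1) * (\<Sum>j<n N. cmod (cnj (c N j)) * cmod (coeff_fun f b (x + y N j)) powr p)"
    unfolding u_def by (rule powr_sum_le[OF p])
   also have "\<dots> \<le> M powr (p - 1) * (\<Sum>j<n N. cmod (c N j) * cmod (coeff_fun f b (x + y N j)) powr p)"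
    using cy(1)[of N] p by (intro mult_mono powr_mono2) (auto intro!: sum_nonneg)
   finally have "ennreal (cmod (u N x) powr p) \<le> ennreal (M powr (p - 1) * (\<Sum>j<n N. cmod (c N j) * cmod (coeff_fun f b (x + y N j)) powr p))"
    by (rule ennreal_leI)
   also have "\<dots> = ennreal (M powr (p - 1)) * (\<Sum>j<n N. ennreal (cmod (c N j)) * ennreal (cmod (coeff_fun f b (x + y N j)) powr p))"
   proof -
    have "ennreal (\<Sum>j<n N. cmod (c N j) * cmod (coeff_fun f b (x + y N j)) powr p) = (\<Sum>j<n N. ennreal (cmod (c N j) * cmod (coeff_fun f b (x + y N j)) powr p))"
     by (rule sum_ennreal[symmetric]) simp
    also have "\<dots> = (\<Sum>j<n N. ennreal (cmod (c N j)) * ennreal (cmod (coeff_fun f b (x + y N j)) powr p))"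
     by (rule sum.cong) (simp_all add: ennreal_mult)
    finally show ?thesis by (subst ennreal_mult) (simp_all add: sum_nonneg)
   qed
   finally show "ennreal (cmod (u N x) powr p) \<le> ennreal (M powr (p - 1)) * (\<Sum>j<n N. ennreal (cmod (c N j)) * ennreal (cmod (coeff_fun f b (x + y N j)) powr p))" .
  qed
  also have "\<dots> = ennreal (M powr (p - 1)) * (\<Sum>j<n N. ennreal (cmod (c N j)) * (\<integral>\<^sup>+x. ennreal (cmod (coeff_fun f b (x + y N j)) powr p) \<partial>lborel))"
   by (simp add: nn_integral_cmult nn_integral_sum)
  also have "\<dots> = ennreal (M powr (p - 1)) * (\<Sum>j<n N. ennreal (cmod (c N j)) * pint p (coeff_fun f b))"
  proof -
   have "(\<integral>\<^sup>+x. ennreal (cmod (coeff_fun f b (x + t)) powr p) \<partial>lborel) = pint p (coeff_fun f b)" for t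
    unfolding pint_def by (rule nn_integral_translate[of "\<lambda>x. ennreal (cmod (coeff_fun f b x) powr p)"]) measurable
   then show ?thesis by simp
  qed
  also have "\<dots> = ennreal (M powr (p - 1)) * (ennreal (\<Sum>j<n N. cmod (c N j)) * pint p (coeff_fun f b))"
   by (simp add: sum_distrib_right[symmetric])
  also have "\<dots> \<le> ennreal (M powr (p - 1)) * (ennreal M * pint p (coeff_fun f b))"
   by (intro mult_left_mono mult_right_mono ennreal_leI cy) auto
  also have "\<dots> = ennreal (M powr (p - 1) * M) * pint p (coeff_fun f b)"
   using M0 by (simp add: ennreal_mult mult.assoc)
  also have "M powr (p - 1) * M = M powr p"
   using M0 by (cases "M = 0") (use p in \<open>auto simp: powr_diff\<close>)
  also have "ennreal (M powr p) * pint p (coeff_fun f b) \<le> ennreal (L powr p) * pint p (coeff_fun f b)"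
   using M0 L p unfolding M_def[symmetric] by (intro mult_right_mono ennreal_leI powr_mono2) auto
  finally show ?thesis .
 qed
 have "pint p (coeff_fun f a) = (\<integral>\<^sup>+x. liminf (\<lambda>N. ennreal (cmod (u N x) powr p)) \<partial>lborel)"
  unfolding pint_def
 proof (rule nn_integral_cong)
  fix x
  have "(\<lambda>N. cmod (u N x) powr p) \<longlonglongrightarrow> cmod (coeff_fun f a x) powr p"
   using p by (intro tendsto_powr2 tendsto_norm lim tendsto_const) auto
  then have "(\<lambda>N. ennreal (cmod (u N x) powr p)) \<longlonglongrightarrow> ennreal (cmod (coeff_fun f a x) powr p)"
   by (rule tendsto_ennrealI)
  then show "ennreal (cmod (coeff_fun f a x) powr p) = liminf (\<lambda>N. ennreal (cmod (u N x) powr p))"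
   by (rule lim_imp_Liminf[OF trivial_limit_sequentially, symmetric])
 qed
 also have "\<dots> \<le> liminf (\<lambda>N. pint p (u N))"
  unfolding pint_def by (rule nn_integral_liminf) measurable
 also have "\<dots> \<le> liminf (\<lambda>N::nat. ennreal (L powr p) * pint p (coeff_fun f b))"
  by (rule Liminf_mono) (use ub in auto)
 also have "\<dots> = ennreal (L powr p) * pint p (coeff_fun f b)"
  by (rule Liminf_const) simp
 finally show ?thesis .
qed

section \<open>Families with uniformly bounded derivatives\<close>

text \<open>
  The functions \<open>F i\<close> have derivatives up to order \<open>k\<close> on
  \<open>S\<close> that are bounded independently of \<open>i\<close>. The derivatives are
  existentially quantified, so that closure under the algebraic operations is proved by induction
  without formulas for iterated derivatives.
\<close>

fun ubd :: "nat => 'i set => 'n::finite rvec set => ('i => 'n rvec => complex) => bool" where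
 "ubd 0 I S F \<longleftrightarrow> (\<exists>C. \<forall>i\<in>I. \<forall>x\<in>S. cmod (F i x) \<le> C)"
| "ubd (Suc k) I S F \<longleftrightarrow> (\<exists>C. \<forall>i\<in>I. \<forall>x\<in>S. cmod (F i x) \<le> C) \<and>
   (\<exists>F' :: 'n => 'i => 'n rvec => complex.
    (\<forall>i\<in>I. \<forall>x\<in>S. (F i has_derivative (\<lambda>h. \<Sum>l\<in>UNIV. h $ l *\<^sub>R F' l i x)) (at x)) \<and> (\<forall>l. ubd k I S (F' l)))"

lemma ubd_bounded: "ubd k I S F ==> \<exists>C. \<forall>i\<in>I. \<forall>x\<in>S. cmod (F i x) \<le> C"
 by (cases k) auto

lemma ubd_SucE:
 assumes "ubd (Suc k) I S F"
 obtains F' where "\<And>i x. i \<in> I ==> x \<in> S ==> (F i has_derivative (\<lambda>h. \<Sum>l\<in>UNIV. h $ l *\<^sub>R F' l i x)) (at x)" "\<And>l. ubd k I S (F' l)"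
proof -
 from assms obtain F' where "\<forall>i\<in>I. \<forall>x\<in>S. (F i has_derivative (\<lambda>h. \<Sum>l\<in>UNIV. h $ l *\<^sub>R F' l i x)) (at x)" "\<forall>l. ubd k I S (F' l)"
  unfolding ubd.simps by blast
 then show ?thesis using that[of F'] by blast
qed

lemma ubd_Suc_imp: "ubd (Suc k) I S F ==> ubd k I S F"
proof (induction k arbitrary: F)
 case 0 then show ?case by (simp only: ubd.simps)
next
 case (Suc k)
 from Suc.prems obtain F' where F': "\<And>i x. i \<in> I ==> x \<in> S ==> (F i has_derivative (\<lambda>h. \<Sum>l\<in>UNIV. h $ l *\<^sub>R F' l i x)) (at x)" "\<And>l. ubd (Suc k) I S (F' l)"
  by (rule ubd_SucE) blast
 have "\<forall>l. ubd k I S (F' l)" using Suc.IH[OF F'(2)] by blast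
 then show ?case
  unfolding ubd.simps(2)[of k] using ubd_bounded[OF Suc.prems] F'(1) by blast
qed

lemma ubd_cong:
 assumes "open S" "ubd k I S F" "\<And>i x. i \<in> I ==> x \<in> S ==> F i x = G i x"
 shows "ubd k I S G"
 using assms(2,3)
proof (induction k arbitrary: F G)
 case 0 then show ?case by (simp only: ubd.simps) metis
next
 case (Suc k)
 from Suc.prems(1) obtain F' where F': "\<And>i x. i \<in> I ==> x \<in> S ==> (F i has_derivative (\<lambda>h. \<Sum>l\<in>UNIV. h $ l *\<^sub>R F' l i x)) (at x)" "\<And>l. ubd k I S (F' l)"
  by (rule ubd_SucE) blast
 have "\<exists>C. \<forall>i\<in>I. \<forall>x\<in>S. cmod (G i x) \<le> C" using ubd_bounded[OF Suc.prems(1)] Suc.prems(2) by metis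
 moreover have "(G i has_derivative (\<lambda>h. \<Sum>l\<in>UNIV. h $ l *\<^sub>R F' l i x)) (at x)" if "i \<in> I" "x \<in> S" for i x
  by (rule has_derivative_transform_within_open[OF F'(1)[OF that] assms(1) that(2)]) (use Suc.prems(2) that in auto)
 ultimately show ?case unfolding ubd.simps using F'(2) by blast
qed

lemma ubd_const: assumes "\<exists>C. \<forall>i\<in>I. cmod (c i) \<le> C" shows "ubd k I S (\<lambda>i x. c i)"
 using assms
proof (induction k arbitrary: c)
 case (Suc k)
 have "ubd k I S (\<lambda>i x. 0)" by (rule Suc.IH[of "\<lambda>_. 0"]) auto
 moreover have "((\<lambda>x. c i) has_derivative (\<lambda>h. \<Sum>l\<in>UNIV. h $ l *\<^sub>R 0)) (at x)" for i x by simp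
 ultimately show ?case unfolding ubd.simps using Suc.prems
  by (intro conjI exI[of _ "\<lambda>l i x. 0"]) auto
qed auto

text \<open>
  The number of summands may depend on the index but must be bounded, which is what the lattice
  count provides.
\<close>

lemma ubd_sum_family:
 assumes "ubd k {(i, l). i \<in> I \<and> l \<in> J i} S (\<lambda>(i, l). G i l)" "\<And>i. i \<in> I ==> finite (J i)" "\<And>i. i \<in> I ==> card (J i) \<le> M"
 shows "ubd k I S (\<lambda>i x. \<Sum>l\<in>J i. G i l x)"
 using assms(1)
proof (induction k arbitrary: G)
 have bd: "\<exists>C. \<forall>i\<in>I. \<forall>x\<in>S. cmod (\<Sum>l\<in>J i. G i l x) \<le> C"
  if "\<exists>C. \<forall>a\<in>{(i, l). i \<in> I \<and> l \<in> J i}. \<forall>x\<in>S. cmod ((\<lambda>(i, l). G i l) a x) \<le> C" for G :: "'a => 'b => 'c rvec => complex"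
 proof -
  from that obtain C where C: "\<And>i l x. i \<in> I ==> l \<in> J i ==> x \<in> S ==> cmod (G i l x) \<le> C" by auto
  have "cmod (\<Sum>l\<in>J i. G i l x) \<le> real M * \<bar>C\<bar>" if "i \<in> I" "x \<in> S" for i x
  proof -
   have "cmod (\<Sum>l\<in>J i. G i l x) \<le> (\<Sum>l\<in>J i. \<bar>C\<bar>)"
    by (rule order.trans[OF norm_sum], rule sum_mono) (use C that in force)
   also have "\<dots> = real (card (J i)) * \<bar>C\<bar>" by simp
   also have "\<dots> \<le> real M * \<bar>C\<bar>" using assms(3)[OF that(1)] by (intro mult_right_mono) auto
   finally show ?thesis .
  qed
  then show ?thesis by blast
 qed
 {
  case 0 then show ?case using bd[of G] by (simp only: ubd.simps)
 next
  case (Suc k)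
  from Suc.prems obtain F' where F': "\<And>a x. a \<in> {(i, l). i \<in> I \<and> l \<in> J i} ==> x \<in> S ==>
    ((\<lambda>(i, l). G i l) a has_derivative (\<lambda>h. \<Sum>r\<in>UNIV. h $ r *\<^sub>R F' r a x)) (at x)" "\<And>r. ubd k {(i, l). i \<in> I \<and> l \<in> J i} S (F' r)"
   by (rule ubd_SucE) blast
  have "ubd k I S (\<lambda>i x. \<Sum>l\<in>J i. F' r (i, l) x)" for r
  proof (rule Suc.IH)
   have "(\<lambda>(i, l). F' r (i, l)) = F' r" by auto
   with F'(2)[of r] show "ubd k {(i, l). i \<in> I \<and> l \<in> J i} S (\<lambda>(i, l). F' r (i, l))" by simp
  qed
  moreover have "((\<lambda>x. \<Sum>l\<in>J i. G i l x) has_derivative (\<lambda>h. \<Sum>r\<in>UNIV. h $ r *\<^sub>R (\<Sum>l\<in>J i. F' r (i, l) x))) (at x)" if "i \<in> I" "x \<in> S" for i x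
  proof -
   have "((\<lambda>x. \<Sum>l\<in>J i. G i l x) has_derivative (\<lambda>h. \<Sum>l\<in>J i. \<Sum>r\<in>UNIV. h $ r *\<^sub>R F' r (i, l) x)) (at x)"
   proof (rule has_derivative_sum)
    fix l assume "l \<in> J i"
    with F'(1)[of "(i, l)" x] that show "(G i l has_derivative (\<lambda>h. \<Sum>r\<in>UNIV. h $ r *\<^sub>R F' r (i, l) x)) (at x)" by simp
   qed
   moreover have "(\<lambda>h. \<Sum>l\<in>J i. \<Sum>r\<in>UNIV. h $ r *\<^sub>R F' r (i, l) x) = (\<lambda>h. \<Sum>r\<in>UNIV. h $ r *\<^sub>R (\<Sum>l\<in>J i. F' r (i, l) x))"
    by (rule ext, subst sum.swap) (simp add: scaleR_sum_right)
   ultimately show ?thesis by simp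
  qed
  ultimately show ?case
   using bd[OF ubd_bounded[OF Suc.prems]] unfolding ubd.simps by (intro conjI exI[of _ "\<lambda>r i x. \<Sum>l\<in>J i. F' r (i, l) x"]) auto
 }
qed

lemma ubd_add:
 assumes "ubd k I S F" "ubd k I S G" shows "ubd k I S (\<lambda>i x. F i x + G i x)"
 using assms
proof (induction k arbitrary: F G)
 have bd: "\<exists>C. \<forall>i\<in>I. \<forall>x\<in>S. cmod (F i x + G i x) \<le> C"
  if F: "\<exists>C. \<forall>i\<in>I. \<forall>x\<in>S. cmod (F i x) \<le> C" and G: "\<exists>C. \<forall>i\<in>I. \<forall>x\<in>S. cmod (G i x) \<le> C" for F G :: "'a => 'b rvec => complex"
 proof -
  from F obtain C where C: "\<And>i x. i \<in> I ==> x \<in> S ==> cmod (F i x) \<le> C" by blast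
  from G obtain D where D: "\<And>i x. i \<in> I ==> x \<in> S ==> cmod (G i x) \<le> D" by blast
  have "cmod (F i x + G i x) \<le> C + D" if "i \<in> I" "x \<in> S" for i x
   using norm_triangle_ineq[of "F i x" "G i x"] C[OF that] D[OF that] by linarith
  then show ?thesis by blast
 qed
 {
  case 0 then show ?case using bd[of F G] by (simp only: ubd.simps)
 next
  case (Suc k)
  from Suc.prems(1) obtain F' where F': "\<And>i x. i \<in> I ==> x \<in> S ==> (F i has_derivative (\<lambda>h. \<Sum>l\<in>UNIV. h $ l *\<^sub>R F' l i x)) (at x)" "\<And>l. ubd k I S (F' l)"
   by (rule ubd_SucE) blast
  from Suc.prems(2) obtain G' where G': "\<And>i x. i \<in> I ==> x \<in> S ==> (G i has_derivative (\<lambda>h. \<Sum>l\<in>UNIV. h $ l *\<^sub>R G' l i x)) (at x)" "\<And>l. ubd k I S (G' l)"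
   by (rule ubd_SucE) blast
  have "((\<lambda>x. F i x + G i x) has_derivative (\<lambda>h. \<Sum>l\<in>UNIV. h $ l *\<^sub>R (F' l i x + G' l i x))) (at x)" if "i \<in> I" "x \<in> S" for i x
   using has_derivative_add[OF F'(1)[OF that] G'(1)[OF that]] by (simp add: scaleR_add_right sum.distrib)
  moreover have "ubd k I S (\<lambda>i x. F' l i x + G' l i x)" for l by (rule Suc.IH[OF F'(2) G'(2)])
  ultimately show ?case
   using bd[OF ubd_bounded[OF Suc.prems(1)] ubd_bounded[OF Suc.prems(2)]] unfolding ubd.simps
   by (intro conjI exI[of _ "\<lambda>l i x. F' l i x + G' l i x"]) auto
 }
qed

lemma ubd_mult:
 assumes "ubd k I S F" "ubd k I S G" shows "ubd k I S (\<lambda>i x. F i x * G i x)"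
 using assms
proof (induction k arbitrary: F G)
 have bd: "\<exists>C. \<forall>i\<in>I. \<forall>x\<in>S. cmod (F i x * G i x) \<le> C"
  if F: "\<exists>C. \<forall>i\<in>I. \<forall>x\<in>S. cmod (F i x) \<le> C" and G: "\<exists>C. \<forall>i\<in>I. \<forall>x\<in>S. cmod (G i x) \<le> C" for F G :: "'a => 'b rvec => complex"
 proof -
  from F obtain C where C: "\<And>i x. i \<in> I ==> x \<in> S ==> cmod (F i x) \<le> C" by blast
  from G obtain D where D: "\<And>i x. i \<in> I ==> x \<in> S ==> cmod (G i x) \<le> D" by blast
  have "cmod (F i x * G i x) \<le> \<bar>C\<bar> * \<bar>D\<bar>" if "i \<in> I" "x \<in> S" for i x
   unfolding norm_mult using C[OF that] D[OF that] by (intro mult_mono) auto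
  then show ?thesis by blast
 qed
 {
  case 0 then show ?case using bd[of F G] by (simp only: ubd.simps)
 next
  case (Suc k)
  from Suc.prems(1) obtain F' where F': "\<And>i x. i \<in> I ==> x \<in> S ==> (F i has_derivative (\<lambda>h. \<Sum>l\<in>UNIV. h $ l *\<^sub>R F' l i x)) (at x)" "\<And>l. ubd k I S (F' l)"
   by (rule ubd_SucE) blast
  from Suc.prems(2) obtain G' where G': "\<And>i x. i \<in> I ==> x \<in> S ==> (G i has_derivative (\<lambda>h. \<Sum>l\<in>UNIV. h $ l *\<^sub>R G' l i x)) (at x)" "\<And>l. ubd k I S (G' l)"
   by (rule ubd_SucE) blast
  have "((\<lambda>x. F i x * G i x) has_derivative (\<lambda>h. \<Sum>l\<in>UNIV. h $ l *\<^sub>R (F i x * G' l i x + F' l i x * G i x))) (at x)" if "i \<in> I" "x \<in> S" for i x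
   using has_derivative_mult[OF F'(1)[OF that] G'(1)[OF that]]
   by (simp add: scaleR_add_right sum.distrib sum_distrib_left sum_distrib_right)
  moreover have "ubd k I S (\<lambda>i x. F i x * G' l i x + F' l i x * G i x)" for l
   by (intro ubd_add Suc.IH ubd_Suc_imp[OF Suc.prems(1)] ubd_Suc_imp[OF Suc.prems(2)] F'(2) G'(2))
  ultimately show ?case
   using bd[OF ubd_bounded[OF Suc.prems(1)] ubd_bounded[OF Suc.prems(2)]] unfolding ubd.simps
   by (intro conjI exI[of _ "\<lambda>l i x. F i x * G' l i x + F' l i x * G i x"]) auto
 }
qed

text \<open>
  The derivative of \<open>1 / F\<close> is \<open>- F' / F\<^sup>2\<close>, a product of
  functions already known to be uniformly bounded up to the order below.
\<close>

lemma ubd_inverse: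
 assumes F: "ubd k I S F" and d: "d > 0" "\<And>i x. i \<in> I ==> x \<in> S ==> cmod (F i x) \<ge> d"
 shows "ubd k I S (\<lambda>i x. inverse (F i x))"
 using F
proof (induction k)
 have bd: "\<exists>C. \<forall>i\<in>I. \<forall>x\<in>S. cmod (inverse (F i x)) \<le> C"
  using d by (intro exI[of _ "inverse d"]) (auto simp: norm_inverse le_imp_inverse_le)
 {
  case 0 then show ?case using bd by (simp only: ubd.simps)
 next
  case (Suc k)
  from Suc.prems obtain F' where F': "\<And>i x. i \<in> I ==> x \<in> S ==> (F i has_derivative (\<lambda>h. \<Sum>l\<in>UNIV. h $ l *\<^sub>R F' l i x)) (at x)" "\<And>l. ubd k I S (F' l)"
   by (rule ubd_SucE) blast
  have IH: "ubd k I S (\<lambda>i x. inverse (F i x))" by (rule Suc.IH[OF ubd_Suc_imp[OF Suc.prems]])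
  have "((\<lambda>x. inverse (F i x)) has_derivative (\<lambda>h. \<Sum>l\<in>UNIV. h $ l *\<^sub>R ((- 1) * (inverse (F i x) * F' l i x * inverse (F i x))))) (at x)" if "i \<in> I" "x \<in> S" for i x
  proof -
   have nz: "F i x \<noteq> 0" using d(2)[OF that] d(1) by auto
   show ?thesis
    using Deriv.has_derivative_inverse[OF nz F'(1)[OF that]]
    by (simp add: sum_distrib_left sum_distrib_right sum_negf)
  qed
  moreover have "ubd k I S (\<lambda>i x. (- 1) * (inverse (F i x) * F' l i x * inverse (F i x)))" for l
   by (intro ubd_mult IH F'(2) ubd_const) auto
  ultimately show ?case
   using bd unfolding ubd.simps
   by (intro conjI exI[of _ "\<lambda>l i x. (- 1) * (inverse (F i x) * F' l i x * inverse (F i x))"]) auto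
 }
qed

lemma ubd_pair_finite:
 fixes G :: "'l::finite => 'i => 'n::finite rvec => complex"
 assumes "\<And>l. ubd k I S (\<lambda>i x. G l i x)"
 shows "ubd k {(i, l). i \<in> I \<and> l \<in> UNIV} S (\<lambda>(i, l). \<lambda>x. G l i x)"
 using assms
proof (induction k arbitrary: G)
 have bd: "\<exists>C. \<forall>a\<in>{(i, l). i \<in> I \<and> l \<in> UNIV}. \<forall>x\<in>S. cmod ((\<lambda>(i, l). \<lambda>x. G l i x) a x) \<le> C"
  if "\<And>l. \<exists>C. \<forall>i\<in>I. \<forall>x\<in>S. cmod (G l i x) \<le> C" for G :: "'l => 'i => 'n rvec => complex"
 proof -
  from that have "\<forall>l. \<exists>C. \<forall>i\<in>I. \<forall>x\<in>S. cmod (G l i x) \<le> C" by blast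
  from choice[OF this] obtain C where C: "\<And>l i x. i \<in> I ==> x \<in> S ==> cmod (G l i x) \<le> C l" by blast
  have "C l \<le> (\<Sum>l\<in>UNIV. \<bar>C l\<bar>)" for l
   using member_le_sum[of l UNIV "\<lambda>l. \<bar>C l\<bar>"] by auto
  then have "cmod (G l i x) \<le> (\<Sum>l\<in>UNIV. \<bar>C l\<bar>)" if "i \<in> I" "x \<in> S" for l i x
   using C[OF that, of l] order.trans by blast
  then show ?thesis by (intro exI[of _ "\<Sum>l\<in>UNIV. \<bar>C l\<bar>"]) auto
 qed
 {
  case 0 then show ?case using bd[of G] by (simp only: ubd.simps)
 next
  case (Suc k)
  have "\<exists>F'. (\<forall>i\<in>I. \<forall>x\<in>S. ((\<lambda>x. G l i x) has_derivative (\<lambda>h. \<Sum>r\<in>UNIV. h $ r *\<^sub>R F' r i x)) (at x)) \<and> (\<forall>r. ubd k I S (F' r))" for l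
   using Suc.prems[of l] unfolding ubd.simps by blast
  then have "\<forall>l. \<exists>F'. (\<forall>i\<in>I. \<forall>x\<in>S. ((\<lambda>x. G l i x) has_derivative (\<lambda>h. \<Sum>r\<in>UNIV. h $ r *\<^sub>R F' r i x)) (at x)) \<and> (\<forall>r. ubd k I S (F' r))" by blast
  from choice[OF this] obtain F' where F': "\<And>l i x. i \<in> I ==> x \<in> S ==> ((\<lambda>x. G l i x) has_derivative (\<lambda>h. \<Sum>r\<in>UNIV. h $ r *\<^sub>R F' l r i x)) (at x)"
   "\<And>l r. ubd k I S (F' l r)" by blast
  have "ubd k {(i, l). i \<in> I \<and> l \<in> UNIV} S (\<lambda>(i, l). \<lambda>x. F' l r i x)" for r
   by (rule Suc.IH[of "\<lambda>l. F' l r"]) (rule F'(2))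
  then show ?case
   using bd[OF ubd_bounded[OF Suc.prems]] F'(1) unfolding ubd.simps
   by (intro conjI exI[of _ "\<lambda>r. (\<lambda>(i, l). \<lambda>x. F' l r i x)"]) auto
 }
qed

text \<open>
  Composition with linear maps whose entries are bounded uniformly over the family. The map
  \<open>r\<close> allows several members of the new family to come from one member of the old
  one.
\<close>

lemma ubd_linear:
 fixes F :: "'i => 'n::finite rvec => complex" and A :: "'j => 'n rmat" and r :: "'j => 'i"
 assumes F: "ubd k I UNIV F" and r: "\<And>j. j \<in> J ==> r j \<in> I" and A: "\<And>j l i. j \<in> J ==> \<bar>A j $ l $ i\<bar> \<le> B"
 shows "ubd k J UNIV (\<lambda>j x. F (r j) (A j *v x))"
 using F
proof (induction k arbitrary: F)
 have bd: "\<exists>C. \<forall>j\<in>J. \<forall>x\<in>UNIV. cmod (F (r j) (A j *v x)) \<le> C"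
  if F: "\<exists>C. \<forall>i\<in>I. \<forall>x\<in>UNIV. cmod (F i x) \<le> C" for F :: "'i => 'n rvec => complex"
 proof -
  from that obtain C where "\<And>i x. i \<in> I ==> cmod (F i x) \<le> C" by blast
  then show ?thesis using r by (intro exI[of _ C]) auto
 qed
 {
  case 0 then show ?case using bd[of F] by (simp only: ubd.simps)
 next
  case (Suc k)
  from Suc.prems(1) obtain F' where F': "\<And>i x. i \<in> I ==> x \<in> UNIV ==> (F i has_derivative (\<lambda>h. \<Sum>l\<in>UNIV. h $ l *\<^sub>R F' l i x)) (at x)" "\<And>l. ubd k I UNIV (F' l)"
   by (rule ubd_SucE) blast
  define G' where "G' m j x = (\<Sum>l\<in>UNIV. of_real (A j $ l $ m) * F' l (r j) (A j *v x))" for m j x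
  have "((\<lambda>x. F (r j) (A j *v x)) has_derivative (\<lambda>h. \<Sum>m\<in>UNIV. h $ m *\<^sub>R G' m j x)) (at x)" if "j \<in> J" for j x
  proof -
   have 1: "((\<lambda>x. A j *v x) has_derivative (\<lambda>h. A j *v h)) (at x)"
    by (rule bounded_linear_imp_has_derivative) (rule matrix_vector_mul_bounded_linear)
   have "((\<lambda>x. F (r j) (A j *v x)) has_derivative (\<lambda>h. \<Sum>l\<in>UNIV. (A j *v h) $ l *\<^sub>R F' l (r j) (A j *v x))) (at x)"
    using has_derivative_compose[OF 1 F'(1)[OF r[OF that] UNIV_I]] .
   moreover have "(\<lambda>h. \<Sum>l\<in>UNIV. (A j *v h) $ l *\<^sub>R F' l (r j) (A j *v x)) = (\<lambda>h. \<Sum>m\<in>UNIV. h $ m *\<^sub>R G' m j x)"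
   proof
    fix h
    have "(\<Sum>l\<in>UNIV. (A j *v h) $ l *\<^sub>R F' l (r j) (A j *v x)) = (\<Sum>l\<in>UNIV. \<Sum>m\<in>UNIV. (A j $ l $ m * h $ m) *\<^sub>R F' l (r j) (A j *v x))"
     unfolding scaleR_sum_left[symmetric] by (rule sum.cong) (simp_all add: matrix_vector_mult_def)
    also have "\<dots> = (\<Sum>m\<in>UNIV. \<Sum>l\<in>UNIV. (A j $ l $ m * h $ m) *\<^sub>R F' l (r j) (A j *v x))"
     by (rule sum.swap)
    also have "\<dots> = (\<Sum>m\<in>UNIV. h $ m *\<^sub>R G' m j x)"
     unfolding G'_def scaleR_sum_right by (intro sum.cong refl) (simp add: scaleR_conv_of_real mult_ac)
    finally show "(\<Sum>l\<in>UNIV. (A j *v h) $ l *\<^sub>R F' l (r j) (A j *v x)) = (\<Sum>m\<in>UNIV. h $ m *\<^sub>R G' m j x)" .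
   qed
   ultimately show ?thesis by simp
  qed
  moreover have "ubd k J UNIV (G' m)" for m
  proof -
   have "ubd k J UNIV (\<lambda>j x. of_real (A j $ l $ m) * F' l (r j) (A j *v x))" for l
   proof (rule ubd_mult)
    show "ubd k J UNIV (\<lambda>j x. complex_of_real (A j $ l $ m))"
     by (rule ubd_const) (use A in \<open>auto intro!: exI[of _ B]\<close>)
    show "ubd k J UNIV (\<lambda>j x. F' l (r j) (A j *v x))" by (rule Suc.IH[OF F'(2)])
   qed
   then have "ubd k {(j, l). j \<in> J \<and> l \<in> UNIV} UNIV (\<lambda>(j, l). \<lambda>x. of_real (A j $ l $ m) * F' l (r j) (A j *v x))"
    by (rule ubd_pair_finite)
   then have "ubd k J UNIV (\<lambda>j x. \<Sum>l\<in>UNIV. of_real (A j $ l $ m) * F' l (r j) (A j *v x))"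
    by (rule ubd_sum_family[where M = "CARD('n)" and J = "\<lambda>_. UNIV"]) auto
   then show ?thesis unfolding G'_def .
  qed
  ultimately show ?case
   using bd[OF ubd_bounded[OF Suc.prems(1)]] unfolding ubd.simps by (intro conjI exI[of _ G']) auto
 }
qed

lemma ubd_fourier:
 fixes f :: "'n::{finite,linorder} rvec => complex"
 assumes "rapid f"
 shows "ubd k UNIV UNIV (\<lambda>_::unit. fourier f)"
 using assms
proof (induction k arbitrary: f)
 have bd: "\<exists>C. \<forall>i\<in>(UNIV::unit set). \<forall>x\<in>UNIV. cmod (fourier f x) \<le> C" if "rapid f" for f :: "'n rvec => complex"
  using fourier_bound[OF rapid_integrable[OF that]] by blast
 {
  case 0 then show ?case using bd by (simp only: ubd.simps)
 next
  case (Suc k)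
  let ?F' = "\<lambda>l (_::unit) w. fourier (\<lambda>x. (- \<i> * of_real (lsign l)) * (of_real (x $ l) * f x)) w"
  have "ubd k UNIV UNIV (?F' l)" for l
   by (intro Suc.IH rapid_cmult rapid_mult_coord Suc.prems)
  then show ?case
   unfolding ubd.simps using bd[OF Suc.prems] fourier_has_derivative[OF Suc.prems]
   by (intro conjI exI[of _ ?F']) blast+
 }
qed

lemma supp_partial_deriv:
 fixes \<phi> :: "'n::finite rvec => real"
 assumes "x \<notin> supp \<phi>" shows "partial_deriv i \<phi> x = 0"
proof -
 have o: "open (- supp \<phi>)" unfolding supp_def by (intro open_Compl closed_closure)
 have "(\<phi> has_derivative (\<lambda>h. 0)) (at x)"
 proof (rule has_derivative_transform_within_open[OF _ o])
  show "((\<lambda>x. 0) has_derivative (\<lambda>h. 0)) (at x)" by simp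
  show "x \<in> - supp \<phi>" using assms by simp
  show "0 = \<phi> y" if "y \<in> - supp \<phi>" for y
   using that closure_subset[of "{x. \<phi> x \<noteq> 0}"] by (auto simp: supp_def)
 qed
 from partial_deriv_eq[OF this] show ?thesis .
qed

lemma supp_partial_deriv_subset: "supp (partial_deriv i \<phi>) \<subseteq> supp (\<phi> :: 'n::finite rvec => real)"
 unfolding supp_def[of "partial_deriv i \<phi>"]
proof (rule closure_minimal)
 show "{x. partial_deriv i \<phi> x \<noteq> 0} \<subseteq> supp \<phi>" using supp_partial_deriv by blast
 show "closed (supp \<phi>)" by (simp add: supp_def)
qed

lemma ubd_compact_supp:
 fixes \<phi> :: "'n::finite rvec => real"
 assumes "smooth \<phi>" "compact (supp \<phi>)"
 shows "ubd k UNIV UNIV (\<lambda>(_::unit) x. complex_of_real (\<phi> x))"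
 using assms
proof (induction k arbitrary: \<phi>)
 have diff: "\<phi> differentiable (at x)" if "smooth \<phi>" for \<phi> :: "'n rvec => real" and x
  using that unfolding smooth_def differentiable_on_def
  by (metis (mono_tags, lifting) UNIV_I partial_derivs.simps(1))
 have bd: "\<exists>C. \<forall>i\<in>(UNIV::unit set). \<forall>x\<in>UNIV. cmod (complex_of_real (\<phi> x)) \<le> C" if "smooth \<phi>" "compact (supp \<phi>)" for \<phi> :: "'n rvec => real"
 proof -
  have "continuous_on (supp \<phi>) \<phi>"
   by (intro continuous_at_imp_continuous_on ballI differentiable_imp_continuous_within diff that)
  then have "bounded (\<phi> ` supp \<phi>)" using that by (intro compact_imp_bounded compact_continuous_image)
  then obtain C where C: "\<And>x. x \<in> supp \<phi> ==> \<bar>\<phi> x\<bar> \<le> C" unfolding bounded_iff by auto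
  have "\<bar>\<phi> x\<bar> \<le> \<bar>C\<bar>" for x
  proof (cases "x \<in> supp \<phi>")
   case True then show ?thesis using C[OF True] by simp
  next
   case False
   then have "\<phi> x = 0" using closure_subset[of "{x. \<phi> x \<noteq> 0}"] by (auto simp: supp_def)
   then show ?thesis by simp
  qed
  then show ?thesis by (intro exI[of _ "\<bar>C\<bar>"]) simp
 qed
 {
  case 0 then show ?case using bd[of \<phi>] by (simp only: ubd.simps)
 next
  case (Suc k)
  let ?F' = "\<lambda>l (_::unit) x. complex_of_real (partial_deriv l \<phi> x)"
  have "ubd k UNIV UNIV (?F' l)" for l
  proof (rule Suc.IH)
   show "smooth (partial_deriv l \<phi>)"
    using Suc.prems(1) unfolding smooth_def using partial_derivs_append[of _ "[l]" \<phi>] by (metis partial_derivs.simps)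
   have "supp (partial_deriv l \<phi>) = supp \<phi> \<inter> supp (partial_deriv l \<phi>)" using supp_partial_deriv_subset by blast
   then show "compact (supp (partial_deriv l \<phi>))"
    using compact_Int_closed[OF Suc.prems(2), of "supp (partial_deriv l \<phi>)"] by (simp add: supp_def)
  qed
  moreover have "((\<lambda>x. complex_of_real (\<phi> x)) has_derivative (\<lambda>h. \<Sum>l\<in>UNIV. h $ l *\<^sub>R complex_of_real (partial_deriv l \<phi> x))) (at x)" for x
   using bounded_linear.has_derivative[OF bounded_linear_of_real has_derivative_partial_deriv[OF diff[OF Suc.prems(1)]], of x]
   by (simp add: scaleR_conv_of_real)
  ultimately show ?case
   unfolding ubd.simps using bd[OF Suc.prems]
   by (intro conjI exI[of _ ?F']) blast+
 }
qed

text \<open>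
  Quotients such as \<open>\<phi> / \<Phi>\<close> are controlled only near the support of the
  numerator. Since the function vanishes off the closed set \<open>T\<close> inside the open set
  \<open>S\<close>, its derivatives do too, and all bounds hold globally.
\<close>

lemma ubd_extend_zero:
 fixes F :: "'i => 'n::finite rvec => complex"
 assumes "ubd k I S F" and S: "open S" and T: "closed T" "T \<subseteq> S" and z: "\<And>i x. i \<in> I ==> x \<notin> T ==> F i x = 0"
 shows "ubd k I UNIV F"
 using assms(1) z
proof (induction k arbitrary: F)
 have bd: "\<exists>C. \<forall>i\<in>I. \<forall>x\<in>UNIV. cmod (F i x) \<le> C"
  if "\<exists>C. \<forall>i\<in>I. \<forall>x\<in>S. cmod (F i x) \<le> C" and z: "\<And>i x. i \<in> I ==> x \<notin> T ==> F i x = 0" for F :: "'i => 'n rvec => complex"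
 proof -
  from that obtain C where C: "\<And>i x. i \<in> I ==> x \<in> S ==> cmod (F i x) \<le> C" by blast
  have "cmod (F i x) \<le> \<bar>C\<bar>" if "i \<in> I" for i x
   using C[OF that, of x] z[OF that, of x] T(2) by (cases "x \<in> T") (auto intro: order.trans[OF _ abs_ge_self])
  then show ?thesis by blast
 qed
 {
  case 0
  have "\<exists>C. \<forall>i\<in>I. \<forall>x\<in>S. cmod (F i x) \<le> C" using 0(1) unfolding ubd.simps .
  from bd[OF this 0(2)] show ?case unfolding ubd.simps .
 next
  case (Suc k)
  from Suc.prems(1) obtain F' where F': "\<And>i x. i \<in> I ==> x \<in> S ==> (F i has_derivative (\<lambda>h. \<Sum>l\<in>UNIV. h $ l *\<^sub>R F' l i x)) (at x)" "\<And>l. ubd k I S (F' l)"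
   by (rule ubd_SucE) blast
  define G where "G l i x = (if x \<in> S then F' l i x else 0)" for l i x
  have zd: "(F i has_derivative (\<lambda>h. 0)) (at x)" if "i \<in> I" "x \<notin> T" for i x
  proof (rule has_derivative_transform_within_open[OF _ open_Compl[OF T(1)]])
   show "((\<lambda>x. 0) has_derivative (\<lambda>h. 0)) (at x)" by simp
  qed (use that T Suc.prems(2) in auto)
  have Gz: "G l i x = 0" if "i \<in> I" "x \<notin> T" for l i x
  proof (cases "x \<in> S")
   case True
   have "(\<lambda>h. \<Sum>l\<in>UNIV. h $ l *\<^sub>R F' l i x) = (\<lambda>h. 0)"
    by (rule has_derivative_unique[OF F'(1)[OF that(1) True] zd[OF that]])
   from fun_cong[OF this, of "axis l 1"] have "F' l i x = 0"
    by (simp add: axis_def if_distrib[of "\<lambda>c. c *\<^sub>R _"] cong: if_cong)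
   then show ?thesis by (simp add: G_def)
  qed (simp add: G_def)
  have "(F i has_derivative (\<lambda>h. \<Sum>l\<in>UNIV. h $ l *\<^sub>R G l i x)) (at x)" if "i \<in> I" for i x
  proof (cases "x \<in> S")
   case True then show ?thesis using F'(1)[OF that True] by (simp add: G_def)
  next
   case False
   then have "x \<notin> T" using T by auto
   from zd[OF that this] show ?thesis using False by (simp add: G_def)
  qed
  moreover have "ubd k I UNIV (G l)" for l
  proof (rule Suc.IH)
   show "ubd k I S (G l)" by (rule ubd_cong[OF S F'(2)[of l]]) (simp add: G_def)
  qed (rule Gz)
  ultimately show ?case
   using bd[OF ubd_bounded[OF Suc.prems(1)] Suc.prems(2)] unfolding ubd.simps by (intro conjI exI[of _ G]) auto
 }
qed

lemma integrable_bounded_supp: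
 fixes F :: "'n::finite rvec => complex"
 assumes F: "F \<in> borel_measurable borel" "\<And>x. cmod (F x) \<le> C" "\<And>x. x \<notin> T ==> F x = 0" and T: "compact T"
 shows "integrable lborel F" "cmod (\<integral>x. F x \<partial>lborel) \<le> C * measure lborel T"
proof -
 have fin: "emeasure lborel T < \<infinity>" using T by (rule emeasure_compact_finite)
 have Tm: "T \<in> sets lborel" using T by (simp add: borel_compact)
 have i: "integrable lborel (\<lambda>x. C * indicat_real T x)"
  by (intro integrable_mult_right integrable_real_indicator Tm fin)
 have le: "cmod (F x) \<le> C * indicat_real T x" for x
  using F(2)[of x] F(3)[of x] by (cases "x \<in> T") auto
 show "integrable lborel F"
 proof (rule Bochner_Integration.integrable_bound[OF i])
  show "AE x in lborel. norm (F x) \<le> norm (C * indicat_real T x)"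
   by (intro AE_I2) (metis le abs_ge_self order.trans real_norm_def)
 qed (use F in simp)
 then have "cmod (\<integral>x. F x \<partial>lborel) \<le> (\<integral>x. C * indicat_real T x \<partial>lborel)"
  by (intro Bochner_Integration.integral_norm_bound_integral i le)
 also have "\<dots> = C * measure lborel T" using Tm by simp
 finally show "cmod (\<integral>x. F x \<partial>lborel) \<le> C * measure lborel T" .
qed

lemma vector_derivative_quotient:
 fixes f :: "real => 'a::real_normed_vector"
 assumes d: "(f has_vector_derivative D) (at 0)" and e: "e \<longlonglongrightarrow> 0" "\<And>m::nat. e m \<noteq> 0"
 shows "(\<lambda>m. (1 / e m) *\<^sub>R (f (e m) - f 0)) \<longlonglongrightarrow> D"
proof -
 have "(\<lambda>h. norm (f (0 + h) - f 0 - h *\<^sub>R D) / norm h) \<midarrow>0\<rightarrow> 0"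
  using d unfolding has_vector_derivative_def has_derivative_at by blast
 then have "(\<lambda>m. norm (f (0 + e m) - f 0 - e m *\<^sub>R D) / norm (e m)) \<longlonglongrightarrow> 0"
  using e unfolding tendsto_at_iff_sequentially by (auto simp: o_def)
 moreover have "norm (f (0 + e m) - f 0 - e m *\<^sub>R D) / norm (e m) = norm ((1 / e m) *\<^sub>R (f (e m) - f 0) - D)" for m
 proof -
  have "(1 / e m) *\<^sub>R (f (e m) - f 0) - D = (1 / e m) *\<^sub>R (f (0 + e m) - f 0 - e m *\<^sub>R D)"
   using e(2)[of m] by (simp add: scaleR_diff_right)
  then show ?thesis by (simp add: divide_inverse mult.commute)
 qed
 ultimately have "(\<lambda>m. norm ((1 / e m) *\<^sub>R (f (e m) - f 0) - D)) \<longlonglongrightarrow> 0" by simp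
 then have "(\<lambda>m. (1 / e m) *\<^sub>R (f (e m) - f 0) - D) \<longlonglongrightarrow> 0" by (rule tendsto_norm_zero_cancel)
 then show ?thesis by (simp add: LIM_zero_iff)
qed

text \<open>
  Integration by parts without boundary terms: translation invariance makes the integral of every
  difference quotient zero, and dominated convergence passes to the derivative.
\<close>

lemma integral_derivative_zero:
 fixes F :: "'n::finite rvec => complex"
 assumes d: "\<And>x. (F has_derivative (\<lambda>h. \<Sum>l\<in>UNIV. h $ l *\<^sub>R F' l x)) (at x)"
  and b: "\<And>x. cmod (F' i x) \<le> C" and bF: "\<And>x. cmod (F x) \<le> C"
  and z: "\<And>x. x \<notin> T ==> F x = 0" and T: "compact T"
  and m: "F' i \<in> borel_measurable borel"
 shows "(\<integral>x. F' i x \<partial>lborel) = 0"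
proof -
 have cont: "continuous_on UNIV F"
  using d by (intro continuous_at_imp_continuous_on ballI) (rule has_derivative_continuous)
 have [measurable]: "F \<in> borel_measurable borel" by (rule borel_measurable_continuous_onI[OF cont])
 have iF: "integrable lborel F" by (rule integrable_bounded_supp(1)[OF _ bF z T]) simp
 define e where "e m = 1 / real (Suc m)" for m
 have e: "0 < e m" "e m \<le> 1" for m by (auto simp: e_def)
 have e0: "e \<longlonglongrightarrow> 0" unfolding e_def by (rule LIMSEQ_Suc[OF lim_1_over_n])
 define a where "a = (axis i 1 :: 'n rvec)"
 have na: "norm a = 1" by (simp add: a_def)
 have line: "((\<lambda>t. F (x + t *\<^sub>R a)) has_vector_derivative F' i (x + t *\<^sub>R a)) (at t)" for x t
 proof -
  have 1: "((\<lambda>t. x + t *\<^sub>R a) has_derivative (\<lambda>t. t *\<^sub>R a)) (at t)" by (auto intro!: derivative_eq_intros)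
  have "((\<lambda>t. F (x + t *\<^sub>R a)) has_derivative (\<lambda>s. \<Sum>l\<in>UNIV. (s *\<^sub>R a) $ l *\<^sub>R F' l (x + t *\<^sub>R a))) (at t)"
   using has_derivative_compose[OF 1 d] .
  moreover have "(\<Sum>l\<in>UNIV. (s *\<^sub>R a) $ l *\<^sub>R F' l (x + t *\<^sub>R a)) = s *\<^sub>R F' i (x + t *\<^sub>R a)" for s
  proof -
   have "(\<Sum>l\<in>UNIV. (s *\<^sub>R a) $ l *\<^sub>R F' l (x + t *\<^sub>R a)) = (\<Sum>l\<in>UNIV. if l = i then s *\<^sub>R F' i (x + t *\<^sub>R a) else 0)"
    by (rule sum.cong) (auto simp: a_def axis_def)
   then show ?thesis by simp
  qed
  ultimately show ?thesis by (simp add: has_vector_derivative_def)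
 qed
 define G where "G m x = (1 / e m) *\<^sub>R (F (x + e m *\<^sub>R a) - F x)" for m x
 have tr: "F (x + e m *\<^sub>R a) = F (e m *\<^sub>R a + x)" for x m by (simp add: add.commute)
 have iFt: "integrable lborel (\<lambda>x. F (x + e m *\<^sub>R a))" for m
  using integrable_scale[OF iF, of 1 "e m *\<^sub>R a"] unfolding tr by simp
 have G0: "(\<integral>x. G m x \<partial>lborel) = 0" for m
 proof -
  have "(\<integral>x. F (x + e m *\<^sub>R a) \<partial>lborel) = (\<integral>x. F x \<partial>lborel)"
   unfolding tr by (rule integral_lborel_translate) simp
  then show ?thesis unfolding G_def by (simp add: Bochner_Integration.integral_diff[OF iFt iF])
 qed
 obtain R where R: "\<And>x. x \<in> T ==> norm x \<le> R" using compact_imp_bounded[OF T] unfolding bounded_iff by blast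
 have lip: "cmod (F (x + t *\<^sub>R a) - F x) \<le> C * \<bar>t\<bar>" for x t
 proof -
  have "cmod ((\<lambda>t. F (x + t *\<^sub>R a)) t - (\<lambda>t. F (x + t *\<^sub>R a)) 0) \<le> C * norm (t - 0)"
  proof (rule differentiable_bound[OF convex_UNIV])
   fix s :: real
   show "((\<lambda>t. F (x + t *\<^sub>R a)) has_derivative (\<lambda>u. u *\<^sub>R F' i (x + s *\<^sub>R a))) (at s within UNIV)"
    using line by (simp add: has_vector_derivative_def)
   show "onorm (\<lambda>u. u *\<^sub>R F' i (x + s *\<^sub>R a)) \<le> C"
   proof (rule onorm_le)
    fix u :: real
    show "norm (u *\<^sub>R F' i (x + s *\<^sub>R a)) \<le> C * norm u"
     using mult_left_mono[OF b[of "x + s *\<^sub>R a"] abs_ge_zero[of u]] by (simp add: mult.commute)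
   qed
  qed auto
  then show ?thesis by simp
 qed
 have Gle: "cmod (G m x) \<le> C * indicat_real (cball 0 (R + 1)) x" for m x
 proof (cases "x \<in> cball 0 (R + 1)")
  case True
  have "cmod (F (x + e m *\<^sub>R a) - F x) \<le> C * e m" using lip[of x "e m"] e(1)[of m] by simp
  moreover have "cmod (G m x) = (1 / e m) * cmod (F (x + e m *\<^sub>R a) - F x)"
   unfolding G_def norm_scaleR using e(1)[of m] by simp
  ultimately have "cmod (G m x) \<le> C" using e(1)[of m] by (simp add: pos_divide_le_eq)
  then show ?thesis using True by simp
 next
  case False
  then have n: "norm x > R + 1" by simp
  have "norm (x + e m *\<^sub>R a) \<ge> norm x - norm (e m *\<^sub>R a)" using norm_diff_ineq by blast
  moreover have "norm (e m *\<^sub>R a) \<le> 1" using e[of m] na by simp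
  ultimately have "norm (x + e m *\<^sub>R a) > R" using n by linarith
  then have "F (x + e m *\<^sub>R a) = 0" using z R by force
  moreover have "F x = 0" using z R n by force
  ultimately show ?thesis using False by (simp add: G_def)
 qed
 have "(\<lambda>m. \<integral>x. G m x \<partial>lborel) \<longlonglongrightarrow> (\<integral>x. F' i x \<partial>lborel)"
 proof (rule integral_dominated_convergence[where w = "\<lambda>x. C * indicat_real (cball 0 (R + 1)) x"])
  show "integrable lborel (\<lambda>x::'n rvec. C * indicat_real (cball 0 (R + 1)) x)"
   using emeasure_compact_finite[OF compact_cball[of "0::'n rvec" "R + 1"]]
   by (intro integrable_mult_right integrable_real_indicator) simp_all
  show "F' i \<in> borel_measurable lborel" using m by simp
  show "G n \<in> borel_measurable lborel" for n unfolding G_def by measurable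
  show "AE x in lborel. (\<lambda>m. G m x) \<longlonglongrightarrow> F' i x"
  proof (rule AE_I2)
   fix x
   have "((\<lambda>t. F (x + t *\<^sub>R a)) has_vector_derivative F' i x) (at 0)" using line[of x 0] by simp
   from vector_derivative_quotient[OF this e0] e(1)
   have "(\<lambda>m. (1 / e m) *\<^sub>R (F (x + e m *\<^sub>R a) - F (x + 0 *\<^sub>R a))) \<longlonglongrightarrow> F' i x"
    by (simp add: less_imp_neq[symmetric])
   then show "(\<lambda>m. G m x) \<longlonglongrightarrow> F' i x" by (simp add: G_def)
  qed
  show "AE x in lborel. norm (G m x) \<le> C * indicat_real (cball 0 (R + 1)) x" for m using Gle by (intro AE_I2)
 qed
 then show ?thesis by (simp add: G0 LIMSEQ_const_iff)
qed

section \<open>Uniform integrability of inverse Fourier transforms\<close>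

lemma inv_fourier_eq_fourier: "inv_fourier F x = fourier F (- x)"
proof -
 have "\<i> * of_real (lorentz x w) = - \<i> * of_real (lorentz w (- x))" for w :: "'a rvec"
  using lorentz_commute[of w "- x"] by (simp add: lorentz_minus_left)
 then show ?thesis unfolding inv_fourier_def fourier_eq by simp
qed

text \<open>
  One integration by parts turns a factor \<open>x\<^sub>l\<close> into a derivative of
  \<open>F\<close>.
\<close>

lemma inv_fourier_by_parts:
 fixes F :: "'n::{finite,linorder} rvec => complex"
 assumes d: "\<And>x. (F has_derivative (\<lambda>h. \<Sum>l\<in>UNIV. h $ l *\<^sub>R F' l x)) (at x)"
  and F'm: "F' l \<in> borel_measurable borel" and b: "\<And>x. cmod (F' l x) \<le> C" "\<And>x. cmod (F x) \<le> C"
  and z: "\<And>x. x \<notin> T ==> F x = 0" "\<And>x. x \<notin> T ==> F' l x = 0" and T: "compact T"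
 shows "\<bar>x $ l\<bar> * cmod (inv_fourier F x) = cmod (inv_fourier (F' l) x)"
proof -
 define e where "e w = exp (\<i> * complex_of_real (lorentz x w))" for w
 have em[measurable]: "e \<in> borel_measurable borel" unfolding e_def by measurable
 have ce: "cmod (e w) = 1" for w by (simp add: e_def)
 have cont: "continuous_on UNIV F"
  using d by (intro continuous_at_imp_continuous_on ballI) (rule has_derivative_continuous)
 have Fm[measurable]: "F \<in> borel_measurable borel" by (rule borel_measurable_continuous_onI[OF cont])
 note F'm[measurable]
 define G' where "G' r w = F w * (e w * (\<i> * of_real (lsign r * x $ r))) + F' r w * e w" for r w
 have le: "((\<lambda>w. lorentz x w) has_derivative (\<lambda>h. lorentz x h)) (at w)" for w
 proof -
  have "bounded_linear (\<lambda>h. lorentz x h)"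
   by (rule bounded_linear_intro[where K = "norm x"])
     (use abs_lorentz_le[of x] in \<open>auto simp: lorentz_add_right lorentz_scaleR_right mult.commute\<close>)
  then show ?thesis by (rule bounded_linear_imp_has_derivative)
 qed
 have de: "(e has_derivative (\<lambda>h. e w * (\<i> * of_real (lorentz x h)))) (at w)" for w
 proof -
  have 1: "((\<lambda>w. \<i> * complex_of_real (lorentz x w)) has_derivative (\<lambda>h. \<i> * complex_of_real (lorentz x h))) (at w)"
   by (intro has_derivative_mult_right has_derivative_of_real le)
  have 2: "(exp has_derivative (\<lambda>h. exp (\<i> * complex_of_real (lorentz x w)) * h)) (at (\<i> * complex_of_real (lorentz x w)))"
   using DERIV_exp[of "\<i> * complex_of_real (lorentz x w)"] by (simp only: has_field_derivative_def)
  show ?thesis using has_derivative_compose[OF 1 2] unfolding e_def[abs_def] .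
 qed
 have dG: "((\<lambda>w. F w * e w) has_derivative (\<lambda>h. \<Sum>r\<in>UNIV. h $ r *\<^sub>R G' r w)) (at w)" for w
 proof -
  have "((\<lambda>w. F w * e w) has_derivative (\<lambda>h. F w * (e w * (\<i> * of_real (lorentz x h))) + (\<Sum>r\<in>UNIV. h $ r *\<^sub>R F' r w) * e w)) (at w)"
   by (rule has_derivative_mult[OF d de])
  moreover have "(\<lambda>h. F w * (e w * (\<i> * of_real (lorentz x h))) + (\<Sum>r\<in>UNIV. h $ r *\<^sub>R F' r w) * e w) = (\<lambda>h. \<Sum>r\<in>UNIV. h $ r *\<^sub>R G' r w)"
  proof
   fix h
   have "F w * (e w * (\<i> * of_real (lorentz x h))) = (\<Sum>r\<in>UNIV. h $ r *\<^sub>R (F w * (e w * (\<i> * of_real (lsign r * x $ r)))))"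
    unfolding lorentz_sum by (simp add: sum_distrib_left scaleR_conv_of_real mult_ac)
   moreover have "(\<Sum>r\<in>UNIV. h $ r *\<^sub>R F' r w) * e w = (\<Sum>r\<in>UNIV. h $ r *\<^sub>R (F' r w * e w))"
    by (simp add: sum_distrib_right)
   ultimately show "F w * (e w * (\<i> * of_real (lorentz x h))) + (\<Sum>r\<in>UNIV. h $ r *\<^sub>R F' r w) * e w = (\<Sum>r\<in>UNIV. h $ r *\<^sub>R G' r w)"
    unfolding G'_def scaleR_add_right sum.distrib by (simp only:)
  qed
  ultimately show ?thesis by simp
 qed
 have C0: "C \<ge> 0" using b(2)[of 0] norm_ge_zero order.trans by blast
 have G'm: "G' l \<in> borel_measurable borel" unfolding G'_def by measurable
 have "(\<integral>w. G' l w \<partial>lborel) = 0"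
 proof (rule integral_derivative_zero[OF dG _ _ _ T G'm, where C = "C * \<bar>x $ l\<bar> + C"])
  fix w
  have "cmod (G' l w) \<le> cmod (F w) * \<bar>x $ l\<bar> + cmod (F' l w)"
   unfolding G'_def by (rule order.trans[OF norm_triangle_ineq]) (simp add: norm_mult ce lsign_def)
  also have "\<dots> \<le> C * \<bar>x $ l\<bar> + C" by (intro add_mono mult_right_mono b) auto
  finally show "cmod (G' l w) \<le> C * \<bar>x $ l\<bar> + C" .
  show "cmod (F w * e w) \<le> C * \<bar>x $ l\<bar> + C"
   using b(2)[of w] C0 by (simp add: norm_mult ce add_increasing)
  show "F w * e w = 0" if "w \<notin> T" using z that by simp
 qed
 moreover have i1: "integrable lborel (\<lambda>w. F w * e w)"
  by (rule integrable_bounded_supp(1)[of _ C T]) (use b z T in \<open>auto simp: norm_mult ce\<close>)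
 moreover have i2: "integrable lborel (\<lambda>w. F' l w * e w)"
  by (rule integrable_bounded_supp(1)[of _ C T]) (use b z T in \<open>auto simp: norm_mult ce\<close>)
 moreover have "(\<integral>w. G' l w \<partial>lborel) = (\<i> * of_real (lsign l * x $ l)) * (\<integral>w. F w * e w \<partial>lborel) + (\<integral>w. F' l w * e w \<partial>lborel)"
 proof -
  have "(\<lambda>w. G' l w) = (\<lambda>w. (\<i> * of_real (lsign l * x $ l)) * (F w * e w) + F' l w * e w)"
   unfolding G'_def by (rule ext) (simp only: mult_ac)
  then have "(\<integral>w. G' l w \<partial>lborel) = (\<integral>w. (\<i> * of_real (lsign l * x $ l)) * (F w * e w) + F' l w * e w \<partial>lborel)" by simp
  also have "\<dots> = (\<integral>w. (\<i> * of_real (lsign l * x $ l)) * (F w * e w) \<partial>lborel) + (\<integral>w. F' l w * e w \<partial>lborel)"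
   by (rule Bochner_Integration.integral_add[OF integrable_mult_right[OF i1] i2])
  finally show ?thesis by (simp only: integral_mult_right_zero)
 qed
 ultimately have "(\<integral>w. F' l w * e w \<partial>lborel) = - ((\<i> * of_real (lsign l * x $ l)) * (\<integral>w. F w * e w \<partial>lborel))"
  by (simp add: eq_neg_iff_add_eq_0 add.commute)
 then have "cmod (\<integral>w. F' l w * e w \<partial>lborel) = \<bar>x $ l\<bar> * cmod (\<integral>w. F w * e w \<partial>lborel)"
  by (simp add: norm_mult lsign_def)
 then show ?thesis
  unfolding inv_fourier_def e_def using fcst_pos[where 'n = 'n] by (simp add: norm_mult)
qed

lemma inv_fourier_coord_decay:
 fixes F :: "'i => 'n::{finite,linorder} rvec => complex"
 assumes "ubd (Suc k) I UNIV F" and "\<And>i x. i \<in> I ==> x \<notin> T ==> F i x = 0" and T: "compact T"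
 shows "\<exists>C. \<forall>i\<in>I. \<forall>x l. \<bar>x $ l\<bar> ^ k * cmod (inv_fourier (F i) x) \<le> C"
 using assms(1,2)
proof (induction k arbitrary: F)
 case 0
 from 0(1) obtain F' where F': "\<And>i x. i \<in> I ==> x \<in> UNIV ==> (F i has_derivative (\<lambda>h. \<Sum>l\<in>UNIV. h $ l *\<^sub>R F' l i x)) (at x)" "\<And>l. ubd 0 I UNIV (F' l)"
  by (rule ubd_SucE) blast
 obtain C where C: "\<And>i x. i \<in> I ==> cmod (F i x) \<le> C" using ubd_bounded[OF 0(1)] by blast
 have "cmod (inv_fourier (F i) x) \<le> fcst TYPE('n) * (C * measure lborel T)" if "i \<in> I" for i x
 proof -
  have cont: "continuous_on UNIV (F i)"
   by (intro continuous_at_imp_continuous_on ballI) (rule has_derivative_continuous, rule F'(1)[OF that UNIV_I])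
  have Fm[measurable]: "F i \<in> borel_measurable borel" by (rule borel_measurable_continuous_onI[OF cont])
  have "cmod (\<integral>w. F i w * exp (\<i> * of_real (lorentz x w)) \<partial>lborel) \<le> C * measure lborel T"
   by (rule integrable_bounded_supp(2)) (use C[OF that] 0(2)[OF that] T in \<open>auto simp: norm_mult\<close>)
  then show ?thesis unfolding inv_fourier_def using fcst_pos[where 'n = 'n] by (simp add: norm_mult)
 qed
 then show ?case by (intro exI[of _ "fcst TYPE('n) * (C * measure lborel T)"]) simp
next
 case (Suc k)
 from Suc.prems(1) obtain F' where F': "\<And>i x. i \<in> I ==> x \<in> UNIV ==> (F i has_derivative (\<lambda>h. \<Sum>l\<in>UNIV. h $ l *\<^sub>R F' l i x)) (at x)" "\<And>l. ubd (Suc k) I UNIV (F' l)"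
  by (rule ubd_SucE) blast
 have z': "F' l i x = 0" if "i \<in> I" "x \<notin> T" for l i x
 proof -
  have "(F i has_derivative (\<lambda>h. 0)) (at x)"
  proof (rule has_derivative_transform_within_open[OF _ open_Compl[OF compact_imp_closed[OF T]]])
   show "((\<lambda>x. 0) has_derivative (\<lambda>h. 0)) (at x)" by simp
  qed (use that T Suc.prems(2) in \<open>auto intro: compact_imp_closed\<close>)
  from fun_cong[OF has_derivative_unique[OF F'(1)[OF that(1) UNIV_I] this], of "axis l 1"]
  show ?thesis by (simp add: axis_def if_distrib[of "\<lambda>c. c *\<^sub>R _"] cong: if_cong)
 qed
 have "\<exists>C. \<forall>i\<in>I. \<forall>x r. \<bar>x $ r\<bar> ^ k * cmod (inv_fourier (F' l i) x) \<le> C" for l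
  by (rule Suc.IH[OF F'(2) z'])
 then have "\<forall>l. \<exists>C. \<forall>i\<in>I. \<forall>x r. \<bar>x $ r\<bar> ^ k * cmod (inv_fourier (F' l i) x) \<le> C" by blast
 from choice[OF this] obtain C where C: "\<And>l i x r. i \<in> I ==> \<bar>x $ r\<bar> ^ k * cmod (inv_fourier (F' l i) x) \<le> C l" by blast
 obtain D where D: "\<And>i x. i \<in> I ==> cmod (F i x) \<le> D" using ubd_bounded[OF Suc.prems(1)] by blast
 have "\<bar>x $ l\<bar> ^ Suc k * cmod (inv_fourier (F i) x) \<le> (\<Sum>l\<in>UNIV. \<bar>C l\<bar>)" if i: "i \<in> I" for i x l
 proof -
  obtain D' where D': "\<And>i x. i \<in> I ==> cmod (F' l i x) \<le> D'" using ubd_bounded[OF F'(2)] by blast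
  obtain F'' where F'': "\<And>i x. i \<in> I ==> x \<in> UNIV ==> (F' l i has_derivative (\<lambda>h. \<Sum>r\<in>UNIV. h $ r *\<^sub>R F'' r i x)) (at x)"
   using F'(2)[of l] by (rule ubd_SucE) blast
  have cont: "continuous_on UNIV (F' l i)"
   by (intro continuous_at_imp_continuous_on ballI) (rule has_derivative_continuous, rule F''[OF i UNIV_I])
  have "\<bar>x $ l\<bar> * cmod (inv_fourier (F i) x) = cmod (inv_fourier (F' l i) x)"
  proof (rule inv_fourier_by_parts[OF F'(1)[OF i UNIV_I] borel_measurable_continuous_onI[OF cont] _ _ _ _ T, where C = "max D D'"])
   show "cmod (F' l i x) \<le> max D D'" "cmod (F i x) \<le> max D D'" for x using D[OF i, of x] D'[OF i, of x] by auto
  qed (use Suc.prems(2)[OF i] z'[OF i] in auto)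
  then have "\<bar>x $ l\<bar> ^ Suc k * cmod (inv_fourier (F i) x) = \<bar>x $ l\<bar> ^ k * cmod (inv_fourier (F' l i) x)"
   by (simp only: power_Suc2 mult.assoc)
  also have "\<dots> \<le> C l" by (rule C[OF i])
  also have "\<dots> \<le> \<bar>C l\<bar>" by simp
  also have "\<dots> \<le> (\<Sum>l\<in>UNIV. \<bar>C l\<bar>)" by (rule member_le_sum) auto
  finally show ?thesis .
 qed
 then show ?case by blast
qed

text \<open>
  Integrating by parts sufficiently often bounds \<open>(1 + norm x) ^ k\<close> times the inverse
  transform, with constants depending only on the bounds of the family and on \<open>T\<close>. In
  particular the \<open>L\<^sup>1\<close> norms of the kernels are uniformly bounded; this is the
  source of the uniform constants for multipliers at all scales.
\<close>

theorem inv_fourier_uniform_decay: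
 fixes F :: "'i => 'n::{finite,linorder} rvec => complex"
 assumes u: "\<And>k. ubd k I UNIV F" and z: "\<And>i x. i \<in> I ==> x \<notin> T ==> F i x = 0" and T: "compact T"
 obtains C where "\<And>i. i \<in> I ==> integrable lborel (F i)" "\<And>i. i \<in> I ==> rapid (inv_fourier (F i))"
  "\<And>i. i \<in> I ==> (\<integral>x. cmod (inv_fourier (F i) x) \<partial>lborel) \<le> C"
proof -
 have meas: "F i \<in> borel_measurable borel" if "i \<in> I" for i
 proof -
  from u[of "Suc 0"] obtain F' where F': "\<And>i x. i \<in> I ==> x \<in> UNIV ==> (F i has_derivative (\<lambda>h. \<Sum>l\<in>UNIV. h $ l *\<^sub>R F' l i x)) (at x)" "\<And>l. ubd 0 I UNIV (F' l)"
   by (rule ubd_SucE) blast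
  have "continuous_on UNIV (F i)"
   by (intro continuous_at_imp_continuous_on ballI) (rule has_derivative_continuous, rule F'(1)[OF that UNIV_I])
  then show ?thesis by (rule borel_measurable_continuous_onI)
 qed
 obtain D where D: "\<And>i x. i \<in> I ==> cmod (F i x) \<le> D" using ubd_bounded[OF u[of 0]] by blast
 have int: "integrable lborel (F i)" if "i \<in> I" for i
  by (rule integrable_bounded_supp(1)[OF meas[OF that] D[OF that] z[OF that] T])
 have rF: "rapid (F i)" if i: "i \<in> I" for i
  unfolding rapid_def
 proof (intro conjI meas[OF i] allI)
  fix k
  obtain R where R: "\<And>x. x \<in> T ==> norm x \<le> R" using compact_imp_bounded[OF T] unfolding bounded_iff by blast
  have "(1 + norm x) ^ k * cmod (F i x) \<le> (1 + \<bar>R\<bar>) ^ k * \<bar>D\<bar>" for x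
  proof (cases "x \<in> T")
   case True
   then have "1 + norm x \<le> 1 + \<bar>R\<bar>" using R[OF True] by linarith
   then show ?thesis using D[OF i, of x] by (intro mult_mono power_mono) auto
  qed (use z[OF i] in auto)
  then show "\<exists>C. \<forall>x. (1 + norm x) ^ k * cmod (F i x) \<le> C" by blast
 qed
 have dec: "\<exists>C. \<forall>i\<in>I. \<forall>x. (1 + norm x) ^ k * cmod (inv_fourier (F i) x) \<le> C" for k
 proof -
  obtain C where C: "\<And>i x l. i \<in> I ==> \<bar>x $ l\<bar> ^ k * cmod (inv_fourier (F i) x) \<le> C"
   using inv_fourier_coord_decay[OF u z T] by blast
  obtain C0 where C0: "\<And>i x l. i \<in> I ==> \<bar>x $ l\<bar> ^ 0 * cmod (inv_fourier (F i) x) \<le> C0"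
   using inv_fourier_coord_decay[OF u z T] by blast
  have "(1 + norm x) ^ k * cmod (inv_fourier (F i) x) \<le> (1 + real CARD('n)) ^ k * (C0 + C)" if i: "i \<in> I" for i x
  proof -
   have "finite (range (\<lambda>l. \<bar>x $ l\<bar>))" "range (\<lambda>l. \<bar>x $ l\<bar>) \<noteq> {}" by auto
   from Max_in[OF this] obtain l where l': "Max (range (\<lambda>l. \<bar>x $ l\<bar>)) = \<bar>x $ l\<bar>" by blast
   have l: "\<bar>x $ r\<bar> \<le> \<bar>x $ l\<bar>" for r unfolding l'[symmetric] by (rule Max_ge) auto
   have "norm x \<le> (\<Sum>r\<in>UNIV. \<bar>x $ r\<bar>)" by (rule norm_le_l1_cart)
   also have "\<dots> \<le> (\<Sum>r\<in>(UNIV::'n set). \<bar>x $ l\<bar>)" by (intro sum_mono l)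
   finally have nx: "norm x \<le> real CARD('n) * \<bar>x $ l\<bar>" by simp
   define M where "M = max 1 \<bar>x $ l\<bar>"
   have "1 + norm x \<le> 1 * M + real CARD('n) * M"
    using nx by (intro add_mono order.trans[OF nx] mult_left_mono) (auto simp: M_def)
   then have "1 + norm x \<le> (1 + real CARD('n)) * M" by (simp add: distrib_right)
   then have "(1 + norm x) ^ k \<le> ((1 + real CARD('n)) * M) ^ k" by (intro power_mono) auto
   also have "\<dots> = (1 + real CARD('n)) ^ k * M ^ k" by (rule power_mult_distrib)
   also have "\<dots> \<le> (1 + real CARD('n)) ^ k * (1 + \<bar>x $ l\<bar> ^ k)"
    by (intro mult_left_mono) (auto simp: M_def max_def)
   finally have "(1 + norm x) ^ k * cmod (inv_fourier (F i) x) \<le> (1 + real CARD('n)) ^ k * (1 + \<bar>x $ l\<bar> ^ k) * cmod (inv_fourier (F i) x)"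
    by (intro mult_right_mono) auto
   also have "\<dots> = (1 + real CARD('n)) ^ k * (cmod (inv_fourier (F i) x) + \<bar>x $ l\<bar> ^ k * cmod (inv_fourier (F i) x))"
    by (simp only: mult.assoc distrib_right mult_1_left)
   also have "\<dots> \<le> (1 + real CARD('n)) ^ k * (C0 + C)"
    using C0[OF i, of x l] C[OF i, of x l] by (intro mult_left_mono add_mono) auto
   finally show ?thesis .
  qed
  then show ?thesis by blast
 qed
 have im: "inv_fourier (F i) \<in> borel_measurable borel" if "i \<in> I" for i
 proof -
  have "fourier (F i) \<in> borel_measurable borel" by (rule borel_measurable_continuous_onI[OF fourier_continuous[OF rF[OF that]]])
  then have "(\<lambda>x. fourier (F i) (- x)) \<in> borel_measurable borel" by (rule measurable_compose[rotated]) simp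
  then show ?thesis by (simp add: inv_fourier_eq_fourier[abs_def])
 qed
 have rap: "rapid (inv_fourier (F i))" if "i \<in> I" for i
  unfolding rapid_def using im[OF that] dec that by blast
 obtain C where C: "\<And>i x. i \<in> I ==> (1 + norm x) ^ (2 * CARD('n)) * cmod (inv_fourier (F i) x) \<le> C" using dec by blast
 have "(\<integral>x. cmod (inv_fourier (F i) x) \<partial>lborel) \<le> (\<integral>x. C * (1 / (1 + norm x) ^ (2 * CARD('n))) \<partial>(lborel :: 'n rvec measure))" if i: "i \<in> I" for i
 proof (rule integral_mono)
  show "integrable lborel (\<lambda>x. cmod (inv_fourier (F i) x))" by (intro integrable_norm rapid_integrable rap i)
  show "integrable lborel (\<lambda>x::'n rvec. C * (1 / (1 + norm x) ^ (2 * CARD('n))))"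
   by (intro integrable_mult_right integrable_inverse_power_norm)
  fix x :: "'n rvec"
  have p: "(1 + norm x) ^ (2 * CARD('n)) > 0" by (intro zero_less_power add_pos_nonneg) auto
  show "cmod (inv_fourier (F i) x) \<le> C * (1 / (1 + norm x) ^ (2 * CARD('n)))"
   using C[OF i, of x] p by (simp add: pos_le_divide_eq mult.commute)
 qed
 then show ?thesis using that int rap by blast
qed

lemma rapid_linear:
 fixes L :: "'n::finite rmat"
 assumes m: "rapid m" and L: "invertible L" shows "rapid (\<lambda>x. m (L *v x))"
 unfolding rapid_def
proof (intro conjI allI)
 have [measurable]: "m \<in> borel_measurable borel" by (rule rapid_measurable[OF m])
 show "(\<lambda>x. m (L *v x)) \<in> borel_measurable borel" by measurable
 fix k
 obtain C where C: "\<And>x. (1 + norm x) ^ k * cmod (m x) \<le> C" using m unfolding rapid_def by blast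
 obtain A d where A: "A \<ge> 1" "d > 0" "\<And>L' b' x. norm (L' - L) \<le> d ==> norm (b' - 0) \<le> d ==> 1 + norm x \<le> A * (1 + norm (L' *v x + b'))"
  using affine_expansion_bound[OF L] by metis
 have "(1 + norm x) ^ k * cmod (m (L *v x)) \<le> A ^ k * C" for x
 proof -
  have "(1 + norm x) ^ k * cmod (m (L *v x)) \<le> (A * (1 + norm (L *v x))) ^ k * cmod (m (L *v x))"
   using A(2) A(3)[of L 0 x] by (intro mult_right_mono power_mono) auto
  also have "\<dots> \<le> A ^ k * C"
   using C[of "L *v x"] A(1) by (simp add: power_mult_distrib mult.assoc)
  finally show ?thesis .
 qed
 then show "\<exists>C. \<forall>x. (1 + norm x) ^ k * cmod (m (L *v x)) \<le> C" by blast
qed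

lemma three_bounds:
 fixes A B D' p r y :: real
 assumes "\<bar>p\<bar> \<le> B" "\<bar>r\<bar> \<le> D'" "0 \<le> A" "0 \<le> B" "0 \<le> D'"
 shows "y = (r - p) / 2 ==> \<bar>y\<bar> \<le> A + B + D'" "y = (r + p) / 2 ==> \<bar>y\<bar> \<le> A + B + D'"
 using assms by (simp_all add: abs_le_iff)

context forward_cone
begin

section \<open>Properness of the action\<close>

text \<open>
  Boxes of group coordinates exhaust the group and play the part of compact sets; only finitely
  many real inequalities have to be checked for membership.
\<close>

definition hbox :: "real => 'n H_coords set" where
 "hbox R = {(\<gamma>, t, c). exp (- R) \<le> \<gamma> \<and> \<gamma> \<le> exp R \<and> \<bar>t\<bar> \<le> R \<and> (\<forall>i\<in>idx_mid. \<bar>c i\<bar> \<le> R)}"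

lemma hbox_mono: "R \<le> R' ==> hbox R \<subseteq> hbox R'"
 unfolding hbox_def by (auto intro: order.trans[of "exp (- R')" "exp (- R)"] order.trans[of _ "exp R" "exp R'"] order.trans)

lemma hbox_fst: "a \<in> hbox R ==> fst a > 0"
 unfolding hbox_def by (auto intro: less_le_trans[OF exp_gt_zero])

lemma hbox_fst_bounds: "a \<in> hbox R ==> exp (- R) \<le> fst a" "a \<in> hbox R ==> fst a \<le> exp R"
 unfolding hbox_def by auto

lemma hbox_hinv: assumes "a \<in> hbox R" "R \<ge> 0" shows "hinv a \<in> hbox (R * exp R + R)"
proof -
 obtain \<gamma> t c where a: "a = (\<gamma>, t, c)" by (cases a)
 have b: "exp (- R) \<le> \<gamma>" "\<gamma> \<le> exp R" "\<bar>t\<bar> \<le> R" "\<And>i. i \<in> idx_mid ==> \<bar>c i\<bar> \<le> R" using assms by (auto simp: a hbox_def)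
 have R': "R \<le> R * exp R + R" using assms by simp
 have g: "\<gamma> > 0" using b(1) exp_gt_zero[of "- R"] by linarith
 have "exp (- (R * exp R + R)) \<le> exp (- R)" using R' by simp
 also have "\<dots> = 1 / exp R" by (simp add: exp_minus inverse_eq_divide)
 also have "\<dots> \<le> 1 / \<gamma>" using b g by (intro divide_left_mono) auto
 finally have 1: "exp (- (R * exp R + R)) \<le> 1 / \<gamma>" .
 have "1 / \<gamma> \<le> 1 / exp (- R)" using b g by (intro divide_left_mono) auto
 also have "\<dots> = exp R" by (simp add: exp_minus inverse_eq_divide)
 also have "\<dots> \<le> exp (R * exp R + R)" using R' by simp
 finally have 2: "1 / \<gamma> \<le> exp (R * exp R + R)" .
 have "\<bar>exp t * c i\<bar> \<le> R * exp R + R" if "i \<in> idx_mid" for i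
 proof -
  have "\<bar>exp t * c i\<bar> \<le> exp R * R" unfolding abs_mult using b(3) b(4)[OF that] by (intro mult_mono) auto
  then show ?thesis using assms by (simp add: mult.commute)
 qed
 moreover have "\<bar>- t\<bar> \<le> R * exp R + R" using b(3) R' by linarith
 ultimately show ?thesis using 1 2 unfolding a hbox_def by simp
qed

lemma hm_bound: assumes R: "R \<ge> 0"
 obtains C where "C > 0" "\<And>a x. a \<in> hbox R ==> norm (hm a *v x) \<le> C * norm x" "\<And>a i j. a \<in> hbox R ==> \<bar>hm a $ i $ j\<bar> \<le> C"
proof -
 let ?n = "real (card (idx_mid :: 'n set))"
 define C1 where "C1 = exp R * (1 + 2 * R) + exp R * exp R * 2 + exp R * exp R * (2 + ?n * R\<^sup>2 * 2 + 2 * (?n * R))"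
 have C1: "C1 > 0" unfolding C1_def using R by (intro add_pos_nonneg) (auto intro!: mult_pos_pos add_pos_nonneg)
 have comp: "\<bar>(hm a *v x) $ i\<bar> \<le> C1 * norm x" if a: "a \<in> hbox R" for a x i
 proof -
  obtain \<gamma> t c where abc: "a = (\<gamma>, t, c)" by (cases a)
  have b: "0 < \<gamma>" "\<gamma> \<le> exp R" "\<bar>t\<bar> \<le> R" "\<And>i. i \<in> idx_mid ==> \<bar>c i\<bar> \<le> R" using a hbox_fst[OF a] by (auto simp: abc hbox_def)
  have p: "\<bar>lc_p x\<bar> \<le> 2 * norm x" "\<bar>lc_r x\<bar> \<le> 2 * norm x"
   using component_le_norm_cart[of x idx_first] component_le_norm_cart[of x idx_last] by (auto simp: lc_p_def lc_r_def)
  have xi: "\<bar>x $ i\<bar> \<le> norm x" for i by (rule component_le_norm_cart)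
  have mid: "\<bar>(hm a *v x) $ i\<bar> \<le> exp R * (1 + 2 * R) * norm x" if i: "i \<in> idx_mid" for i
  proof -
   have "\<bar>x $ i - c i * lc_p x\<bar> \<le> norm x + R * (2 * norm x)"
    by (rule order.trans[OF abs_triangle_ineq4], unfold abs_mult) (intro add_mono mult_mono xi b(4)[OF i] p; use R in simp)
   then have "\<bar>\<gamma> * (x $ i - c i * lc_p x)\<bar> \<le> exp R * (norm x + R * (2 * norm x))"
    unfolding abs_mult using b by (intro mult_mono) auto
   then show ?thesis using i by (simp add: abc h_mat_mult algebra_simps)
  qed
  have et: "exp t \<le> exp R" "exp (- t) \<le> exp R" using b(3) by auto
  have ge: "\<bar>\<gamma> * exp (- t)\<bar> \<le> exp R * exp R" "\<bar>\<gamma> * exp t\<bar> \<le> exp R * exp R"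
   unfolding abs_mult using b et by (auto intro!: mult_mono)
  have P: "\<bar>lc_p (hm a *v x)\<bar> \<le> exp R * exp R * 2 * norm x"
   using mult_mono[OF ge(1) p(1)] by (simp add: abc h_mat_mult abs_mult mult_ac)
  have D: "\<bar>\<Sum>k\<in>idx_mid. (c k)\<^sup>2\<bar> \<le> ?n * R\<^sup>2"
  proof -
   have "\<bar>\<Sum>k\<in>idx_mid. (c k)\<^sup>2\<bar> \<le> (\<Sum>k\<in>(idx_mid::'n set). R\<^sup>2)"
   proof (rule order.trans[OF sum_abs], rule sum_mono)
    fix k :: 'n assume "k \<in> idx_mid"
    from power_mono[OF b(4)[OF this] abs_ge_zero, of 2] show "\<bar>(c k)\<^sup>2\<bar> \<le> R\<^sup>2" by simp
   qed
   then show ?thesis by simp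
  qed
  have E: "\<bar>\<Sum>k\<in>idx_mid. c k * x $ k\<bar> \<le> ?n * R * norm x"
  proof -
   have "\<bar>\<Sum>k\<in>idx_mid. c k * x $ k\<bar> \<le> (\<Sum>k\<in>(idx_mid::'n set). R * norm x)"
    by (rule order.trans[OF sum_abs], rule sum_mono, unfold abs_mult, rule mult_mono) (use b(4) xi R in auto)
   then show ?thesis by simp
  qed
  have "\<bar>lc_r x + (\<Sum>k\<in>idx_mid. (c k)\<^sup>2) * lc_p x - 2 * (\<Sum>k\<in>idx_mid. c k * x $ k)\<bar> \<le> (2 * norm x + (?n * R\<^sup>2) * (2 * norm x)) + 2 * (?n * R * norm x)"
   by (rule order.trans[OF abs_triangle_ineq4], rule add_mono, rule order.trans[OF abs_triangle_ineq], rule add_mono[OF p(2)],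
     unfold abs_mult, rule mult_mono[OF D p(1)]) (use E in auto)
  note bnd = this
  have "lc_r (hm a *v x) = \<gamma> * exp t * (lc_r x + (\<Sum>k\<in>idx_mid. (c k)\<^sup>2) * lc_p x - 2 * (\<Sum>k\<in>idx_mid. c k * x $ k))"
   by (simp only: abc hm.simps h_mat_mult)
  then have "\<bar>lc_r (hm a *v x)\<bar> = \<bar>\<gamma> * exp t\<bar> * \<bar>lc_r x + (\<Sum>k\<in>idx_mid. (c k)\<^sup>2) * lc_p x - 2 * (\<Sum>k\<in>idx_mid. c k * x $ k)\<bar>"
   by (simp only: abs_mult[of "\<gamma> * exp t"])
  also have "\<dots> \<le> exp R * exp R * ((2 * norm x + (?n * R\<^sup>2) * (2 * norm x)) + 2 * (?n * R * norm x))"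
   by (rule mult_mono[OF ge(2) bnd]) simp_all
  also have "\<dots> = exp R * exp R * (2 + ?n * R\<^sup>2 * 2 + 2 * (?n * R)) * norm x" by (simp add: algebra_simps)
  finally have Q: "\<bar>lc_r (hm a *v x)\<bar> \<le> exp R * exp R * (2 + ?n * R\<^sup>2 * 2 + 2 * (?n * R)) * norm x" .
  have n0: "norm x \<ge> 0" by simp
  have parts: "exp R * (1 + 2 * R) * norm x \<ge> 0" "exp R * exp R * 2 * norm x \<ge> 0" "exp R * exp R * (2 + ?n * R\<^sup>2 * 2 + 2 * (?n * R)) * norm x \<ge> 0"
   using R by auto
  have Cn: "C1 * norm x = exp R * (1 + 2 * R) * norm x + exp R * exp R * 2 * norm x + exp R * exp R * (2 + ?n * R\<^sup>2 * 2 + 2 * (?n * R)) * norm x"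
   unfolding C1_def by (simp only: distrib_right)
  show ?thesis
  proof (cases i rule: idx_cases)
   case 1
   have "(hm a *v x) $ i = (lc_r (hm a *v x) - lc_p (hm a *v x)) / 2" by (simp add: 1 lc_p_def lc_r_def)
   then show ?thesis unfolding Cn by (rule three_bounds(1)[OF P Q parts])
  next
   case 2
   have "(hm a *v x) $ i = (lc_r (hm a *v x) + lc_p (hm a *v x)) / 2" by (simp add: 2 lc_p_def lc_r_def)
   then show ?thesis unfolding Cn by (rule three_bounds(2)[OF P Q parts])
  next
   case 3
   show ?thesis unfolding Cn using add_increasing2[OF parts(3) add_increasing2[OF parts(2) mid[OF 3]]] .
  qed
 qed
 have N: "norm (hm a *v x) \<le> real CARD('n) * C1 * norm x" if "a \<in> hbox R" for a x
 proof -
  have "norm (hm a *v x) \<le> (\<Sum>i\<in>UNIV. \<bar>(hm a *v x) $ i\<bar>)" by (rule norm_le_l1_cart)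
  also have "\<dots> \<le> (\<Sum>i\<in>(UNIV::'n set). C1 * norm x)" by (intro sum_mono comp that)
  finally show ?thesis by simp
 qed
 have n1: "real CARD('n) \<ge> 1" using card2 by simp
 show ?thesis
 proof (rule that[of "real CARD('n) * C1"])
  show "real CARD('n) * C1 > 0" using C1 n1 by simp
  show "\<bar>hm a $ i $ j\<bar> \<le> real CARD('n) * C1" if "a \<in> hbox R" for a i j
  proof -
   have "\<bar>hm a $ i $ j\<bar> \<le> C1" using comp[OF that, of "axis j 1" i] by (simp add: matrix_vector_mult_basis column_def norm_axis_1)
   also have "\<dots> \<le> real CARD('n) * C1" using n1 C1 by simp
   finally show ?thesis .
  qed
 qed (rule N)
qed

lemma lc_scale: "lc_p (s *\<^sub>R y) = s * lc_p y" "lc_r (s *\<^sub>R y) = s * lc_r y"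
 by (simp_all add: lc_p_def lc_r_def algebra_simps)

lemma continuous_lc: "continuous_on S lc_p" "continuous_on S (\<lambda>x::'n rvec. lorentz x x)" "continuous_on S (\<lambda>x::'n rvec. x $ i)"
 unfolding lc_p_def[abs_def] by (auto intro!: continuous_intros)

lemma compact_cone_bounds:
 assumes S: "compact S" "S \<subseteq> light_cone"
 obtains m M where "0 < m" "m \<le> M" "\<And>x i. x \<in> S ==> m \<le> lorentz x x \<and> lorentz x x \<le> M \<and> m \<le> lc_p x \<and> lc_p x \<le> M \<and> \<bar>x $ i\<bar> \<le> M"
proof (cases "S = {}")
 case True then show ?thesis using that[of 1 1] by auto
next
 case False
 have pos: "lorentz x x > 0" "lc_p x > 0" if "x \<in> S" for x using S that by (auto simp: light_cone_iff)
 obtain x1 where x1: "x1 \<in> S" "\<And>x. x \<in> S ==> lorentz x1 x1 \<le> lorentz x x"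
  using continuous_attains_inf[OF S(1) False continuous_lc(2)] by blast
 obtain x2 where x2: "x2 \<in> S" "\<And>x. x \<in> S ==> lc_p x2 \<le> lc_p x"
  using continuous_attains_inf[OF S(1) False continuous_lc(1)] by blast
 obtain B where B: "\<And>x. x \<in> S ==> norm x \<le> B" using compact_imp_bounded[OF S(1)] unfolding bounded_iff by blast
 have B0: "B \<ge> 0" using B[OF x1(1)] norm_ge_zero order.trans by blast
 define m where "m = min (lorentz x1 x1) (lc_p x2)"
 define M where "M = B * B + 2 * B + m"
 have m: "m > 0" using pos x1 x2 by (auto simp: m_def)
 show ?thesis
 proof (rule that[OF m, of M])
  show "m \<le> M" using B0 by (simp add: M_def)
  fix x i assume x: "x \<in> S"
  have "lorentz x x \<le> B * B" using abs_lorentz_le[of x x] mult_mono[OF B[OF x] B[OF x]] B0 by auto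
  moreover have "lc_p x \<le> 2 * B"
   using component_le_norm_cart[of x idx_first] component_le_norm_cart[of x idx_last] B[OF x] by (auto simp: lc_p_def)
  moreover have "\<bar>x $ i\<bar> \<le> B" using component_le_norm_cart[of x i] B[OF x] by linarith
  ultimately show "m \<le> lorentz x x \<and> lorentz x x \<le> M \<and> m \<le> lc_p x \<and> lc_p x \<le> M \<and> \<bar>x $ i\<bar> \<le> M"
   using x1(2)[OF x] x2(2)[OF x] B0 m by (auto simp: m_def M_def intro: add_increasing add_increasing2)
 qed
qed

text \<open>
  If \<open>h\<close> moves a point of one compact set into another, then \<open>\<gamma>\<close>
  is controlled by the quotient of Lorentz squares, \<open>t\<close> by the quotient of the
  light-cone coordinates \<open>lc_p\<close>, and \<open>c\<close> by the middle coordinates.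
\<close>

lemma proper_action:
 assumes S: "compact S" "S \<subseteq> light_cone" and S': "compact S'" "S' \<subseteq> light_cone"
 obtains R where "R > 0" "\<And>a x. fst a > 0 ==> x \<in> S ==> hm a *v x \<in> S' ==> a \<in> hbox R"
proof -
 obtain m1 M1 where 1: "0 < m1" "m1 \<le> M1" "\<And>x i. x \<in> S ==> m1 \<le> lorentz x x \<and> lorentz x x \<le> M1 \<and> m1 \<le> lc_p x \<and> lc_p x \<le> M1 \<and> \<bar>x $ i\<bar> \<le> M1"
  using compact_cone_bounds[OF S] by blast
 obtain m2 M2 where 2: "0 < m2" "m2 \<le> M2" "\<And>x i. x \<in> S' ==> m2 \<le> lorentz x x \<and> lorentz x x \<le> M2 \<and> m2 \<le> lc_p x \<and> lc_p x \<le> M2 \<and> \<bar>x $ i\<bar> \<le> M2"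
  using compact_cone_bounds[OF S'] by blast
 define m where "m = min m1 m2"
 define M where "M = max M1 M2"
 have mM: "0 < m" "m \<le> M" "0 < M" using 1 2 by (auto simp: m_def M_def)
 have B1: "m \<le> lorentz x x" "lorentz x x \<le> M" "m \<le> lc_p x" "lc_p x \<le> M" "\<bar>x $ i\<bar> \<le> M" if "x \<in> S" for x i
  using 1(3)[OF that, of i] by (auto simp: m_def M_def)
 have B2: "m \<le> lorentz x x" "lorentz x x \<le> M" "m \<le> lc_p x" "lc_p x \<le> M" "\<bar>x $ i\<bar> \<le> M" if "x \<in> S'" for x i
  using 2(3)[OF that, of i] by (auto simp: m_def M_def)
 define q where "q = M / m"
 have q: "q \<ge> 1" "q > 0" using mM by (auto simp: q_def)
 have lq: "ln q \<ge> 0" using q by simp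
 define R where "R = 2 * ln q + 2 * (M / m) * q + 1"
 have Mm: "M / m > 0" using mM by simp
 have T0: "2 * (M / m) * q > 0" using Mm q by (intro mult_pos_pos) auto
 have R: "R > 0" "ln q \<le> R" "2 * ln q \<le> R" "2 * (M / m) * q \<le> R" using lq T0 unfolding R_def by linarith+
 show ?thesis
 proof (rule that[OF R(1)])
  fix a x assume a0: "fst a > 0" and x: "x \<in> S" and y: "hm a *v x \<in> S'"
  obtain \<gamma> t c where a: "a = (\<gamma>, t, c)" by (cases a)
  have \<gamma>: "\<gamma> > 0" using a0 a by simp
  have div: "u / v \<le> q" if "0 \<le> u" "u \<le> M" "m \<le> v" for u v using that mM unfolding q_def by (intro frac_le) auto
  have divl: "1 / q \<le> u / v" if "m \<le> u" "v \<le> M" "0 < v" for u v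
  proof -
   have "1 / q = m / M" by (simp add: q_def)
   also have "\<dots> \<le> u / v" using that mM by (intro frac_le) auto
   finally show ?thesis .
  qed
  have le: "lorentz (hm a *v x) (hm a *v x) = \<gamma>\<^sup>2 * lorentz x x" by (simp add: lorentz_hm a del: hm.simps)
  have lx: "lorentz x x > 0" "lc_p x > 0" using B1(1,3)[OF x] mM(1) by linarith+
  have "\<gamma>\<^sup>2 = lorentz (hm a *v x) (hm a *v x) / lorentz x x" using le lx(1) by (metis less_irrefl nonzero_eq_divide_eq)
  then have g2: "1 / q \<le> \<gamma>\<^sup>2" "\<gamma>\<^sup>2 \<le> q"
   using div[of "lorentz (hm a *v x) (hm a *v x)" "lorentz x x"] divl[of "lorentz (hm a *v x) (hm a *v x)" "lorentz x x"] B1[OF x] B2[OF y] mM by auto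
  have lg: "\<bar>ln \<gamma>\<bar> \<le> ln q"
  proof -
   have l2: "ln (\<gamma>\<^sup>2) = 2 * ln \<gamma>" using \<gamma> by (simp add: ln_realpow)
   have "ln (1 / q) \<le> ln (\<gamma>\<^sup>2)" by (rule ln_le_cancel_iff[THEN iffD2, OF _ _ g2(1)]) (use q \<gamma> in auto)
   moreover have "ln (\<gamma>\<^sup>2) \<le> ln q" by (rule ln_le_cancel_iff[THEN iffD2, OF _ _ g2(2)]) (use q \<gamma> in auto)
   moreover have "ln (1 / q) = - ln q" using q by (simp add: ln_div)
   ultimately show ?thesis using lq unfolding l2 by linarith
  qed
  have l1: "- R \<le> ln \<gamma>" "ln \<gamma> \<le> R" using lg R(2) by linarith+
  have "exp (- R) \<le> exp (ln \<gamma>)" "exp (ln \<gamma>) \<le> exp R" using l1 by (simp_all only: exp_le_cancel_iff)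
  then have b1: "exp (- R) \<le> \<gamma>" "\<gamma> \<le> exp R" by (simp_all only: exp_ln[OF \<gamma>])
  have pe: "lc_p (hm a *v x) = \<gamma> * exp (- t) * lc_p x" by (simp add: a h_mat_mult)
  have ln_mono': "ln u \<le> ln v" if "0 < u" "u \<le> v" for u v :: real
   by (rule ln_le_cancel_iff[THEN iffD2, OF _ _ that(2)]) (use that in auto)
  have "\<gamma> * exp (- t) = lc_p (hm a *v x) / lc_p x" using pe lx(2) by (metis less_irrefl nonzero_eq_divide_eq)
  then have "1 / q \<le> \<gamma> * exp (- t)" "\<gamma> * exp (- t) \<le> q"
   using div[of "lc_p (hm a *v x)" "lc_p x"] divl[of "lc_p (hm a *v x)" "lc_p x"] B1[OF x] B2[OF y] mM by auto
  then have "ln (1 / q) \<le> ln (\<gamma> * exp (- t))" "ln (\<gamma> * exp (- t)) \<le> ln q"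
   by - (rule ln_mono'; use q \<gamma> in simp)+
  moreover have "ln (1 / q) = - ln q" using q by (simp add: ln_div)
  moreover have "ln (\<gamma> * exp (- t)) = ln \<gamma> - t" using \<gamma> by (simp add: ln_mult)
  ultimately have "\<bar>ln \<gamma> - t\<bar> \<le> ln q" by linarith
  then have bt: "\<bar>t\<bar> \<le> R" using lg R(3) by linarith
  have ig: "1 / \<gamma> \<le> q"
  proof -
   have "1 / \<gamma> = exp (- ln \<gamma>)" using \<gamma> by (simp add: exp_minus inverse_eq_divide)
   also have "\<dots> \<le> exp (ln q)" using lg by simp
   finally show ?thesis using q by simp
  qed
  have "\<bar>c i\<bar> \<le> R" if i: "i \<in> idx_mid" for i
  proof -
   have p0: "lc_p x > 0" using B1(3)[OF x] mM by linarith
   have "(hm a *v x) $ i = \<gamma> * (x $ i - c i * lc_p x)" using i by (simp add: a h_mat_mult)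
   then have "c i * lc_p x = x $ i - (hm a *v x) $ i * (1 / \<gamma>)" using \<gamma> by (simp add: field_simps)
   then have "\<bar>c i\<bar> * lc_p x = \<bar>x $ i - (hm a *v x) $ i * (1 / \<gamma>)\<bar>"
    using arg_cong[of _ _ abs] abs_mult[of "c i" "lc_p x"] abs_of_pos[OF p0] by presburger
   also have "\<dots> \<le> M + M * q"
    by (rule order.trans[OF abs_triangle_ineq4], unfold abs_mult, intro add_mono mult_mono) (use B1(5)[OF x] B2(5)[OF y] ig \<gamma> mM in auto)
   also have "\<dots> \<le> 2 * M * q"
    using mult_left_mono[OF q(1), of M] mM(3) by (simp only: mult_1_right mult.assoc) linarith
   finally have "\<bar>c i\<bar> * lc_p x \<le> 2 * M * q" .
   moreover have "\<bar>c i\<bar> * m \<le> \<bar>c i\<bar> * lc_p x" using B1(3)[OF x] by (intro mult_left_mono) auto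
   ultimately have "\<bar>c i\<bar> * m \<le> 2 * M * q" by linarith
   then have "\<bar>c i\<bar> \<le> 2 * (M / m) * q" using mM by (simp add: field_simps)
   with R(4) show ?thesis by linarith
  qed
  with b1 bt show "a \<in> hbox R" by (auto simp: a hbox_def)
 qed
qed

lemma K_props:
 fixes k :: "'n rmat"
 assumes k: "k \<in> K_grp"
 shows "norm (k *v x) = norm x" "(k *v x) $ idx_last = x $ idx_last"
proof -
 have "transpose k ** k = mat 1" using k by (simp add: K_grp_def orthogonal_matrix)
 then have "(k *v x) \<bullet> (k *v x) = x \<bullet> x"
  by (metis dot_lmul_matrix matrix_vector_mul_assoc matrix_vector_mul_lid transpose_matrix_vector transpose_transpose inner_commute)
 then show "norm (k *v x) = norm x" by (simp add: norm_eq_sqrt_inner)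
 have "(k *v x) $ idx_last = (\<Sum>j\<in>UNIV. if j = idx_last then x $ j else 0)"
  unfolding matrix_vector_mult_def vec_lambda_beta
  by (rule sum.cong) (use k in \<open>auto simp: K_grp_def\<close>)
 then show "(k *v x) $ idx_last = x $ idx_last" by simp
qed

lemma lorentz_norm: "lorentz x x = 2 * (x $ idx_last)\<^sup>2 - (norm x)\<^sup>2" for x :: "'n rvec"
proof -
 have "(norm x)\<^sup>2 = x $ idx_last * x $ idx_last + (\<Sum>i\<in>UNIV - {idx_last}. x $ i * x $ i)"
  unfolding power2_norm_eq_inner inner_vec_def by (subst sum.remove[of _ idx_last]) auto
 then show ?thesis by (simp add: lorentz_def power2_eq_square)
qed

text \<open>
  The rotations in \<open>K\<close> preserve the Euclidean norm, so the balls around the base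
  point are bounded.
\<close>

lemma cone_ball_base_props:
 assumes x: "x \<in> cone_ball_base \<rho>"
 shows "x \<in> (light_cone :: 'n rvec set)" "norm x \<le> exp (2 * sqrt \<rho>) * 2"
proof -
 obtain k t \<tau> where k: "k \<in> K_grp" "t\<^sup>2 + \<tau>\<^sup>2 < \<rho>" and x: "x = k *v (exp t *\<^sub>R (a_mat \<tau> *v base_pt))"
  using x unfolding cone_ball_base_def by blast
 define y :: "'n rvec" where "y = exp t *\<^sub>R (a_mat \<tau> *v base_pt)"
 have y: "y = hm (exp t, \<tau>, \<lambda>_. 0) *v base_pt"
  unfolding y_def by (rule lc_eqI) (simp_all add: lc_scale h_mat_mult a_mat_mult base_pt_lc)
 have yc: "y \<in> light_cone" unfolding y by (rule hm_light_cone[OF _ base_pt_light_cone]) simp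
 have xy: "x = k *v y" by (simp add: x y_def)
 have yp: "lorentz y y > 0" "y $ idx_last > 0" using yc by (auto simp: light_cone_def)
 have "lorentz (k *v y) (k *v y) = lorentz y y" unfolding lorentz_norm K_props[OF k(1)] ..
 then have "k *v y \<in> light_cone" using yp K_props(2)[OF k(1), of y] by (simp add: light_cone_def)
 then show "x \<in> light_cone" by (simp only: xy)
 have "t\<^sup>2 \<le> \<rho>" "\<tau>\<^sup>2 \<le> \<rho>" using k(2) zero_le_power2[of t] zero_le_power2[of \<tau>] by linarith+
 then have tb: "\<bar>t\<bar> \<le> sqrt \<rho>" "\<bar>\<tau>\<bar> \<le> sqrt \<rho>"
  by (metis real_le_rsqrt power2_abs)+
 have "\<tau> \<le> sqrt \<rho>" "- \<tau> \<le> sqrt \<rho>" "t \<le> sqrt \<rho>" using tb by linarith+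
 then have e: "exp \<tau> \<le> exp (sqrt \<rho>)" "exp (- \<tau>) \<le> exp (sqrt \<rho>)" "exp t \<le> exp (sqrt \<rho>)" by (simp_all only: exp_le_cancel_iff)
 have yl: "y $ idx_last = (exp t * exp (- \<tau>) + exp t * exp \<tau>) / 2"
 proof -
  have "y $ idx_last = (lc_p y + lc_r y) / 2" by (simp add: lc_p_def lc_r_def)
  moreover have "lc_p y = exp t * exp (- \<tau>)" "lc_r y = exp t * exp \<tau>"
   unfolding y by (simp_all add: h_mat_mult base_pt_lc)
  ultimately show ?thesis by (simp only:)
 qed
 have ybd: "(norm y)\<^sup>2 \<le> 2 * (y $ idx_last)\<^sup>2" using yp(1) unfolding lorentz_norm by linarith
 also have "\<dots> \<le> (2 * y $ idx_last)\<^sup>2" by (simp add: power_mult_distrib)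
 finally have "norm y \<le> 2 * y $ idx_last"
  by (rule power2_le_imp_le) (use yp(2) in simp)
 also have "\<dots> = exp t * exp (- \<tau>) + exp t * exp \<tau>" by (simp add: yl)
 also have "\<dots> \<le> exp (sqrt \<rho>) * exp (sqrt \<rho>) + exp (sqrt \<rho>) * exp (sqrt \<rho>)"
  using e by (intro add_mono mult_mono) auto
 also have "\<dots> = exp (2 * sqrt \<rho>) * 2"
  unfolding mult_2[of "sqrt \<rho>"] exp_add by (rule mult_2_right[symmetric])
 finally show "norm x \<le> exp (2 * sqrt \<rho>) * 2" by (simp only: xy K_props(1)[OF k(1)])
qed

lemma cone_ball_eq:
 assumes "fst a > 0" "w = hm a *v base_pt"
 shows "cone_ball \<rho> w = (*v) (hm a) ` cone_ball_base \<rho>"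
proof -
 have "{h \<in> H_grp. h *v base_pt = w} = {hm a}"
 proof (intro set_eqI iffI)
  fix h assume "h \<in> {h \<in> H_grp. h *v base_pt = w}"
  then obtain \<gamma> t c where h: "h = hm (\<gamma>, t, c)" "\<gamma> > 0" "h *v base_pt = w" unfolding H_grp_def by auto
  have "hm (\<gamma>, t, c) = hm a" by (rule hm_base_inj) (use h assms in auto)
  with h show "h \<in> {hm a}" by simp
 next
  fix h assume h: "h \<in> {hm a}"
  obtain \<gamma> t c where a: "a = (\<gamma>, t, c)" by (cases a)
  have e: "hm a = h_mat \<gamma> t (restrict c idx_mid)" unfolding a using hm_cong[of c "restrict c idx_mid" \<gamma> t] by simp
  have "hm a \<in> H_grp" unfolding e H_grp_def
   by (intro CollectI exI conjI, rule refl) (use assms(1) a in auto)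
  with h assms show "h \<in> {h \<in> H_grp. h *v base_pt = w}" by simp
 qed
 then show ?thesis by (simp add: cone_ball_def)
qed

lemma cone_ball_base_pt: "cone_ball \<rho> (base_pt :: 'n rvec) = cone_ball_base \<rho>"
proof -
 have 1: "cone_ball \<rho> (base_pt :: 'n rvec) = (*v) (hm (1, 0, \<lambda>_. 0)) ` cone_ball_base \<rho>"
 proof (rule cone_ball_eq)
  show "fst (1::real, 0::real, \<lambda>_::'n. 0::real) > 0" by simp
  show "(base_pt :: 'n rvec) = hm (1, 0, \<lambda>_. 0) *v base_pt"
   unfolding hm_one by (rule matrix_vector_mul_lid[symmetric])
 qed
 have 2: "(*v) (mat 1 :: 'n rmat) = id" by (rule ext) simp
 show ?thesis unfolding 1 hm_one 2 by simp
qed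

section \<open>Dilations and the wavelet transform\<close>

text \<open>
  The involution \<open>\<gamma> \<mapsto> 1 / \<gamma>\<close>. The adjoint of \<open>h\<close>
  for the Lorentz form is \<open>\<gamma>\<^sup>2 h\<^sup>-\<^sup>1\<close>, so a dilation by
  \<open>h\<close> on the space side is a dilation by \<open>theta h\<close> on the frequency
  side.
\<close>

fun theta :: "'n H_coords => 'n H_coords" where "theta (\<gamma>, t, c) = (1 / \<gamma>, t, c)"

lemma fst_theta: "fst a > 0 ==> fst (theta a) > 0" by (cases a) auto
lemma fst_theta_eq: "fst (theta a) = 1 / fst a" by (cases a) auto
lemma theta_theta: "theta (theta a) = a" by (cases a) auto

lemma hm_hinv_theta: assumes "fst a > 0" shows "hm (hinv (theta a)) *v x = (fst a)\<^sup>2 *\<^sub>R (hm (hinv a) *v x)"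
proof -
 obtain \<gamma> t c where a: "a = (\<gamma>, t, c)" by (cases a)
 have \<gamma>: "\<gamma> > 0" using assms a by simp
 show ?thesis
  unfolding a by (rule lc_eqI) (use \<gamma> in \<open>simp_all add: lc_scale h_mat_mult power2_eq_square\<close>)
qed

lemma lorentz_adj: assumes "fst a > 0" shows "lorentz x (hm a *v y) = lorentz (hm (hinv (theta a)) *v x) y"
proof -
 have "x = hm a *v (hm (hinv a) *v x)" by (simp add: matrix_vector_mul_assoc hm_hinv[OF assms])
 then have "lorentz x (hm a *v y) = lorentz (hm a *v (hm (hinv a) *v x)) (hm a *v y)" by simp
 also have "\<dots> = (fst a)\<^sup>2 * lorentz (hm (hinv a) *v x) y" by (rule lorentz_hm_polar)
 finally show ?thesis by (simp add: hm_hinv_theta[OF assms] lorentz_scaleR_left)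
qed

lemma hm_hinv_cancel:
 assumes "fst a > 0" shows "hm a *v (hm (hinv a) *v x) = x" "hm (hinv a) *v (hm a *v x) = x"
 by (simp_all add: matrix_vector_mul_assoc hm_hinv[OF assms])

text \<open>
  Change of variables and the adjoint formula for the Lorentz form.
\<close>

lemma fourier_hm:
 assumes a: "fst a > 0" and m[measurable]: "u \<in> borel_measurable borel"
 shows "fourier (\<lambda>x. u (hm (hinv a) *v x)) w = of_real (fst a ^ CARD('n)) * fourier u (hm (hinv (theta a)) *v w)"
proof -
 have "(\<integral>x. u (hm (hinv a) *v x) * exp (- \<i> * of_real (lorentz x w)) \<partial>lborel)
  = \<bar>det (hm a)\<bar> *\<^sub>R (\<integral>x. u (hm (hinv a) *v (hm a *v x + 0)) * exp (- \<i> * of_real (lorentz (hm a *v x + 0) w)) \<partial>lborel)"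
  by (rule integral_affine[where f = "\<lambda>x. u (hm (hinv a) *v x) * exp (- \<i> * of_real (lorentz x w))"]) (measurable, rule det_hm_nz[OF a])
 also have "\<dots> = of_real (fst a ^ CARD('n)) * (\<integral>x. u x * exp (- \<i> * of_real (lorentz x (hm (hinv (theta a)) *v w))) \<partial>lborel)"
  unfolding abs_det_hm[OF a] add_0_right hm_hinv_cancel[OF a] scaleR_conv_of_real
  by (simp only: lorentz_commute[of "hm a *v _" w] lorentz_adj[OF a] lorentz_commute[of "hm (hinv (theta a)) *v w"])
 finally show ?thesis unfolding fourier_eq by (simp only: mult.left_commute)
qed

lemma inv_fourier_hm:
 assumes a: "fst a > 0" and m[measurable]: "F \<in> borel_measurable borel"
 shows "inv_fourier (\<lambda>w. F (hm (hinv a) *v w)) x = of_real (fst a ^ CARD('n)) * inv_fourier F (hm (hinv (theta a)) *v x)"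
 unfolding inv_fourier_eq_fourier fourier_hm[OF assms] by (simp add: linear_neg[OF matrix_vector_mul_linear])

lemma hinv_theta_theta: "fst a > 0 ==> fst (hinv (theta a)) = fst a"
 by (cases a) auto

lemma L1_hm:
 assumes a: "fst a > 0" and m: "rapid m"
 shows "(\<integral>x. cmod (of_real (fst a ^ CARD('n)) * m (hm (hinv (theta a)) *v x)) \<partial>lborel) = (\<integral>x. cmod (m x) \<partial>lborel)"
  "rapid (\<lambda>x. of_real (fst a ^ CARD('n)) * m (hm (hinv (theta a)) *v x))"
proof -
 have pos: "fst (hinv (theta a)) > 0" using a by (simp add: fst_hinv fst_theta)
 have mm[measurable]: "m \<in> borel_measurable borel" by (rule rapid_measurable[OF m])
 have "of_real (\<integral>x. cmod (m x) \<partial>lborel) = (\<integral>x. complex_of_real (cmod (m x)) \<partial>lborel)" by simp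
 also have "\<dots> = \<bar>det (hm (hinv (theta a)))\<bar> *\<^sub>R (\<integral>x. complex_of_real (cmod (m (hm (hinv (theta a)) *v x + 0))) \<partial>lborel)"
  by (rule integral_affine[where f = "\<lambda>x. complex_of_real (cmod (m x))"]) (measurable, rule det_hm_nz[OF pos])
 also have "\<dots> = complex_of_real (fst a ^ CARD('n) * (\<integral>x. cmod (m (hm (hinv (theta a)) *v x)) \<partial>lborel))"
  unfolding abs_det_hm[OF pos] hinv_theta_theta[OF a] by (simp add: scaleR_conv_of_real)
 finally have "(\<integral>x. cmod (m x) \<partial>lborel) = fst a ^ CARD('n) * (\<integral>x. cmod (m (hm (hinv (theta a)) *v x)) \<partial>lborel)"
  using of_real_eq_iff by blast
 also have "\<dots> = (\<integral>x. cmod (of_real (fst a ^ CARD('n)) * m (hm (hinv (theta a)) *v x)) \<partial>lborel)"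
  using a by (simp add: norm_mult norm_power)
 finally show "(\<integral>x. cmod (of_real (fst a ^ CARD('n)) * m (hm (hinv (theta a)) *v x)) \<partial>lborel) = (\<integral>x. cmod (m x) \<partial>lborel)" ..
 show "rapid (\<lambda>x. of_real (fst a ^ CARD('n)) * m (hm (hinv (theta a)) *v x))"
  by (intro rapid_cmult rapid_linear[OF m] hm_invertible pos)
qed

lemma hm_closure_light_cone: assumes "fst a > 0" "x \<in> closure light_cone" shows "hm a *v x \<in> closure (light_cone :: 'n rvec set)"
proof -
 have "(*v) (hm a) ` closure light_cone \<subseteq> closure (light_cone :: 'n rvec set)"
 proof (rule image_closure_subset)
  show "continuous_on (closure light_cone) ((*v) (hm a))" by (intro linear_continuous_on matrix_vector_mul_bounded_linear)
  show "(*v) (hm a) ` light_cone \<subseteq> closure light_cone" using hm_light_cone[OF assms(1)] closure_subset by fast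
 qed simp
 with assms show ?thesis by blast
qed

definition dilate :: "'n H_coords => ('n rvec => complex) => 'n rvec => complex" where
 "dilate a u x = u (hm (hinv a) *v x)"

lemma S_cone_dilate: assumes "fst a > 0" "u \<in> S_cone" shows "dilate a u \<in> S_cone"
proof (rule S_coneI)
 have "(\<lambda>x. u (hm (hinv a) *v x + 0)) \<in> schwartz"
  by (intro schwartz_affine S_cone_schwartz assms hm_invertible fst_hinv)
 then show "dilate a u \<in> schwartz" by (simp add: dilate_def[abs_def])
 show "{w. fourier (dilate a u) w \<noteq> 0} \<subseteq> closure light_cone"
 proof
  fix w assume "w \<in> {w. fourier (dilate a u) w \<noteq> 0}"
  then have "fourier u (hm (hinv (theta a)) *v w) \<noteq> 0"
   using fourier_hm[OF assms(1) schwartz_measurable[OF S_cone_schwartz[OF assms(2)]], of w] by (auto simp: dilate_def[abs_def])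
  from hm_closure_light_cone[OF fst_theta[OF assms(1)] S_coneD[OF assms(2) this]]
  show "w \<in> closure light_cone" by (simp add: hm_hinv_cancel[OF fst_theta[OF assms(1)]])
 qed
qed

lemma wavelet_transform_eq:
 assumes "f \<in> S_cone_dual" "u \<in> S_cone" "fst a > 0"
 shows "wavelet_transform u f (a, b) = of_real (fst a powr (- real CARD('n) / 2)) * coeff_fun f (dilate a u) b"
proof -
 obtain \<gamma> t c where a: "a = (\<gamma>, t, c)" by (cases a)
 have "G_rep (a, b) u = (\<lambda>x. of_real (fst a powr (- real CARD('n) / 2)) * dilate a u (x - b))"
  by (rule ext) (use matrix_inv_hm[OF assms(3)] in \<open>simp add: a dilate_def\<close>)
 then show ?thesis
  unfolding wavelet_transform_def coeff_fun_def
  by (simp add: S_cone_dual_cmult[OF assms(1)] S_cone_translate S_cone_dilate assms)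
qed

definition trunc :: "('n => real) => 'n rvec" where "trunc c = (\<chi> i. if i \<in> idx_mid then c i else 0)"

lemma tendsto_hm:
 assumes g: "g \<longlonglongrightarrow> \<gamma>" and t: "s \<longlonglongrightarrow> t" and c: "d \<longlonglongrightarrow> (c :: 'n rvec)"
 shows "(\<lambda>m. hm (g m, s m, vec_nth (d m))) \<longlonglongrightarrow> hm (\<gamma>, t, vec_nth c)"
proof (rule vec_tendstoI, rule vec_tendstoI)
 fix i j
 have cc: "(\<lambda>m. d m $ i) \<longlonglongrightarrow> c $ i" for i by (rule tendsto_vec_nth[OF c])
 have col: "hm a $ i $ j = (hm a *v axis j 1) $ i" for a by (simp add: matrix_vector_mult_basis column_def)
 define x where "x = (axis j 1 :: 'n rvec)"
 have es: "(\<lambda>m. exp (s m)) \<longlonglongrightarrow> exp t" "(\<lambda>m. exp (- s m)) \<longlonglongrightarrow> exp (- t)" by (intro tendsto_intros t)+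
 have p: "(\<lambda>m. lc_p (hm (g m, s m, vec_nth (d m)) *v x)) \<longlonglongrightarrow> lc_p (hm (\<gamma>, t, vec_nth c) *v x)"
  by (simp only: hm.simps h_mat_mult) (intro tendsto_mult g es tendsto_const)
 have r: "(\<lambda>m. lc_r (hm (g m, s m, vec_nth (d m)) *v x)) \<longlonglongrightarrow> lc_r (hm (\<gamma>, t, vec_nth c) *v x)"
  by (simp only: hm.simps h_mat_mult) (intro tendsto_mult tendsto_diff tendsto_add tendsto_sum tendsto_power g es cc tendsto_const)
 have "(\<lambda>m. (hm (g m, s m, vec_nth (d m)) *v x) $ i) \<longlonglongrightarrow> (hm (\<gamma>, t, vec_nth c) *v x) $ i"
 proof (cases i rule: idx_cases)
  case 1
  have y: "y $ i = (lc_r y - lc_p y) / 2" for y by (simp add: 1 lc_p_def lc_r_def)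
  show ?thesis unfolding y by (rule tendsto_divide[OF tendsto_diff[OF r p] tendsto_const]) simp
 next
  case 2
  have y: "y $ i = (lc_r y + lc_p y) / 2" for y by (simp add: 2 lc_p_def lc_r_def)
  show ?thesis unfolding y by (rule tendsto_divide[OF tendsto_add[OF r p] tendsto_const]) simp
 next
  case 3
  then show ?thesis by (simp only: hm.simps h_mat_mult) (intro tendsto_mult tendsto_diff g cc tendsto_const)
 qed
 then show "(\<lambda>m. hm (g m, s m, vec_nth (d m)) $ i $ j) \<longlonglongrightarrow> hm (\<gamma>, t, vec_nth c) $ i $ j"
  by (simp only: col x_def)
qed

lemma tendsto_matrix_vector_mult:
 fixes L :: "nat => 'n rmat"
 assumes "L \<longlonglongrightarrow> L0" "e \<longlonglongrightarrow> b" shows "(\<lambda>n. L n *v e n) \<longlonglongrightarrow> L0 *v b"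
 by (rule vec_tendstoI, unfold matrix_vector_mult_def vec_lambda_beta)
   (intro tendsto_sum tendsto_mult tendsto_vec_nth assms)

lemma hm_trunc: "hm (\<gamma>, t, vec_nth (trunc c)) = hm (\<gamma>, t, c)"
 by (rule hm_cong) (simp add: trunc_def)

text \<open>
  Sequential continuity: the translated and dilated wavelets converge in the Schwartz space and
  the functional is continuous there. The middle coordinates are taken from a vector, so that the
  parameters range over a Euclidean space.
\<close>

lemma continuous_coeff_dilate:
 assumes f: "f \<in> S_cone_dual" and u: "u \<in> S_cone"
 shows "continuous_on ({0<..} \<times> UNIV) (\<lambda>(\<gamma>, t, c :: 'n rvec, b). coeff_fun f (dilate (\<gamma>, t, vec_nth c) u) b)"
proof (rule continuous_on_sequentiallyI)
 fix X a assume X: "\<forall>n. X n \<in> {0<..} \<times> UNIV" and a: "a \<in> {0<..} \<times> UNIV" and lim: "X \<longlonglongrightarrow> (a :: real \<times> real \<times> 'n rvec \<times> 'n rvec)"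
 obtain \<gamma> t c b where a': "a = (\<gamma>, t, c, b)" by (cases a)
 define g where "g n = fst (X n)" for n
 define s where "s n = fst (snd (X n))" for n
 define d where "d n = fst (snd (snd (X n)))" for n
 define e where "e n = snd (snd (snd (X n)))" for n
 have X': "X n = (g n, s n, d n, e n)" for n by (simp add: g_def s_def d_def e_def)
 have l: "g \<longlonglongrightarrow> \<gamma>" "s \<longlonglongrightarrow> t" "d \<longlonglongrightarrow> c" "e \<longlonglongrightarrow> b"
  unfolding g_def s_def d_def e_def using lim a' by (auto intro!: tendsto_eq_intros)
 have pos: "\<gamma> > 0" "g n > 0" for n using X a unfolding a' X' by auto
 define L where "L n = hm (hinv (g n, s n, vec_nth (d n)))" for n
 define L0 where "L0 = hm (hinv (\<gamma>, t, vec_nth c))"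
 have Leq: "hm (hinv (x, y, vec_nth z)) = hm (1 / x, - y, vec_nth ((- exp y) *\<^sub>R z))" for x y and z :: "'n rvec"
  unfolding hinv.simps by (rule hm_cong) simp
 have Llim: "L \<longlonglongrightarrow> L0"
  unfolding L_def L0_def Leq using pos
  by (intro tendsto_hm tendsto_divide tendsto_const l tendsto_minus tendsto_scaleR tendsto_exp) auto
 have inv: "invertible L0" "invertible (L n)" for n
  unfolding L_def L0_def using pos by (auto intro!: hm_invertible simp del: hm.simps)
 have blim: "(\<lambda>n. - (L n *v e n)) \<longlonglongrightarrow> - (L0 *v b)"
  by (intro tendsto_minus tendsto_matrix_vector_mult Llim l)
 have "schwartz_lim (\<lambda>n x. u (L n *v x + - (L n *v e n))) (\<lambda>x. u (L0 *v x + - (L0 *v b)))"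
  by (rule schwartz_lim_affine[OF S_cone_schwartz[OF u] inv Llim blim])
 then have sl: "schwartz_lim (\<lambda>n x. dilate (g n, s n, vec_nth (d n)) u (x - e n)) (\<lambda>x. dilate (\<gamma>, t, vec_nth c) u (x - b))"
  by (simp add: dilate_def L_def L0_def matrix_vector_mult_diff_distrib del: hm.simps hinv.simps)
 have "(\<lambda>n. f (\<lambda>x. dilate (g n, s n, vec_nth (d n)) u (x - e n))) \<longlonglongrightarrow> f (\<lambda>x. dilate (\<gamma>, t, vec_nth c) u (x - b))"
  by (rule S_cone_dual_tendsto[OF f _ _ sl]; rule S_cone_translate, rule S_cone_dilate) (use pos u in auto)
 then show "(\<lambda>n. (\<lambda>(\<gamma>, t, c :: 'n rvec, b). coeff_fun f (dilate (\<gamma>, t, vec_nth c) u) b) (X n)) \<longlonglongrightarrow> (\<lambda>(\<gamma>, t, c, b). coeff_fun f (dilate (\<gamma>, t, vec_nth c) u) b) a"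
  by (simp add: X' a' coeff_fun_def)
qed

lemma measurable_coord_fst: "fst \<in> borel_measurable (coord_measure :: 'n H_coords measure)"
 and measurable_coord_t: "(\<lambda>a. fst (snd a)) \<in> borel_measurable (coord_measure :: 'n H_coords measure)"
 and measurable_coord_c: "i \<in> idx_mid ==> (\<lambda>a. snd (snd a) i) \<in> borel_measurable (coord_measure :: 'n H_coords measure)"
proof -
 have 1: "fst \<in> measurable (coord_measure :: 'n H_coords measure) (restrict_space lborel {0<..})"
  unfolding coord_measure_def by (rule measurable_fst)
 then show "fst \<in> borel_measurable (coord_measure :: 'n H_coords measure)"
  using measurable_restrict_space2_iff[of fst "coord_measure :: 'n H_coords measure" "lborel :: real measure" "{0<..}"] measurable_lborel1 by blast
 have 2: "snd \<in> measurable (coord_measure :: 'n H_coords measure) (lborel \<Otimes>\<^sub>M (\<Pi>\<^sub>M i\<in>idx_mid. lborel))"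
  unfolding coord_measure_def by (rule measurable_snd)
 show "(\<lambda>a. fst (snd a)) \<in> borel_measurable (coord_measure :: 'n H_coords measure)"
  using measurable_compose[OF 2 measurable_fst] by simp
 show "(\<lambda>a. snd (snd a) i) \<in> borel_measurable (coord_measure :: 'n H_coords measure)" if "i \<in> idx_mid"
  using measurable_compose[OF measurable_compose[OF 2 measurable_snd] measurable_component_singleton[OF that]] by simp
qed

lemma space_coord_measure: "a \<in> space (coord_measure :: 'n H_coords measure) ==> fst a > 0"
 unfolding coord_measure_def by (auto simp: space_pair_measure space_restrict_space)

lemma measurable_wavelet_transform:
 fixes u :: "'n rvec => complex"
 assumes f: "f \<in> S_cone_dual" and u: "u \<in> S_cone"
 shows "wavelet_transform u f \<in> borel_measurable (coord_measure \<Otimes>\<^sub>M lborel)"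
proof -
 let ?M = "(coord_measure :: 'n H_coords measure) \<Otimes>\<^sub>M (lborel :: 'n rvec measure)"
 define T where "T = (\<lambda>(a :: 'n H_coords, b :: 'n rvec). (fst a, fst (snd a), trunc (snd (snd a)), b))"
 have tr: "(\<lambda>a. trunc (snd (snd a))) \<in> borel_measurable (coord_measure :: 'n H_coords measure)"
  unfolding trunc_def
 proof (rule borel_measurable_vec_lambda)
  fix i :: 'n
  show "(\<lambda>a. if i \<in> idx_mid then snd (snd a) i else 0) \<in> borel_measurable (coord_measure :: 'n H_coords measure)"
   using measurable_coord_c[of i] by (cases "i \<in> idx_mid") simp_all
 qed
 have sm: "snd \<in> borel_measurable ?M" using measurable_snd[of coord_measure "lborel :: 'n rvec measure"] by simp
 have Tm: "T \<in> borel_measurable ?M"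
  unfolding T_def case_prod_beta'
  by (intro borel_measurable_Pair measurable_compose[OF measurable_fst measurable_coord_fst] measurable_compose[OF measurable_fst measurable_coord_t]
    measurable_compose[OF measurable_fst tr] sm)
 define G where "G = (\<lambda>(\<gamma>, t, c :: 'n rvec, b). coeff_fun f (dilate (\<gamma>, t, vec_nth c) u) b)"
 define D where "D = {0::real<..} \<times> (UNIV :: (real \<times> 'n rvec \<times> 'n rvec) set)"
 have "open D" unfolding D_def by (intro open_Times) auto
 then have Gm: "(\<lambda>x. indicator D x *\<^sub>R G x) \<in> borel_measurable borel"
  using continuous_coeff_dilate[OF f u] unfolding G_def[symmetric] D_def[symmetric]
  by (intro borel_measurable_continuous_on_indicator) auto
 have gm: "(\<lambda>x. complex_of_real (fst (fst x) powr (- real CARD('n) / 2))) \<in> borel_measurable ?M"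
  using measurable_compose[OF measurable_fst measurable_coord_fst, of "lborel :: 'n rvec measure"] by measurable
 have "(\<lambda>x. complex_of_real (fst (fst x) powr (- real CARD('n) / 2)) * (indicator D (T x) *\<^sub>R G (T x))) \<in> borel_measurable ?M"
  by (intro borel_measurable_times gm measurable_compose[OF Tm Gm])
 moreover have "wavelet_transform u f x = complex_of_real (fst (fst x) powr (- real CARD('n) / 2)) * (indicator D (T x) *\<^sub>R G (T x))"
  if x: "x \<in> space ?M" for x
 proof -
  obtain \<gamma> t c b where xe: "x = ((\<gamma>, t, c), b)" by (metis surj_pair)
  have "(\<gamma>, t, c) \<in> space (coord_measure :: 'n H_coords measure)" using x unfolding xe by (simp add: space_pair_measure)
  from space_coord_measure[OF this] have pos: "\<gamma> > 0" by simp
  have "hm (hinv (\<gamma>, t, c)) = hm (hinv (\<gamma>, t, vec_nth (trunc c)))"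
   unfolding hinv.simps by (rule hm_cong) (simp add: trunc_def)
  then have "dilate (\<gamma>, t, c) u = dilate (\<gamma>, t, vec_nth (trunc c)) u" by (simp only: dilate_def[abs_def])
  then show ?thesis
   using wavelet_transform_eq[OF f u, of "(\<gamma>, t, c)" b] pos by (simp add: xe T_def G_def D_def)
 qed
 ultimately show ?thesis by (subst measurable_cong) auto
qed

section \<open>Counting lattice points of a Whitney cover\<close>

text \<open>
  Together with continuity of the parametrisation this shows that cone balls are countable unions
  of compact sets, hence Borel sets.
\<close>

lemma compact_K_grp: "compact (K_grp :: 'n rmat set)"
proof -
 have ent: "continuous_on UNIV (\<lambda>k::'n rmat. k $ i $ j)" for i j by (intro continuous_intros)
 have "continuous_on UNIV (\<lambda>k::'n rmat. transpose k ** k)"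
  unfolding matrix_matrix_mult_def transpose_def vec_lambda_beta by (intro continuous_intros)
 then have c1: "closed {k::'n rmat. transpose k ** k = mat 1}" by (intro closed_Collect_eq continuous_on_const)
 have "continuous_on UNIV (\<lambda>k::'n rmat. det k)" unfolding det_def by (intro continuous_intros)
 then have c2: "closed {k::'n rmat. det k = 1}" by (intro closed_Collect_eq continuous_on_const)
 have c3: "closed {k::'n rmat. k $ idx_last $ idx_last = 1}" by (intro closed_Collect_eq continuous_on_const ent)
 have c4: "closed (\<Inter>i\<in>UNIV - {idx_last}. {k::'n rmat. k $ i $ idx_last = 0} \<inter> {k. k $ idx_last $ i = 0})"
  by (intro closed_INT ballI closed_Int closed_Collect_eq continuous_on_const ent)
 have eq: "K_grp = {k::'n rmat. transpose k ** k = mat 1} \<inter> {k. det k = 1} \<inter> {k. k $ idx_last $ idx_last = 1}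
  \<inter> (\<Inter>i\<in>UNIV - {idx_last}. {k. k $ i $ idx_last = 0} \<inter> {k. k $ idx_last $ i = 0})"
  unfolding K_grp_def orthogonal_matrix by auto
 have "closed (K_grp :: 'n rmat set)" unfolding eq by (intro closed_Int c1 c2 c3 c4)
 moreover have "bounded (K_grp :: 'n rmat set)"
  unfolding bounded_iff
 proof (intro exI ballI)
  fix k :: "'n rmat" assume k: "k \<in> K_grp"
  have e: "\<bar>k $ i $ j\<bar> \<le> 1" for i j
  proof -
   have "k $ i $ j = (k *v axis j 1) $ i" by (simp add: matrix_vector_mult_basis column_def)
   then have "\<bar>k $ i $ j\<bar> \<le> norm (k *v axis j 1)" using component_le_norm_cart[of "k *v axis j 1" i] by simp
   then show ?thesis by (simp add: K_props[OF k] norm_axis_1)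
  qed
  have "norm k \<le> (\<Sum>i\<in>UNIV. norm (k $ i))" unfolding norm_vec_def[of k] by (rule L2_set_le_sum) simp
  also have "\<dots> \<le> (\<Sum>i\<in>(UNIV::'n set). \<Sum>j\<in>(UNIV::'n set). 1)"
   by (intro sum_mono order.trans[OF norm_le_l1_cart] e)
  finally show "norm k \<le> (\<Sum>i\<in>(UNIV::'n set). \<Sum>j\<in>(UNIV::'n set). 1)" .
 qed
 ultimately show ?thesis by (simp add: compact_eq_bounded_closed)
qed

lemma borel_cone_ball_base: assumes "\<rho> > 0" shows "(cone_ball_base \<rho> :: 'n rvec set) \<in> sets borel"
proof -
 define v where "v \<tau> = cosh \<tau> *\<^sub>R axis idx_last 1 + sinh \<tau> *\<^sub>R (axis idx_first 1 :: 'n rvec)" for \<tau> :: real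
 have v: "a_mat \<tau> *v base_pt = v \<tau>" for \<tau>
 proof (rule lc_eqI)
  have e: "exp (- \<tau>) = cosh \<tau> - sinh \<tau>" "exp \<tau> = cosh \<tau> + sinh \<tau>" by (simp_all add: cosh_def sinh_def field_simps)
  show "lc_p (a_mat \<tau> *v base_pt) = lc_p (v \<tau>)" "lc_r (a_mat \<tau> *v base_pt) = lc_r (v \<tau>)"
   unfolding a_mat_mult base_pt_lc e by (simp_all add: v_def lc_p_def lc_r_def axis_def)
  show "(a_mat \<tau> *v base_pt) $ i = v \<tau> $ i" if "i \<in> idx_mid" for i
   using that idx_mid_neq[OF that] by (simp add: a_mat_mult base_pt_lc v_def axis_def)
 qed
 define f where "f = (\<lambda>(k :: 'n rmat, p :: real \<times> real). k *v (exp (fst p) *\<^sub>R v (snd p)))"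
 have cont: "continuous_on UNIV f"
  unfolding f_def case_prod_beta' matrix_vector_mult_def v_def by (intro continuous_intros)
 have eq: "cone_ball_base \<rho> = (\<Union>m::nat. f ` (K_grp \<times> cball 0 (sqrt \<rho> - inverse (real (Suc m)))))"
 proof (intro set_eqI iffI)
  fix x :: "'n rvec" assume "x \<in> cone_ball_base \<rho>"
  then obtain k t \<tau> where k: "k \<in> K_grp" "t\<^sup>2 + \<tau>\<^sup>2 < \<rho>" "x = k *v (exp t *\<^sub>R (a_mat \<tau> *v base_pt))"
   unfolding cone_ball_base_def by blast
  have "norm (t, \<tau>) < sqrt \<rho>" using k(2) by (simp add: norm_Pair)
  then obtain m where m: "inverse (real (Suc m)) < sqrt \<rho> - norm (t, \<tau>)" using reals_Archimedean[of "sqrt \<rho> - norm (t, \<tau>)"] by auto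
  then have "(t, \<tau>) \<in> cball 0 (sqrt \<rho> - inverse (real (Suc m)))" by simp
  moreover have "x = f (k, (t, \<tau>))" by (simp add: f_def k(3) v)
  ultimately show "x \<in> (\<Union>m::nat. f ` (K_grp \<times> cball 0 (sqrt \<rho> - inverse (real (Suc m)))))" using k(1) by blast
 next
  fix x :: "'n rvec" assume "x \<in> (\<Union>m::nat. f ` (K_grp \<times> cball 0 (sqrt \<rho> - inverse (real (Suc m)))))"
  then obtain m k t \<tau> where m: "k \<in> K_grp" "norm (t, \<tau>) \<le> sqrt \<rho> - inverse (real (Suc m))" "x = f (k, (t, \<tau>))" by force
  have "inverse (real (Suc m)) > 0" by simp
  then have "norm (t, \<tau>) < sqrt \<rho>" using m(2) by linarith
  then have "t\<^sup>2 + \<tau>\<^sup>2 < \<rho>" by (simp add: norm_Pair)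
  with m show "x \<in> cone_ball_base \<rho>" unfolding cone_ball_base_def f_def by (auto simp: v[symmetric])
 qed
 have "f ` (K_grp \<times> cball 0 r) \<in> sets borel" for r
  by (intro borel_compact compact_continuous_image continuous_on_subset[OF cont] compact_Times compact_K_grp compact_cball) auto
 then show ?thesis unfolding eq by (intro sets.countable_UN) auto
qed

lemma hm_image:
 assumes a: "fst a > 0" and X[measurable]: "X \<in> sets borel"
 shows "(*v) (hm a) ` X \<in> sets borel" "emeasure lborel ((*v) (hm a) ` X) = ennreal (fst a ^ CARD('n)) * emeasure lborel X"
proof -
 have eq: "(*v) (hm a) ` X = {y. hm (hinv a) *v y \<in> X}"
 proof (intro set_eqI iffI)
  fix y assume "y \<in> {y. hm (hinv a) *v y \<in> X}"
  then show "y \<in> (*v) (hm a) ` X" by (intro image_eqI[of _ _ "hm (hinv a) *v y"]) (simp_all add: hm_hinv_cancel[OF a])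
 qed (auto simp: hm_hinv_cancel[OF a])
 have "(\<lambda>y. hm (hinv a) *v y) -` X \<inter> space borel \<in> sets borel" by (rule measurable_sets[OF measurable_matrix_vector_mult X])
 then show m[measurable]: "(*v) (hm a) ` X \<in> sets borel" unfolding eq by (simp add: vimage_def)
 have ind: "indicator ((*v) (hm a) ` X) (hm a *v x) = (indicator X x :: ennreal)" for x
  unfolding eq by (simp add: indicator_def hm_hinv_cancel[OF a])
 have "emeasure lborel ((*v) (hm a) ` X) = (\<integral>\<^sup>+x. indicator ((*v) (hm a) ` X) x \<partial>lborel)" by simp
 also have "\<dots> = ennreal \<bar>det (hm a)\<bar> * (\<integral>\<^sup>+x. indicator ((*v) (hm a) ` X) (hm a *v x + 0) \<partial>lborel)"
  by (rule nn_integral_affine) (simp_all add: det_hm_nz[OF a])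
 also have "\<dots> = ennreal (fst a ^ CARD('n)) * emeasure lborel X"
  unfolding add_0_right ind abs_det_hm[OF a] by simp
 finally show "emeasure lborel ((*v) (hm a) ` X) = ennreal (fst a ^ CARD('n)) * emeasure lborel X" .
qed

lemma open_light_cone: "open (light_cone :: 'n rvec set)"
proof -
 have eq: "light_cone = {x::'n rvec. 0 < lorentz x x} \<inter> {x. 0 < x $ idx_last}" by (auto simp: light_cone_def)
 have "open {x::'n rvec. 0 < lorentz x x}" by (intro open_Collect_less continuous_on_const continuous_lc)
 moreover have "open {x::'n rvec. 0 < x $ idx_last}" by (intro open_Collect_less continuous_on_const continuous_lc)
 ultimately show ?thesis unfolding eq by (rule open_Int)
qed

end

text \<open>
  The matrices that carry the base point to the lattice points are given by their group
  coordinates \<open>gc\<close>.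
\<close>

locale whitney = forward_cone dummy for dummy :: "'n::{finite,linorder} itself" +
 fixes \<delta> :: real and w :: "nat => 'n rvec" and gc :: "nat => 'n H_coords"
 assumes wc: "whitney_cover \<delta> w" and gc: "\<And>j. fst (gc j) > 0" "\<And>j. w j = hm (gc j) *v base_pt"
begin

definition B :: "'n rvec set" where "B = cone_ball_base \<delta>"

lemma delta_pos: "\<delta> > 0" using wc by (simp add: whitney_cover_def)

lemma ball_w: "cone_ball \<delta> (w j) = (*v) (hm (gc j)) ` B" "cone_ball \<rho> (w j) = (*v) (hm (gc j)) ` cone_ball_base \<rho>"
 using cone_ball_eq[OF gc] by (auto simp: B_def)

lemma covers: "v \<in> light_cone ==> \<exists>j. hm (hinv (gc j)) *v v \<in> B"
proof -
 assume "v \<in> light_cone"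
 then obtain j where "v \<in> cone_ball \<delta> (w j)" using wc unfolding whitney_cover_def by blast
 then show ?thesis unfolding ball_w(1) by (auto simp: hm_hinv_cancel[OF gc(1)] intro!: exI[of _ j])
qed

lemma B_borel: "B \<in> sets borel" unfolding B_def by (rule borel_cone_ball_base[OF delta_pos])

text \<open>
  Countably many linear images of \<open>B\<close> cover the open cone, so \<open>B\<close> cannot
  be a null set.
\<close>

lemma B_measure: "0 < measure lborel B" "emeasure lborel B = ennreal (measure lborel B)"
proof -
 have "bounded B" unfolding bounded_iff B_def using cone_ball_base_props(2) by blast
 then have fin: "emeasure lborel B < \<infinity>" by (rule emeasure_bounded_finite)
 then show e: "emeasure lborel B = ennreal (measure lborel B)" by (intro emeasure_eq_ennreal_measure) auto
 have "measure lborel B \<noteq> 0"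
 proof
  assume "measure lborel B = 0"
  then have "emeasure lborel B = 0" using e by simp
  then have "(*v) (hm (gc j)) ` B \<in> null_sets lborel" for j
   using hm_image[OF gc(1) B_borel, of j] by (auto simp: null_sets_def)
  then have n: "(\<Union>j. (*v) (hm (gc j)) ` B) \<in> null_sets lborel" by (rule null_sets_UN)
  have "(light_cone :: 'n rvec set) \<subseteq> (\<Union>j. (*v) (hm (gc j)) ` B)"
  proof
   fix v :: "'n rvec" assume "v \<in> light_cone"
   from covers[OF this] obtain j where j: "hm (hinv (gc j)) *v v \<in> B" by (elim exE)
   show "v \<in> (\<Union>j. (*v) (hm (gc j)) ` B)"
    by (rule UN_I[OF UNIV_I, of _ _ j], rule image_eqI[OF _ j]) (simp add: hm_hinv_cancel[OF gc(1)])
  qed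
  from null_sets_subset[OF n _ this] have "(light_cone :: 'n rvec set) \<in> null_sets lborel" using open_light_cone by auto
  then have "negligible (light_cone :: 'n rvec set)"
   unfolding negligible_iff_null_sets by (rule null_sets_completionI)
  then show False using open_not_negligible[OF open_light_cone] base_pt_light_cone by blast
 qed
 then show "0 < measure lborel B" using measure_nonneg[of lborel B] by linarith
qed

text \<open>
  A volume argument. All balls whose lattice point is within the box around \<open>b\<close> lie
  in one set of measure comparable to \<open>(fst b) ^ n\<close>, each has measure comparable to
  \<open>(fst b) ^ n\<close>, and at most \<open>N\<close> of them meet at a point. The bound does
  not depend on \<open>b\<close>.
\<close>

lemma count_bound:
 assumes R: "R \<ge> 0"
 obtains M where "\<And>b. fst b > 0 ==> finite {j. hprod (hinv (gc j)) b \<in> hbox R} \<and> card {j. hprod (hinv (gc j)) b \<in> hbox R} \<le> M"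
proof -
 obtain N where N: "\<And>v. v \<in> light_cone ==> finite {j. v \<in> cone_ball \<delta> (w j)} \<and> card {j. v \<in> cone_ball \<delta> (w j)} \<le> N"
  using wc unfolding whitney_cover_def by blast
 define R' where "R' = R * exp R + R"
 have R': "R' \<ge> 0" using R by (simp add: R'_def)
 obtain C where C: "C > 0" "\<And>a (x :: 'n rvec). a \<in> hbox R' ==> norm (hm a *v x) \<le> C * norm x"
   "\<And>a i j. a \<in> hbox R' ==> \<bar>hm a $ i $ j\<bar> \<le> C" by (rule hm_bound[OF R']) (rule that, assumption+)
 obtain \<rho> where \<rho>: "\<And>x. x \<in> B ==> norm x \<le> \<rho>"
  by (rule that[of "exp (2 * sqrt \<delta>) * 2"]) (unfold B_def, rule cone_ball_base_props(2))
 define V where "V = measure lborel (cball (0::'n rvec) (C * \<rho>))"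
 have V: "emeasure lborel (cball (0::'n rvec) (C * \<rho>)) = ennreal V"
  unfolding V_def by (rule emeasure_eq_ennreal_measure) (use emeasure_compact_finite[OF compact_cball[of "0::'n rvec" "C * \<rho>"]] in auto)
 define n where "n = CARD('n)"
 define M where "M = nat \<lceil>real N * V * exp R ^ n / measure lborel B\<rceil>"
 have key: "card J \<le> M" if b: "fst b > 0" and J: "J \<subseteq> {j. hprod (hinv (gc j)) b \<in> hbox R}" "finite J" for b J
 proof -
  have sub: "(*v) (hm (gc j)) ` B \<subseteq> (*v) (hm b) ` cball 0 (C * \<rho>)" and ge: "fst b / exp R \<le> fst (gc j)" if "j \<in> J" for j
  proof -
   define k where "k = hprod (hinv (gc j)) b"
   have k: "k \<in> hbox R" using J that by (auto simp: k_def)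
   have kp: "fst k > 0" by (rule hbox_fst[OF k])
   have ki: "hinv k \<in> hbox R'" unfolding R'_def by (rule hbox_hinv[OF k R])
   have hb: "hm k *v x = hm (hinv (gc j)) *v (hm b *v x)" for x by (simp add: k_def hm_hprod matrix_vector_mul_assoc del: hm.simps)
   show "(*v) (hm (gc j)) ` B \<subseteq> (*v) (hm b) ` cball 0 (C * \<rho>)"
   proof
    fix y assume "y \<in> (*v) (hm (gc j)) ` B"
    then obtain x where x: "x \<in> B" "y = hm (gc j) *v x" by auto
    define z where "z = hm (hinv k) *v x"
    have "x = hm k *v z" by (simp add: z_def hm_hinv_cancel[OF kp])
    then have "y = hm b *v z" unfolding x(2) hb by (simp add: hm_hinv_cancel[OF gc(1)])
    moreover have "norm z \<le> C * \<rho>" unfolding z_def using C(2)[OF ki, of x] \<rho>[OF x(1)] C(1) by (meson mult_left_mono less_imp_le order.trans)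
    ultimately show "y \<in> (*v) (hm b) ` cball 0 (C * \<rho>)" by auto
   qed
   have "fst k = fst b / fst (gc j)" unfolding k_def by (cases "gc j"; cases b) simp
   then have "fst b / fst (gc j) \<le> exp R" using hbox_fst_bounds(2)[OF k] by simp
   then show "fst b / exp R \<le> fst (gc j)" using gc(1)[of j] by (simp add: field_simps)
  qed
  have "ennreal (real (card J) * ((fst b / exp R) ^ n * measure lborel B)) = (\<Sum>j\<in>J. ennreal ((fst b / exp R) ^ n * measure lborel B))"
   using b by (simp add: ennreal_mult ennreal_of_nat_eq_real_of_nat)
  also have "\<dots> \<le> (\<Sum>j\<in>J. emeasure lborel ((*v) (hm (gc j)) ` B))"
  proof (rule sum_mono)
   fix j assume j: "j \<in> J"
   have "(fst b / exp R) ^ n \<le> fst (gc j) ^ n" using ge[OF j] b by (intro power_mono) auto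
   then have "ennreal ((fst b / exp R) ^ n * measure lborel B) \<le> ennreal (fst (gc j) ^ n * measure lborel B)"
    by (intro ennreal_leI mult_right_mono) auto
   also have "\<dots> = emeasure lborel ((*v) (hm (gc j)) ` B)"
    unfolding hm_image(2)[OF gc(1) B_borel] B_measure(2) n_def using gc(1)[of j] by (subst ennreal_mult) auto
   finally show "ennreal ((fst b / exp R) ^ n * measure lborel B) \<le> emeasure lborel ((*v) (hm (gc j)) ` B)" .
  qed
  also have "\<dots> = (\<integral>\<^sup>+x. (\<Sum>j\<in>J. indicator ((*v) (hm (gc j)) ` B) x) \<partial>lborel)"
   using hm_image(1)[OF gc(1) B_borel] by (subst nn_integral_sum) auto
  also have "\<dots> \<le> (\<integral>\<^sup>+x. of_nat N * indicator ((*v) (hm b) ` cball 0 (C * \<rho>)) x \<partial>lborel)"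
  proof (rule nn_integral_mono)
   fix x
   define J' where "J' = {j\<in>J. x \<in> (*v) (hm (gc j)) ` B}"
   have fJ': "finite J'" using J(2) by (simp add: J'_def)
   have s: "(\<Sum>j\<in>J. indicator ((*v) (hm (gc j)) ` B) x) = (of_nat (card J') :: ennreal)"
   proof -
    have "(\<Sum>j\<in>J. indicator ((*v) (hm (gc j)) ` B) x) = (\<Sum>j\<in>J'. 1 :: ennreal)"
     by (rule sum.mono_neutral_cong_right) (auto simp: J'_def J(2) indicator_def)
    then show ?thesis by simp
   qed
   show "(\<Sum>j\<in>J. indicator ((*v) (hm (gc j)) ` B) x) \<le> of_nat N * (indicator ((*v) (hm b) ` cball 0 (C * \<rho>)) x :: ennreal)"
   proof (cases "J' = {}")
    case True then show ?thesis unfolding s by simp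
   next
    case False
    then obtain j where j: "j \<in> J" "x \<in> (*v) (hm (gc j)) ` B" by (auto simp: J'_def)
    have "x \<in> light_cone" using j(2) cone_ball_base_props(1) hm_light_cone[OF gc(1)] by (auto simp: B_def)
    note Nx = N[OF this]
    have "J' \<subseteq> {j. x \<in> cone_ball \<delta> (w j)}" by (auto simp: J'_def ball_w(1))
    then have "card J' \<le> N" using Nx card_mono order.trans by blast
    moreover have "x \<in> (*v) (hm b) ` cball 0 (C * \<rho>)" using sub[OF j(1)] j(2) by blast
    ultimately show ?thesis unfolding s by (simp add: of_nat_mono)
   qed
  qed
  also have "\<dots> = of_nat N * emeasure lborel ((*v) (hm b) ` cball 0 (C * \<rho>))"
   using hm_image(1)[OF b, of "cball 0 (C * \<rho>)"] by (subst nn_integral_cmult) auto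
  also have "\<dots> = ennreal (real N * (fst b ^ n * V))"
   using hm_image(2)[OF b, of "cball 0 (C * \<rho>)"] b by (simp add: V n_def ennreal_mult V_def ennreal_of_nat_eq_real_of_nat)
  finally have "real (card J) * ((fst b / exp R) ^ n * measure lborel B) \<le> real N * (fst b ^ n * V)"
   using b by (subst (asm) ennreal_le_iff) (auto simp: V_def)
  then have "fst b ^ n * (real (card J) * measure lborel B) \<le> fst b ^ n * (real N * V * exp R ^ n)"
   by (simp add: power_divide field_simps)
  then have "real (card J) * measure lborel B \<le> real N * V * exp R ^ n"
   using b by (subst (asm) mult_le_cancel_left_pos) auto
  then have "real (card J) \<le> real N * V * exp R ^ n / measure lborel B"
   using B_measure(1) by (simp add: pos_le_divide_eq)
  then show ?thesis unfolding M_def by linarith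
 qed
 show ?thesis
 proof (rule that[of M])
  fix b :: "'n H_coords" assume "fst b > 0"
  from key[OF this] show "finite {j. hprod (hinv (gc j)) b \<in> hbox R} \<and> card {j. hprod (hinv (gc j)) b \<in> hbox R} \<le> M"
   by (intro finite_if_finite_subsets_card_bdd) auto
 qed
qed

end

context forward_cone
begin

section \<open>Haar measure of group boxes\<close>

text \<open>
  The dilations whose frequency-side element \<open>theta h\<close> is within the box around
  \<open>a\<close>.
\<close>

definition Eset :: "'n H_coords => real => 'n H_coords set" where
 "Eset a R = {h. fst h > 0 \<and> hprod (hinv a) (theta h) \<in> hbox R}"

lemma mem_Eset:
 "(\<gamma>, t, c) \<in> Eset (\<gamma>0, t0, c0) R \<longleftrightarrow> \<gamma> > 0 \<and> exp (- R) \<le> 1 / (\<gamma>0 * \<gamma>) \<and> 1 / (\<gamma>0 * \<gamma>) \<le> exp R \<and> \<bar>t - t0\<bar> \<le> R \<and>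
  (\<forall>i\<in>idx_mid. \<bar>c i - exp (t0 - t) * c0 i\<bar> \<le> R)"
proof -
 have e: "exp (- t) * (exp t0 * x) = exp (t0 - t) * x" for x :: real
  unfolding mult.assoc[symmetric] exp_add[symmetric] by simp
 show ?thesis by (auto simp: Eset_def hbox_def e)
qed

text \<open>
  The Lebesgue measure of the box: \<open>2 R\<close> for \<open>t\<close> and for every middle
  coordinate, and the length of an interval for \<open>\<gamma>\<close>.
\<close>

definition vol :: "real => real" where "vol R = (2 * R) ^ card (idx_mid :: 'n set) * (2 * R) * (exp R - exp (- R))"

lemma vol_pos: "R > 0 ==> vol R > 0" by (simp add: vol_def)

text \<open>
  Integrate the middle coordinates first: for fixed \<open>t\<close> each runs through an interval
  of length \<open>2 R\<close>, whose position depends on \<open>t\<close>.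
\<close>

lemma indicator_Eset_measurable: "(\<lambda>h. indicator (Eset a R) h :: ennreal) \<in> borel_measurable (coord_measure :: 'n H_coords measure)"
 and nn_integral_Eset: "fst a > 0 ==> R > 0 ==> (\<integral>\<^sup>+h. indicator (Eset a R) h \<partial>(coord_measure :: 'n H_coords measure)) = ennreal (vol R / fst a)"
proof -
 obtain \<gamma>0 t0 c0 where a: "a = (\<gamma>0, t0, c0)" by (cases a)
 define f :: "'n H_coords => ennreal" where "f = (\<lambda>h. indicator {\<gamma>. 0 < \<gamma> \<and> exp (- R) \<le> 1 / (\<gamma>0 * \<gamma>) \<and> 1 / (\<gamma>0 * \<gamma>) \<le> exp R} (fst h) *
   (indicator {t0 - R..t0 + R} (fst (snd h)) * (\<Prod>i\<in>idx_mid. indicator {- R..R} (snd (snd h) i - exp (t0 - fst (snd h)) * c0 i))))"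
 have fe: "indicator (Eset a R) h = f h" for h
 proof -
  obtain \<gamma> t c where h: "h = (\<gamma>, t, c)" by (cases h)
  have p: "(\<Prod>i\<in>idx_mid. indicator {- R..R} (c i - exp (t0 - t) * c0 i)) = (if \<forall>i\<in>idx_mid. \<bar>c i - exp (t0 - t) * c0 i\<bar> \<le> R then 1 else (0 :: ennreal))"
  proof (cases "\<forall>i\<in>idx_mid. \<bar>c i - exp (t0 - t) * c0 i\<bar> \<le> R")
   case True then show ?thesis by (auto simp: indicator_def abs_le_iff intro!: prod.neutral)
  next
   case False
   then obtain i where "i \<in> idx_mid" "\<not> \<bar>c i - exp (t0 - t) * c0 i\<bar> \<le> R" by blast
   then show ?thesis using False by (auto intro!: prod_zero bexI[of _ i] simp: abs_le_iff indicator_def)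
  qed
  have t: "indicator {t0 - R..t0 + R} t = (if \<bar>t - t0\<bar> \<le> R then 1 else (0 :: ennreal))" by (auto simp: indicator_def abs_le_iff)
  show ?thesis unfolding h a f_def fst_conv snd_conv p t by (auto simp: indicator_def mem_Eset)
 qed
 have mg: "Measurable.pred borel (\<lambda>\<gamma>. 0 < \<gamma> \<and> exp (- R) \<le> 1 / (\<gamma>0 * \<gamma>) \<and> 1 / (\<gamma>0 * \<gamma>) \<le> exp R)" by measurable
 have m1: "(\<lambda>\<gamma>. indicator {\<gamma>. 0 < \<gamma> \<and> exp (- R) \<le> 1 / (\<gamma>0 * \<gamma>) \<and> 1 / (\<gamma>0 * \<gamma>) \<le> exp R} \<gamma> :: ennreal) \<in> borel_measurable borel"
  using mg by (intro borel_measurable_indicator) (simp add: pred_def)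
 have mf: "f \<in> borel_measurable (coord_measure :: 'n H_coords measure)"
  unfolding f_def
 proof (intro borel_measurable_times_ennreal borel_measurable_prod_ennreal)
  show "(\<lambda>h. indicator {\<gamma>. 0 < \<gamma> \<and> exp (- R) \<le> 1 / (\<gamma>0 * \<gamma>) \<and> 1 / (\<gamma>0 * \<gamma>) \<le> exp R} (fst h) :: ennreal) \<in> borel_measurable (coord_measure :: 'n H_coords measure)"
   by (rule measurable_compose[OF measurable_coord_fst m1])
  show "(\<lambda>h. indicator {t0 - R..t0 + R} (fst (snd h)) :: ennreal) \<in> borel_measurable (coord_measure :: 'n H_coords measure)"
   by (rule measurable_compose[OF measurable_coord_t]) simp
  fix i :: 'n assume i: "i \<in> idx_mid"
  have "(\<lambda>h. snd (snd h) i - exp (t0 - fst (snd h)) * c0 i) \<in> borel_measurable (coord_measure :: 'n H_coords measure)"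
   using measurable_coord_c[OF i] measurable_coord_t by measurable
  then show "(\<lambda>h. indicator {- R..R} (snd (snd h) i - exp (t0 - fst (snd h)) * c0 i) :: ennreal) \<in> borel_measurable (coord_measure :: 'n H_coords measure)"
   by (rule measurable_compose) simp
 qed
 show "(\<lambda>h. indicator (Eset a R) h :: ennreal) \<in> borel_measurable (coord_measure :: 'n H_coords measure)" 
  unfolding ext[of "indicator (Eset a R)" f, OF fe] by (rule mf)
 assume a0: "fst a > 0" and R: "R > 0"
 have g0: "\<gamma>0 > 0" using a0 a by simp
 interpret PS: product_sigma_finite "\<lambda>_::'n. lborel :: real measure" by standard
 interpret PF: finite_product_sigma_finite "\<lambda>_::'n. lborel :: real measure" idx_mid by standard simp
 interpret P: pair_sigma_finite "lborel :: real measure" "\<Pi>\<^sub>M i\<in>(idx_mid::'n set). (lborel :: real measure)" by standard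
 define A where "A = {\<gamma>. 0 < \<gamma> \<and> exp (- R) \<le> 1 / (\<gamma>0 * \<gamma>) \<and> 1 / (\<gamma>0 * \<gamma>) \<le> exp R}"
 have Ae: "A = {exp (- R) / \<gamma>0 .. exp R / \<gamma>0}"
 proof (intro set_eqI)
  fix \<gamma>
  have "0 < \<gamma>" if "exp (- R) / \<gamma>0 \<le> \<gamma>" using that g0 divide_pos_pos[OF exp_gt_zero g0, of "- R"] by linarith
  then show "\<gamma> \<in> A \<longleftrightarrow> \<gamma> \<in> {exp (- R) / \<gamma>0 .. exp R / \<gamma>0}"
   unfolding A_def using g0 by (auto simp: field_simps exp_minus)
 qed
 have inner: "(\<integral>\<^sup>+c. (\<Prod>i\<in>idx_mid. indicator {- R..R} (c i - s * c0 i)) \<partial>(\<Pi>\<^sub>M i\<in>(idx_mid::'n set). (lborel :: real measure))) = ennreal ((2 * R) ^ card (idx_mid :: 'n set))" for s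
 proof -
  have one: "(\<integral>\<^sup>+x. indicator {- R..R} (x - s * c0 i) \<partial>(lborel :: real measure)) = ennreal (2 * R)" for i
  proof -
   have "(\<integral>\<^sup>+x. indicator {- R..R} (x - s * c0 i) \<partial>(lborel :: real measure)) = (\<integral>\<^sup>+x. indicator {s * c0 i - R..s * c0 i + R} x \<partial>lborel)"
    by (rule nn_integral_cong) (auto simp: indicator_def)
   also have "\<dots> = ennreal (2 * R)" using R by simp
   finally show ?thesis .
  qed
  have "(\<integral>\<^sup>+c. (\<Prod>i\<in>idx_mid. indicator {- R..R} (c i - s * c0 i)) \<partial>(\<Pi>\<^sub>M i\<in>(idx_mid::'n set). (lborel :: real measure))) = (\<Prod>i\<in>(idx_mid::'n set). ennreal (2 * R))"
   by (subst PS.product_nn_integral_prod[of idx_mid "\<lambda>i x. indicator {- R..R} (x - s * c0 i)"]) (simp_all add: one)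
  then show ?thesis using R by (simp add: ennreal_power)
 qed
 have "(\<integral>\<^sup>+h. indicator (Eset a R) h \<partial>(coord_measure :: 'n H_coords measure)) = (\<integral>\<^sup>+h. f h \<partial>coord_measure)" unfolding fe ..
 also have "\<dots> = (\<integral>\<^sup>+\<gamma>. \<integral>\<^sup>+tc. f (\<gamma>, tc) \<partial>(lborel \<Otimes>\<^sub>M (\<Pi>\<^sub>M i\<in>idx_mid. lborel)) \<partial>(restrict_space lborel {0<..}))"
  using mf unfolding coord_measure_def by (rule P.nn_integral_fst[symmetric])
 also have "\<dots> = (\<integral>\<^sup>+\<gamma>. indicator A \<gamma> * (ennreal (2 * R) * ennreal ((2 * R) ^ card (idx_mid :: 'n set))) \<partial>(restrict_space lborel {0<..}))"
 proof (rule nn_integral_cong)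
  fix \<gamma>
  define q :: "real \<times> ('n => real) => ennreal" where "q = (\<lambda>tc. indicator {t0 - R..t0 + R} (fst tc) * (\<Prod>i\<in>idx_mid. indicator {- R..R} (snd tc i - exp (t0 - fst tc) * c0 i)))"
  have mq: "q \<in> borel_measurable (lborel \<Otimes>\<^sub>M (\<Pi>\<^sub>M i\<in>(idx_mid::'n set). (lborel :: real measure)))"
   unfolding q_def
  proof (intro borel_measurable_times_ennreal borel_measurable_prod_ennreal)
   have mt: "fst \<in> borel_measurable (lborel \<Otimes>\<^sub>M (\<Pi>\<^sub>M i\<in>(idx_mid::'n set). (lborel :: real measure)))"
    using measurable_fst[of "lborel :: real measure" "\<Pi>\<^sub>M i\<in>(idx_mid::'n set). (lborel :: real measure)"] by simp
   show "(\<lambda>h. indicator {t0 - R..t0 + R} (fst h) :: ennreal) \<in> borel_measurable (lborel \<Otimes>\<^sub>M (\<Pi>\<^sub>M i\<in>(idx_mid::'n set). (lborel :: real measure)))"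
    by (rule measurable_compose[OF mt]) simp
   fix i :: 'n assume i: "i \<in> idx_mid"
   have "(\<lambda>tc. snd tc i) \<in> measurable ((lborel :: real measure) \<Otimes>\<^sub>M (\<Pi>\<^sub>M i\<in>(idx_mid::'n set). (lborel :: real measure))) (lborel :: real measure)"
    by (rule measurable_compose[OF measurable_snd measurable_component_singleton[OF i]])
   then have mc: "(\<lambda>tc. snd tc i) \<in> borel_measurable ((lborel :: real measure) \<Otimes>\<^sub>M (\<Pi>\<^sub>M i\<in>(idx_mid::'n set). (lborel :: real measure)))"
    by (simp only: measurable_lborel1)
   have "(\<lambda>h. snd h i - exp (t0 - fst h) * c0 i) \<in> borel_measurable (lborel \<Otimes>\<^sub>M (\<Pi>\<^sub>M i\<in>(idx_mid::'n set). (lborel :: real measure)))"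
    using mt mc by measurable
   then show "(\<lambda>h. indicator {- R..R} (snd h i - exp (t0 - fst h) * c0 i) :: ennreal) \<in> borel_measurable (lborel \<Otimes>\<^sub>M (\<Pi>\<^sub>M i\<in>(idx_mid::'n set). (lborel :: real measure)))"
    by (rule measurable_compose) simp
  qed
  have "(\<integral>\<^sup>+tc. f (\<gamma>, tc) \<partial>(lborel \<Otimes>\<^sub>M (\<Pi>\<^sub>M i\<in>idx_mid. lborel))) = (\<integral>\<^sup>+tc. indicator A \<gamma> * q tc \<partial>(lborel \<Otimes>\<^sub>M (\<Pi>\<^sub>M i\<in>idx_mid. lborel)))"
   by (simp add: f_def q_def A_def)
  also have "\<dots> = indicator A \<gamma> * (\<integral>\<^sup>+tc. q tc \<partial>(lborel \<Otimes>\<^sub>M (\<Pi>\<^sub>M i\<in>idx_mid. lborel)))"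
   by (rule nn_integral_cmult[OF mq])
  also have "(\<integral>\<^sup>+tc. q tc \<partial>(lborel \<Otimes>\<^sub>M (\<Pi>\<^sub>M i\<in>idx_mid. lborel))) = (\<integral>\<^sup>+t. \<integral>\<^sup>+c. q (t, c) \<partial>(\<Pi>\<^sub>M i\<in>idx_mid. lborel) \<partial>lborel)"
   by (rule PF.nn_integral_fst[OF mq, symmetric])
  also have "\<dots> = (\<integral>\<^sup>+t. indicator {t0 - R..t0 + R} t * ennreal ((2 * R) ^ card (idx_mid :: 'n set)) \<partial>lborel)"
  proof (rule nn_integral_cong)
   fix t
   have "(\<integral>\<^sup>+c. q (t, c) \<partial>(\<Pi>\<^sub>M i\<in>idx_mid. lborel)) = indicator {t0 - R..t0 + R} t * (\<integral>\<^sup>+c. (\<Prod>i\<in>idx_mid. indicator {- R..R} (c i - exp (t0 - t) * c0 i)) \<partial>(\<Pi>\<^sub>M i\<in>(idx_mid::'n set). (lborel :: real measure)))"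
    unfolding q_def fst_conv snd_conv
   proof (rule nn_integral_cmult, intro borel_measurable_prod_ennreal)
    fix i :: 'n assume i: "i \<in> idx_mid"
    have mc: "(\<lambda>c. c i) \<in> borel_measurable (\<Pi>\<^sub>M i\<in>(idx_mid::'n set). (lborel :: real measure))"
     using measurable_component_singleton[OF i, of "\<lambda>_. lborel :: real measure"] by simp
    have "(\<lambda>c. c i - exp (t0 - t) * c0 i) \<in> borel_measurable (\<Pi>\<^sub>M i\<in>(idx_mid::'n set). (lborel :: real measure))"
     using mc by measurable
    then show "(\<lambda>c. indicator {- R..R} (c i - exp (t0 - t) * c0 i) :: ennreal) \<in> borel_measurable (\<Pi>\<^sub>M i\<in>(idx_mid::'n set). (lborel :: real measure))"
     by (rule measurable_compose) simp
   qed
   then show "(\<integral>\<^sup>+c. q (t, c) \<partial>(\<Pi>\<^sub>M i\<in>idx_mid. lborel)) = indicator {t0 - R..t0 + R} t * ennreal ((2 * R) ^ card (idx_mid :: 'n set))"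
    unfolding inner .
  qed
  also have "\<dots> = ennreal (2 * R) * ennreal ((2 * R) ^ card (idx_mid :: 'n set))"
   using R by (simp add: nn_integral_multc)
  finally show "(\<integral>\<^sup>+tc. f (\<gamma>, tc) \<partial>(lborel \<Otimes>\<^sub>M (\<Pi>\<^sub>M i\<in>idx_mid. lborel))) = indicator A \<gamma> * (ennreal (2 * R) * ennreal ((2 * R) ^ card (idx_mid :: 'n set)))" .
 qed
 also have "\<dots> = (\<integral>\<^sup>+\<gamma>. indicator A \<gamma> * (ennreal (2 * R) * ennreal ((2 * R) ^ card (idx_mid :: 'n set))) \<partial>lborel)"
 proof -
  have "indicator A \<gamma> * (ennreal (2 * R) * ennreal ((2 * R) ^ card (idx_mid :: 'n set))) * indicator {0<..} \<gamma> = indicator A \<gamma> * (ennreal (2 * R) * ennreal ((2 * R) ^ card (idx_mid :: 'n set)))" for \<gamma>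
   by (auto simp: A_def indicator_def)
  then show ?thesis by (subst nn_integral_restrict_space) simp_all
 qed
 also have "\<dots> = ennreal (exp R / \<gamma>0 - exp (- R) / \<gamma>0) * (ennreal (2 * R) * ennreal ((2 * R) ^ card (idx_mid :: 'n set)))"
  unfolding Ae using R g0 by (simp add: nn_integral_multc divide_right_mono)
 also have "\<dots> = ennreal ((exp R / \<gamma>0 - exp (- R) / \<gamma>0) * (2 * R * (2 * R) ^ card (idx_mid :: 'n set)))"
  using R g0 by (simp add: ennreal_mult divide_right_mono)
 also have "(exp R / \<gamma>0 - exp (- R) / \<gamma>0) * (2 * R * (2 * R) ^ card (idx_mid :: 'n set)) = vol R / fst a"
  by (simp add: vol_def a diff_divide_distrib[symmetric] mult_ac)
 finally show "(\<integral>\<^sup>+h. indicator (Eset a R) h \<partial>(coord_measure :: 'n H_coords measure)) = ennreal (vol R / fst a)" .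
qed

text \<open>
  On the set the product \<open>fst a * fst h\<close> lies between \<open>exp (- R)\<close> and
  \<open>exp R\<close>, so powers of \<open>fst h\<close> are comparable to inverse powers of
  \<open>fst a\<close>.
\<close>

lemma Eset_weight:
 assumes h: "h \<in> Eset a R" and a: "fst a > 0" and R: "R \<ge> 0"
 shows "exp (- R * \<bar>\<sigma> - 1\<bar>) * fst a powr (1 - \<sigma>) \<le> fst h powr (\<sigma> - 1)" "fst h powr (\<sigma> - 1) \<le> exp (R * \<bar>\<sigma> - 1\<bar>) * fst a powr (1 - \<sigma>)"
proof -
 obtain \<gamma>0 t0 c0 \<gamma> t c where ah: "a = (\<gamma>0, t0, c0)" "h = (\<gamma>, t, c)" by (cases a; cases h)
 have g: "\<gamma>0 > 0" "\<gamma> > 0" and x: "exp (- R) \<le> 1 / (\<gamma>0 * \<gamma>)" "1 / (\<gamma>0 * \<gamma>) \<le> exp R"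
  using h a by (auto simp: ah mem_Eset)
 have "1 / (\<gamma>0 * \<gamma>) = exp (- ln (\<gamma>0 * \<gamma>))" using g by (simp add: exp_minus inverse_eq_divide)
 then have "- R \<le> - ln (\<gamma>0 * \<gamma>)" "- ln (\<gamma>0 * \<gamma>) \<le> R"
  using x by (simp_all only: exp_le_cancel_iff)
 then have "\<bar>ln (\<gamma>0 * \<gamma>)\<bar> \<le> R" by auto
 then have b: "\<bar>(\<sigma> - 1) * ln (\<gamma>0 * \<gamma>)\<bar> \<le> R * \<bar>\<sigma> - 1\<bar>" unfolding abs_mult mult.commute[of R] by (intro mult_left_mono) auto
 have e: "\<gamma> powr (\<sigma> - 1) = exp ((\<sigma> - 1) * ln (\<gamma>0 * \<gamma>)) * \<gamma>0 powr (1 - \<sigma>)"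
  using g by (simp add: powr_def ln_mult exp_add[symmetric] algebra_simps)
 show "exp (- R * \<bar>\<sigma> - 1\<bar>) * fst a powr (1 - \<sigma>) \<le> fst h powr (\<sigma> - 1)"
  unfolding ah fst_conv e using b by (intro mult_right_mono) auto
 show "fst h powr (\<sigma> - 1) \<le> exp (R * \<bar>\<sigma> - 1\<bar>) * fst a powr (1 - \<sigma>)"
  unfolding ah fst_conv e using b by (intro mult_right_mono) auto
qed

end

section \<open>Finite sums in mixed norms\<close>

lemma epowr_ennreal: "x \<ge> 0 ==> epowr (ennreal x) r = ennreal (x powr r)"
 by (simp add: epowr_def)

lemma epowr_top: "epowr top r = top"
 by (simp add: epowr_def)

lemma epowr_mono:
 assumes "x \<le> y" "r \<ge> 0" shows "epowr x r \<le> epowr y r"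
proof (cases y rule: ennreal_cases)
 case (real b)
 with assms(1) obtain a where a: "x = ennreal a" "a \<ge> 0" by (cases x rule: ennreal_cases) (auto simp: top_unique)
 have "a powr r \<le> b powr r" using assms real a by (intro powr_mono2) auto
 then show ?thesis using real a by (simp add: epowr_ennreal ennreal_leI)
next
 case top then show ?thesis by (simp add: epowr_top)
qed

lemma epowr_cmult:
 assumes "c > 0" shows "epowr (ennreal c * x) r = ennreal (c powr r) * epowr x r"
proof (cases x rule: ennreal_cases)
 case (real b)
 then show ?thesis using assms by (simp add: ennreal_mult[symmetric] epowr_ennreal powr_mult)
next
 case top
 have "c powr r > 0" using assms by simp
 with top assms show ?thesis by (simp add: epowr_top ennreal_mult_top)
qed

lemma epowr_epowr: "epowr (epowr x a) b = epowr x (a * b)"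
 by (cases x rule: ennreal_cases) (simp_all add: epowr_top epowr_ennreal powr_powr)

lemma measurable_epowr:
 assumes [measurable]: "F \<in> borel_measurable M" shows "(\<lambda>x. epowr (F x) r) \<in> borel_measurable M"
 unfolding epowr_def by measurable

text \<open>
  Both convex and concave powers occur. Bounding the sum by \<open>M\<close> times its largest
  term treats all exponents alike.
\<close>

lemma epowr_sum_le:
 assumes J: "finite J" "card J \<le> M" and r: "r > 0" and M: "M > 0"
 shows "epowr (\<Sum>j\<in>J. x j) r \<le> ennreal (real M powr r) * (\<Sum>j\<in>J. epowr (x j) r)"
proof (cases "J = {}")
 case True
 have "epowr 0 r = 0" using epowr_ennreal[of 0 r] by simp
 then show ?thesis unfolding True by simp
next
 case False
 define m where "m = Max (x ` J)"
 have "m \<in> x ` J" unfolding m_def using J(1) False by (intro Max_in) auto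
 then obtain j0 where j0: "j0 \<in> J" "m = x j0" by blast
 have "(\<Sum>j\<in>J. x j) \<le> of_nat (card J) * m" using J(1) by (intro sum_bounded_above) (simp add: m_def)
 also have "\<dots> \<le> ennreal (real M) * m"
  unfolding ennreal_of_nat_eq_real_of_nat using J(2) by (intro mult_right_mono ennreal_leI) auto
 finally have "epowr (\<Sum>j\<in>J. x j) r \<le> epowr (ennreal (real M) * m) r" using r by (intro epowr_mono) auto
 also have "\<dots> = ennreal (real M powr r) * epowr m r" using M by (intro epowr_cmult) simp
 also have "\<dots> \<le> ennreal (real M powr r) * (\<Sum>j\<in>J. epowr (x j) r)"
  unfolding j0(2) by (rule mult_left_mono[OF member_le_sum[of j0 J "\<lambda>j. epowr (x j) r"]]) (use j0 J in auto)
 finally show ?thesis .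
qed

lemma pint_sum_le:
 assumes m: "\<And>j. j \<in> J ==> F j \<in> borel_measurable borel" and J: "finite J" "card J \<le> M" and p: "p > 0" and M: "M > 0"
 shows "pint p (\<lambda>x. \<Sum>j\<in>J. F j x) \<le> ennreal (real M powr p) * (\<Sum>j\<in>J. pint p (F j))"
proof -
 have m': "(\<lambda>x. ennreal (cmod (F j x) powr p)) \<in> borel_measurable lborel" if "j \<in> J" for j
  using m[OF that] by measurable
 have "ennreal (cmod (\<Sum>j\<in>J. F j x) powr p) \<le> ennreal (real M powr p) * (\<Sum>j\<in>J. ennreal (cmod (F j x) powr p))" for x
 proof -
  have "ennreal (cmod (\<Sum>j\<in>J. F j x) powr p) \<le> ennreal ((\<Sum>j\<in>J. cmod (F j x)) powr p)"
   using p norm_sum[of "\<lambda>j. F j x" J] by (intro ennreal_leI powr_mono2) auto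
  also have "\<dots> = epowr (\<Sum>j\<in>J. ennreal (cmod (F j x))) p"
   by (subst sum_ennreal) (simp_all add: epowr_ennreal sum_nonneg)
  also have "\<dots> \<le> ennreal (real M powr p) * (\<Sum>j\<in>J. epowr (ennreal (cmod (F j x))) p)" by (rule epowr_sum_le[OF J p M])
  finally show ?thesis by (simp add: epowr_ennreal)
 qed
 then have "pint p (\<lambda>x. \<Sum>j\<in>J. F j x) \<le> (\<integral>\<^sup>+x. ennreal (real M powr p) * (\<Sum>j\<in>J. ennreal (cmod (F j x) powr p)) \<partial>lborel)"
  unfolding pint_def by (rule nn_integral_mono)
 also have "\<dots> = ennreal (real M powr p) * (\<integral>\<^sup>+x. (\<Sum>j\<in>J. ennreal (cmod (F j x) powr p)) \<partial>lborel)"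
  by (rule nn_integral_cmult) (intro borel_measurable_sum m')
 also have "(\<integral>\<^sup>+x. (\<Sum>j\<in>J. ennreal (cmod (F j x) powr p)) \<partial>lborel) = (\<Sum>j\<in>J. pint p (F j))"
  unfolding pint_def by (rule nn_integral_sum) (rule m')
 finally show ?thesis .
qed

text \<open>
  The quantity that is summed in the Besov norm and integrated in the coorbit norm: the
  \<open>q\<close>-th power of the \<open>L\<^sup>p\<close> norm of a coefficient function.
\<close>

definition cpow :: "real => real => (('n::finite rvec => complex) => complex) => ('n rvec => complex) => ennreal" where
 "cpow p q f a = epowr (pint p (coeff_fun f a)) (q / p)"

lemma coeff_fun_sum:
 assumes f: "f \<in> S_cone_dual" and J: "finite J" and b: "\<And>j. j \<in> J ==> b j \<in> S_cone"
 shows "coeff_fun f (\<lambda>x. \<Sum>j\<in>J. b j x) = (\<lambda>x. \<Sum>j\<in>J. coeff_fun f (b j) x)"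
 unfolding coeff_fun_def by (rule ext) (intro S_cone_dual_sum f J S_cone_translate b)

lemma fourier_sum:
 assumes "finite J" "\<And>j. j \<in> J ==> b j \<in> schwartz"
 shows "fourier (\<lambda>x. \<Sum>j\<in>J. b j x) w = (\<Sum>j\<in>J. fourier (b j) w)"
 using assms
proof (induction J rule: finite_induct)
 case empty then show ?case by (simp add: fourier_def)
next
 case (insert i J)
 have "fourier (\<lambda>x. b i x + (\<Sum>j\<in>J. b j x)) w = fourier (b i) w + fourier (\<lambda>x. \<Sum>j\<in>J. b j x) w"
  by (rule fourier_add) (use insert.prems in \<open>auto intro!: schwartz_sum\<close>)
 then show ?case using insert by simp
qed

text \<open>
  The constant depends on the multiplier only through the bound \<open>L\<close> for the
  \<open>L\<^sup>1\<close> norm of its kernel, and on the sum only through the number of terms.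
\<close>

definition mult_const :: "'n::finite itself => real => real => nat => real => real" where
 "mult_const T p q M L = ((fcst T * L) powr p) powr (q / p) * ((real M powr p) powr (q / p) * real M powr (q / p))"

text \<open>
  If the transform of \<open>a\<close> is a multiplier times the sum of the transforms of the
  \<open>b j\<close>, then \<open>a\<close> is a convolution of the kernel with that sum, and the
  Young inequality applies.
\<close>

lemma cpow_le:
 fixes f :: "('n::{finite,linorder} rvec => complex) => complex"
 assumes p: "p \<ge> 1" and q: "q \<ge> 1" and f: "f \<in> S_cone_dual" and a: "a \<in> S_cone"
  and J: "finite J" "card J \<le> M" "M > 0" and b: "\<And>j. j \<in> J ==> b j \<in> S_cone"
  and F: "integrable lborel F" "rapid (inv_fourier F)" "(\<integral>x. cmod (inv_fourier F x) \<partial>lborel) \<le> L" and L: "L > 0"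
  and eq: "\<And>v. fourier a v = F v * (\<Sum>j\<in>J. fourier (b j) v)"
 shows "cpow p q f a \<le> ennreal (mult_const TYPE('n) p q M L) * (\<Sum>j\<in>J. cpow p q f (b j))"
proof -
 define b' where "b' = (\<lambda>x. \<Sum>j\<in>J. b j x)"
 have b': "b' \<in> S_cone" unfolding b'_def by (rule S_cone_sum[OF b])
 define m where "m = (\<lambda>y. of_real (fcst TYPE('n)) * inv_fourier F y)"
 have fp: "fcst TYPE('n) > 0" by (rule fcst_pos)
 have cs: "coeff_fun f (\<lambda>x. \<Sum>j\<in>J. b j x) = (\<lambda>x. \<Sum>j\<in>J. coeff_fun f (b j) x)"
  by (rule coeff_fun_sum[OF f J(1)]) (rule b)
 have "a = convol m b'"
  unfolding m_def
 proof (rule fourier_multiplier_convol[OF S_cone_schwartz[OF a] S_cone_schwartz[OF b'] F(1)])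
  show "fourier a w = F w * fourier b' w" for w
   unfolding b'_def using fourier_sum[OF J(1) S_cone_schwartz[OF b], where w = w] eq[of w] by simp
  show "inv_fourier F \<in> borel_measurable borel" by (rule rapid_measurable[OF F(2)])
 qed
 moreover have "rapid m" unfolding m_def by (rule rapid_cmult[OF F(2)])
 moreover have "(\<integral>x. cmod (m x) \<partial>lborel) \<le> fcst TYPE('n) * L"
  using F(3) fp by (simp add: m_def norm_mult mult_left_mono)
 ultimately have "pint p (coeff_fun f a) \<le> ennreal ((fcst TYPE('n) * L) powr p) * pint p (coeff_fun f b')"
  using young_coeff_fun[OF f a b' _ _ p] by blast
 also have "\<dots> \<le> ennreal ((fcst TYPE('n) * L) powr p) * (ennreal (real M powr p) * (\<Sum>j\<in>J. pint p (coeff_fun f (b j))))"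
  unfolding b'_def cs
  by (rule mult_left_mono[OF pint_sum_le[OF measurable_coeff_fun[OF f b] J(1,2) _ J(3)]]) (use p in auto)
 finally have "cpow p q f a \<le> epowr (ennreal ((fcst TYPE('n) * L) powr p) * (ennreal (real M powr p) * (\<Sum>j\<in>J. pint p (coeff_fun f (b j))))) (q / p)"
  unfolding cpow_def by (rule epowr_mono) (use p q in auto)
 also have "\<dots> = ennreal (((fcst TYPE('n) * L) powr p) powr (q / p)) * (ennreal ((real M powr p) powr (q / p)) * epowr (\<Sum>j\<in>J. pint p (coeff_fun f (b j))) (q / p))"
  by (subst epowr_cmult, use fp L in simp, subst epowr_cmult, use J in simp) (rule refl)
 also have "\<dots> \<le> ennreal (((fcst TYPE('n) * L) powr p) powr (q / p)) * (ennreal ((real M powr p) powr (q / p)) * (ennreal (real M powr (q / p)) * (\<Sum>j\<in>J. cpow p q f (b j))))"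
  unfolding cpow_def by (intro mult_left_mono epowr_sum_le J) (use p q in auto)
 also have "\<dots> = ennreal (mult_const TYPE('n) p q M L) * (\<Sum>j\<in>J. cpow p q f (b j))"
  unfolding mult_const_def by (simp add: ennreal_mult mult.assoc)
 finally show ?thesis .
qed

lemma mult_const_pos: "M > 0 ==> L > 0 ==> mult_const TYPE('n::finite) p q M L > 0"
 unfolding mult_const_def using fcst_pos[where 'n = 'n] by simp

lemma ubd_mono: "ubd k I S F ==> T \<subseteq> S ==> ubd k I T F"
proof (induction k arbitrary: F)
 case 0 then show ?case unfolding ubd.simps by (meson subsetD)
next
 case (Suc k)
 obtain F' where F': "\<And>i x. i \<in> I ==> x \<in> S ==> (F i has_derivative (\<lambda>h. \<Sum>l\<in>UNIV. h $ l *\<^sub>R F' l i x)) (at x)" "\<And>l. ubd k I S (F' l)"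
  by (rule ubd_SucE[OF Suc.prems(1)]) (rule that, assumption+)
 obtain C where C: "\<forall>i\<in>I. \<forall>x\<in>S. cmod (F i x) \<le> C" using ubd_bounded[OF Suc.prems(1)] by (elim exE)
 show ?case unfolding ubd.simps(2)[of k]
 proof (intro conjI exI[of _ F'] exI[of _ C] ballI allI)
  show "ubd k I T (F' l)" for l by (rule Suc.IH[OF F'(2) Suc.prems(2)])
  show "cmod (F i x) \<le> C" if "i \<in> I" "x \<in> T" for i x using C that Suc.prems(2) by auto
  show "(F i has_derivative (\<lambda>h. \<Sum>l\<in>UNIV. h $ l *\<^sub>R F' l i x)) (at x)" if "i \<in> I" "x \<in> T" for i x
   by (rule F'(1)[OF that(1) subsetD[OF Suc.prems(2) that(2)]])
 qed
qed

lemma fourier_compact_integrable: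
 assumes a: "a \<in> schwartz" and T: "compact T" "\<And>v. v \<notin> T ==> fourier a v = 0"
 shows "integrable lborel (fourier a)"
 by (rule integrable_bounded_supp(1)[OF borel_measurable_continuous_onI[OF fourier_continuous[OF schwartz_rapid[OF a]]]
   fourier_bound[OF schwartz_integrable[OF a]] T(2) T(1)])

lemma schwartz_fourier_inversion:
 assumes a: "a \<in> schwartz" and i: "integrable lborel (fourier a)"
 shows "inv_fourier (fourier a) = a"
proof -
 obtain C where "\<forall>x. (1 + norm x) ^ 0 * cmod (a x) \<le> C" using schwartz_rapid[OF a] unfolding rapid_def by blast
 then have "cmod (a x) \<le> C" for x by simp
 then show ?thesis using fourier_inversion[OF schwartz_continuous[OF a] _ schwartz_integrable[OF a] i] by blast
qed

context forward_cone
begin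

text \<open>
  Joint continuity of the action at the identity, uniformly over small boxes; a sequence violating
  the claim would converge to the identity.
\<close>

lemma hbox_nbhd:
 assumes U: "open U" "(z :: 'n rvec) \<in> U"
 obtains r d where "r > 0" "d > 0" "\<And>v y. v \<in> hbox r ==> dist y z < d ==> hm (hinv v) *v y \<in> U"
proof (rule ccontr)
 assume n: "\<not> thesis"
 define e where "e m = inverse (real (Suc m))" for m
 have e0: "e m > 0" for m by (simp add: e_def)
 have E: "e \<longlonglongrightarrow> 0" unfolding e_def[abs_def] by (rule LIMSEQ_inverse_real_of_nat)
 have "\<exists>vy. fst vy \<in> hbox (e m) \<and> dist (snd vy) z < e m \<and> hm (hinv (fst vy)) *v snd vy \<notin> U" for m
 proof (rule ccontr)
  assume c: "\<not> (\<exists>vy. fst vy \<in> hbox (e m) \<and> dist (snd vy) z < e m \<and> hm (hinv (fst vy)) *v snd vy \<notin> U)"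
  have thesis
  proof (rule that[OF e0 e0])
   fix v y assume "v \<in> hbox (e m)" "dist y z < e m"
   then show "hm (hinv v) *v y \<in> U" using c by (metis fst_conv snd_conv)
  qed
  with n show False by blast
 qed
 then obtain X where X: "\<And>m. fst (X m) \<in> hbox (e m) \<and> dist (snd (X m)) z < e m \<and> hm (hinv (fst (X m))) *v snd (X m) \<notin> U" by metis
 define g where "g m = fst (fst (X m))" for m
 define t where "t m = fst (snd (fst (X m)))" for m
 define c where "c m = snd (snd (fst (X m)))" for m
 have Xe: "fst (X m) = (g m, t m, c m)" for m by (simp add: g_def t_def c_def)
 have b: "exp (- e m) \<le> g m" "g m \<le> exp (e m)" "\<bar>t m\<bar> \<le> e m" "\<And>i. i \<in> idx_mid ==> \<bar>c m i\<bar> \<le> e m" for m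
  using X[of m] unfolding Xe hbox_def by auto
 have "(\<lambda>m. exp (- e m)) \<longlonglongrightarrow> exp (- 0)" "(\<lambda>m. exp (e m)) \<longlonglongrightarrow> exp 0" by (intro tendsto_intros E)+
 then have ee: "(\<lambda>m. exp (- e m)) \<longlonglongrightarrow> 1" "(\<lambda>m. exp (e m)) \<longlonglongrightarrow> 1" by simp_all
 have gl: "g \<longlonglongrightarrow> 1"
  by (rule tendsto_sandwich[OF _ _ ee]) (use b in auto)
 have tl: "t \<longlonglongrightarrow> 0" by (rule Lim_null_comparison[OF _ E]) (use b in auto)
 define d where "d m = trunc (\<lambda>i. - exp (t m) * c m i)" for m
 have dl: "d \<longlonglongrightarrow> 0"
 proof (rule vec_tendstoI)
  fix i
  show "(\<lambda>m. d m $ i) \<longlonglongrightarrow> 0 $ i"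
  proof (cases "i \<in> idx_mid")
   case True
   have "(\<lambda>m. c m i) \<longlonglongrightarrow> 0" by (rule Lim_null_comparison[OF _ E]) (use b(4)[OF True] in auto)
   from tendsto_mult[OF tendsto_minus[OF tendsto_exp[OF tl]] this]
   show ?thesis using True by (simp add: d_def trunc_def)
  next
   case False then show ?thesis by (simp add: d_def trunc_def)
  qed
 qed
 have he: "hm (hinv (fst (X m))) = hm (1 / g m, - t m, vec_nth (d m))" for m
  unfolding d_def hm_trunc Xe hinv.simps ..
 have "(\<lambda>m. hm (hinv (fst (X m)))) \<longlonglongrightarrow> hm (1 / 1, - 0, vec_nth 0)"
  unfolding he by (intro tendsto_hm tendsto_divide tendsto_const gl tendsto_minus tl dl) simp
 moreover have "hm (1 / 1, - 0, vec_nth 0) = mat 1" unfolding hm_one[symmetric] by (simp add: zero_vec_def del: hm.simps) (rule hm_cong, simp)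
 ultimately have L: "(\<lambda>m. hm (hinv (fst (X m)))) \<longlonglongrightarrow> mat 1" by (simp only:)
 have "(\<lambda>m. dist (snd (X m)) z) \<longlonglongrightarrow> 0" by (rule Lim_null_comparison[OF _ E]) (use X in \<open>auto simp: less_imp_le\<close>)
 then have Y: "(\<lambda>m. snd (X m)) \<longlonglongrightarrow> z" by (subst tendsto_dist_iff)
 have "(\<lambda>m. hm (hinv (fst (X m))) *v snd (X m)) \<longlonglongrightarrow> mat 1 *v z" by (rule tendsto_matrix_vector_mult[OF L Y])
 then have "(\<lambda>m. hm (hinv (fst (X m))) *v snd (X m)) \<longlonglongrightarrow> z" by (simp only: matrix_vector_mul_lid)
 from topological_tendstoD[OF this U] have "eventually (\<lambda>m. hm (hinv (fst (X m))) *v snd (X m) \<in> U) sequentially" .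
 then obtain m where "hm (hinv (fst (X m))) *v snd (X m) \<in> U" unfolding eventually_sequentially by blast
 with X show False by blast
qed

end

text \<open>
  The wavelet, a smooth bump \<open>\<phi>\<close> equal to one on the base ball, and the
  functions \<open>\<psi> j\<close> whose transforms are the normalised translates of the bump.
\<close>

locale besov_setting = whitney dummy \<delta> w gc
 for dummy :: "'n::{finite,linorder} itself" and \<delta> :: real and w :: "nat => 'n rvec" and gc :: "nat => 'n H_coords" +
 fixes u :: "'n rvec => complex" and \<phi> :: "'n rvec => real" and \<psi> :: "nat => 'n rvec => complex"
 assumes u: "cone_wavelet u"
  and phi: "smooth \<phi>" "\<And>x. 0 \<le> \<phi> x \<and> \<phi> x \<le> 1" "supp \<phi> \<subseteq> cone_ball_base (2 * \<delta>)" "\<And>x. x \<in> cone_ball_base \<delta> ==> \<phi> x = 1"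
  and psi: "\<And>j. \<psi> j \<in> schwartz"
   "\<And>j. fourier (\<psi> j) = (\<lambda>v. of_real (\<phi> (hm (hinv (gc j)) *v v) / (\<Sum>i. \<phi> (hm (hinv (gc i)) *v v))))"
begin

section \<open>Littlewood--Paley pieces and wavelet coefficients\<close>

text \<open>
  The denominator of the partition of unity. At a point of the cone only finitely many terms are
  nonzero, by properness and the lattice count, and one of them equals one.
\<close>

definition Phi :: "'n rvec => real" where "Phi v = (\<Sum>i. \<phi> (hm (hinv (gc i)) *v v))"
definition S0 :: "'n rvec set" where "S0 = supp (fourier u)"
definition S1 :: "'n rvec set" where "S1 = supp \<phi>"

lemma uS: "u \<in> S_cone" using u by (simp add: cone_wavelet_def)
lemma u_schwartz: "u \<in> schwartz" by (rule S_cone_schwartz[OF uS])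

lemma S0: "compact S0" "S0 \<subseteq> light_cone" "fourier u v \<noteq> 0 ==> v \<in> S0"
 using u by (auto simp: cone_wavelet_def S0_def supp_def intro!: subsetD[OF closure_subset])

lemma S1: "compact S1" "S1 \<subseteq> light_cone" "\<phi> v \<noteq> 0 ==> v \<in> S1"
proof -
 have "bounded S1" unfolding bounded_iff S1_def using cone_ball_base_props(2) phi(3) by blast
 then show "compact S1" by (simp add: compact_eq_bounded_closed S1_def supp_def)
 show "S1 \<subseteq> light_cone" unfolding S1_def using cone_ball_base_props(1) phi(3) by blast
 show "\<phi> v \<noteq> 0 ==> v \<in> S1" unfolding S1_def supp_def by (rule subsetD[OF closure_subset]) simp
qed

text \<open>
  Which lattice translates of the bump can be nonzero at \<open>hm b *v x\<close> is decided by
  the position of \<open>b\<close> alone, uniformly for \<open>x\<close> in a compact set.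
\<close>

lemma partition_overlap:
 assumes "compact S" "S \<subseteq> light_cone"
 obtains R where "R > 0"
  "\<And>i b x. fst b > 0 ==> x \<in> S ==> \<phi> (hm (hinv (gc i)) *v (hm b *v x)) \<noteq> 0 ==> hprod (hinv (gc i)) b \<in> hbox R"
proof -
 obtain R where R: "R > 0" "\<And>a x. fst a > 0 ==> x \<in> S ==> hm a *v x \<in> S1 ==> a \<in> hbox R"
  by (rule proper_action[OF assms S1(1,2)]) (rule that, assumption+)
 show ?thesis
 proof (rule that[OF R(1)])
  fix i b x assume a: "fst b > 0" "x \<in> S" "\<phi> (hm (hinv (gc i)) *v (hm b *v x)) \<noteq> 0"
  have e: "hm (hinv (gc i)) *v (hm b *v x) = hm (hprod (hinv (gc i)) b) *v x"
   by (simp add: hm_hprod matrix_vector_mul_assoc del: hm.simps)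
  show "hprod (hinv (gc i)) b \<in> hbox R"
   by (rule R(2)[OF fst_hprod[OF fst_hinv[OF gc(1)] a(1)] a(2)]) (use S1(3)[OF a(3)] in \<open>simp only: e\<close>)
 qed
qed

lemma Phi_eq:
 assumes "finite J" "\<And>i. i \<notin> J ==> \<phi> (hm (hinv (gc i)) *v v) = 0"
 shows "Phi v = (\<Sum>i\<in>J. \<phi> (hm (hinv (gc i)) *v v))"
 unfolding Phi_def by (rule suminf_finite[OF assms])

lemma finite_active: assumes "v \<in> light_cone" shows "finite {i. \<phi> (hm (hinv (gc i)) *v v) \<noteq> 0}"
proof -
 obtain b where b: "fst b > 0" "hm b *v base_pt = v" by (rule hm_transitive[OF assms]) (rule that, assumption+)
 obtain R where R: "R > 0" "\<And>i b x. fst b > 0 ==> x \<in> {base_pt} ==> \<phi> (hm (hinv (gc i)) *v (hm b *v x)) \<noteq> 0 ==> hprod (hinv (gc i)) b \<in> hbox R"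
  by (rule partition_overlap[of "{base_pt}"]) (use base_pt_light_cone in simp_all)
 obtain M where M: "\<And>b. fst b > 0 ==> finite {j. hprod (hinv (gc j)) b \<in> hbox R} \<and> card {j. hprod (hinv (gc j)) b \<in> hbox R} \<le> M"
  by (rule count_bound[OF less_imp_le[OF R(1)]]) (rule that, assumption+)
 have "{i. \<phi> (hm (hinv (gc i)) *v v) \<noteq> 0} \<subseteq> {j. hprod (hinv (gc j)) b \<in> hbox R}"
  using R(2)[OF b(1), of base_pt] unfolding b(2) by auto
 then show ?thesis using M[OF b(1)] finite_subset by blast
qed

lemma Phi_ge_1: assumes v: "v \<in> light_cone" shows "Phi v \<ge> 1"
proof -
 obtain j where j: "hm (hinv (gc j)) *v v \<in> B" using covers[OF v] by (elim exE)
 have 1: "\<phi> (hm (hinv (gc j)) *v v) = 1" by (rule phi(4)) (use j in \<open>simp only: B_def\<close>)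
 have "\<phi> (hm (hinv (gc j)) *v v) \<le> (\<Sum>i\<in>{i. \<phi> (hm (hinv (gc i)) *v v) \<noteq> 0}. \<phi> (hm (hinv (gc i)) *v v))"
  by (rule member_le_sum[where f = "\<lambda>i. \<phi> (hm (hinv (gc i)) *v v)"]) (use 1 phi(2) finite_active[OF v] in auto)
 also have "\<dots> = Phi v" by (rule Phi_eq[symmetric, OF finite_active[OF v]]) simp
 finally show ?thesis unfolding 1 .
qed

lemma fourier_psi: "fourier (\<psi> j) v = of_real (\<phi> (hm (hinv (gc j)) *v v) / Phi v)"
 by (simp only: psi(2) Phi_def)

lemma sum_fourier_psi:
 assumes v: "v \<in> light_cone" and J: "finite J" "\<And>i. i \<notin> J ==> \<phi> (hm (hinv (gc i)) *v v) = 0"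
 shows "(\<Sum>j\<in>J. fourier (\<psi> j) v) = 1"
proof -
 have "(\<Sum>j\<in>J. fourier (\<psi> j) v) = complex_of_real (\<Sum>j\<in>J. \<phi> (hm (hinv (gc j)) *v v) / Phi v)"
  unfolding fourier_psi by (rule of_real_sum[symmetric])
 also have "(\<Sum>j\<in>J. \<phi> (hm (hinv (gc j)) *v v) / Phi v) = (\<Sum>j\<in>J. \<phi> (hm (hinv (gc j)) *v v)) / Phi v"
  by (rule sum_divide_distrib[symmetric])
 also have "(\<Sum>j\<in>J. \<phi> (hm (hinv (gc j)) *v v)) = Phi v" by (rule Phi_eq[OF J, symmetric])
 finally show ?thesis using Phi_ge_1[OF v] by simp
qed

lemma psi_supp:
 assumes "fourier (\<psi> j) v \<noteq> 0" shows "hm (hinv (gc j)) *v v \<in> S1" "v \<in> light_cone"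
proof -
 show 1: "hm (hinv (gc j)) *v v \<in> S1" by (rule S1(3)) (use assms in \<open>auto simp: fourier_psi\<close>)
 show "v \<in> light_cone" using S1(2) 1 hm_light_cone_iff[OF fst_hinv[OF gc(1)], of j v] by blast
qed

lemma psi_S_cone: "\<psi> j \<in> S_cone"
proof (rule S_coneI[OF psi(1)], rule subsetI)
 fix v assume "v \<in> {w. fourier (\<psi> j) w \<noteq> 0}"
 then have "v \<in> light_cone" using psi_supp(2) by blast
 then show "v \<in> closure light_cone" by (rule subsetD[OF closure_subset])
qed

text \<open>
  The transform of \<open>\<psi> j\<close> is real. The distributional convolution with
  \<open>\<psi> j\<close> is therefore its coefficient function, without any reflection or
  conjugation.
\<close>

lemma psi_cnj: "cnj (\<psi> j (- x)) = \<psi> j x"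
proof -
 define F where "F = fourier (\<psi> j)"
 have int: "integrable lborel (fourier (\<psi> j))"
 proof (rule fourier_compact_integrable[OF psi(1)])
  show "compact ((*v) (hm (gc j)) ` S1)"
   by (intro compact_continuous_image S1 linear_continuous_on matrix_vector_mul_bounded_linear)
  fix v assume v: "v \<notin> (*v) (hm (gc j)) ` S1"
  show "fourier (\<psi> j) v = 0"
  proof (rule ccontr)
   assume "fourier (\<psi> j) v \<noteq> 0"
   from psi_supp(1)[OF this] have "hm (gc j) *v (hm (hinv (gc j)) *v v) \<in> (*v) (hm (gc j)) ` S1" by blast
   with v show False by (simp add: hm_hinv_cancel[OF gc(1)])
  qed
 qed
 have e: "\<psi> j y = of_real (fcst TYPE('n)) * (\<integral>v. F v * exp (\<i> * of_real (lorentz y v)) \<partial>lborel)" for y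
  unfolding F_def inv_fourier_def[symmetric] schwartz_fourier_inversion[OF psi(1) int] ..
 have lm: "lorentz (- x) v = - lorentz x v" for v using lorentz_scaleR_left[of "-1" x v] by simp
 have c: "cnj (F v * exp (\<i> * of_real (lorentz (- x) v))) = F v * exp (\<i> * of_real (lorentz x v))" for v
  by (simp add: F_def fourier_psi exp_cnj lm)
 have "cnj (\<psi> j (- x)) = of_real (fcst TYPE('n)) * cnj (\<integral>v. F v * exp (\<i> * of_real (lorentz (- x) v)) \<partial>lborel)"
  unfolding e by simp
 also have "cnj (\<integral>v. F v * exp (\<i> * of_real (lorentz (- x) v)) \<partial>lborel) = (\<integral>v. cnj (F v * exp (\<i> * of_real (lorentz (- x) v))) \<partial>lborel)"
  by (rule Bochner_Integration.integral_cnj[symmetric])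
 also have "\<dots> = (\<integral>v. F v * exp (\<i> * of_real (lorentz x v)) \<partial>lborel)" by (simp only: c)
 finally show ?thesis unfolding e .
qed

lemma dist_conv_psi: "dist_conv f (\<psi> j) = coeff_fun f (\<psi> j)"
proof
 fix x
 have "cnj (\<psi> j (x - y)) = \<psi> j (y - x)" for y using psi_cnj[of j "y - x"] by simp
 then show "dist_conv f (\<psi> j) x = coeff_fun f (\<psi> j) x" by (simp only: dist_conv_def coeff_fun_def)
qed

text \<open>
  The dilated wavelet, normalised to constant \<open>L\<^sup>1\<close> norm and indexed by the
  frequency-side element \<open>k = theta h\<close>: its transform is that of \<open>u\<close>
  composed with the inverse of \<open>k\<close>.
\<close>

definition ndil :: "'n H_coords => 'n rvec => complex" where
 "ndil k x = of_real (fst k ^ CARD('n)) * u (hm (hinv (theta k)) *v x)"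

lemma ndil_dilate: "ndil k = (\<lambda>x. of_real (fst k ^ CARD('n)) * dilate (theta k) u x)"
 by (rule ext) (simp only: ndil_def dilate_def)

text \<open>
  The dilated wavelet, normalised to constant \<open>L\<^sup>1\<close> norm and indexed by the
  frequency-side element \<open>k = theta h\<close>: its transform is that of \<open>u\<close>
  composed with the inverse of \<open>k\<close>.
\<close>

lemma ndil:
 assumes k: "fst k > 0"
 shows "fourier (ndil k) v = fourier u (hm (hinv k) *v v)" "ndil k \<in> S_cone" "rapid (ndil k)"
  "(\<integral>x. cmod (ndil k x) \<partial>lborel) = (\<integral>x. cmod (u x) \<partial>lborel)"
proof -
 have "fourier (ndil k) v = of_real (fst k ^ CARD('n)) * (of_real (fst (theta k) ^ CARD('n)) * fourier u (hm (hinv (theta (theta k))) *v v))"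
  unfolding ndil_def[abs_def] fourier_cmult fourier_hm[OF fst_theta[OF k] schwartz_measurable[OF u_schwartz]] ..
 also have "\<dots> = (of_real (fst k ^ CARD('n)) * of_real (fst (theta k) ^ CARD('n))) * fourier u (hm (hinv k) *v v)"
  by (simp only: theta_theta mult.assoc)
 also have "of_real (fst k ^ CARD('n)) * of_real (fst (theta k) ^ CARD('n)) = (1 :: complex)"
  unfolding of_real_mult[symmetric] power_mult_distrib[symmetric] fst_theta_eq using k by simp
 finally show "fourier (ndil k) v = fourier u (hm (hinv k) *v v)" by simp
 show "ndil k \<in> S_cone" unfolding ndil_dilate by (intro S_cone_cmult S_cone_dilate fst_theta k uS)
 show "rapid (ndil k)" "(\<integral>x. cmod (ndil k x) \<partial>lborel) = (\<integral>x. cmod (u x) \<partial>lborel)"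
  using L1_hm[OF k schwartz_rapid[OF u_schwartz]] by (simp_all only: ndil_def[abs_def])
qed

lemma ndil_integrable: assumes k: "fst k > 0" shows "integrable lborel (fourier (ndil k))"
proof (rule fourier_compact_integrable[OF S_cone_schwartz[OF ndil(2)[OF k]]])
 show "compact ((*v) (hm k) ` S0)"
  by (intro compact_continuous_image S0 linear_continuous_on matrix_vector_mul_bounded_linear)
 fix v assume v: "v \<notin> (*v) (hm k) ` S0"
 show "fourier (ndil k) v = 0"
 proof (rule ccontr)
  assume "fourier (ndil k) v \<noteq> 0"
  then have "hm (hinv k) *v v \<in> S0" unfolding ndil(1)[OF k] by (rule S0(3))
  then have "hm k *v (hm (hinv k) *v v) \<in> (*v) (hm k) ` S0" by blast
  with v show False by (simp add: hm_hinv_cancel[OF k])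
 qed
qed

text \<open>
  On the support of the transform of \<open>ndil k\<close> only boundedly many \<open>\<psi>
  j\<close> are active, and they sum to one there. So \<open>ndil k\<close> is reproduced by
  convolving their sum with \<open>ndil k\<close> itself, whose \<open>L\<^sup>1\<close> norm is
  that of \<open>u\<close>.
\<close>

lemma wavelet_coeff_le:
 fixes p q :: real
 assumes p: "p \<ge> 1" and q: "q \<ge> 1"
 obtains R C where "R > 0" "C > 0"
  "\<And>f k. f \<in> S_cone_dual ==> fst k > 0 ==> finite {j. hprod (hinv (gc j)) k \<in> hbox R} \<and>
    cpow p q f (ndil k) \<le> ennreal C * (\<Sum>j\<in>{j. hprod (hinv (gc j)) k \<in> hbox R}. cpow p q f (\<psi> j))"
proof -
 obtain R where R: "R > 0" "\<And>i b x. fst b > 0 ==> x \<in> S0 ==> \<phi> (hm (hinv (gc i)) *v (hm b *v x)) \<noteq> 0 ==> hprod (hinv (gc i)) b \<in> hbox R"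
  by (rule partition_overlap[OF S0(1,2)]) (rule that, assumption+)
 obtain M where M: "\<And>b. fst b > 0 ==> finite {j. hprod (hinv (gc j)) b \<in> hbox R} \<and> card {j. hprod (hinv (gc j)) b \<in> hbox R} \<le> M"
  by (rule count_bound[OF less_imp_le[OF R(1)]]) (rule that, assumption+)
 define L where "L = (\<integral>x. cmod (u x) \<partial>lborel) + 1"
 have L: "L > 0" unfolding L_def by (intro add_nonneg_pos integral_nonneg_AE) auto
 show ?thesis
 proof (rule that[OF R(1)])
  show "mult_const TYPE('n) p q (Suc M) L > 0" by (rule mult_const_pos) (use L in auto)
  fix f :: "('n rvec => complex) => complex" and k :: "'n H_coords" assume f: "f \<in> S_cone_dual" and k: "fst k > 0"
  define J where "J = {j. hprod (hinv (gc j)) k \<in> hbox R}"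
  have J: "finite J" "card J \<le> Suc M" using M[OF k] by (auto simp: J_def)
  note inv = schwartz_fourier_inversion[OF S_cone_schwartz[OF ndil(2)[OF k]] ndil_integrable[OF k]]
  have "cpow p q f (ndil k) \<le> ennreal (mult_const TYPE('n) p q (Suc M) L) * (\<Sum>j\<in>J. cpow p q f (\<psi> j))"
  proof (rule cpow_le[OF p q f ndil(2)[OF k] J zero_less_Suc psi_S_cone ndil_integrable[OF k] _ _ L])
   show "rapid (inv_fourier (fourier (ndil k)))" unfolding inv by (rule ndil(3)[OF k])
   show "(\<integral>x. cmod (inv_fourier (fourier (ndil k)) x) \<partial>lborel) \<le> L" unfolding inv ndil(4)[OF k] by (simp add: L_def)
   fix v
   show "fourier (ndil k) v = fourier (ndil k) v * (\<Sum>j\<in>J. fourier (\<psi> j) v)"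
   proof (cases "fourier (ndil k) v = 0")
    case False
    then have x: "hm (hinv k) *v v \<in> S0" unfolding ndil(1)[OF k] by (rule S0(3))
    have vx: "hm k *v (hm (hinv k) *v v) = v" by (rule hm_hinv_cancel(1)[OF k])
    have "v \<in> light_cone" using hm_light_cone[OF k subsetD[OF S0(2) x]] by (simp only: vx)
    moreover have "\<phi> (hm (hinv (gc i)) *v v) = 0" if "i \<notin> J" for i
     using R(2)[OF k x, of i] that unfolding vx J_def by blast
    ultimately have "(\<Sum>j\<in>J. fourier (\<psi> j) v) = 1" by (intro sum_fourier_psi J(1))
    then show ?thesis by simp
   qed simp
  qed
  with J(1) show "finite {j. hprod (hinv (gc j)) k \<in> hbox R} \<and>
    cpow p q f (ndil k) \<le> ennreal (mult_const TYPE('n) p q (Suc M) L) * (\<Sum>j\<in>{j. hprod (hinv (gc j)) k \<in> hbox R}. cpow p q f (\<psi> j))"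
   unfolding J_def by blast
 qed
qed

lemma wavelet_real:
 shows "Re (fourier u v) \<ge> 0" and "\<exists>U. open U \<and> base_pt \<in> U \<and> (\<forall>v\<in>U. Re (fourier u v) > 1 / 2)"
proof -
 have "fourier u v \<in> of_real ` {0..1}" using u by (simp add: cone_wavelet_def)
 then show "Re (fourier u v) \<ge> 0" by auto
 obtain U where U: "open U" "base_pt \<in> U" "\<forall>v\<in>U. fourier u v \<in> of_real ` {1/2<..1}"
  using u unfolding cone_wavelet_def by blast
 have "Re (fourier u v) > 1 / 2" if "v \<in> U" for v using U(3)[rule_format, OF that] by auto
 with U show "\<exists>U. open U \<and> base_pt \<in> U \<and> (\<forall>v\<in>U. Re (fourier u v) > 1 / 2)" by blast
qed

section \<open>Littlewood--Paley pieces as multiples of dilated wavelets\<close>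

text \<open>
  Near every point of the support \<open>S1\<close> some dilate of the wavelet has transform above
  one half, and this persists under perturbation of the dilation within a small box. By
  compactness finitely many dilations \<open>\<kappa>\<close> suffice. The perturbations \<open>v
  \<kappa>\<close> are independent of each other, which later allows an average over each of them
  separately.
\<close>

lemma finite_wavelet_cover:
 obtains K r W S2 where "finite K" "\<And>\<kappa>. \<kappa> \<in> K ==> fst \<kappa> > 0" "r > 0" "open W" "S1 \<subseteq> W" "W \<subseteq> S2" "compact S2" "S2 \<subseteq> light_cone"
  "\<And>v y. \<forall>\<kappa>\<in>K. v \<kappa> \<in> hbox r ==> y \<in> W ==> 1 / 2 \<le> cmod (\<Sum>\<kappa>\<in>K. fourier u (hm (hinv (v \<kappa>)) *v (hm (hinv \<kappa>) *v y)))"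
proof -
 obtain U where U: "open U" "base_pt \<in> U" "\<And>v. v \<in> U ==> Re (fourier u v) > 1 / 2" using wavelet_real(2) by blast
 define Pr where "Pr x t \<longleftrightarrow> fst (fst t) > 0 \<and> fst (snd t) > 0 \<and> snd (snd t) > (0::real) \<and> cball x (snd (snd t)) \<subseteq> light_cone \<and>
   (\<forall>v y. v \<in> hbox (fst (snd t)) \<longrightarrow> y \<in> ball x (snd (snd t)) \<longrightarrow> hm (hinv v) *v (hm (hinv (fst t)) *v y) \<in> U)"
  for x and t :: "'n H_coords \<times> real \<times> real"
 have ex: "\<exists>t. Pr x t" if x: "x \<in> S1" for x
 proof -
  have xl: "x \<in> light_cone" using x S1(2) by blast
  obtain a where a: "fst a > 0" "hm a *v base_pt = x" by (rule hm_transitive[OF xl]) (rule that, assumption+)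
  obtain r d where rd: "r > 0" "d > 0" "\<And>v y. v \<in> hbox r ==> dist y base_pt < d ==> hm (hinv v) *v y \<in> U"
   by (rule hbox_nbhd[OF U(1,2)]) (rule that, assumption+)
  define N where "N = {y. hm (hinv a) *v y \<in> ball base_pt d} \<inter> light_cone"
  have c: "continuous_on UNIV ((*v) (hm (hinv a)))" by (intro linear_continuous_on matrix_vector_mul_bounded_linear)
  have "open ((*v) (hm (hinv a)) -` ball base_pt d)" by (rule open_vimage[OF open_ball c])
  then have "open N" unfolding N_def vimage_def using open_light_cone by (rule open_Int)
  moreover have "x \<in> N" using xl rd(2) hm_hinv_cancel(2)[OF a(1), of base_pt] by (simp add: N_def a(2))
  ultimately obtain e where e: "e > 0" "cball x e \<subseteq> N" using open_contains_cball by blast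
  have "Pr x (a, r, e)"
   unfolding Pr_def fst_conv snd_conv
  proof (intro conjI allI impI a(1) rd(1) e(1))
   show "cball x e \<subseteq> light_cone" using e(2) by (auto simp: N_def)
   fix v y assume v: "v \<in> hbox r" and y: "y \<in> ball x e"
   from y have "y \<in> N" using e(2) ball_subset_cball[of x e] by blast
   then have "hm (hinv a) *v y \<in> ball base_pt d" unfolding N_def by blast
   then show "hm (hinv v) *v (hm (hinv a) *v y) \<in> U" by (intro rd(3)[OF v]) (simp add: dist_commute)
  qed
  then show ?thesis by blast
 qed
 then obtain h where h: "\<And>x. x \<in> S1 ==> Pr x (h x)" by metis
 obtain X where X: "X \<subseteq> S1" "finite X" "S1 \<subseteq> (\<Union>x\<in>X. ball x (snd (snd (h x))))"
 proof (rule compactE_image[OF S1(1), of S1 "\<lambda>x. ball x (snd (snd (h x)))"])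
  show "S1 \<subseteq> (\<Union>x\<in>S1. ball x (snd (snd (h x))))"
  proof
   fix x assume x: "x \<in> S1"
   have "snd (snd (h x)) > 0" using h[OF x] unfolding Pr_def by blast
   then show "x \<in> (\<Union>x\<in>S1. ball x (snd (snd (h x))))" using x by (intro UN_I[OF x]) simp
  qed
 qed (simp, rule that, assumption+)
 have hX: "Pr x (h x)" if "x \<in> X" for x using h X(1) that by blast
 define r where "r = Min (insert 1 ((\<lambda>x. fst (snd (h x))) ` X))"
 have r: "r > 0" "\<And>x. x \<in> X ==> r \<le> fst (snd (h x))"
 proof -
  have "fst (snd (h x)) > 0" if "x \<in> X" for x using hX[OF that] unfolding Pr_def by blast
  then have "\<forall>y\<in>insert 1 ((\<lambda>x. fst (snd (h x))) ` X). y > 0" by auto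
  then show "r > 0" unfolding r_def using X(2) by (subst Min_gr_iff) auto
  show "r \<le> fst (snd (h x))" if "x \<in> X" for x unfolding r_def using X(2) that by (intro Min_le) auto
 qed
 let ?K = "(\<lambda>x. fst (h x)) ` X" and ?W = "\<Union>x\<in>X. ball x (snd (snd (h x)))" and ?S2 = "\<Union>x\<in>X. cball x (snd (snd (h x)))"
 show ?thesis
 proof (rule that[of ?K r ?W ?S2])
  show "finite ?K" using X(2) by simp
  show "fst \<kappa> > 0" if "\<kappa> \<in> ?K" for \<kappa> using that hX unfolding Pr_def by blast
  show "r > 0" by (rule r(1))
  show "open ?W" by (intro open_UN ballI open_ball)
  show "S1 \<subseteq> ?W" by (rule X(3))
  show "?W \<subseteq> ?S2" by (intro UN_mono subset_refl ball_subset_cball)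
  show "compact ?S2" using X(2) by (intro compact_UN) auto
  show "?S2 \<subseteq> light_cone" using hX unfolding Pr_def by blast
  fix v y assume v: "\<forall>\<kappa>\<in>?K. v \<kappa> \<in> hbox r" and y: "y \<in> ?W"
  define T where "T \<kappa> = fourier u (hm (hinv (v \<kappa>)) *v (hm (hinv \<kappa>) *v y))" for \<kappa>
  obtain x where x: "x \<in> X" "y \<in> ball x (snd (snd (h x)))" using y by blast
  define \<kappa> where "\<kappa> = fst (h x)"
  have k: "\<kappa> \<in> ?K" using x(1) by (simp add: \<kappa>_def)
  have vb: "v \<kappa> \<in> hbox (fst (snd (h x)))" using bspec[OF v k] hbox_mono[OF r(2)[OF x(1)]] by blast
  have "hm (hinv (v \<kappa>)) *v (hm (hinv \<kappa>) *v y) \<in> U"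
   using hX[OF x(1)] vb x(2) unfolding Pr_def \<kappa>_def by blast
  then have "1 / 2 \<le> Re (T \<kappa>)" using U(3) unfolding T_def by (simp add: less_imp_le)
  also have "\<dots> \<le> (\<Sum>\<kappa>\<in>?K. Re (T \<kappa>))"
   by (rule member_le_sum[OF k, of "\<lambda>\<kappa>. Re (T \<kappa>)"]) (use X(2) wavelet_real(1) in \<open>auto simp: T_def\<close>)
  also have "\<dots> = Re (\<Sum>\<kappa>\<in>?K. T \<kappa>)" by (rule Re_sum[symmetric])
  also have "\<dots> \<le> cmod (\<Sum>\<kappa>\<in>?K. T \<kappa>)" by (rule complex_Re_le_cmod)
  finally show "1 / 2 \<le> cmod (\<Sum>\<kappa>\<in>?K. fourier u (hm (hinv (v \<kappa>)) *v (hm (hinv \<kappa>) *v y)))" unfolding T_def .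
 qed
qed

text \<open>
  After translation to the base point, the transform of \<open>\<psi> j\<close> is \<open>\<phi> /
  \<Phi>\<^sub>j\<close>, and the dilated wavelets add up to a function \<open>D\<close> that is
  bounded below near \<open>S1\<close>. The multiplier \<open>\<phi> / (\<Phi>\<^sub>j D)\<close>
  ranges over a family with uniformly bounded derivatives and fixed compact support, so its
  kernels have uniformly bounded \<open>L\<^sup>1\<close> norms.
\<close>

lemma psi_le_wavelet_coeff:
 fixes p q :: real
 assumes p: "p \<ge> 1" and q: "q \<ge> 1"
 obtains K r C where "finite K" "\<And>\<kappa>. \<kappa> \<in> K ==> fst \<kappa> > 0" "r > 0" "C > 0"
  "\<And>f j k. f \<in> S_cone_dual ==> \<forall>\<kappa>\<in>K. fst (k \<kappa>) > 0 \<and> hprod (hinv (hprod (gc j) \<kappa>)) (k \<kappa>) \<in> hbox r ==>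
    cpow p q f (\<psi> j) \<le> ennreal C * (\<Sum>\<kappa>\<in>K. cpow p q f (ndil (k \<kappa>)))"
proof -
 obtain K r W S2 where K: "finite K" "\<And>\<kappa>. \<kappa> \<in> K ==> fst \<kappa> > 0" and r: "r > 0"
  and W: "open W" "S1 \<subseteq> W" "W \<subseteq> S2" and S2: "compact S2" "S2 \<subseteq> light_cone"
  and low: "\<And>v y. \<forall>\<kappa>\<in>K. v \<kappa> \<in> hbox r ==> y \<in> W ==> 1 / 2 \<le> cmod (\<Sum>\<kappa>\<in>K. fourier u (hm (hinv (v \<kappa>)) *v (hm (hinv \<kappa>) *v y)))"
  by (rule finite_wavelet_cover) (rule that, assumption+)
 obtain R where R: "R > 0" "\<And>i b x. fst b > 0 ==> x \<in> S2 ==> \<phi> (hm (hinv (gc i)) *v (hm b *v x)) \<noteq> 0 ==> hprod (hinv (gc i)) b \<in> hbox R"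
  by (rule partition_overlap[OF S2]) (rule that, assumption+)
 obtain M where M: "\<And>b. fst b > 0 ==> finite {j. hprod (hinv (gc j)) b \<in> hbox R} \<and> card {j. hprod (hinv (gc j)) b \<in> hbox R} \<le> M"
  by (rule count_bound[OF less_imp_le[OF R(1)]]) (rule that, assumption+)
 define I where "I = {i :: nat \<times> ('n H_coords => 'n H_coords). \<forall>\<kappa>\<in>K. snd i \<kappa> \<in> hbox r}"
 define J where "J i = {l. hprod (hinv (gc l)) (gc (fst i)) \<in> hbox R}" for i :: "nat \<times> ('n H_coords => 'n H_coords)"
 have J: "finite (J i)" "card (J i) \<le> M" for i using M[OF gc(1)] by (auto simp: J_def)
 (* The finite sum agrees with the denominator on W, but it is defined and smooth everywhere. *)
 define P where "P i y = (\<Sum>l\<in>J i. complex_of_real (\<phi> (hm (hprod (hinv (gc l)) (gc (fst i))) *v y)))" for i y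
 define D where "D i y = (\<Sum>\<kappa>\<in>K. fourier u (hm (hinv (snd i \<kappa>)) *v (hm (hinv \<kappa>) *v y)))" for i :: "nat \<times> ('n H_coords => 'n H_coords)" and y
 have ubdphi: "ubd k UNIV UNIV (\<lambda>(_::unit) x. complex_of_real (\<phi> x))" for k
  by (rule ubd_compact_supp[OF phi(1)]) (use S1(1) in \<open>simp only: S1_def\<close>)
 obtain C1 where C1: "C1 > 0" "\<And>a (x :: 'n rvec). a \<in> hbox R ==> norm (hm a *v x) \<le> C1 * norm x" "\<And>a i j. a \<in> hbox R ==> \<bar>hm a $ i $ j\<bar> \<le> C1"
  by (rule hm_bound[OF less_imp_le[OF R(1)]]) (rule that, assumption+)
 have ubdP: "ubd k I UNIV P" for k
 proof -
  have "ubd k {(i, l). i \<in> I \<and> l \<in> J i} UNIV (\<lambda>q x. complex_of_real (\<phi> (hm (hprod (hinv (gc (snd q))) (gc (fst (fst q)))) *v x)))"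
  proof (rule ubd_linear[OF ubdphi, where r = "\<lambda>_. ()" and B = C1])
   fix q l i assume "q \<in> {(i, l). i \<in> I \<and> l \<in> J i}"
   then have "hprod (hinv (gc (snd q))) (gc (fst (fst q))) \<in> hbox R" by (auto simp: J_def)
   then show "\<bar>hm (hprod (hinv (gc (snd q))) (gc (fst (fst q)))) $ l $ i\<bar> \<le> C1" by (rule C1(3))
  qed simp
  then have "ubd k {(i, l). i \<in> I \<and> l \<in> J i} UNIV (\<lambda>(i, l) x. complex_of_real (\<phi> (hm (hprod (hinv (gc l)) (gc (fst i))) *v x)))"
   unfolding case_prod_beta' .
  then show ?thesis unfolding P_def by (rule ubd_sum_family[OF _ J])
 qed
 define r' where "r' = r * exp r + r"
 have r': "r' \<ge> 0" using r by (simp add: r'_def)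
 obtain C2 where C2: "C2 > 0" "\<And>a (x :: 'n rvec). a \<in> hbox r' ==> norm (hm a *v x) \<le> C2 * norm x" "\<And>a i j. a \<in> hbox r' ==> \<bar>hm a $ i $ j\<bar> \<le> C2"
  by (rule hm_bound[OF r']) (rule that, assumption+)
 have ubdD: "ubd k I UNIV D" for k
 proof -
  let ?IK = "{(i, \<kappa>). i \<in> I \<and> \<kappa> \<in> K}"
  have "ubd k ?IK UNIV (\<lambda>q x. fourier u (hm (hinv (snd (fst q) (snd q))) *v x))"
  proof (rule ubd_linear[OF ubd_fourier[OF schwartz_rapid[OF u_schwartz]], where r = "\<lambda>_. ()" and B = C2])
   fix q l i assume "q \<in> ?IK"
   then have "snd (fst q) (snd q) \<in> hbox r" by (auto simp: I_def)
   then have "hinv (snd (fst q) (snd q)) \<in> hbox r'" unfolding r'_def by (rule hbox_hinv) (use r in simp)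
   then show "\<bar>hm (hinv (snd (fst q) (snd q))) $ l $ i\<bar> \<le> C2" by (rule C2(3))
  qed simp
  then have "ubd k ?IK UNIV (\<lambda>q x. fourier u (hm (hinv (snd (fst q) (snd q))) *v (hm (hinv (snd q)) *v x)))"
  proof (rule ubd_linear[where r = "\<lambda>q. q" and A = "\<lambda>q. hm (hinv (snd q))" and B = "\<Sum>\<kappa>\<in>K. norm (hm (hinv \<kappa>))"])
   fix q l i assume "q \<in> ?IK"
   then have q: "snd q \<in> K" by auto
   have "\<bar>hm (hinv (snd q)) $ l $ i\<bar> \<le> norm (hm (hinv (snd q)))"
    using component_le_norm_cart[of "hm (hinv (snd q)) $ l" i] Finite_Cartesian_Product.norm_nth_le[of "hm (hinv (snd q))" l] by linarith
   also have "\<dots> \<le> (\<Sum>\<kappa>\<in>K. norm (hm (hinv \<kappa>)))" by (rule member_le_sum[OF q, of "\<lambda>\<kappa>. norm (hm (hinv \<kappa>))"]) (use K(1) in auto)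
   finally show "\<bar>hm (hinv (snd q)) $ l $ i\<bar> \<le> (\<Sum>\<kappa>\<in>K. norm (hm (hinv \<kappa>)))" .
  qed
  then have "ubd k ?IK UNIV (\<lambda>(i, \<kappa>) x. fourier u (hm (hinv (snd i \<kappa>)) *v (hm (hinv \<kappa>) *v x)))"
   unfolding case_prod_beta' .
  then show ?thesis unfolding D_def by (rule ubd_sum_family[OF _ K(1) le_refl])
 qed
 have Phi_P: "Phi (hm (gc (fst i)) *v y) = (\<Sum>l\<in>J i. \<phi> (hm (hprod (hinv (gc l)) (gc (fst i))) *v y))" if y: "y \<in> W" for i y
 proof -
  have "Phi (hm (gc (fst i)) *v y) = (\<Sum>l\<in>J i. \<phi> (hm (hinv (gc l)) *v (hm (gc (fst i)) *v y)))"
  proof (rule Phi_eq[OF J(1)])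
   fix l assume l: "l \<notin> J i"
   show "\<phi> (hm (hinv (gc l)) *v (hm (gc (fst i)) *v y)) = 0"
    using R(2)[OF gc(1) subsetD[OF W(3) y], of l "fst i"] l unfolding J_def by blast
  qed
  then show ?thesis by (simp only: hm_hprod matrix_vector_mul_assoc)
 qed
 have P_low: "1 \<le> cmod (P i y)" "P i y = complex_of_real (Phi (hm (gc (fst i)) *v y))" if y: "y \<in> W" for i y
 proof -
  have "y \<in> light_cone" using y W(3) S2(2) by blast
  then have "1 \<le> Phi (hm (gc (fst i)) *v y)" by (intro Phi_ge_1 hm_light_cone gc(1))
  moreover show e: "P i y = complex_of_real (Phi (hm (gc (fst i)) *v y))" unfolding Phi_P[OF y] P_def by (rule of_real_sum[symmetric])
  ultimately show "1 \<le> cmod (P i y)" by simp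
 qed
 have D_low: "1 / 2 \<le> cmod (D i y)" if "i \<in> I" "y \<in> W" for i y
  unfolding D_def by (rule low[OF _ that(2)]) (use that(1) in \<open>auto simp: I_def\<close>)
 (* The multiplier at the base point; its numerator vanishes where the denominator is not controlled. *)
 define F where "F i y = complex_of_real (\<phi> y) * inverse (P i y * D i y)" for i y
 have ubdF: "ubd k I UNIV F" for k
 proof (rule ubd_extend_zero[OF _ W(1) _ W(2)])
  show "closed S1" using S1(1) by (rule compact_imp_closed)
  show "F i x = 0" if "x \<notin> S1" for i x
  proof -
   have "\<phi> x = 0" using S1(3)[of x] that by blast
   then show ?thesis by (simp add: F_def)
  qed
  have "ubd k I UNIV (\<lambda>i x. complex_of_real (\<phi> (mat 1 *v x)))"
   by (rule ubd_linear[OF ubdphi, where r = "\<lambda>_. ()" and B = 1]) (simp_all add: mat_def)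
  then have "ubd k I W (\<lambda>i x. complex_of_real (\<phi> x))" unfolding matrix_vector_mul_lid by (rule ubd_mono) simp
  moreover have "ubd k I W (\<lambda>i x. inverse (P i x * D i x))"
  proof (rule ubd_inverse[where d = "1 / 2"])
   show "ubd k I W (\<lambda>i x. P i x * D i x)" by (intro ubd_mult ubd_mono[OF ubdP] ubd_mono[OF ubdD]) auto
   show "1 / 2 \<le> cmod (P i x * D i x)" if "i \<in> I" "x \<in> W" for i x
    unfolding norm_mult using mult_mono[OF P_low(1)[OF that(2), of i] D_low[OF that]] by simp
  qed simp
  ultimately show "ubd k I W F" unfolding F_def[abs_def] by (rule ubd_mult)
 qed
 obtain L where L: "\<And>i. i \<in> I ==> integrable lborel (F i)" "\<And>i. i \<in> I ==> rapid (inv_fourier (F i))"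
  "\<And>i. i \<in> I ==> (\<integral>x. cmod (inv_fourier (F i) x) \<partial>lborel) \<le> L"
 proof (rule inv_fourier_uniform_decay[OF ubdF _ S1(1)])
  show "F i x = 0" if "x \<notin> S1" for i x
  proof -
   have "\<phi> x = 0" using S1(3)[of x] that by blast
   then show ?thesis by (simp add: F_def)
  qed
 qed (rule that, assumption+)
 define L' where "L' = \<bar>L\<bar> + 1"
 have L': "L' > 0" "L \<le> L'" by (auto simp: L'_def)
 show ?thesis
 proof (rule that[OF K r])
  show "mult_const TYPE('n) p q (Suc (card K)) L' > 0" by (rule mult_const_pos) (use L' in auto)
  fix f :: "('n rvec => complex) => complex" and j :: nat and k :: "'n H_coords => 'n H_coords"
  assume f: "f \<in> S_cone_dual" and k': "\<forall>\<kappa>\<in>K. fst (k \<kappa>) > 0 \<and> hprod (hinv (hprod (gc j) \<kappa>)) (k \<kappa>) \<in> hbox r"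
  note k = bspec[OF k']
  define i where "i = (j, \<lambda>\<kappa>. hprod (hinv (hprod (gc j) \<kappa>)) (k \<kappa>))"
  have i: "i \<in> I" using k by (simp add: I_def i_def)
  (* The same multiplier at scale j: its kernel is a dilate, with the same L1 norm. *)
  define G where "G v = F i (hm (hinv (gc j)) *v v)" for v
  have Fm: "F i \<in> borel_measurable borel" using borel_measurable_integrable[OF L(1)[OF i]] by simp
  have invG: "inv_fourier G = (\<lambda>x. of_real (fst (gc j) ^ CARD('n)) * inv_fourier (F i) (hm (hinv (theta (gc j))) *v x))"
   unfolding G_def by (rule ext) (rule inv_fourier_hm[OF gc(1) Fm])
  show "cpow p q f (\<psi> j) \<le> ennreal (mult_const TYPE('n) p q (Suc (card K)) L') * (\<Sum>\<kappa>\<in>K. cpow p q f (ndil (k \<kappa>)))"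
  proof (rule cpow_le[OF p q f psi_S_cone K(1) _ zero_less_Suc _ _ _ _ L'(1)])
   show "card K \<le> Suc (card K)" by simp
   show "ndil (k \<kappa>) \<in> S_cone" if "\<kappa> \<in> K" for \<kappa> using k[OF that] by (intro ndil(2)) simp
   show "integrable lborel G"
    using integrable_affine[OF L(1)[OF i] det_hm_nz[OF fst_hinv[OF gc(1)]], of j 0] by (simp add: G_def[abs_def])
   show "rapid (inv_fourier G)" unfolding invG by (rule L1_hm(2)[OF gc(1) L(2)[OF i]])
   show "(\<integral>x. cmod (inv_fourier G x) \<partial>lborel) \<le> L'"
    unfolding invG L1_hm(1)[OF gc(1) L(2)[OF i]] using L(3)[OF i] L'(2) by linarith
   fix v
   define y where "y = hm (hinv (gc j)) *v v"
   have vy: "v = hm (gc j) *v y" by (simp add: y_def hm_hinv_cancel(1)[OF gc(1)])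
   show "fourier (\<psi> j) v = G v * (\<Sum>\<kappa>\<in>K. fourier (ndil (k \<kappa>)) v)"
   proof (cases "\<phi> y = 0")
    case True
    then show ?thesis unfolding fourier_psi G_def y_def[symmetric] F_def by simp
   next
    case False
    then have yW: "y \<in> W" using S1(3) W(2) by blast
    have "fourier (ndil (k \<kappa>)) v = fourier u (hm (hinv (snd i \<kappa>)) *v (hm (hinv \<kappa>) *v y))" if \<kappa>: "\<kappa> \<in> K" for \<kappa>
    proof -
     have kp: "fst (k \<kappa>) > 0" using k[OF \<kappa>] by blast
     have ap: "fst (hprod (gc j) \<kappa>) > 0" by (rule fst_hprod[OF gc(1) K(2)[OF \<kappa>]])
     have vp: "fst (snd i \<kappa>) > 0" unfolding i_def snd_conv by (rule fst_hprod[OF fst_hinv[OF ap] kp])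
     define z where "z = hm (hinv (k \<kappa>)) *v v"
     have ha: "hm (gc j) *v y = hm (hprod (gc j) \<kappa>) *v (hm (hinv \<kappa>) *v y)"
      unfolding hm_hprod matrix_vector_mul_assoc[symmetric] hm_hinv_cancel(1)[OF K(2)[OF \<kappa>]] ..
     have "hm (snd i \<kappa>) *v z = hm (hinv (hprod (gc j) \<kappa>)) *v v"
      unfolding i_def snd_conv hm_hprod[of "hinv (hprod (gc j) \<kappa>)" "k \<kappa>"] matrix_vector_mul_assoc[symmetric] z_def hm_hinv_cancel(1)[OF kp] ..
     also have "\<dots> = hm (hinv \<kappa>) *v y" unfolding vy ha hm_hinv_cancel(2)[OF ap] ..
     finally have "hm (hinv (snd i \<kappa>)) *v (hm (hinv \<kappa>) *v y) = z" using hm_hinv_cancel(2)[OF vp, of z] by simp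
     then show ?thesis unfolding ndil(1)[OF kp] z_def by simp
    qed
    then have s: "(\<Sum>\<kappa>\<in>K. fourier (ndil (k \<kappa>)) v) = D i y" unfolding D_def by (intro sum.cong) auto
    have Dn: "D i y \<noteq> 0" using D_low[OF i yW] by auto
    have Pe: "P i y = complex_of_real (Phi v)" using P_low(2)[OF yW, of i] by (simp add: i_def vy)
    have Pn: "P i y \<noteq> 0" using P_low(1)[OF yW, of i] by auto
    have "fourier (\<psi> j) v = complex_of_real (\<phi> y) / P i y" unfolding fourier_psi y_def[symmetric] Pe by simp
    also have "\<dots> = F i y * D i y" using Dn Pn by (simp add: F_def field_simps)
    finally show ?thesis unfolding s G_def y_def[symmetric] .
   qed
  qed
 qed
qed

end

section \<open>Equivalence of the norms\<close>

text \<open>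
  The choices are independent of each other, so near-minimisers may be taken simultaneously.
\<close>

lemma le_sum_INF:
 fixes Q :: "'a => ennreal"
 assumes K: "finite K" and C: "C > 0"
  and le: "\<And>k. \<forall>\<kappa>\<in>K. k \<kappa> \<in> E \<kappa> ==> x \<le> ennreal C * (\<Sum>\<kappa>\<in>K. Q (k \<kappa>))"
 shows "x \<le> ennreal C * (\<Sum>\<kappa>\<in>K. INF h\<in>E \<kappa>. Q h)"
proof (rule ennreal_le_epsilon)
 fix e :: real assume fin: "ennreal C * (\<Sum>\<kappa>\<in>K. INF h\<in>E \<kappa>. Q h) < top" and e: "e > 0"
 define m where "m \<kappa> = (INF h\<in>E \<kappa>. Q h)" for \<kappa>
 (* The successor keeps the denominator positive when K is empty. *)
 define \<epsilon> where "\<epsilon> = e / (C * real (Suc (card K)))"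
 have \<epsilon>: "\<epsilon> > 0" using e C by (simp add: \<epsilon>_def)
 have mfin: "m \<kappa> \<noteq> \<infinity>" if k: "\<kappa> \<in> K" for \<kappa>
 proof
  assume "m \<kappa> = \<infinity>"
  moreover have "m \<kappa> \<le> (\<Sum>\<kappa>\<in>K. m \<kappa>)" by (rule member_le_sum[OF k _ K]) simp
  ultimately have "(\<Sum>\<kappa>\<in>K. m \<kappa>) = top" by (simp add: top_unique)
  then show False using fin C unfolding m_def[symmetric] by (simp add: ennreal_mult_top)
 qed
 have "\<exists>h. h \<in> E \<kappa> \<and> Q h < m \<kappa> + ennreal \<epsilon>" if k: "\<kappa> \<in> K" for \<kappa>
  using INF_approx_ennreal[of \<epsilon> "m \<kappa>" Q "E \<kappa>"] \<epsilon> mfin[OF k] unfolding m_def by (auto simp: Bex_def)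
 then obtain k where k: "\<And>\<kappa>. \<kappa> \<in> K ==> k \<kappa> \<in> E \<kappa> \<and> Q (k \<kappa>) < m \<kappa> + ennreal \<epsilon>" by metis
 have "x \<le> ennreal C * (\<Sum>\<kappa>\<in>K. Q (k \<kappa>))" by (rule le) (use k in blast)
 also have "\<dots> \<le> ennreal C * (\<Sum>\<kappa>\<in>K. m \<kappa> + ennreal \<epsilon>)"
  using k by (intro mult_left_mono sum_mono) (auto intro: less_imp_le)
 also have "\<dots> = ennreal C * (\<Sum>\<kappa>\<in>K. m \<kappa>) + ennreal C * (of_nat (card K) * ennreal \<epsilon>)"
  by (simp add: sum.distrib distrib_left)
 also have "ennreal C * (of_nat (card K) * ennreal \<epsilon>) = ennreal (C * (real (card K) * \<epsilon>))"
  using C \<epsilon> by (simp add: ennreal_mult ennreal_of_nat_eq_real_of_nat)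
 also have "\<dots> \<le> ennreal e"
 proof (rule ennreal_leI)
  define N where "N = real (Suc (card K))"
  have "N > 0" by (simp add: N_def)
  then have "C * (real (Suc (card K)) * \<epsilon>) = e" unfolding \<epsilon>_def N_def[symmetric] using C by simp
  moreover have "C * (real (card K) * \<epsilon>) \<le> C * (real (Suc (card K)) * \<epsilon>)"
   using C \<epsilon> by (intro mult_left_mono mult_right_mono) auto
  ultimately show "C * (real (card K) * \<epsilon>) \<le> e" by linarith
 qed
 finally show "x \<le> ennreal C * (\<Sum>\<kappa>\<in>K. INF h\<in>E \<kappa>. Q h) + ennreal e"
  unfolding m_def by (simp add: add_left_mono)
qed

context forward_cone
begin

text \<open>
  The coordinate form of \<open>\<kappa> (a \<kappa>)\<^sup>-\<^sup>1 b = a\<^sup>-\<^sup>1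
  b\<close>.
\<close>

lemma hprod_cancel:
 assumes "fst a > 0" "fst \<kappa> > 0"
 shows "hprod \<kappa> (hprod (hinv (hprod a \<kappa>)) b) = hprod (hinv a) b"
proof -
 obtain \<gamma> t c where a: "a = (\<gamma>, t, c)" by (cases a)
 obtain \<gamma>1 t1 c1 where k: "\<kappa> = (\<gamma>1, t1, c1)" by (cases \<kappa>)
 obtain \<gamma>2 t2 c2 where b: "b = (\<gamma>2, t2, c2)" by (cases b)
 have p: "\<gamma> > 0" "\<gamma>1 > 0" using assms by (simp_all add: a k)
 have e: "exp (- t2) * (exp (t + t1) * (c1 i + exp (- t1) * c i)) = exp (- (- (t + t1) + t2)) * c1 i + exp (- t2) * (exp t * c i)" for i
 proof -
  have "exp (- (- (t + t1) + t2)) = exp (- t2) * exp t * exp t1" unfolding exp_add[symmetric] by simp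
  moreover have "exp (t + t1) = exp t * exp t1" by (rule exp_add)
  moreover have "exp t1 * exp (- t1) = 1" unfolding exp_add[symmetric] by simp
  ultimately show ?thesis by algebra
 qed
 have c: "c2 i + exp (- t2) * (- exp (t + t1) * (c1 i + exp (- t1) * c i)) + exp (- (- (t + t1) + t2)) * c1 i = c2 i + exp (- t2) * (- exp t * c i)" for i
  using e[of i] by (simp only: mult_minus_left mult_minus_right)
 show ?thesis
  unfolding a k b hprod.simps hinv.simps prod.inject
 proof (intro conjI ext)
  show "\<gamma>1 * (1 / (\<gamma> * \<gamma>1) * \<gamma>2) = 1 / \<gamma> * \<gamma>2" using p by simp
  show "t1 + (- (t + t1) + t2) = - t + t2" by simp
 qed (rule c)
qed

lemma hbox_hprod:
 assumes \<kappa>: "\<kappa> \<in> hbox R" and v: "v \<in> hbox r" and R: "R \<ge> 0" "r \<ge> 0"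
 shows "hprod \<kappa> v \<in> hbox (R + r + exp r * R)"
proof -
 obtain \<gamma> t c where k: "\<kappa> = (\<gamma>, t, c)" by (cases \<kappa>)
 obtain \<gamma>1 t1 c1 where v': "v = (\<gamma>1, t1, c1)" by (cases v)
 have b: "exp (- R) \<le> \<gamma>" "\<gamma> \<le> exp R" "\<bar>t\<bar> \<le> R" "\<And>i. i \<in> idx_mid ==> \<bar>c i\<bar> \<le> R" using \<kappa> by (auto simp: k hbox_def)
 have b1: "exp (- r) \<le> \<gamma>1" "\<gamma>1 \<le> exp r" "\<bar>t1\<bar> \<le> r" "\<And>i. i \<in> idx_mid ==> \<bar>c1 i\<bar> \<le> r" using v by (auto simp: v' hbox_def)
 have p: "\<gamma> > 0" "\<gamma>1 > 0" using hbox_fst[OF \<kappa>] hbox_fst[OF v] by (simp_all add: k v')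
 have T: "exp r * R \<ge> 0" using R by simp
 have "exp (- (R + r + exp r * R)) \<le> exp (- R + - r)" using T by simp
 also have "\<dots> \<le> \<gamma> * \<gamma>1" unfolding exp_add using b b1 p by (intro mult_mono) auto
 finally have 1: "exp (- (R + r + exp r * R)) \<le> \<gamma> * \<gamma>1" .
 have "\<gamma> * \<gamma>1 \<le> exp (R + r)" unfolding exp_add using b b1 p by (intro mult_mono) auto
 also have "\<dots> \<le> exp (R + r + exp r * R)" using T by simp
 finally have 2: "\<gamma> * \<gamma>1 \<le> exp (R + r + exp r * R)" .
 have 3: "\<bar>t + t1\<bar> \<le> R + r + exp r * R" using b(3) b1(3) T by linarith
 have 4: "\<bar>c1 i + exp (- t1) * c i\<bar> \<le> R + r + exp r * R" if i: "i \<in> idx_mid" for i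
 proof -
  have "exp (- t1) \<le> exp r" using b1(3) by simp
  then have "\<bar>exp (- t1) * c i\<bar> \<le> exp r * R" unfolding abs_mult using b(4)[OF i] by (intro mult_mono) auto
  then show ?thesis using b1(4)[OF i] R(1) by linarith
 qed
 show ?thesis unfolding k v' using 1 2 3 4 by (simp add: hbox_def)
qed

lemma in_some_box: assumes "fst a > 0" obtains R where "R \<ge> 0" "a \<in> hbox R"
proof -
 obtain \<gamma> t c where a: "a = (\<gamma>, t, c)" by (cases a)
 have p: "\<gamma> > 0" using assms by (simp add: a)
 define A where "A = (\<Sum>i\<in>(idx_mid :: 'n set). \<bar>c i\<bar>)"
 define R where "R = \<bar>ln \<gamma>\<bar> + \<bar>t\<bar> + A"
 have A: "A \<ge> 0" unfolding A_def by (intro sum_nonneg) simp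
 have c: "\<bar>c i\<bar> \<le> A" if "i \<in> idx_mid" for i unfolding A_def by (rule member_le_sum[OF that]) auto
 have l: "- R \<le> ln \<gamma>" "ln \<gamma> \<le> R" using A unfolding R_def by linarith+
 have "exp (- R) \<le> exp (ln \<gamma>)" "exp (ln \<gamma>) \<le> exp R" using l by (simp_all only: exp_le_cancel_iff)
 then have "exp (- R) \<le> \<gamma>" "\<gamma> \<le> exp R" by (simp_all only: exp_ln[OF p])
 moreover have "\<bar>t\<bar> \<le> R" using A unfolding R_def by linarith
 moreover have "\<bar>c i\<bar> \<le> R" if "i \<in> idx_mid" for i using c[OF that] unfolding R_def by linarith
 ultimately have "a \<in> hbox R" by (simp add: a hbox_def)
 moreover have "R \<ge> 0" using A unfolding R_def by linarith
 ultimately show ?thesis by (rule that[rotated])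
qed

end

context besov_setting
begin

text \<open>
  The integrand of the \<open>q\<close>-th power of the coorbit norm on the group.
\<close>

definition wint :: "real => real => real => (('n rvec => complex) => complex) => 'n H_coords => ennreal" where
 "wint p q s f h = epowr (\<integral>\<^sup>+b. ennreal (cmod (wavelet_transform u f (h, b)) powr p) \<partial>lborel) (q / p)
   * ennreal (fst h powr s / fst h ^ (CARD('n) + 1))"

lemma coorbit_norm_wint: "coorbit_norm u p q s f = epowr (\<integral>\<^sup>+h. wint p q s f h \<partial>coord_measure) (1 / q)"
 by (simp add: coorbit_norm_def Lpqs_norm_def wint_def case_prod_beta')

text \<open>
  The normalisation \<open>\<gamma>\<^sup>-\<^sup>n\<^sup>/\<^sup>2\<close> of the representation,
  the \<open>L\<^sup>1\<close> normalisation of \<open>ndil\<close> and the Haar density combine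
  to the power \<open>\<sigma> - 1\<close>. This is where the Besov index comes from.
\<close>

lemma wint_eq:
 assumes p: "p \<ge> 1" and f: "f \<in> S_cone_dual" and h: "fst h > 0" and \<sigma>: "\<sigma> = s + real CARD('n) * q / 2 - real CARD('n)"
 shows "wint p q s f h = ennreal (fst h powr (\<sigma> - 1)) * cpow p q f (ndil (theta h))"
proof -
 define \<gamma> where "\<gamma> = fst h"
 define n where "n = real CARD('n)"
 have g: "\<gamma> > 0" using h by (simp add: \<gamma>_def)
 have gn: "\<gamma> ^ CARD('n) = \<gamma> powr n" using g by (simp add: n_def powr_realpow)
 have th: "fst (theta h) > 0" by (rule fst_theta[OF h])
 have nd: "dilate h u = (\<lambda>x. of_real (\<gamma> ^ CARD('n)) * ndil (theta h) x)"
 proof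
  fix x
  have "of_real (\<gamma> ^ CARD('n)) * ndil (theta h) x = of_real ((\<gamma> * (1 / \<gamma>)) ^ CARD('n)) * dilate h u x"
   unfolding ndil_dilate fst_theta_eq theta_theta \<gamma>_def power_mult_distrib of_real_mult by (simp only: mult.assoc)
  then show "dilate h u x = of_real (\<gamma> ^ CARD('n)) * ndil (theta h) x" using g by simp
 qed
 have cf: "coeff_fun f (dilate h u) b = cnj (of_real (\<gamma> ^ CARD('n))) * coeff_fun f (ndil (theta h)) b" for b
  unfolding nd coeff_fun_def by (rule S_cone_dual_cmult[OF f]) (intro S_cone_translate ndil(2) th)
 have W: "cmod (wavelet_transform u f (h, b)) = \<gamma> powr (n / 2) * cmod (coeff_fun f (ndil (theta h)) b)" for b
 proof -
  have "cmod (wavelet_transform u f (h, b)) = \<gamma> powr (- n / 2) * (\<gamma> ^ CARD('n) * cmod (coeff_fun f (ndil (theta h)) b))"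
   unfolding wavelet_transform_eq[OF f uS h] cf using g by (simp add: norm_mult norm_power \<gamma>_def n_def)
  also have "\<dots> = (\<gamma> powr (- n / 2) * \<gamma> powr n) * cmod (coeff_fun f (ndil (theta h)) b)" unfolding gn by (simp only: mult.assoc)
  also have "\<gamma> powr (- n / 2) * \<gamma> powr n = \<gamma> powr (n / 2)" unfolding powr_add[symmetric] by simp
  finally show ?thesis .
 qed
 have "(\<integral>\<^sup>+b. ennreal (cmod (wavelet_transform u f (h, b)) powr p) \<partial>lborel)
  = (\<integral>\<^sup>+b. ennreal (\<gamma> powr (n * p / 2)) * ennreal (cmod (coeff_fun f (ndil (theta h)) b) powr p) \<partial>lborel)"
  by (rule nn_integral_cong) (simp add: W powr_mult powr_powr ennreal_mult[symmetric])
 also have "\<dots> = ennreal (\<gamma> powr (n * p / 2)) * pint p (coeff_fun f (ndil (theta h)))"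
  unfolding pint_def using measurable_coeff_fun[OF f ndil(2)[OF th]] by (intro nn_integral_cmult) measurable
 finally have "wint p q s f h = ennreal ((\<gamma> powr (n * p / 2)) powr (q / p)) * cpow p q f (ndil (theta h)) * ennreal (\<gamma> powr s / \<gamma> ^ (CARD('n) + 1))"
  using g unfolding wint_def \<gamma>_def[symmetric] cpow_def by (subst epowr_cmult[symmetric]) simp_all
 also have "\<dots> = ennreal ((\<gamma> powr (n * p / 2)) powr (q / p) * (\<gamma> powr s / \<gamma> ^ (CARD('n) + 1))) * cpow p q f (ndil (theta h))"
  by (subst ennreal_mult) (use g in \<open>simp_all add: mult_ac\<close>)
 also have "(\<gamma> powr (n * p / 2)) powr (q / p) * (\<gamma> powr s / \<gamma> ^ (CARD('n) + 1)) = \<gamma> powr (\<sigma> - 1)"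
 proof -
  have 1: "(\<gamma> powr (n * p / 2)) powr (q / p) = \<gamma> powr (n * q / 2)" using p by (simp add: powr_powr)
  have 2: "\<gamma> ^ (CARD('n) + 1) = \<gamma> powr (n + 1)" using g powr_realpow[of \<gamma> "CARD('n) + 1"] by (simp add: n_def add.commute)
  show ?thesis unfolding 1 2 powr_diff[symmetric] powr_add[symmetric] \<sigma> n_def[symmetric] by (rule arg_cong[of _ _ "(powr) \<gamma>"]) linarith
 qed
 finally show ?thesis unfolding \<gamma>_def .
qed

lemma measurable_wint:
 assumes f: "f \<in> S_cone_dual" shows "wint p q s f \<in> borel_measurable coord_measure"
proof -
 have "(\<lambda>x. ennreal (cmod (wavelet_transform u f x) powr p)) \<in> borel_measurable (coord_measure \<Otimes>\<^sub>M lborel)"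
  using measurable_wavelet_transform[OF f uS] by measurable
 then have "(\<lambda>(h, b). ennreal (cmod (wavelet_transform u f (h, b)) powr p)) \<in> borel_measurable (coord_measure \<Otimes>\<^sub>M lborel)"
  by (simp add: case_prod_beta')
 from lborel.borel_measurable_nn_integral[OF this]
 have 1: "(\<lambda>h. epowr (\<integral>\<^sup>+b. ennreal (cmod (wavelet_transform u f (h, b)) powr p) \<partial>lborel) (q / p)) \<in> borel_measurable coord_measure"
  by (rule measurable_epowr)
 have 2: "(\<lambda>h. ennreal (fst h powr s / fst h ^ (CARD('n) + 1))) \<in> borel_measurable (coord_measure :: 'n H_coords measure)"
  using measurable_coord_fst by measurable
 show ?thesis unfolding wint_def[abs_def] by (rule borel_measurable_times_ennreal[OF 1 2])
qed

definition bsum :: "real => real => real => (('n rvec => complex) => complex) => ennreal" where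
 "bsum p q \<sigma> f = (\<Sum>j. ennreal (fst (gc j) powr (- \<sigma>)) * cpow p q f (\<psi> j))"

lemma besov_norm_bsum: "besov_norm w \<psi> p q \<sigma> f = epowr (bsum p q \<sigma> f) (1 / q)"
proof -
 have d: "Det (w j) = fst (gc j)" for j
  unfolding Det_def gc(2) lorentz_hm base_pt_lc using gc(1)[of j] by simp
 have "epowr (Lp_norm p (dist_conv f (\<psi> j))) q = cpow p q f (\<psi> j)" for j
  unfolding Lp_norm_def dist_conv_psi epowr_epowr cpow_def pint_def by simp
 then show ?thesis by (simp only: besov_norm_def bsum_def d)
qed

text \<open>
  The pointwise bound is integrated term by term. Each term contributes the weight times the
  measure of the group box around \<open>gc j\<close>, and \<open>fst (gc j) powr (1 - \<sigma>) /
  fst (gc j)\<close> is the Besov weight.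
\<close>

lemma wint_le_bsum:
 assumes p: "p \<ge> 1" and q: "q \<ge> 1" and \<sigma>: "\<sigma> = s + real CARD('n) * q / 2 - real CARD('n)"
 obtains C where "C > 0" "\<And>f. f \<in> S_cone_dual ==> (\<integral>\<^sup>+h. wint p q s f h \<partial>coord_measure) \<le> ennreal C * bsum p q \<sigma> f"
proof -
 obtain R C where R: "R > 0" and C: "C > 0"
  and le: "\<And>f k. f \<in> S_cone_dual ==> fst k > 0 ==> finite {j. hprod (hinv (gc j)) k \<in> hbox R} \<and>
    cpow p q f (ndil k) \<le> ennreal C * (\<Sum>j\<in>{j. hprod (hinv (gc j)) k \<in> hbox R}. cpow p q f (\<psi> j))"
  by (rule wavelet_coeff_le[OF p q]) (rule that, assumption+)
 define A where "A = exp (R * \<bar>\<sigma> - 1\<bar>) * vol R"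
 have A: "A > 0" using vol_pos[OF R] by (simp add: A_def)
 show ?thesis
 proof (rule that[of "C * A"])
  show "C * A > 0" using C A by simp
  fix f :: "('n rvec => complex) => complex" assume f: "f \<in> S_cone_dual"
  define c where "c j = ennreal (exp (R * \<bar>\<sigma> - 1\<bar>) * fst (gc j) powr (1 - \<sigma>)) * cpow p q f (\<psi> j)" for j
  define I where "I j h = (indicator (Eset (gc j) R) h :: ennreal)" for j h
  have pt: "wint p q s f h \<le> ennreal C * (\<Sum>j. c j * I j h)" if h: "h \<in> space coord_measure" for h
  proof -
   have hp: "fst h > 0" by (rule space_coord_measure[OF h])
   define J where "J = {j. hprod (hinv (gc j)) (theta h) \<in> hbox R}"
   have J: "finite J" using le[OF f fst_theta[OF hp]] by (simp add: J_def)
   have "wint p q s f h = ennreal (fst h powr (\<sigma> - 1)) * cpow p q f (ndil (theta h))" by (rule wint_eq[OF p f hp \<sigma>])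
   also have "\<dots> \<le> ennreal (fst h powr (\<sigma> - 1)) * (ennreal C * (\<Sum>j\<in>J. cpow p q f (\<psi> j)))"
    using le[OF f fst_theta[OF hp]] unfolding J_def by (intro mult_left_mono) auto
   also have "\<dots> = ennreal C * (\<Sum>j\<in>J. ennreal (fst h powr (\<sigma> - 1)) * cpow p q f (\<psi> j))"
    by (simp only: mult.left_commute[of _ "ennreal C"] sum_distrib_left)
   also have "\<dots> \<le> ennreal C * (\<Sum>j\<in>J. c j * I j h)"
   proof (intro mult_left_mono sum_mono)
    fix j assume "j \<in> J"
    then have E: "h \<in> Eset (gc j) R" using hp by (simp add: Eset_def J_def)
    have "ennreal (fst h powr (\<sigma> - 1)) \<le> ennreal (exp (R * \<bar>\<sigma> - 1\<bar>) * fst (gc j) powr (1 - \<sigma>))"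
     by (intro ennreal_leI Eset_weight(2)[OF E gc(1)]) (use R in simp)
    then show "ennreal (fst h powr (\<sigma> - 1)) * cpow p q f (\<psi> j) \<le> c j * I j h"
     using E unfolding c_def I_def by (simp add: mult_right_mono)
   qed simp
   also have "\<dots> \<le> ennreal C * (\<Sum>j. c j * I j h)"
    by (intro mult_left_mono sum_le_suminf J) auto
   finally show ?thesis .
  qed
  have mI: "I j \<in> borel_measurable coord_measure" for j
   unfolding I_def by (rule indicator_Eset_measurable)
  have mcI: "(\<lambda>h. c j * I j h) \<in> borel_measurable coord_measure" for j
   by (intro borel_measurable_times_ennreal borel_measurable_const mI)
  have "(\<integral>\<^sup>+h. wint p q s f h \<partial>coord_measure) \<le> (\<integral>\<^sup>+h. ennreal C * (\<Sum>j. c j * I j h) \<partial>coord_measure)"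
   by (rule nn_integral_mono) (rule pt)
  also have "\<dots> = ennreal C * (\<integral>\<^sup>+h. (\<Sum>j. c j * I j h) \<partial>coord_measure)"
   by (rule nn_integral_cmult) (intro borel_measurable_suminf_order mcI)
  also have "(\<integral>\<^sup>+h. (\<Sum>j. c j * I j h) \<partial>coord_measure) = (\<Sum>j. \<integral>\<^sup>+h. c j * I j h \<partial>coord_measure)"
   by (rule nn_integral_suminf[OF mcI])
  also have "(\<lambda>j. \<integral>\<^sup>+h. c j * I j h \<partial>coord_measure) = (\<lambda>j. ennreal A * (ennreal (fst (gc j) powr (- \<sigma>)) * cpow p q f (\<psi> j)))"
  proof
   fix j
   have g: "fst (gc j) > 0" by (rule gc(1))
   have "(\<integral>\<^sup>+h. c j * I j h \<partial>coord_measure) = c j * ennreal (vol R / fst (gc j))"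
    unfolding nn_integral_cmult[OF mI] unfolding I_def nn_integral_Eset[OF g R] ..
   also have "\<dots> = ennreal (exp (R * \<bar>\<sigma> - 1\<bar>) * fst (gc j) powr (1 - \<sigma>) * (vol R / fst (gc j))) * cpow p q f (\<psi> j)"
    unfolding c_def by (subst ennreal_mult) (use g vol_pos[OF R] in \<open>simp_all add: mult_ac\<close>)
   also have "exp (R * \<bar>\<sigma> - 1\<bar>) * fst (gc j) powr (1 - \<sigma>) * (vol R / fst (gc j)) = A * fst (gc j) powr (- \<sigma>)"
    using g by (simp add: A_def powr_diff powr_minus field_simps)
   also have "ennreal (A * fst (gc j) powr (- \<sigma>)) * cpow p q f (\<psi> j) = ennreal A * (ennreal (fst (gc j) powr (- \<sigma>)) * cpow p q f (\<psi> j))"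
    using A by (simp add: ennreal_mult mult.assoc)
   finally show "(\<integral>\<^sup>+h. c j * I j h \<partial>coord_measure) = ennreal A * (ennreal (fst (gc j) powr (- \<sigma>)) * cpow p q f (\<psi> j))" .
  qed
  also have "(\<Sum>j. ennreal A * (ennreal (fst (gc j) powr (- \<sigma>)) * cpow p q f (\<psi> j))) = ennreal A * bsum p q \<sigma> f"
   unfolding bsum_def by (rule ennreal_suminf_cmult)
  also have "ennreal C * (ennreal A * bsum p q \<sigma> f) = ennreal (C * A) * bsum p q \<sigma> f"
   using C A by (simp add: ennreal_mult mult.assoc)
  finally show "(\<integral>\<^sup>+h. wint p q s f h \<partial>coord_measure) \<le> ennreal (C * A) * bsum p q \<sigma> f" .
 qed
qed

text \<open>
  An infimum over a group box times the measure of the box is at most the integral over the box.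
  By the lattice count the boxes around the elements \<open>gc j\<close> times
  \<open>\<kappa>\<close> have bounded overlap, so the integrals add up to a multiple of the
  integral over the group.
\<close>

lemma weighted_INF_le_wint:
 assumes p: "p \<ge> 1" and \<sigma>: "\<sigma> = s + real CARD('n) * q / 2 - real CARD('n)" and \<kappa>: "fst \<kappa> > 0" and r: "r > 0"
 shows "\<exists>C>0. \<forall>f\<in>S_cone_dual. (\<Sum>j. ennreal (fst (gc j) powr (- \<sigma>)) * (INF h\<in>Eset (hprod (gc j) \<kappa>) r. cpow p q f (ndil (theta h))))
   \<le> ennreal C * (\<integral>\<^sup>+h. wint p q s f h \<partial>coord_measure)"
proof -
 obtain R1 where R1: "R1 \<ge> 0" "\<kappa> \<in> hbox R1" by (rule in_some_box[OF \<kappa>]) (rule that, assumption+)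
 (* By hprod_cancel, a box around gc j times \<kappa> lies in a box of this size around gc j. *)
 define R2 where "R2 = R1 + r + exp r * R1"
 have R2: "R2 \<ge> 0" using R1 r by (simp add: R2_def)
 obtain N where N: "\<And>b. fst b > 0 ==> finite {j. hprod (hinv (gc j)) b \<in> hbox R2} \<and> card {j. hprod (hinv (gc j)) b \<in> hbox R2} \<le> N"
  by (rule count_bound[OF R2]) (rule that, assumption+)
 have ap: "fst (hprod (gc j) \<kappa>) > 0" for j by (rule fst_hprod[OF gc(1) \<kappa>])
 have fa: "fst (hprod (gc j) \<kappa>) = fst (gc j) * fst \<kappa>" for j by (cases "gc j"; cases \<kappa>) simp
 define I where "I j h = (indicator (Eset (hprod (gc j) \<kappa>) r) h :: ennreal)" for j h
 have over: "(\<Sum>j. I j h) \<le> ennreal (real N)" if h: "fst h > 0" for h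
 proof -
  define J where "J = {j. hprod (hinv (gc j)) (theta h) \<in> hbox R2}"
  have J: "finite J" "card J \<le> N" using N[OF fst_theta[OF h]] by (auto simp: J_def)
  have z: "I j h = 0" if j: "j \<notin> J" for j
  proof (rule ccontr)
   assume "I j h \<noteq> 0"
   then have "hprod (hinv (hprod (gc j) \<kappa>)) (theta h) \<in> hbox r" by (auto simp: I_def Eset_def indicator_def split: if_splits)
   from hbox_hprod[OF R1(2) this R1(1) less_imp_le[OF r]] have "hprod (hinv (gc j)) (theta h) \<in> hbox R2"
    unfolding hprod_cancel[OF gc(1) \<kappa>] R2_def .
   with j show False by (simp add: J_def)
  qed
  have "(\<Sum>j. I j h) = (\<Sum>j\<in>J. I j h)" by (rule suminf_finite[OF J(1) z])
  also have "\<dots> \<le> of_nat (card J) * 1" by (rule sum_bounded_above) (simp add: I_def indicator_def)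
  also have "\<dots> \<le> ennreal (real N)" using J(2) by (simp add: ennreal_of_nat_eq_real_of_nat ennreal_leI)
  finally show ?thesis .
 qed
 have mI: "I j \<in> borel_measurable coord_measure" for j
  unfolding I_def by (rule indicator_Eset_measurable)
 define A where "A = exp (- r * \<bar>\<sigma> - 1\<bar>) * vol r"
 have A: "A > 0" using vol_pos[OF r] by (simp add: A_def)
 define c where "c = fst \<kappa> powr \<sigma> / A"
 have c: "c > 0" using A \<kappa> by (simp add: c_def)
 show ?thesis
 proof (intro exI[of _ "c * real (Suc N)"] conjI ballI)
  show "c * real (Suc N) > 0" using c by simp
  fix f :: "('n rvec => complex) => complex" assume f: "f \<in> S_cone_dual"
  define m where "m j = (INF h\<in>Eset (hprod (gc j) \<kappa>) r. cpow p q f (ndil (theta h)))" for j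
  have mw: "wint p q s f \<in> borel_measurable coord_measure" by (rule measurable_wint[OF f])
  have mwI: "(\<lambda>h. wint p q s f h * I j h) \<in> borel_measurable coord_measure" for j
   by (intro borel_measurable_times_ennreal mw mI)
  have one: "ennreal (fst (gc j) powr (- \<sigma>)) * m j \<le> ennreal c * (\<integral>\<^sup>+h. wint p q s f h * I j h \<partial>coord_measure)" for j
  proof -
   let ?a = "hprod (gc j) \<kappa>"
   have g: "fst ?a > 0" by (rule ap)
   define d where "d = exp (- r * \<bar>\<sigma> - 1\<bar>) * fst ?a powr (1 - \<sigma>)"
   have d0: "0 \<le> d * (vol r / fst ?a)" using g vol_pos[OF r] by (simp add: d_def)
   have "ennreal (d * (vol r / fst ?a)) * m j = ennreal d * m j * ennreal (vol r / fst ?a)"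
    by (subst ennreal_mult) (use g vol_pos[OF r] in \<open>simp_all add: d_def mult_ac\<close>)
   also have "\<dots> = (\<integral>\<^sup>+h. ennreal d * m j * I j h \<partial>coord_measure)"
    unfolding nn_integral_cmult[OF mI] unfolding I_def nn_integral_Eset[OF g r] ..
   also have "\<dots> \<le> (\<integral>\<^sup>+h. wint p q s f h * I j h \<partial>coord_measure)"
   proof (rule nn_integral_mono)
    fix h assume h: "h \<in> space (coord_measure :: 'n H_coords measure)"
    show "ennreal d * m j * I j h \<le> wint p q s f h * I j h"
    proof (cases "h \<in> Eset ?a r")
     case True
     have "ennreal d \<le> ennreal (fst h powr (\<sigma> - 1))"
      unfolding d_def by (intro ennreal_leI Eset_weight(1)[OF True g]) (use r in simp)
     moreover have "m j \<le> cpow p q f (ndil (theta h))" unfolding m_def by (rule INF_lower[OF True])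
     ultimately have "ennreal d * m j \<le> wint p q s f h"
      unfolding wint_eq[OF p f space_coord_measure[OF h] \<sigma>] by (intro mult_mono) auto
     then show ?thesis by (rule mult_right_mono) simp
    next
     case False then show ?thesis by (simp add: I_def)
    qed
   qed
   finally have 1: "ennreal (d * (vol r / fst ?a)) * m j \<le> (\<integral>\<^sup>+h. wint p q s f h * I j h \<partial>coord_measure)" .
   have "fst (gc j) powr (- \<sigma>) = c * (d * (vol r / fst ?a))"
   proof -
    have "d * (vol r / fst ?a) = A * fst ?a powr (- \<sigma>)"
     using g by (simp add: A_def d_def powr_diff powr_minus field_simps)
    also have "fst ?a powr (- \<sigma>) = fst (gc j) powr (- \<sigma>) * fst \<kappa> powr (- \<sigma>)"
     unfolding fa using gc(1)[of j] \<kappa> by (simp add: powr_mult)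
    finally have e: "d * (vol r / fst ?a) = A * (fst (gc j) powr (- \<sigma>) * fst \<kappa> powr (- \<sigma>))" .
    have "fst \<kappa> powr \<sigma> * fst \<kappa> powr (- \<sigma>) = 1" unfolding powr_add[symmetric] using \<kappa> by simp
    then show ?thesis unfolding e c_def using A by (simp add: field_simps)
   qed
   then have "ennreal (fst (gc j) powr (- \<sigma>)) * m j = ennreal c * (ennreal (d * (vol r / fst ?a)) * m j)"
    by (simp only: ennreal_mult[OF less_imp_le[OF c] d0] mult.assoc)
   also have "\<dots> \<le> ennreal c * (\<integral>\<^sup>+h. wint p q s f h * I j h \<partial>coord_measure)" by (intro mult_left_mono 1) simp
   finally show ?thesis .
  qed
  have "(\<Sum>j. ennreal (fst (gc j) powr (- \<sigma>)) * m j) \<le> (\<Sum>j. ennreal c * (\<integral>\<^sup>+h. wint p q s f h * I j h \<partial>coord_measure))"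
   by (intro suminf_le one summableI)
  also have "\<dots> = ennreal c * (\<Sum>j. \<integral>\<^sup>+h. wint p q s f h * I j h \<partial>coord_measure)" by (rule ennreal_suminf_cmult)
  also have "(\<Sum>j. \<integral>\<^sup>+h. wint p q s f h * I j h \<partial>coord_measure) = (\<integral>\<^sup>+h. (\<Sum>j. wint p q s f h * I j h) \<partial>coord_measure)"
   by (rule nn_integral_suminf[OF mwI, symmetric])
  also have "\<dots> \<le> (\<integral>\<^sup>+h. ennreal (real (Suc N)) * wint p q s f h \<partial>coord_measure)"
  proof (rule nn_integral_mono)
   fix h assume h: "h \<in> space (coord_measure :: 'n H_coords measure)"
   have "(\<Sum>j. wint p q s f h * I j h) = wint p q s f h * (\<Sum>j. I j h)" by (rule ennreal_suminf_cmult)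
   also have "\<dots> \<le> wint p q s f h * ennreal (real (Suc N))"
    by (intro mult_left_mono order.trans[OF over[OF space_coord_measure[OF h]]] ennreal_leI) auto
   finally show "(\<Sum>j. wint p q s f h * I j h) \<le> ennreal (real (Suc N)) * wint p q s f h" by (simp only: mult.commute)
  qed
  also have "\<dots> = ennreal (real (Suc N)) * (\<integral>\<^sup>+h. wint p q s f h \<partial>coord_measure)" by (rule nn_integral_cmult[OF mw])
  also have "ennreal c * (ennreal (real (Suc N)) * (\<integral>\<^sup>+h. wint p q s f h \<partial>coord_measure)) = ennreal (c * real (Suc N)) * (\<integral>\<^sup>+h. wint p q s f h \<partial>coord_measure)"
   using c by (simp only: ennreal_mult[OF less_imp_le[OF c] of_nat_0_le_iff] mult.assoc)
  finally show "(\<Sum>j. ennreal (fst (gc j) powr (- \<sigma>)) * (INF h\<in>Eset (hprod (gc j) \<kappa>) r. cpow p q f (ndil (theta h))))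
    \<le> ennreal (c * real (Suc N)) * (\<integral>\<^sup>+h. wint p q s f h \<partial>coord_measure)"
   unfolding m_def by (simp add: mult_left_mono)
 qed
qed

text \<open>
  Because the dilations in the local estimate may be chosen freely in their boxes, the wavelet
  coefficients can be replaced by their infima.
\<close>

lemma bsum_le_wint:
 assumes p: "p \<ge> 1" and q: "q \<ge> 1" and \<sigma>: "\<sigma> = s + real CARD('n) * q / 2 - real CARD('n)"
 obtains C where "C > 0" "\<And>f. f \<in> S_cone_dual ==> bsum p q \<sigma> f \<le> ennreal C * (\<integral>\<^sup>+h. wint p q s f h \<partial>coord_measure)"
proof -
 obtain K r C where K: "finite K" "\<And>\<kappa>. \<kappa> \<in> K ==> fst \<kappa> > 0" and r: "r > 0" and C: "C > 0"
  and le: "\<And>f j k. f \<in> S_cone_dual ==> \<forall>\<kappa>\<in>K. fst (k \<kappa>) > 0 \<and> hprod (hinv (hprod (gc j) \<kappa>)) (k \<kappa>) \<in> hbox r ==>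
    cpow p q f (\<psi> j) \<le> ennreal C * (\<Sum>\<kappa>\<in>K. cpow p q f (ndil (k \<kappa>)))"
  by (rule psi_le_wavelet_coeff[OF p q]) (rule that, assumption+)
 define X where "X \<kappa> c \<longleftrightarrow> c > 0 \<and> (\<forall>f\<in>S_cone_dual. (\<Sum>j. ennreal (fst (gc j) powr (- \<sigma>)) * (INF h\<in>Eset (hprod (gc j) \<kappa>) r. cpow p q f (ndil (theta h))))
   \<le> ennreal c * (\<integral>\<^sup>+h. wint p q s f h \<partial>coord_measure))" for \<kappa> c
 have "\<exists>c. X \<kappa> c" if "\<kappa> \<in> K" for \<kappa> using weighted_INF_le_wint[OF p \<sigma> K(2)[OF that] r] unfolding X_def by blast
 then obtain c where c: "\<And>\<kappa>. \<kappa> \<in> K ==> X \<kappa> (c \<kappa>)" by metis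
 have c0: "c \<kappa> > 0" if "\<kappa> \<in> K" for \<kappa> using c[OF that] by (simp add: X_def)
 have sc: "(\<Sum>\<kappa>\<in>K. c \<kappa>) \<ge> 0" by (intro sum_nonneg less_imp_le c0)
 show ?thesis
 proof (rule that[of "C * ((\<Sum>\<kappa>\<in>K. c \<kappa>) + 1)"])
  show "C * ((\<Sum>\<kappa>\<in>K. c \<kappa>) + 1) > 0" using C sc by simp
  fix f :: "('n rvec => complex) => complex" assume f: "f \<in> S_cone_dual"
  define m where "m j \<kappa> = (INF h\<in>Eset (hprod (gc j) \<kappa>) r. cpow p q f (ndil (theta h)))" for j \<kappa>
  define W where "W = (\<integral>\<^sup>+h. wint p q s f h \<partial>coord_measure)"
  have psi_m: "cpow p q f (\<psi> j) \<le> ennreal C * (\<Sum>\<kappa>\<in>K. m j \<kappa>)" for j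
   unfolding m_def
  proof (rule le_sum_INF[OF K(1) C])
   fix k :: "'n H_coords => 'n H_coords" assume k: "\<forall>\<kappa>\<in>K. k \<kappa> \<in> Eset (hprod (gc j) \<kappa>) r"
   show "cpow p q f (\<psi> j) \<le> ennreal C * (\<Sum>\<kappa>\<in>K. cpow p q f (ndil (theta (k \<kappa>))))"
    by (rule le[OF f, where k = "\<lambda>\<kappa>. theta (k \<kappa>)"]) (use k in \<open>auto simp: Eset_def fst_theta\<close>)
  qed
  have "bsum p q \<sigma> f \<le> (\<Sum>j. ennreal C * (\<Sum>\<kappa>\<in>K. ennreal (fst (gc j) powr (- \<sigma>)) * m j \<kappa>))"
   unfolding bsum_def
  proof (rule suminf_le[OF _ summableI summableI])
   fix j
   have "ennreal (fst (gc j) powr (- \<sigma>)) * cpow p q f (\<psi> j) \<le> ennreal (fst (gc j) powr (- \<sigma>)) * (ennreal C * (\<Sum>\<kappa>\<in>K. m j \<kappa>))"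
    by (rule mult_left_mono[OF psi_m]) simp
   then show "ennreal (fst (gc j) powr (- \<sigma>)) * cpow p q f (\<psi> j) \<le> ennreal C * (\<Sum>\<kappa>\<in>K. ennreal (fst (gc j) powr (- \<sigma>)) * m j \<kappa>)"
    by (simp only: mult.left_commute[of _ "ennreal C"] sum_distrib_left)
  qed
  also have "\<dots> = ennreal C * (\<Sum>j. \<Sum>\<kappa>\<in>K. ennreal (fst (gc j) powr (- \<sigma>)) * m j \<kappa>)" by (rule ennreal_suminf_cmult)
  also have "(\<Sum>j. \<Sum>\<kappa>\<in>K. ennreal (fst (gc j) powr (- \<sigma>)) * m j \<kappa>) = (\<Sum>\<kappa>\<in>K. \<Sum>j. ennreal (fst (gc j) powr (- \<sigma>)) * m j \<kappa>)"
   by (rule suminf_sum) (rule summableI)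
  also have "\<dots> \<le> (\<Sum>\<kappa>\<in>K. ennreal (c \<kappa>) * W)"
   by (rule sum_mono) (use c f in \<open>simp add: X_def m_def W_def\<close>)
  also have "\<dots> = ennreal (\<Sum>\<kappa>\<in>K. c \<kappa>) * W"
   unfolding sum_distrib_right[symmetric] by (subst sum_ennreal) (use c0 in \<open>auto intro: less_imp_le\<close>)
  also have "\<dots> \<le> ennreal ((\<Sum>\<kappa>\<in>K. c \<kappa>) + 1) * W" by (intro mult_right_mono ennreal_leI) auto
  also have "ennreal C * (ennreal ((\<Sum>\<kappa>\<in>K. c \<kappa>) + 1) * W) = ennreal (C * ((\<Sum>\<kappa>\<in>K. c \<kappa>) + 1)) * W"
   using C sc by (subst ennreal_mult) (auto simp: mult.assoc)
  finally show "bsum p q \<sigma> f \<le> ennreal (C * ((\<Sum>\<kappa>\<in>K. c \<kappa>) + 1)) * (\<integral>\<^sup>+h. wint p q s f h \<partial>coord_measure)"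
   unfolding W_def by (simp add: mult_left_mono)
 qed
qed

theorem coorbit_besov_equivalence:
 assumes p: "p \<ge> 1" and q: "q \<ge> 1" and \<sigma>: "\<sigma> = s + real CARD('n) * q / 2 - real CARD('n)"
 obtains C1 C2 where "C1 > 0" "C2 > 0"
  "\<And>f. f \<in> S_cone_dual ==> coorbit_norm u p q s f \<le> ennreal C1 * besov_norm w \<psi> p q \<sigma> f"
  "\<And>f. f \<in> S_cone_dual ==> besov_norm w \<psi> p q \<sigma> f \<le> ennreal C2 * coorbit_norm u p q s f"
proof -
 obtain C where C: "C > 0" "\<And>f. f \<in> S_cone_dual ==> (\<integral>\<^sup>+h. wint p q s f h \<partial>coord_measure) \<le> ennreal C * bsum p q \<sigma> f"
  by (rule wint_le_bsum[OF p q \<sigma>]) (rule that, assumption+)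
 obtain D where D: "D > 0" "\<And>f. f \<in> S_cone_dual ==> bsum p q \<sigma> f \<le> ennreal D * (\<integral>\<^sup>+h. wint p q s f h \<partial>coord_measure)"
  by (rule bsum_le_wint[OF p q \<sigma>]) (rule that, assumption+)
 show ?thesis
 proof (rule that[of "C powr (1 / q)" "D powr (1 / q)"])
  fix f :: "('n rvec => complex) => complex" assume f: "f \<in> S_cone_dual"
  show "coorbit_norm u p q s f \<le> ennreal (C powr (1 / q)) * besov_norm w \<psi> p q \<sigma> f"
   unfolding coorbit_norm_wint besov_norm_bsum epowr_cmult[OF C(1), symmetric] by (rule epowr_mono[OF C(2)[OF f]]) (use q in simp)
  show "besov_norm w \<psi> p q \<sigma> f \<le> ennreal (D powr (1 / q)) * coorbit_norm u p q s f"
   unfolding coorbit_norm_wint besov_norm_bsum epowr_cmult[OF D(1), symmetric] by (rule epowr_mono[OF D(2)[OF f]]) (use q in simp)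
 qed (use C(1) D(1) in simp_all)
qed

end

theorem theorem5p10:
  fixes u :: "'n::{finite,linorder} rvec \<Rightarrow> complex"
    and w :: "nat \<Rightarrow> 'n rvec"
    and \<phi> :: "'n rvec \<Rightarrow> real"
    and g :: "nat \<Rightarrow> 'n rmat"
    and \<psi> :: "nat \<Rightarrow> 'n rvec \<Rightarrow> complex"
    and p q s \<delta> :: real
  assumes "CARD('n) \<ge> 2"
    and "1 \<le> p" and "1 \<le> q"
    and "cone_wavelet u"
    and "whitney_cover \<delta> w"
    and "littlewood_paley \<delta> w \<phi> g \<psi>"
  defines "\<sigma> \<equiv> s + real CARD('n) * q / 2 - real CARD('n)"
  shows "besov w \<psi> p q \<sigma> = coorbit u p q s \<and>
    (\<exists>c C. 0 < c \<and> 0 < C \<and>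
      (\<forall>f\<in>coorbit u p q s.
        ennreal c * coorbit_norm u p q s f \<le> besov_norm w \<psi> p q \<sigma> f \<and>
        besov_norm w \<psi> p q \<sigma> f \<le> ennreal C * coorbit_norm u p q s f))"
proof -
  interpret D: forward_cone "TYPE('n)" by unfold_locales (rule assms(1))
  have lp: "smooth \<phi>" "\<And>x. 0 \<le> \<phi> x \<and> \<phi> x \<le> 1" "supp \<phi> \<subseteq> cone_ball (2 * \<delta>) base_pt" "\<And>x. x \<in> cone_ball \<delta> base_pt \<Longrightarrow> \<phi> x = 1"
    "\<And>j. g j \<in> H_grp" "\<And>j. w j = g j *v base_pt" "\<And>j. \<psi> j \<in> schwartz"
    "\<And>j. fourier (\<psi> j) = (\<lambda>v. of_real (\<phi> (matrix_inv (g j) *v v) / (\<Sum>i. \<phi> (matrix_inv (g i) *v v))))"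
    using assms(6) unfolding littlewood_paley_def by blast+
  have "\<exists>a. fst a > 0 \<and> g j = D.hm a" for j
  proof -
    obtain \<gamma> t c where "g j = h_mat \<gamma> t c" "\<gamma> > 0" using lp(5)[of j] unfolding H_grp_def by blast
    then show ?thesis by (intro exI[of _ "(\<gamma>, t, c)"]) simp
  qed
  then obtain gc where gc: "\<And>j. fst (gc j) > 0 \<and> g j = D.hm (gc j)" by metis
  have mi: "matrix_inv (g j) = D.hm (D.hinv (gc j))" for j using D.matrix_inv_hm gc by (metis (no_types))
  interpret B: besov_setting "TYPE('n)" \<delta> w gc u \<phi> \<psi>
  proof unfold_locales
    show "whitney_cover \<delta> w" "cone_wavelet u" "smooth \<phi>" by (rule assms lp)+
    show "fst (gc j) > 0" "w j = D.hm (gc j) *v base_pt" for j using gc[of j] lp(6)[of j] by simp_all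
    show "0 \<le> \<phi> x \<and> \<phi> x \<le> 1" for x by (rule lp(2))
    show "supp \<phi> \<subseteq> cone_ball_base (2 * \<delta>)" using lp(3) by (simp only: D.cone_ball_base_pt)
    show "\<phi> x = 1" if "x \<in> cone_ball_base \<delta>" for x using lp(4)[of x] that by (simp only: D.cone_ball_base_pt)
    show "\<psi> j \<in> schwartz" for j by (rule lp(7))
    show "fourier (\<psi> j) = (\<lambda>v. of_real (\<phi> (D.hm (D.hinv (gc j)) *v v) / (\<Sum>i. \<phi> (D.hm (D.hinv (gc i)) *v v))))" for j
      using lp(8)[of j] by (simp only: mi)
  qed
  obtain C1 C2 where C: "C1 > 0" "C2 > 0"
    "\<And>f. f \<in> S_cone_dual \<Longrightarrow> coorbit_norm u p q s f \<le> ennreal C1 * besov_norm w \<psi> p q \<sigma> f"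
    "\<And>f. f \<in> S_cone_dual \<Longrightarrow> besov_norm w \<psi> p q \<sigma> f \<le> ennreal C2 * coorbit_norm u p q s f"
    by (rule B.coorbit_besov_equivalence[OF assms(2,3) \<sigma>_def[THEN meta_eq_to_obj_eq]]) (rule that, assumption+)
  have fin: "x < \<infinity>" if "x \<le> ennreal c * y" "y < \<infinity>" for x y c
    using that by (auto simp: ennreal_mult_less_top intro: le_less_trans)
  have eq: "besov w \<psi> p q \<sigma> = coorbit u p q s"
  proof (intro set_eqI iffI)
    fix f assume "f \<in> besov w \<psi> p q \<sigma>"
    then have f: "f \<in> S_cone_dual" "besov_norm w \<psi> p q \<sigma> f < \<infinity>" by (auto simp: besov_def)
    have "Lpqs_norm p q s (wavelet_transform u f) < \<infinity>"
      using fin[OF C(3)[OF f(1)] f(2)] by (simp only: coorbit_norm_def)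
    then show "f \<in> coorbit u p q s"
      using f(1) D.measurable_wavelet_transform[OF f(1) B.uS] by (simp add: coorbit_def Lpqs_def)
  next
    fix f assume "f \<in> coorbit u p q s"
    then have f: "f \<in> S_cone_dual" "coorbit_norm u p q s f < \<infinity>" by (auto simp: coorbit_def Lpqs_def coorbit_norm_def)
    then show "f \<in> besov w \<psi> p q \<sigma>" using fin[OF C(4)[OF f(1)] f(2)] by (simp add: besov_def)
  qed
  show ?thesis
  proof (rule conjI[OF eq], rule exI[of _ "1 / C1"], rule exI[of _ C2], intro conjI ballI)
    show "0 < 1 / C1" "0 < C2" using C by simp_all
    fix f assume "f \<in> coorbit u p q s"
    then have f: "f \<in> S_cone_dual" by (simp add: coorbit_def)
    show "besov_norm w \<psi> p q \<sigma> f \<le> ennreal C2 * coorbit_norm u p q s f" by (rule C(4)[OF f])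
    have "ennreal (1 / C1) * coorbit_norm u p q s f \<le> ennreal (1 / C1) * (ennreal C1 * besov_norm w \<psi> p q \<sigma> f)"
      by (rule mult_left_mono[OF C(3)[OF f]]) simp
    also have "\<dots> = ennreal (1 / C1 * C1) * besov_norm w \<psi> p q \<sigma> f"
      using C(1) by (subst ennreal_mult) (simp_all add: mult.assoc)
    also have "\<dots> = besov_norm w \<psi> p q \<sigma> f" using C(1) by simp
    finally show "ennreal (1 / C1) * coorbit_norm u p q s f \<le> besov_norm w \<psi> p q \<sigma> f" .
  qed
qed

end
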